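(* Let $N$ be a positive integer, $w=\mathrm{polylog}(N)$, and let $f\colon[N]\to[2^{w}]$ be a function computable in $\tilde{O}(1)$ time. For any choice of a constant $0<\alpha<1$, one can construct in $\tilde{O}(N)$ time with high probability a data structure using $\tilde{O}(N^{1-\alpha/4})$ words of space which supports the following queries in $\tilde{O}(N^{\alpha})$ time: (Ranking) given an integer $y\in[2^{w}]$, return $|\{x\in[N] : f(x)<y\}|$; (Selection) given an integer $k\in[N]$, report $x\in[N]$ such that $f(x)$ is the $k$th largest value in $f([N])$, if it exists.
   Context: $[M]$ denotes $\{0,1,\dots,M-1\}$. The notation $\tilde{O}(\cdot)$ omits factors polylogarithmic in $N$. Space is measured in machine words (word RAM model). *)

theory Defs
  imports
    "HOL-Probability.Probability"
    "HOL-Library.Landau_Symbols"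
    "HOL-Library.Stream"
begin

section \<open>Soft-O notation\<close>

definition soft_O :: "(nat \<Rightarrow> real) \<Rightarrow> (nat \<Rightarrow> real) set" where
  "soft_O h = (\<Union>k::nat. O(\<lambda>N. h N * (ln (real N)) ^ k))"

abbreviation polylog :: "(nat \<Rightarrow> real) \<Rightarrow> bool" where
  "polylog g \<equiv> g \<in> soft_O (\<lambda>_. 1)"


section \<open>The randomised word RAM\<close>

text \<open>
  Machine words of length \<open>b\<close> are natural numbers below \<open>2 ^ b\<close>. A program is a structured command.
  It mentions finitely many registers and finitely many memory arrays, each indexed by a machine
  word. This is the flat-memory word RAM up to constant factors, since a fixed number of arrays can
  be interleaved. Every elementary operation and every test costs one time unit.

  There is also a read-only input memory. The function \<open>f\<close> of the theorem may refer to it (think of a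
  text that \<open>f\<close> is defined from), so \<open>f\<close> need not be uniformly computable from \<open>N\<close> alone. It is part
  of the description of \<open>f\<close>, not of the data structure. An all-zero input memory gives the
  plain model.
\<close>

datatype binop = Add | Sub | Mul | Div | Mod | And | Or | Xor | Shl | Shr | Eq | Lt

fun binop_val :: "binop \<Rightarrow> nat \<Rightarrow> nat \<Rightarrow> nat \<Rightarrow> nat" where
  "binop_val Add b x y = (x + y) mod 2 ^ b"
| "binop_val Sub b x y = (x + 2 ^ b - y) mod 2 ^ b"
| "binop_val Mul b x y = (x * y) mod 2 ^ b"
| "binop_val Div b x y = x div y"
| "binop_val Mod b x y = x mod y"
| "binop_val And b x y = Bit_Operations.and x y"
| "binop_val Or b x y = Bit_Operations.or x y"
| "binop_val Xor b x y = Bit_Operations.xor x y"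
| "binop_val Shl b x y = (x * 2 ^ y) mod 2 ^ b"
| "binop_val Shr b x y = x div 2 ^ y"
| "binop_val Eq b x y = (if x = y then 1 else 0)"
| "binop_val Lt b x y = (if x < y then 1 else 0)"

type_synonym reg = nat
type_synonym array = nat

datatype com =
    Skip
  | Const reg nat
  | Op binop reg reg reg
  | Load reg array reg
  | Store array reg reg
  | Input reg reg
  | Rand reg
  | Seq com com
  | IfNZ reg com com
  | WhileNZ reg com

text \<open>\<open>tape\<close> holds the random words that have not been drawn yet.\<close>

record state =
  regs :: "reg \<Rightarrow> nat"
  mem :: "array \<Rightarrow> nat \<Rightarrow> nat"
  tape :: "nat stream"

definition valid_state :: "nat \<Rightarrow> state \<Rightarrow> bool" where
  "valid_state b \<sigma> \<longleftrightarrow>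
     (\<forall>r. regs \<sigma> r < 2 ^ b) \<and> (\<forall>a i. mem \<sigma> a i < 2 ^ b) \<and> sset (tape \<sigma>) \<subseteq> {..<2 ^ b}"

abbreviation set_reg :: "reg \<Rightarrow> nat \<Rightarrow> state \<Rightarrow> state" where
  "set_reg r v \<sigma> \<equiv> \<sigma>\<lparr>regs := (regs \<sigma>)(r := v)\<rparr>"

text \<open>
  \<open>exec b inp c \<sigma> n \<sigma>'\<close>: on words of length \<open>b\<close> and with input memory \<open>inp\<close>, command \<open>c\<close> started in
  \<open>\<sigma>\<close> halts in \<open>\<sigma>'\<close> after exactly \<open>n\<close> time units.
\<close>

inductive exec :: "nat \<Rightarrow> (nat \<Rightarrow> nat) \<Rightarrow> com \<Rightarrow> state \<Rightarrow> nat \<Rightarrow> state \<Rightarrow> bool"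
  for b :: nat and inp :: "nat \<Rightarrow> nat" where
  Skip: "exec b inp Skip \<sigma> 1 \<sigma>"
| Const: "exec b inp (Const r v) \<sigma> 1 (set_reg r (v mod 2 ^ b) \<sigma>)"
| Op: "exec b inp (Op p r r1 r2) \<sigma> 1 (set_reg r (binop_val p b (regs \<sigma> r1) (regs \<sigma> r2)) \<sigma>)"
| Load: "exec b inp (Load r a i) \<sigma> 1 (set_reg r (mem \<sigma> a (regs \<sigma> i)) \<sigma>)"
| Store: "exec b inp (Store a i r) \<sigma> 1
     (\<sigma>\<lparr>mem := (mem \<sigma>)(a := (mem \<sigma> a)(regs \<sigma> i := regs \<sigma> r))\<rparr>)"
| Input: "exec b inp (Input r i) \<sigma> 1 (set_reg r (inp (regs \<sigma> i)) \<sigma>)"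
| Rand: "exec b inp (Rand r) \<sigma> 1 (set_reg r (shd (tape \<sigma>)) (\<sigma>\<lparr>tape := stl (tape \<sigma>)\<rparr>))"
| Seq: "exec b inp c1 \<sigma> n1 \<sigma>' \<Longrightarrow> exec b inp c2 \<sigma>' n2 \<sigma>'' \<Longrightarrow>
     exec b inp (Seq c1 c2) \<sigma> (n1 + n2) \<sigma>''"
| IfTrue: "regs \<sigma> r \<noteq> 0 \<Longrightarrow> exec b inp c1 \<sigma> n \<sigma>' \<Longrightarrow> exec b inp (IfNZ r c1 c2) \<sigma> (Suc n) \<sigma>'"
| IfFalse: "regs \<sigma> r = 0 \<Longrightarrow> exec b inp c2 \<sigma> n \<sigma>' \<Longrightarrow> exec b inp (IfNZ r c1 c2) \<sigma> (Suc n) \<sigma>'"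
| WhileFalse: "regs \<sigma> r = 0 \<Longrightarrow> exec b inp (WhileNZ r c) \<sigma> 1 \<sigma>"
| WhileTrue: "regs \<sigma> r \<noteq> 0 \<Longrightarrow> exec b inp c \<sigma> n1 \<sigma>' \<Longrightarrow> exec b inp (WhileNZ r c) \<sigma>' n2 \<sigma>'' \<Longrightarrow>
     exec b inp (WhileNZ r c) \<sigma> (Suc (n1 + n2)) \<sigma>''"

definition random_tape :: "nat \<Rightarrow> nat stream measure" where
  "random_tape b = stream_space (measure_pmf (pmf_of_set {..<2 ^ b}))"


section \<open>Multi-word integers\<close>

text \<open>
  An integer in \<open>[2 ^ w]\<close> need not fit into one machine word. It is stored in base \<open>2 ^ b\<close>, least
  significant word first, in \<open>\<lceil>w / b\<rceil>\<close> words.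
\<close>

definition holds_int :: "nat \<Rightarrow> nat \<Rightarrow> (nat \<Rightarrow> nat) \<Rightarrow> nat \<Rightarrow> bool" where
  "holds_int b w A v \<longleftrightarrow>
     (\<forall>i < nat \<lceil>real w / real b\<rceil>. A i = (v div (2 ^ b) ^ i) mod 2 ^ b)"


section \<open>Computing a function, and the queries\<close>

text \<open>
  All programs receive \<open>N\<close> and \<open>w\<close> in registers 0 and 1. Registers, memory and tape are otherwise
  unspecified at the start; in particular memory is not assumed to be zeroed.
\<close>

text \<open>\<open>x\<close> is passed in register 2 and \<open>f x\<close> is returned in array 0.\<close>

definition computes_within ::
  "real \<Rightarrow> nat \<Rightarrow> (nat \<Rightarrow> nat) \<Rightarrow> com \<Rightarrow> nat \<Rightarrow> nat \<Rightarrow> (nat \<Rightarrow> nat) \<Rightarrow> bool" where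
  "computes_within t b inp P N w f \<longleftrightarrow>
     (\<forall>x<N. \<forall>\<sigma>. valid_state b \<sigma> \<longrightarrow> regs \<sigma> 0 = N \<longrightarrow> regs \<sigma> 1 = w \<longrightarrow> regs \<sigma> 2 = x \<longrightarrow>
       (\<exists>n \<sigma>'. exec b inp P \<sigma> n \<sigma>' \<and> real n \<le> t \<and> holds_int b w (mem \<sigma>' 0) (f x)))"

text \<open>
  The \<open>s\<close> words of the data structure \<open>D\<close> are in array 0, and a query has to leave them intact. The
  query integer \<open>y\<close> is passed in array 1 and the rank is returned in register 0.
\<close>

definition supports_ranking ::
  "real \<Rightarrow> nat \<Rightarrow> (nat \<Rightarrow> nat) \<Rightarrow> com \<Rightarrow> nat \<Rightarrow> nat \<Rightarrow> (nat \<Rightarrow> nat) \<Rightarrow> nat \<Rightarrow> (nat \<Rightarrow> nat) \<Rightarrow> bool"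
where
  "supports_ranking t b inp P N w f s D \<longleftrightarrow>
     (\<forall>y < 2 ^ w. \<forall>\<sigma>. valid_state b \<sigma> \<longrightarrow> regs \<sigma> 0 = N \<longrightarrow> regs \<sigma> 1 = w \<longrightarrow>
       (\<forall>i<s. mem \<sigma> 0 i = D i) \<longrightarrow> holds_int b w (mem \<sigma> 1) y \<longrightarrow>
       (\<exists>n \<sigma>'. exec b inp P \<sigma> n \<sigma>' \<and> real n \<le> t \<and> (\<forall>i<s. mem \<sigma>' 0 i = D i) \<and>
         regs \<sigma>' 0 = card {x \<in> {..<N}. f x < y}))"

text \<open>
  Since \<open>k\<close> ranges over \<open>{0, ..., N - 1}\<close>, ranks start at 0 (the 0th largest value is the maximum).
  They count the distinct elements of the set \<open>f([N])\<close>, so for \<open>f\<close> not injective on \<open>[N]\<close> some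
  \<open>k\<close> have no answer.
\<close>

definition is_kth_largest :: "(nat \<Rightarrow> nat) \<Rightarrow> nat \<Rightarrow> nat \<Rightarrow> nat \<Rightarrow> bool" where
  "is_kth_largest f N k x \<longleftrightarrow> x < N \<and> card {v \<in> f ` {..<N}. f x < v} = k"

text \<open>
  \<open>k\<close> is passed in register 2. Register 0 returns whether an answer exists (1) or not (0), and
  register 1 returns the answer.
\<close>

definition supports_selection ::
  "real \<Rightarrow> nat \<Rightarrow> (nat \<Rightarrow> nat) \<Rightarrow> com \<Rightarrow> nat \<Rightarrow> nat \<Rightarrow> (nat \<Rightarrow> nat) \<Rightarrow> nat \<Rightarrow> (nat \<Rightarrow> nat) \<Rightarrow> bool"
where
  "supports_selection t b inp P N w f s D \<longleftrightarrow>
     (\<forall>k<N. \<forall>\<sigma>. valid_state b \<sigma> \<longrightarrow> regs \<sigma> 0 = N \<longrightarrow> regs \<sigma> 1 = w \<longrightarrow> regs \<sigma> 2 = k \<longrightarrow>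
       (\<forall>i<s. mem \<sigma> 0 i = D i) \<longrightarrow>
       (\<exists>n \<sigma>'. exec b inp P \<sigma> n \<sigma>' \<and> real n \<le> t \<and> (\<forall>i<s. mem \<sigma>' 0 i = D i) \<and>
         (if \<exists>x. is_kth_largest f N k x
          then regs \<sigma>' 0 = 1 \<and> is_kth_largest f N k (regs \<sigma>' 1)
          else regs \<sigma>' 0 = 0)))"

end

theory Submission
  imports Defs "HOL-Real_Asymp.Real_Asymp"
begin

text \<open>
  Let \<open>n \<ge> N\<close> be a power of two and extend \<open>f\<close> by \<open>0\<close> to \<open>[n]\<close>. List \<open>[n]\<close> by decreasing \<open>(f x, x)\<close> and cut
  the list into \<open>M = n / l\<close> buckets of \<open>l\<close> consecutive elements, where \<open>l\<close> is about \<open>N powr (\<alpha> / 4)\<close>.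
  Storing the first element of each bucket, and the number of distinct values above it, takes about
  \<open>N / l\<close> words. Both queries reduce to a binary search for a bucket and a walk through it, so the
  point is to list a bucket, that is, to invert the map \<open>g : [n] \<rightarrow> [M]\<close> from elements to buckets,
  all of whose fibres have size \<open>l\<close>.

  This is done by rainbow tables. A table follows \<open>M / (4 * l)\<close> chains of length \<open>l\<close>, whose \<open>s\<close>-th step is
  \<open>g \<circ> h s\<close> for pairwise independent hash functions \<open>h s : [M] \<rightarrow> [n]\<close>, and records the start of a chain at
  the address of its end. By a second order Bonferroni bound a table covers a given \<open>x\<close> with
  probability at least \<open>1 / (16 * l)\<close>, so of the order of \<open>l * ln N\<close> tables cover all of \<open>[n]\<close> with
  high probability; together they take about \<open>N / l\<close> words. Listing the candidates for one bucket means
  completing, for each of these tables, one chain from each of its \<open>l\<close> layers, which costs about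
  \<open>l ^ 3\<close>. Each of the \<open>l\<close> steps of a walk finds the next element by a new listing, for a total of
  \<open>l ^ 4\<close>, which is at most \<open>N powr \<alpha>\<close>.
\<close>

section \<open>Executing programs\<close>

text \<open>Exactness dictates the shape. A random word reduced modulo \<open>n\<close> is uniform
  on \<open>[n]\<close> only if \<open>n\<close> divides \<open>2 ^ b\<close>, hence powers of two;
  and a hashed position is uniform on \<open>[M]\<close> only if all fibres of \<open>g\<close> have
  equal size. For arbitrary \<open>f\<close> this balance is obtained by sorting and cutting by
  rank, with ties broken by the index. Collision probabilities then come out as plain quotients, and
  since only first and second moments enter, pairwise independence suffices. A table has
  \<open>M / 4 = n / (4 * l)\<close> chain points for \<open>n\<close> elements, so a covering
  probability of order \<open>1 / l\<close> is the best one can ask for. A recorded start is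
  reliable only if no other chain of the table has the same address, because chains overwrite each
  other. The two factors 4, in the number of chains and in the number of slots, keep the loss from
  shared addresses at 1/2. The estimates, and the room for addresses in a word, are available for
  large \<open>N\<close> only, but the programs must serve every \<open>N\<close>. They contain a
  threshold \<open>2 ^ k0\<close>, below which the structure is empty and the queries search all of
  \<open>[N]\<close>.\<close>

lemma Suc_0_less_two_power: "b > 0 \<Longrightarrow> Suc 0 < 2 ^ b"
  using one_less_power[of "2::nat" b] by simp

lemma binop_val_less:
  assumes "x < 2 ^ b" "y < 2 ^ b" "b > 0"
  shows "binop_val p b x y < 2 ^ b"
proof -
  have 1: "Suc 0 < 2 ^ b" using assms(3) by (rule Suc_0_less_two_power)
  have *: "Bit_Operations.and x y < 2 ^ b" "Bit_Operations.or x y < 2 ^ b" "Bit_Operations.xor x y < 2 ^ b"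
  proof -
    have t: "take_bit b x = x" "take_bit b y = y" using assms by (simp_all add: take_bit_nat_eq_self)
    have "take_bit b (Bit_Operations.and x y) = Bit_Operations.and x y"
      "take_bit b (Bit_Operations.or x y) = Bit_Operations.or x y"
      "take_bit b (Bit_Operations.xor x y) = Bit_Operations.xor x y"
      using t by (simp_all only: take_bit_and take_bit_or take_bit_xor)
    then show "Bit_Operations.and x y < 2 ^ b" "Bit_Operations.or x y < 2 ^ b" "Bit_Operations.xor x y < 2 ^ b"
      by (metis take_bit_nat_less_exp)+
  qed
  have d: "x div y < 2 ^ b" "x mod y < 2 ^ b" "x div 2 ^ y < 2 ^ b"
    using assms(1) by (meson div_le_dividend le_less_trans mod_less_eq_dividend)+
  show ?thesis
    using * d 1 by (cases p) auto
qed

lemma exec_valid: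
  assumes "exec b inp c \<sigma> n \<sigma>'" "valid_state b \<sigma>" "\<And>i. inp i < 2 ^ b" "b > 0"
  shows "valid_state b \<sigma>'"
  using assms
proof (induction rule: exec.induct)
  case (Rand r \<sigma>)
  then show ?case
    by (cases "tape \<sigma>") (auto simp: valid_state_def)
next
  case (Op p r r1 r2 \<sigma>)
  then show ?case by (auto simp: valid_state_def binop_val_less simp del: binop_val.simps)
qed (auto simp: valid_state_def)

text \<open>\<open>modr\<close> and \<open>moda\<close> over-approximate, from the syntax alone, the
  registers and arrays that a run can change. By \<open>exec_agree\<close> they yield a frame rule
  for every program at once, so no specification below has to list what stays fixed.\<close>

fun modr :: "com \<Rightarrow> reg set" where
  "modr Skip = {}"
| "modr (Const r v) = {r}"
| "modr (Op p r r1 r2) = {r}"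
| "modr (Load r a i) = {r}"
| "modr (Store a i r) = {}"
| "modr (Input r i) = {r}"
| "modr (Rand r) = {r}"
| "modr (Seq c1 c2) = modr c1 \<union> modr c2"
| "modr (IfNZ r c1 c2) = modr c1 \<union> modr c2"
| "modr (WhileNZ r c) = modr c"

fun moda :: "com \<Rightarrow> array set" where
  "moda (Store a i r) = {a}"
| "moda (Seq c1 c2) = moda c1 \<union> moda c2"
| "moda (IfNZ r c1 c2) = moda c1 \<union> moda c2"
| "moda (WhileNZ r c) = moda c"
| "moda _ = {}"

definition agree :: "reg set \<Rightarrow> array set \<Rightarrow> state \<Rightarrow> state \<Rightarrow> bool" where
  "agree R A \<sigma> \<sigma>' \<longleftrightarrow> (\<forall>r. r \<notin> R \<longrightarrow> regs \<sigma>' r = regs \<sigma> r) \<and> (\<forall>a. a \<notin> A \<longrightarrow> mem \<sigma>' a = mem \<sigma> a)"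

lemma agree_mem: "agree R A \<sigma> \<sigma>' \<Longrightarrow> a \<notin> A \<Longrightarrow> mem \<sigma>' a = mem \<sigma> a"
  by (simp add: agree_def)

lemma agree_trans: "agree R A \<sigma> \<sigma>' \<Longrightarrow> agree R' A' \<sigma>' \<sigma>'' \<Longrightarrow> R \<subseteq> S \<Longrightarrow> R' \<subseteq> S \<Longrightarrow> A \<subseteq> T \<Longrightarrow> A' \<subseteq> T \<Longrightarrow> agree S T \<sigma> \<sigma>''"
  by (auto simp: agree_def subset_iff) metis+

lemma agree_mono: "agree R A \<sigma> \<sigma>' \<Longrightarrow> R \<subseteq> S \<Longrightarrow> A \<subseteq> T \<Longrightarrow> agree S T \<sigma> \<sigma>'"
  by (auto simp: agree_def)

lemma exec_agree: "exec b inp c \<sigma> n \<sigma>' \<Longrightarrow> agree (modr c) (moda c) \<sigma> \<sigma>'"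
proof (induction rule: exec.induct)
  case (Seq c1 \<sigma> n1 \<sigma>' c2 n2 \<sigma>'')
  then show ?case using agree_trans by fastforce
next
  case (WhileTrue \<sigma> r c n1 \<sigma>' n2 \<sigma>'')
  then show ?case using agree_trans by fastforce
qed (auto simp: agree_def)

lemma exec_eq: "exec b inp c \<sigma> n \<rho> \<Longrightarrow> \<rho> = \<sigma>' \<Longrightarrow> exec b inp c \<sigma> n \<sigma>'"
  by simp

lemma no_tape_prefix:
  assumes "\<And>\<omega>. exec b inp c (\<sigma>\<lparr>tape := \<omega>\<rparr>) n (\<sigma>'\<lparr>tape := \<omega>\<rparr>)" "tape \<sigma>' = tape \<sigma>"
  shows "\<exists>m\<le>n. tape \<sigma>' = sdrop m (tape \<sigma>) \<and>
      (\<forall>\<omega>. exec b inp c (\<sigma>\<lparr>tape := stake m (tape \<sigma>) @- \<omega>\<rparr>) n (\<sigma>'\<lparr>tape := \<omega>\<rparr>))"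
  using assms by (intro exI[of _ 0]) simp

text \<open>One time unit draws at most one random word, so a run of \<open>n\<close> units depends
  on at most \<open>n\<close> words of the tape and can be repeated with any continuation. This
  makes the outcome of a time-bounded run a measurable event.\<close>

lemma exec_tape_prefix:
  "exec b inp c \<sigma> n \<sigma>' \<Longrightarrow>
    \<exists>m\<le>n. tape \<sigma>' = sdrop m (tape \<sigma>) \<and>
      (\<forall>\<omega>. exec b inp c (\<sigma>\<lparr>tape := stake m (tape \<sigma>) @- \<omega>\<rparr>) n (\<sigma>'\<lparr>tape := \<omega>\<rparr>))"
proof (induction rule: exec.induct)
  case (Rand r \<sigma>)
  show ?case
  proof (intro exI[of _ 1] conjI allI)
    fix \<omega>
    have eq: "set_reg r (shd (tape \<sigma>)) (\<sigma>\<lparr>tape := stl (tape \<sigma>)\<rparr>)\<lparr>tape := \<omega>\<rparr> =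
      set_reg r (shd (tape (\<sigma>\<lparr>tape := stake 1 (tape \<sigma>) @- \<omega>\<rparr>)))
         ((\<sigma>\<lparr>tape := stake 1 (tape \<sigma>) @- \<omega>\<rparr>)\<lparr>tape := stl (tape (\<sigma>\<lparr>tape := stake 1 (tape \<sigma>) @- \<omega>\<rparr>))\<rparr>)"
      by (rule state.equality) simp_all
    have "exec b inp (Rand r) (\<sigma>\<lparr>tape := stake 1 (tape \<sigma>) @- \<omega>\<rparr>) 1
      (set_reg r (shd (tape (\<sigma>\<lparr>tape := stake 1 (tape \<sigma>) @- \<omega>\<rparr>)))
         ((\<sigma>\<lparr>tape := stake 1 (tape \<sigma>) @- \<omega>\<rparr>)\<lparr>tape := stl (tape (\<sigma>\<lparr>tape := stake 1 (tape \<sigma>) @- \<omega>\<rparr>))\<rparr>))"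
      by (rule exec.Rand)
    then show "exec b inp (Rand r) (\<sigma>\<lparr>tape := stake 1 (tape \<sigma>) @- \<omega>\<rparr>) 1
            (set_reg r (shd (tape \<sigma>)) (\<sigma>\<lparr>tape := stl (tape \<sigma>)\<rparr>)\<lparr>tape := \<omega>\<rparr>)"
      unfolding eq .
  qed auto
next
  case (Seq c1 \<sigma> n1 \<sigma>' c2 n2 \<sigma>'')
  from Seq.IH obtain m1 m2 where m: "m1 \<le> n1" "m2 \<le> n2" "tape \<sigma>' = sdrop m1 (tape \<sigma>)"
    "tape \<sigma>'' = sdrop m2 (tape \<sigma>')"
    "\<And>\<omega>. exec b inp c1 (\<sigma>\<lparr>tape := stake m1 (tape \<sigma>) @- \<omega>\<rparr>) n1 (\<sigma>'\<lparr>tape := \<omega>\<rparr>)"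
    "\<And>\<omega>. exec b inp c2 (\<sigma>'\<lparr>tape := stake m2 (tape \<sigma>') @- \<omega>\<rparr>) n2 (\<sigma>''\<lparr>tape := \<omega>\<rparr>)" by blast
  show ?case
  proof (intro exI[of _ "m1 + m2"] conjI allI)
    fix \<omega>
    have eq: "stake (m1 + m2) (tape \<sigma>) @- \<omega> = stake m1 (tape \<sigma>) @- (stake m2 (tape \<sigma>') @- \<omega>)"
      using m(3) stake_add[of m1 "tape \<sigma>" m2] by (metis shift_append)
    show "exec b inp (Seq c1 c2) (\<sigma>\<lparr>tape := stake (m1 + m2) (tape \<sigma>) @- \<omega>\<rparr>) (n1 + n2) (\<sigma>''\<lparr>tape := \<omega>\<rparr>)"
      unfolding eq by (rule exec.Seq[OF m(5) m(6)])
  qed (use m(1-4) in \<open>simp_all add: sdrop_add add_mono\<close>)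
next
  case (WhileTrue \<sigma> r c n1 \<sigma>' n2 \<sigma>'')
  from WhileTrue.IH obtain m1 m2 where m: "m1 \<le> n1" "m2 \<le> n2" "tape \<sigma>' = sdrop m1 (tape \<sigma>)"
    "tape \<sigma>'' = sdrop m2 (tape \<sigma>')"
    "\<And>\<omega>. exec b inp c (\<sigma>\<lparr>tape := stake m1 (tape \<sigma>) @- \<omega>\<rparr>) n1 (\<sigma>'\<lparr>tape := \<omega>\<rparr>)"
    "\<And>\<omega>. exec b inp (WhileNZ r c) (\<sigma>'\<lparr>tape := stake m2 (tape \<sigma>') @- \<omega>\<rparr>) n2 (\<sigma>''\<lparr>tape := \<omega>\<rparr>)" by blast
  show ?case
  proof (intro exI[of _ "m1 + m2"] conjI allI)
    fix \<omega>
    have eq: "stake (m1 + m2) (tape \<sigma>) @- \<omega> = stake m1 (tape \<sigma>) @- (stake m2 (tape \<sigma>') @- \<omega>)"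
      using m(3) stake_add[of m1 "tape \<sigma>" m2] by (metis shift_append)
    show "exec b inp (WhileNZ r c) (\<sigma>\<lparr>tape := stake (m1 + m2) (tape \<sigma>) @- \<omega>\<rparr>) (Suc (n1 + n2)) (\<sigma>''\<lparr>tape := \<omega>\<rparr>)"
      unfolding eq by (rule exec.WhileTrue[OF _ m(5) m(6)]) (simp add: WhileTrue.hyps(1))
  qed (use m(1-4) in \<open>simp_all add: sdrop_add add_mono\<close>)
next
  case (IfTrue \<sigma> r c1 n \<sigma>' c2)
  then obtain m where m: "m\<le>n" "tape \<sigma>' = sdrop m (tape \<sigma>)"
      "\<forall>\<omega>. exec b inp c1 (\<sigma>\<lparr>tape := stake m (tape \<sigma>) @- \<omega>\<rparr>) n (\<sigma>'\<lparr>tape := \<omega>\<rparr>)" by blast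
  then show ?case using IfTrue.hyps(1) by (intro exI[of _ m]) (auto intro: exec.IfTrue)
next
  case (IfFalse \<sigma> r c2 n \<sigma>' c1)
  then obtain m where m: "m\<le>n" "tape \<sigma>' = sdrop m (tape \<sigma>)"
      "\<forall>\<omega>. exec b inp c2 (\<sigma>\<lparr>tape := stake m (tape \<sigma>) @- \<omega>\<rparr>) n (\<sigma>'\<lparr>tape := \<omega>\<rparr>)" by blast
  then show ?case using IfFalse.hyps(1) by (intro exI[of _ m]) (auto intro: exec.IfFalse)
next
  case (Const r v \<sigma>)
  show ?case
    by (rule no_tape_prefix, rule exec_eq[OF exec.Const], rule state.equality) simp_all
next
  case (Op p r r1 r2 \<sigma>)
  show ?case
    by (rule no_tape_prefix, rule exec_eq[OF exec.Op], rule state.equality) simp_all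
next
  case (Load r a i \<sigma>)
  show ?case
    by (rule no_tape_prefix, rule exec_eq[OF exec.Load], rule state.equality) simp_all
next
  case (Store a i r \<sigma>)
  show ?case
    by (rule no_tape_prefix, rule exec_eq[OF exec.Store], rule state.equality) simp_all
next
  case (Input r i \<sigma>)
  show ?case
    by (rule no_tape_prefix, rule exec_eq[OF exec.Input], rule state.equality) simp_all
next
  case (Skip \<sigma>)
  show ?case
    by (rule no_tape_prefix, rule exec_eq[OF exec.Skip], rule state.equality) simp_all
next
  case (WhileFalse \<sigma> r c)
  then show ?case by (intro no_tape_prefix exec.WhileFalse) simp_all
qed

subsection \<open>Relocation\<close>

text \<open>The program computing \<open>f\<close> is arbitrary and counts its registers and arrays
  from 0. Shifting all its indices turns it into a subroutine that cannot touch the data of its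
  caller.\<close>

fun relocate :: "reg \<Rightarrow> array \<Rightarrow> com \<Rightarrow> com" where
  "relocate d e Skip = Skip"
| "relocate d e (Const r v) = Const (d + r) v"
| "relocate d e (Op p r r1 r2) = Op p (d + r) (d + r1) (d + r2)"
| "relocate d e (Load r a i) = Load (d + r) (e + a) (d + i)"
| "relocate d e (Store a i r) = Store (e + a) (d + i) (d + r)"
| "relocate d e (Input r i) = Input (d + r) (d + i)"
| "relocate d e (Rand r) = Rand (d + r)"
| "relocate d e (Seq c1 c2) = Seq (relocate d e c1) (relocate d e c2)"
| "relocate d e (IfNZ r c1 c2) = IfNZ (d + r) (relocate d e c1) (relocate d e c2)"
| "relocate d e (WhileNZ r c) = WhileNZ (d + r) (relocate d e c)"

definition view :: "reg \<Rightarrow> array \<Rightarrow> state \<Rightarrow> state" where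
  "view d e \<sigma> = \<sigma>\<lparr>regs := \<lambda>r. regs \<sigma> (d + r), mem := \<lambda>a. mem \<sigma> (e + a)\<rparr>"

lemma view_sel [simp]:
  "regs (view d e \<sigma>) r = regs \<sigma> (d + r)" "mem (view d e \<sigma>) a = mem \<sigma> (e + a)"
  "tape (view d e \<sigma>) = tape \<sigma>"
  by (simp_all add: view_def)

lemma view_upd:
  "view d e (set_reg (d + r) v \<sigma>) = set_reg r v (view d e \<sigma>)"
  "view d e (\<sigma>\<lparr>mem := (mem \<sigma>)(e + a := X)\<rparr>) = (view d e \<sigma>)\<lparr>mem := (mem (view d e \<sigma>))(a := X)\<rparr>"
  "view d e (\<sigma>\<lparr>tape := s\<rparr>) = (view d e \<sigma>)\<lparr>tape := s\<rparr>"
  by (auto simp: view_def fun_eq_iff)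

text \<open>\<open>view\<close> is a simulation relation: each step on the shifted registers mirrors
  one step of the original program at the same cost. What lies outside the window is left to
  \<open>modr\<close> and \<open>moda\<close>.\<close>

lemma exec_relocate:
  assumes "exec b inp c \<sigma> n \<sigma>'" "\<sigma> = view d e \<rho>"
  shows "\<exists>\<rho>'. exec b inp (relocate d e c) \<rho> n \<rho>' \<and> \<sigma>' = view d e \<rho>'"
  using assms
proof (induction arbitrary: \<rho> rule: exec.induct)
  case (Seq c1 \<sigma> n1 \<sigma>' c2 n2 \<sigma>'')
  then show ?case by (metis exec.Seq relocate.simps(8))
next
  case (WhileTrue \<sigma> r c n1 \<sigma>' n2 \<sigma>'')
  from WhileTrue.IH(1)[OF WhileTrue.prems] obtain \<rho>1 where
    1: "exec b inp (relocate d e c) \<rho> n1 \<rho>1" "\<sigma>' = view d e \<rho>1" by blast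
  from WhileTrue.IH(2)[OF 1(2)] obtain \<rho>2 where
    2: "exec b inp (relocate d e (WhileNZ r c)) \<rho>1 n2 \<rho>2" "\<sigma>'' = view d e \<rho>2" by blast
  show ?case using 1 2 WhileTrue.hyps(1) WhileTrue.prems
    by (auto intro!: exI[of _ \<rho>2] exec.WhileTrue)
next
  case (IfTrue \<sigma> r c1 n \<sigma>' c2)
  then show ?case by (metis exec.IfTrue relocate.simps(9) view_sel(1))
next
  case (IfFalse \<sigma> r c2 n \<sigma>' c1)
  then show ?case by (metis exec.IfFalse relocate.simps(9) view_sel(1))
next
  case (WhileFalse \<sigma> r c)
  then show ?case by (metis exec.WhileFalse relocate.simps(10) view_sel(1))
next
  case (Skip \<sigma>)
  then show ?case by (metis exec.Skip relocate.simps(1))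
next
  case (Const r v \<sigma>)
  then show ?case by (metis exec.Const relocate.simps(2) view_upd(1))
next
  case (Op p r r1 r2 \<sigma>)
  then show ?case by (metis exec.Op relocate.simps(3) view_upd(1) view_sel(1))
next
  case (Load r a i \<sigma>)
  then show ?case by (metis exec.Load relocate.simps(4) view_upd(1) view_sel(1,2))
next
  case (Store a i r \<sigma>)
  show ?case
    using exec.Store[of b inp "e + a" "d + i" "d + r" \<rho>] Store by (auto simp: view_upd)
next
  case (Input r i \<sigma>)
  then show ?case by (metis exec.Input relocate.simps(6) view_upd(1) view_sel(1))
next
  case (Rand r \<sigma>)
  have "set_reg r (shd (tape (view d e \<rho>))) (view d e \<rho>\<lparr>tape := stl (tape (view d e \<rho>))\<rparr>)
      = view d e (set_reg (d + r) (shd (tape \<rho>)) (\<rho>\<lparr>tape := stl (tape \<rho>)\<rparr>))"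
    by (rule state.equality) (simp_all add: fun_eq_iff)
  then show ?case
    using exec.Rand[of b inp "d + r" \<rho>] Rand by (metis relocate.simps(7))
qed

subsection \<open>Weakest preconditions\<close>

text \<open>Some terminating run satisfies \<open>Q\<close>, which also receives the running time.
  Times are thus added up by composing postconditions, and \<open>wp_simps\<close> turns
  straight-line code into an equation.\<close>

definition wp :: "nat \<Rightarrow> (nat \<Rightarrow> nat) \<Rightarrow> com \<Rightarrow> (nat \<Rightarrow> state \<Rightarrow> bool) \<Rightarrow> state \<Rightarrow> bool" where
  "wp b inp c Q \<sigma> \<longleftrightarrow> (\<exists>n \<sigma>'. exec b inp c \<sigma> n \<sigma>' \<and> Q n \<sigma>')"

inductive_cases execE:
  "exec b inp Skip \<sigma> n \<sigma>'" "exec b inp (Const r v) \<sigma> n \<sigma>'" "exec b inp (Op p r r1 r2) \<sigma> n \<sigma>'"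
  "exec b inp (Load r a i) \<sigma> n \<sigma>'" "exec b inp (Store a i r) \<sigma> n \<sigma>'"
  "exec b inp (Input r i) \<sigma> n \<sigma>'" "exec b inp (Rand r) \<sigma> n \<sigma>'" "exec b inp (Seq c1 c2) \<sigma> n \<sigma>'"
  "exec b inp (IfNZ r c1 c2) \<sigma> n \<sigma>'"

lemma wp_simps:
  "wp b inp Skip Q \<sigma> = Q 1 \<sigma>"
  "wp b inp (Const r v) Q \<sigma> = Q 1 (set_reg r (v mod 2 ^ b) \<sigma>)"
  "wp b inp (Op p r r1 r2) Q \<sigma> = Q 1 (set_reg r (binop_val p b (regs \<sigma> r1) (regs \<sigma> r2)) \<sigma>)"
  "wp b inp (Load r a i) Q \<sigma> = Q 1 (set_reg r (mem \<sigma> a (regs \<sigma> i)) \<sigma>)"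
  "wp b inp (Store a i r) Q \<sigma> = Q 1 (\<sigma>\<lparr>mem := (mem \<sigma>)(a := (mem \<sigma> a)(regs \<sigma> i := regs \<sigma> r))\<rparr>)"
  "wp b inp (Rand r) Q \<sigma> = Q 1 (set_reg r (shd (tape \<sigma>)) (\<sigma>\<lparr>tape := stl (tape \<sigma>)\<rparr>))"
  "wp b inp (Seq c1 c2) Q \<sigma> = wp b inp c1 (\<lambda>n. wp b inp c2 (\<lambda>m. Q (n + m))) \<sigma>"
  "wp b inp (IfNZ r c1 c2) Q \<sigma> =
    (if regs \<sigma> r \<noteq> 0 then wp b inp c1 (\<lambda>n. Q (Suc n)) \<sigma> else wp b inp c2 (\<lambda>n. Q (Suc n)) \<sigma>)"
  unfolding wp_def
  subgoal by (fastforce elim!: execE intro: exec.intros)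
  subgoal by (fastforce elim!: execE intro: exec.intros)
  subgoal by (fastforce elim!: execE intro: exec.intros)
  subgoal by (fastforce elim!: execE intro: exec.intros)
  subgoal by (fastforce elim!: execE intro: exec.intros)
  subgoal by (fastforce elim!: execE intro: exec.intros)
  subgoal by (fastforce elim!: execE intro: exec.intros)
  subgoal by (cases "regs \<sigma> r = 0") (auto elim!: execE intro: exec.IfTrue exec.IfFalse)
  done

lemma wp_mono: "wp b inp c P \<sigma> \<Longrightarrow> (\<And>n \<sigma>'. P n \<sigma>' \<Longrightarrow> Q n \<sigma>') \<Longrightarrow> wp b inp c Q \<sigma>"
  by (auto simp: wp_def)

text \<open>Validity and frame facts hold for every run, hence also for the one that
  \<open>wp\<close> provides, and may be added to its postcondition.\<close>

lemma wp_conseq: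
  assumes "wp b inp c P \<sigma>" "valid_state b \<sigma>" "\<And>i. inp i < 2 ^ b" "b > 0"
    "\<And>n \<sigma>'. P n \<sigma>' \<Longrightarrow> valid_state b \<sigma>' \<Longrightarrow> agree (modr c) (moda c) \<sigma> \<sigma>' \<Longrightarrow> Q n \<sigma>'"
  shows "wp b inp c Q \<sigma>"
  using assms exec_agree exec_valid unfolding wp_def by blast

lemma wp_while_step:
  "regs \<sigma> r \<noteq> 0 \<Longrightarrow> wp b inp c (\<lambda>n \<sigma>'. wp b inp (WhileNZ r c) (\<lambda>m. Q (Suc (n + m))) \<sigma>') \<sigma> \<Longrightarrow>
    wp b inp (WhileNZ r c) Q \<sigma>"
  unfolding wp_def by (blast intro: exec.WhileTrue)

lemma wp_while_done: "regs \<sigma> r = 0 \<Longrightarrow> Q 1 \<sigma> \<Longrightarrow> wp b inp (WhileNZ r c) Q \<sigma>"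
  unfolding wp_def by (blast intro: exec.WhileFalse)

subsection \<open>Counting loops\<close>

text \<open>Register 52 holds the constant 1 and register 3 the loop condition; nested loops may share
  the latter because it is recomputed at the end of the body.\<close>

definition For :: "reg \<Rightarrow> reg \<Rightarrow> com \<Rightarrow> com" where
  "For i n c = Seq (Const i 0) (Seq (Op Lt 3 i n)
     (WhileNZ 3 (Seq c (Seq (Op Add i i 52) (Op Lt 3 i n)))))"

lemma modr_For [simp]: "modr (For i n c) = {3, i} \<union> modr c"
  and moda_For [simp]: "moda (For i n c) = moda c"
  by (auto simp: For_def)

text \<open>The invariant gets the counter value as an argument and has to survive changes of
  registers 3 and \<open>i\<close>, which the loop itself writes between iterations. The frame in
  \<open>step\<close> is relative to the state before the loop. Besides the body a round costs 3
  units: loop test, increment and comparison.\<close>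

lemma wp_For:
  assumes ok: "valid_state b \<sigma>0" "\<And>i. inp i < 2 ^ b" "b > 0"
    and regs: "regs \<sigma>0 52 = 1" "i \<noteq> 3" "i \<noteq> 52" "n \<noteq> i" "n \<noteq> 3" "i \<notin> modr c" "n \<notin> modr c" "52 \<notin> modr c"
    and inv0: "I 0 \<sigma>0"
    and upd: "\<And>j \<sigma> \<sigma>'. I j \<sigma> \<Longrightarrow> agree {3, i} {} \<sigma> \<sigma>' \<Longrightarrow> tape \<sigma>' = tape \<sigma> \<Longrightarrow> I j \<sigma>'"
    and step: "\<And>j \<sigma>. j < regs \<sigma>0 n \<Longrightarrow> valid_state b \<sigma> \<Longrightarrow> agree ({3, i} \<union> modr c) (moda c) \<sigma>0 \<sigma> \<Longrightarrow>
      regs \<sigma> i = j \<Longrightarrow> I j \<sigma> \<Longrightarrow> wp b inp c (\<lambda>t \<sigma>'. t \<le> T \<and> I (Suc j) \<sigma>') \<sigma>"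
  shows "wp b inp (For i n c) (\<lambda>t \<sigma>'. t \<le> regs \<sigma>0 n * (T + 3) + 3 \<and> I (regs \<sigma>0 n) \<sigma>') \<sigma>0"
proof -
  define k where "k = regs \<sigma>0 n"
  \<comment> \<open>The bound is itself a word, so the counter, which never exceeds it, does not
    wrap around.\<close>
  have k: "k < 2 ^ b" using ok(1) by (simp add: k_def valid_state_def)
  let ?R = "{3, i} \<union> modr c"
  let ?W = "WhileNZ 3 (Seq c (Seq (Op Add i i 52) (Op Lt 3 i n)))"
  have loop: "wp b inp ?W (\<lambda>t \<sigma>'. t \<le> (k - j) * (T + 3) + 1 \<and> I k \<sigma>') \<sigma>"
    if "j \<le> k" "valid_state b \<sigma>" "agree ?R (moda c) \<sigma>0 \<sigma>" "regs \<sigma> i = j"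
      "regs \<sigma> 3 = (if j < k then 1 else 0)" "I j \<sigma>" for j \<sigma>
    using that
  proof (induction "k - j" arbitrary: j \<sigma>)
    case 0
    then have "j = k" by simp
    then show ?case using 0 by (intro wp_while_done) auto
  next
    case (Suc m)
    then have j: "j < k" "m = k - Suc j" by auto
    have "wp b inp c (\<lambda>t. wp b inp (Seq (Op Add i i 52) (Op Lt 3 i n)) (\<lambda>t'. wp b inp ?W
        (\<lambda>t'' \<rho>. Suc (t + t' + t'') \<le> (k - j) * (T + 3) + 1 \<and> I k \<rho>))) \<sigma>"
    proof (rule wp_conseq[OF step[OF _ Suc.prems(2,3,4,6)] Suc.prems(2) ok(2,3)])
      fix t \<sigma>' assume P: "t \<le> T \<and> I (Suc j) \<sigma>'" and v: "valid_state b \<sigma>'"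
        and a: "agree (modr c) (moda c) \<sigma> \<sigma>'"
      define \<sigma>1 where "\<sigma>1 = set_reg 3 (if Suc j < k then 1 else 0) (set_reg i (Suc j) \<sigma>')"
      have r: "regs \<sigma>' i = j" "regs \<sigma>' n = k" "regs \<sigma>' 52 = 1"
        using a Suc.prems(3,4) regs by (auto simp: agree_def k_def)
      have 1: "wp b inp (Seq (Op Add i i 52) (Op Lt 3 i n)) Q \<sigma>' = Q 2 \<sigma>1" for Q
        using r regs k j by (simp add: wp_simps \<sigma>1_def eval_nat_numeral)
      have I: "I (Suc j) \<sigma>1"
        using P by (intro upd[of "Suc j" \<sigma>' \<sigma>1]) (auto simp: \<sigma>1_def agree_def)
      have v1: "valid_state b \<sigma>1"
        using v k j ok(3) by (auto simp: valid_state_def \<sigma>1_def)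
      have a1: "agree ?R (moda c) \<sigma>0 \<sigma>1"
        using Suc.prems(3) a by (auto simp: agree_def \<sigma>1_def)
      have "wp b inp ?W (\<lambda>t \<sigma>'. t \<le> (k - Suc j) * (T + 3) + 1 \<and> I k \<sigma>') \<sigma>1"
        using j regs by (intro Suc.hyps(1)[OF j(2) _ v1 a1 _ _ I]) (auto simp: \<sigma>1_def)
      moreover have "(k - j) * (T + 3) = (k - Suc j) * (T + 3) + (T + 3)"
        using j by (metis Suc_diff_Suc add.commute mult_Suc)
      ultimately show "wp b inp (Seq (Op Add i i 52) (Op Lt 3 i n)) (\<lambda>t'. wp b inp ?W
        (\<lambda>t'' \<rho>. Suc (t + t' + t'') \<le> (k - j) * (T + 3) + 1 \<and> I k \<rho>)) \<sigma>'"
        unfolding 1 using P by (auto elim!: wp_mono)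
    qed (use j in \<open>simp_all add: k_def\<close>)
    then show ?case
      using Suc.prems(5) j by (intro wp_while_step) (auto simp: wp_simps(7) add.assoc elim!: wp_mono)
  qed
  define \<sigma>1 where "\<sigma>1 = set_reg 3 (if 0 < k then 1 else 0) (set_reg i 0 \<sigma>0)"
  have I: "I 0 \<sigma>1"
    using inv0 by (intro upd[of 0 \<sigma>0 \<sigma>1]) (auto simp: \<sigma>1_def agree_def)
  have v1: "valid_state b \<sigma>1"
    using ok(1,3) Suc_0_less_two_power[of b] by (auto simp: valid_state_def \<sigma>1_def)
  have "wp b inp ?W (\<lambda>t \<sigma>'. t \<le> (k - 0) * (T + 3) + 1 \<and> I k \<sigma>') \<sigma>1"
    using regs by (intro loop v1 I) (auto simp: \<sigma>1_def agree_def)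
  then have "wp b inp ?W (\<lambda>t \<sigma>'. Suc (Suc t) \<le> k * (T + 3) + 3 \<and> I k \<sigma>') \<sigma>1"
    by (auto elim!: wp_mono)
  moreover have "wp b inp (For i n c) Q \<sigma>0 = wp b inp ?W (\<lambda>t. Q (Suc (Suc t))) \<sigma>1" for Q
    using regs by (simp add: For_def wp_simps \<sigma>1_def k_def)
  ultimately show ?thesis by (simp add: k_def)
qed

section \<open>Averages over the first random words\<close>

text \<open>The expectation of \<open>\<phi>\<close> over \<open>n\<close> independent uniform words
  below \<open>q\<close>, as an iterated finite mean; positions from \<open>n\<close> on are filled
  with 0. All probabilities are computed in this form, where conditioning on the first words is mere
  unfolding, and \<open>measure_random_tape_prefix\<close> carries the result over to the
  tape.\<close>

primrec avg :: "nat \<Rightarrow> nat \<Rightarrow> ((nat \<Rightarrow> nat) \<Rightarrow> real) \<Rightarrow> real" where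
  "avg q 0 \<phi> = \<phi> (\<lambda>_. 0)"
| "avg q (Suc n) \<phi> = (\<Sum>u<q. avg q n (\<lambda>V. \<phi> (case_nat u V))) / real q"

lemma avg_mono: "(\<And>V. \<phi> V \<le> \<psi> V) \<Longrightarrow> avg q n \<phi> \<le> avg q n \<psi>"
  by (induction n arbitrary: \<phi> \<psi>) (auto intro!: divide_right_mono sum_mono)

lemma avg_add: "avg q n (\<lambda>V. \<phi> V + \<psi> V) = avg q n \<phi> + avg q n \<psi>"
  by (induction n arbitrary: \<phi> \<psi>) (auto simp: sum.distrib add_divide_distrib)

lemma avg_cmult: "avg q n (\<lambda>V. c * \<phi> V) = c * avg q n \<phi>"
  by (induction n arbitrary: \<phi>) (auto simp: sum_distrib_left)

lemma avg_diff: "avg q n (\<lambda>V. \<phi> V - \<psi> V) = avg q n \<phi> - avg q n \<psi>"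
  by (induction n arbitrary: \<phi> \<psi>) (auto simp: sum_subtractf diff_divide_distrib)

lemma avg_const [simp]: "q > 0 \<Longrightarrow> avg q n (\<lambda>V. c) = c"
  by (induction n) auto

lemma avg_sum: "avg q n (\<lambda>V. \<Sum>i\<in>I. \<phi> i V) = (\<Sum>i\<in>I. avg q n (\<phi> i))"
  by (induction n arbitrary: \<phi>) (auto simp: sum_divide_distrib intro: sum.swap)

lemma avg_cong: "(\<And>V. \<phi> V = \<psi> V) \<Longrightarrow> avg q n \<phi> = avg q n \<psi>"
  by presburger

definition join :: "nat \<Rightarrow> (nat \<Rightarrow> nat) \<Rightarrow> (nat \<Rightarrow> nat) \<Rightarrow> nat \<Rightarrow> nat" where
  "join n V V' = (\<lambda>i. if i < n then V i else V' (i - n))"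

lemma join_less [simp]: "i < n \<Longrightarrow> join n V V' i = V i"
  and join_add [simp]: "join n V V' (n + i) = V' i"
  by (auto simp: join_def)

text \<open>Fubini for the first \<open>n\<close> and the next \<open>m\<close> words.\<close>

lemma avg_split: "avg q (n + m) \<phi> = avg q n (\<lambda>V. avg q m (\<lambda>V'. \<phi> (join n V V')))"
proof (induction n arbitrary: \<phi>)
  case 0
  then show ?case by (simp add: join_def)
next
  case (Suc n)
  have "join (Suc n) (case_nat u V) V' = case_nat u (join n V V')" for u V V'
    by (auto simp: join_def fun_eq_iff split: nat.split)
  then show ?case by (simp add: Suc)
qed

lemma avg_of_bool_nonneg: "0 \<le> avg q n (\<lambda>V. of_bool (P V))"
proof (cases "q = 0")
  case True
  then show ?thesis by (cases n) auto
next
  case False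
  then show ?thesis using avg_mono[of "\<lambda>_. 0" "\<lambda>V. of_bool (P V)" q n] by simp
qed

text \<open>An event that depends on the first \<open>K\<close> words is the preimage of a set of
  lists under \<open>stake K\<close>, hence measurable. Its measure follows by induction on
  \<open>K\<close>, since a random stream is a random word followed by an independent stream of the
  same law.\<close>

lemma measure_random_tape_prefix:
  assumes "\<And>V V'. (\<And>i. i < K \<Longrightarrow> V i = V' i) \<Longrightarrow> P V = P V'"
  shows "{\<omega>. P (\<lambda>i. \<omega> !! i)} \<in> sets (random_tape b)"
    and "measure (random_tape b) {\<omega>. P (\<lambda>i. \<omega> !! i)} = avg (2 ^ b) K (\<lambda>V. of_bool (P V))"
proof -
  let ?M = "measure_pmf (pmf_of_set {..<(2::nat) ^ b})"
  have sets: "{\<omega>. P (\<lambda>i. \<omega> !! i)} \<in> sets (random_tape b)"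
    if loc: "\<And>V V'. (\<And>i. i < K \<Longrightarrow> V i = V' i) \<Longrightarrow> P V = P V'" for K P
  proof -
    have "P (\<lambda>i. \<omega> !! i) = P (\<lambda>i. \<omega>' !! i)" if eq: "stake K \<omega> = stake K \<omega>'" for \<omega> \<omega>'
      by (rule loc) (metis eq stake_nth)
    then have "{\<omega>. P (\<lambda>i. \<omega> !! i)} = stake K -` {xs. \<exists>\<omega>. xs = stake K \<omega> \<and> P (\<lambda>i. \<omega> !! i)} \<inter> UNIV"
      by blast
    then have "{\<omega>. P (\<lambda>i. \<omega> !! i)} = stake K -` {xs. \<exists>\<omega>. xs = stake K \<omega> \<and> P (\<lambda>i. \<omega> !! i)} \<inter> space (random_tape b)"
      by (simp add: random_tape_def space_stream_space streams_UNIV)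
    moreover have "stake K \<in> measurable (random_tape b) (count_space UNIV)"
      unfolding random_tape_def by measurable
    ultimately show ?thesis by (simp add: measurable_sets)
  qed
  show "{\<omega>. P (\<lambda>i. \<omega> !! i)} \<in> sets (random_tape b)"
    using assms by (rule sets)
  have eq: "emeasure (random_tape b) {\<omega>. P (\<lambda>i. \<omega> !! i)} = ennreal (avg (2 ^ b) K (\<lambda>V. of_bool (P V)))"
    using assms
  proof (induction K arbitrary: P)
    case 0
    have P: "P V = P (\<lambda>_. 0)" for V using 0 by blast
    have 1: "emeasure (random_tape b) (space (random_tape b)) = 1"
      unfolding random_tape_def
      by (rule prob_space.emeasure_space_1[OF prob_space.prob_space_stream_space[OF prob_space_measure_pmf]])
    have 2: "space (random_tape b) = UNIV"
      by (simp add: random_tape_def space_stream_space streams_UNIV)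
    show ?case
    proof (cases "P (\<lambda>_. 0)")
      case True
      then have "P V" for V using P[of V] by simp
      then show ?thesis using 1 2 by simp
    next
      case False
      then have "\<not> P V" for V using P[of V] by simp
      then show ?thesis by simp
    qed
  next
    case (Suc K)
    have S: "{\<omega>. P (\<lambda>i. \<omega> !! i)} \<in> sets (stream_space ?M)"
      using sets[OF Suc.prems] unfolding random_tape_def .
    have *: "{\<omega> \<in> space (stream_space ?M). u ## \<omega> \<in> {\<omega>. P (\<lambda>i. \<omega> !! i)}} =
        {\<omega>. P (case_nat u (\<lambda>i. \<omega> !! i))}" for u
    proof -
      have "(!!) (u ## \<omega>) = case_nat u ((!!) \<omega>)" for \<omega> by (auto simp: fun_eq_iff Stream_snth)
      then show ?thesis by (simp add: space_stream_space streams_UNIV)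
    qed
    have "emeasure (random_tape b) {\<omega>. P (case_nat u (\<lambda>i. \<omega> !! i))} =
        ennreal (avg (2 ^ b) K (\<lambda>V. of_bool (P (case_nat u V))))" for u
      by (rule Suc.IH, rule Suc.prems) (auto split: nat.split)
    then have "emeasure (random_tape b) {\<omega>. P (\<lambda>i. \<omega> !! i)} =
       (\<integral>\<^sup>+u. ennreal (avg (2 ^ b) K (\<lambda>V. of_bool (P (case_nat u V)))) \<partial>?M)"
      unfolding random_tape_def prob_space.emeasure_stream_space[OF prob_space_measure_pmf S] * by simp
    also have "\<dots> = (\<Sum>u<2 ^ b. ennreal (avg (2 ^ b) K (\<lambda>V. of_bool (P (case_nat u V))))) / ennreal (2 ^ b)"
      by (subst nn_integral_pmf_of_set) (auto simp: ennreal_of_nat_eq_real_of_nat lessThan_empty_iff)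
    also have "\<dots> = ennreal (avg (2 ^ b) (Suc K) (\<lambda>V. of_bool (P V)))"
      by (simp add: sum_ennreal avg_of_bool_nonneg divide_ennreal sum_nonneg)
    finally show ?case .
  qed
  show "measure (random_tape b) {\<omega>. P (\<lambda>i. \<omega> !! i)} = avg (2 ^ b) K (\<lambda>V. of_bool (P V))"
    by (simp add: measure_def eq avg_of_bool_nonneg)
qed


section \<open>Pairwise independent hashing\<close>

text \<open>The sum of the words selected by the low \<open>k\<close> bits of \<open>p\<close>, plus
  the offset word \<open>V k\<close>. The coefficients are 0 and 1, so pairwise independence modulo
  \<open>n\<close> requires neither inverses nor a prime modulus.\<close>

primrec hs :: "nat \<Rightarrow> (nat \<Rightarrow> nat) \<Rightarrow> nat \<Rightarrow> nat" where
  "hs 0 V p = V 0"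
| "hs (Suc k) V p = (p mod 2) * V 0 + hs k (\<lambda>i. V (Suc i)) (p div 2)"

lemma hs_cong: "(\<And>i. i \<le> k \<Longrightarrow> V i = V' i) \<Longrightarrow> hs k V p = hs k V' p"
proof (induction k arbitrary: V V' p)
  case (Suc k)
  have "hs k (\<lambda>i. V (Suc i)) (p div 2) = hs k (\<lambda>i. V' (Suc i)) (p div 2)"
    by (rule Suc.IH) (use Suc.prems in auto)
  then show ?case using Suc.prems[of 0] by simp
qed simp

text \<open>\<open>[q]\<close> splits into \<open>q / n\<close> blocks of \<open>n\<close>
  consecutive numbers, and each block shifted by \<open>c\<close> is a complete residue
  system.\<close>

lemma residue_average:
  assumes "u < n" "n dvd q" "q > 0"
  shows "(\<Sum>v<q. of_bool ((v + c) mod n = u)) / real q = 1 / real n"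
proof -
  obtain e where q: "q = n * e" using assms(2) by blast
  have one: "(\<Sum>v<n. of_bool ((v + c) mod n = u)) = (1::real)"
  proof -
    have "v = v'" if "v \<le> v'" "v' < n" "(v + c) mod n = (v' + c) mod n" for v v'
    proof -
      have "n dvd (v' + c) - (v + c)"
        using that by (subst mod_eq_dvd_iff_nat[symmetric]) auto
      then show ?thesis using that by (auto dest: dvd_imp_le)
    qed
    then have inj: "inj_on (\<lambda>v. (v + c) mod n) {..<n}"
      by (intro inj_onI) (metis lessThan_iff nat_le_linear)
    have "(\<lambda>v. (v + c) mod n) ` {..<n} = {..<n}"
      by (rule endo_inj_surj[OF _ _ inj]) (use assms in auto)
    then have "(\<Sum>v<n. of_bool ((v + c) mod n = u)) = (\<Sum>v<n. of_bool (v = u) :: real)"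
      using sum.reindex[OF inj, of "\<lambda>v. of_bool (v = u) :: real"] by (simp add: comp_def)
    then show ?thesis using assms(1) by simp
  qed
  have "(\<Sum>v<q. of_bool ((v + c) mod n = u)) =
      (\<Sum>m<e. \<Sum>v\<in>{0 + m * n..<n + m * n}. of_bool ((v + c) mod n = u) :: real)"
    unfolding q by (subst mult.commute[of n e]) (simp add: sum.nat_group[symmetric] add.commute)
  also have "\<dots> = real e"
    unfolding sum.shift_bounds_nat_ivl using one by (simp add: add.assoc add.commute[of _ c] lessThan_atLeast0)
      (simp add: add.assoc[symmetric])
  finally have "(\<Sum>v<q. of_bool ((v + c) mod n = u)) = real e" .
  then show ?thesis using assms q by simp
qed

text \<open>The offset word alone is uniform modulo \<open>n\<close>. The words selected by the bits
  only shift it and are absorbed into \<open>c\<close>.\<close>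

lemma hs_uniform:
  assumes "u < n" "n dvd q" "q > 0"
  shows "avg q (Suc k) (\<lambda>V. of_bool ((c + hs k V p) mod n = u)) = 1 / real n"
  using assms
proof (induction k arbitrary: c p)
  case 0
  then show ?case using residue_average[of u n q c] by (simp add: add.commute)
next
  case (Suc k)
  show ?case
    using Suc.IH[OF Suc.prems, of "c + _" "p div 2"] Suc.prems
    by (subst avg.simps) (simp add: add.assoc del: avg.simps)
qed

text \<open>The bits of \<open>p\<close> and \<open>p'\<close> are compared from the lowest on.
  While they agree, the current word shifts both values by the same amount, absorbed into
  \<open>c\<close> and \<open>c'\<close>. At the first difference it enters one value only and makes
  it uniform for every choice of the remaining words, while the other value is uniform by
  \<open>hs_uniform\<close>.\<close>

lemma hs_pairwise:
  assumes "u < n" "u' < n" "n dvd q" "q > 0" "p \<noteq> p'" "p < 2 ^ k" "p' < 2 ^ k"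
  shows "avg q (Suc k) (\<lambda>V. of_bool ((c + hs k V p) mod n = u \<and> (c' + hs k V p') mod n = u')) = 1 / (real n)\<^sup>2"
  using assms
proof (induction k arbitrary: c c' p p')
  case (Suc k)
  have half: "p div 2 < 2 ^ k" "p' div 2 < 2 ^ k" using Suc.prems by auto
  show ?case
  proof (cases "p mod 2 = p' mod 2")
    case True
    then have "p div 2 \<noteq> p' div 2" using Suc.prems(5) by (metis div_mult_mod_eq)
    from Suc.IH[OF Suc.prems(1-4) this half, of "c + _" "c' + _"] show ?thesis
      using Suc.prems by (subst avg.simps) (simp add: add.assoc del: avg.simps)
  next
    case False
    \<comment> \<open>The two ways in which the bits can differ are mirror images; all data are
      generalised here so that one argument serves both.\<close>
    have main: "avg q (Suc (Suc k)) (\<lambda>V. of_bool ((c + hs (Suc k) V p) mod n = u \<and> (c' + hs (Suc k) V p') mod n = u'))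
        = 1 / (real n)\<^sup>2"
      if "p mod 2 = 1" "p' mod 2 = 0" "u < n" "u' < n" for c c' u u' p p'
    proof -
      have "avg q (Suc (Suc k)) (\<lambda>V. of_bool ((c + hs (Suc k) V p) mod n = u \<and> (c' + hs (Suc k) V p') mod n = u')) =
        (\<Sum>v<q. avg q (Suc k) (\<lambda>V. of_bool ((c' + hs k V (p' div 2)) mod n = u') *
            (of_bool ((v + (c + hs k V (p div 2))) mod n = u)))) / real q"
        using that by (subst avg.simps) (simp add: of_bool_conj mult.commute add.commute add.left_commute del: avg.simps)
      \<comment> \<open>The mean over the current word moves inside, to the only factor that
        contains this word.\<close>
      also have "\<dots> = avg q (Suc k) (\<lambda>V. of_bool ((c' + hs k V (p' div 2)) mod n = u') *
            ((\<Sum>v<q. of_bool ((v + (c + hs k V (p div 2))) mod n = u)) / real q))"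
      proof -
        have "(\<Sum>v<q. avg q m (\<lambda>V. A V * B v V)) / real q = avg q m (\<lambda>V. A V * ((\<Sum>v<q. B v V) / real q))"
          for m A and B :: "nat \<Rightarrow> (nat \<Rightarrow> nat) \<Rightarrow> real"
        proof -
          have "(\<Sum>v<q. avg q m (\<lambda>V. A V * B v V)) / real q = avg q m (\<lambda>V. (1 / real q) * (\<Sum>v<q. A V * B v V))"
            unfolding avg_cmult avg_sum by simp
          also have "\<dots> = avg q m (\<lambda>V. A V * ((\<Sum>v<q. B v V) / real q))"
            by (simp add: sum_distrib_left[symmetric])
          finally show ?thesis .
        qed
        then show ?thesis .
      qed
      also have "\<dots> = avg q (Suc k) (\<lambda>V. 1 / real n * of_bool ((c' + hs k V (p' div 2)) mod n = u'))"
        using that Suc.prems by (simp only: residue_average mult.commute)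
      also have "\<dots> = 1 / (real n)\<^sup>2"
        using that Suc.prems by (simp only: avg_cmult hs_uniform) (simp add: power2_eq_square)
      finally show ?thesis .
    qed
    consider "p mod 2 = 1" "p' mod 2 = 0" | "p mod 2 = 0" "p' mod 2 = 1" using False by linarith
    then show ?thesis
    proof cases
      case 1
      then show ?thesis using Suc.prems by (intro main)
    next
      case 2
      then show ?thesis using main[of p' p u' u c' c] Suc.prems by (simp only: conj_commute)
    qed
  qed
qed simp


section \<open>Rainbow tables\<close>

lemma sum_pick:
  fixes \<psi> :: "nat \<Rightarrow> real"
  assumes "y < n"
  shows "(\<Sum>x<n. \<psi> x * of_bool (y = x)) = \<psi> y" "(\<Sum>x<n. \<psi> x * of_bool (x = y)) = \<psi> y"
    "(\<Sum>x<n. of_bool (y = x) * \<psi> x) = \<psi> y" "(\<Sum>x<n. of_bool (x = y) * \<psi> x) = \<psi> y"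
proof -
  have "(\<Sum>x<n. if x = y then \<psi> x else 0) = \<psi> y" using assms by simp
  moreover have "\<psi> x * of_bool (y = x) = (if x = y then \<psi> x else 0)" "\<psi> x * of_bool (x = y) = (if x = y then \<psi> x else 0)"
    "of_bool (y = x) * \<psi> x = (if x = y then \<psi> x else 0)" "of_bool (x = y) * \<psi> x = (if x = y then \<psi> x else 0)" for x
    by auto
  ultimately show "(\<Sum>x<n. \<psi> x * of_bool (y = x)) = \<psi> y" "(\<Sum>x<n. \<psi> x * of_bool (x = y)) = \<psi> y"
    "(\<Sum>x<n. of_bool (y = x) * \<psi> x) = \<psi> y" "(\<Sum>x<n. of_bool (x = y) * \<psi> x) = \<psi> y"
    by simp_all
qed

locale rainbow =
  fixes q n mu M B :: nat and g :: "nat \<Rightarrow> nat"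
  assumes q: "q > 0" "n dvd q" and M: "M = 2 ^ mu" "n = M * B" and B: "B > 0"
    and g_less: "x < n \<Longrightarrow> g x < M"
    and g_fibre: "j < M \<Longrightarrow> card {x. x < n \<and> g x = j} = B"
begin

abbreviation "kappa \<equiv> Suc mu"

text \<open>Layer \<open>z\<close> owns the \<open>kappa\<close> consecutive words from
  \<open>z * kappa\<close> on, one for each bit of a position and one for the offset. Different
  layers are therefore independent.\<close>

definition hv :: "(nat \<Rightarrow> nat) \<Rightarrow> nat \<Rightarrow> nat \<Rightarrow> nat" where
  "hv V z p = hs mu (\<lambda>i. V (z * kappa + i)) p mod n"

fun pos :: "(nat \<Rightarrow> nat) \<Rightarrow> nat \<Rightarrow> nat \<Rightarrow> nat \<Rightarrow> nat" where
  "pos V z 0 p = p"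
| "pos V z (Suc k) p = pos V (Suc z) k (g (hv V z p))"

lemma n_pos: "n > 0" and M_pos: "M > 0"
  using M B by auto

lemma hv_less: "hv V z p < n"
  using n_pos by (simp add: hv_def)

lemma pos_add: "pos V z (k + l) p = pos V (z + k) l (pos V z k p)"
  by (induction k arbitrary: z p) auto

lemma hv_join_0: "hv (join kappa V V') 0 p = hs mu V p mod n"
  unfolding hv_def by (intro arg_cong[of _ _ "\<lambda>x. x mod n"] hs_cong) (simp add: join_def)

lemma hv_join_Suc: "hv (join kappa V V') (Suc z) p = hv V' z p"
  by (simp add: hv_def join_def add.assoc)

lemma pos_join_Suc: "pos (join kappa V V') (Suc z) k p = pos V' z k p"
  by (induction k arbitrary: z p) (auto simp: hv_join_Suc)

lemmas join_simps = hv_join_0 hv_join_Suc pos_join_Suc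

text \<open>The basis of all inductions along a chain: once the first layer is fixed, what remains
  is a chain of length \<open>k\<close> with fresh words.\<close>

lemma avg_layers: "avg q (Suc k * kappa) \<phi> = avg q kappa (\<lambda>V. avg q (k * kappa) (\<lambda>V'. \<phi> (join kappa V V')))"
  unfolding mult_Suc by (rule avg_split)

lemma avg_one:
  "avg q kappa (\<lambda>V. \<psi> (hs mu V p mod n)) = (\<Sum>x<n. \<psi> x) / real n"
proof -
  have *: "\<psi> y = (\<Sum>x<n. \<psi> x * of_bool (y = x))" if "y < n" for y
    using sum_pick(1)[OF that] by simp
  have "avg q kappa (\<lambda>V. \<psi> (hs mu V p mod n)) =
      avg q kappa (\<lambda>V. \<Sum>x<n. \<psi> x * of_bool ((0 + hs mu V p) mod n = x))"
    using n_pos by (intro avg_cong) (subst *, auto)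
  also have "\<dots> = (\<Sum>x<n. \<psi> x / real n)"
    unfolding avg_sum avg_cmult by (intro sum.cong refl, subst hs_uniform) (use q in auto)
  finally show ?thesis by (simp add: sum_divide_distrib)
qed

text \<open>Pairwise independence as a change of variables: the hash values of two different
  positions may be replaced by two independent uniform elements of \<open>[n]\<close>.\<close>

lemma avg_two:
  assumes "p \<noteq> p'" "p < M" "p' < M"
  shows "avg q kappa (\<lambda>V. \<psi> (hs mu V p mod n) (hs mu V p' mod n)) = (\<Sum>x<n. \<Sum>y<n. \<psi> x y) / (real n)\<^sup>2"
proof -
  have *: "\<psi> x' y' = (\<Sum>x<n. \<Sum>y<n. \<psi> x y * of_bool (x' = x \<and> y' = y))" if "x' < n" "y' < n" for x' y'
  proof -
    have "(\<Sum>x<n. \<Sum>y<n. \<psi> x y * of_bool (x' = x \<and> y' = y)) = (\<Sum>x<n. \<Sum>y<n. \<psi> x y * of_bool (y' = y) * of_bool (x' = x))"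
      by (intro sum.cong) auto
    also have "\<dots> = \<psi> x' y'"
      using that by (simp only: sum_distrib_right[symmetric] sum_pick)
    finally show ?thesis by simp
  qed
  have "avg q kappa (\<lambda>V. \<psi> (hs mu V p mod n) (hs mu V p' mod n)) =
      avg q kappa (\<lambda>V. \<Sum>x<n. \<Sum>y<n. \<psi> x y * of_bool ((0 + hs mu V p) mod n = x \<and> (0 + hs mu V p') mod n = y))"
    using n_pos by (intro avg_cong) (subst *, auto)
  also have "\<dots> = (\<Sum>x<n. \<Sum>y<n. \<psi> x y / (real n)\<^sup>2)"
    unfolding avg_sum avg_cmult by (intro sum.cong refl, subst hs_pairwise) (use q assms M in auto)
  finally show ?thesis by (simp add: sum_divide_distrib)
qed

lemma sum_fibre: "j < M \<Longrightarrow> (\<Sum>y<n. of_bool (g y = j)) = real B"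
  using g_fibre[of j] by (simp add: of_bool_def sum.If_cases Collect_conj_eq lessThan_def Int_commute)

lemma sum_fibre': "j < M \<Longrightarrow> (\<Sum>y<n. of_bool (j = g y)) = real B"
  by (simp only: eq_commute[of j] sum_fibre)

text \<open>All fibres of \<open>g\<close> have size \<open>B\<close>, so whatever bucket the first
  chain enters, the second enters the same one with probability \<open>B / n\<close>.\<close>

lemma avg_merge:
  assumes "p \<noteq> p'" "p < M" "p' < M"
  shows "avg q kappa (\<lambda>V. of_bool (g (hs mu V p mod n) = g (hs mu V p' mod n))) = 1 / real M"
proof -
  have "(\<Sum>x<n. \<Sum>y<n. of_bool (g x = g y) :: real) = (\<Sum>x<n. real B)"
    using sum_fibre'[OF g_less] by (intro sum.cong) auto
  then show ?thesis
    using n_pos M_pos B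
    by (subst avg_two[OF assms, of "\<lambda>x y. of_bool (g x = g y)"]) (simp add: M(2) power2_eq_square field_simps)
qed

text \<open>The final position is only recorded modulo \<open>m'\<close>, so that a table can be addressed directly by it.\<close>

context
  fixes m' :: nat
  assumes m': "m' dvd M" "m' > 0"
begin

text \<open>\<open>g\<close> is balanced over \<open>[M]\<close>, and \<open>[M]\<close> is balanced
  over the residues modulo a divisor of \<open>M\<close>.\<close>

lemma sum_congruent: "(\<Sum>y<n. of_bool (g y mod m' = j mod m')) = real n / real m'"
proof -
  obtain e where e: "M = m' * e" using m' by blast
  have "(\<Sum>y<n. of_bool (g y mod m' = j mod m') :: real)
      = (\<Sum>y<n. \<Sum>i<M. of_bool (g y = i) * of_bool (i mod m' = j mod m'))"
    using g_less by (intro sum.cong refl) (simp only: sum_pick lessThan_iff)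
  also have "\<dots> = (\<Sum>i<M. \<Sum>y<n. of_bool (g y = i) * of_bool (i mod m' = j mod m'))"
    by (rule sum.swap)
  also have "\<dots> = (\<Sum>i<M. real B * of_bool (i mod m' = j mod m'))"
    unfolding sum_distrib_right[symmetric] using sum_fibre by (intro sum.cong) auto
  also have "\<dots> = real B * (real M / real m')"
    using residue_average[of "j mod m'" m' M 0] m' M_pos by (simp add: sum_distrib_left[symmetric] field_simps)
  finally show ?thesis by (simp add: M(2))
qed

lemma sum_congruent': "(\<Sum>y<n. of_bool (j mod m' = g y mod m')) = real n / real m'"
  by (simp only: eq_commute[of "j mod m'"] sum_congruent)

lemma avg_end_merge:
  assumes "p \<noteq> p'" "p < M" "p' < M"
  shows "avg q kappa (\<lambda>V. of_bool (g (hs mu V p mod n) mod m' = g (hs mu V p' mod n) mod m')) = 1 / real m'"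
proof -
  have "(\<Sum>x<n. \<Sum>y<n. of_bool (g x mod m' = g y mod m') :: real) = (\<Sum>x<n. real n / real m')"
    by (simp only: sum_congruent')
  then show ?thesis
    using n_pos by (subst avg_two[OF assms, of "\<lambda>x y. of_bool (g x mod m' = g y mod m')"]) (simp add: power2_eq_square)
qed

abbreviation hit :: "nat \<Rightarrow> (nat \<Rightarrow> nat) \<Rightarrow> nat \<Rightarrow> nat \<Rightarrow> bool" where
  "hit x V p s \<equiv> hv V s (pos V 0 s p) = x"

abbreviation same_end :: "nat \<Rightarrow> (nat \<Rightarrow> nat) \<Rightarrow> nat \<Rightarrow> nat \<Rightarrow> bool" where
  "same_end k V p p' \<equiv> pos V 0 k p mod m' = pos V 0 k p' mod m'"

text \<open>The hash value in layer \<open>s\<close> is uniform whatever position the earlier layers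
  lead to.\<close>

lemma prob_hit:
  assumes "s < k" "x < n"
  shows "avg q (k * kappa) (\<lambda>V. of_bool (hit x V p s)) = 1 / real n"
  using assms
proof (induction k arbitrary: s p)
  case (Suc k)
  show ?case
  proof (cases s)
    case 0
    then show ?thesis
      using Suc.prems sum_pick(4)[of x n "\<lambda>_. 1"]
      by (simp only: avg_layers join_simps pos.simps avg_const[OF q(1)] avg_one[of "\<lambda>y. of_bool (y = x)"]) simp
  next
    case s: (Suc s')
    have "avg q (k * kappa) (\<lambda>V. of_bool (hit x V p' s')) = 1 / real n" for p'
      using Suc s by simp
    then show ?thesis by (simp only: s avg_layers join_simps pos.simps avg_const[OF q(1)])
  qed
qed simp

text \<open>Two chains either merge in one of the first \<open>k - 1\<close> steps, with probability
  at most \<open>1 / M\<close> for each step, or are at different positions before the last step and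
  then share an address with probability \<open>1 / m'\<close>.\<close>

lemma prob_same_end:
  assumes "k > 0" "p \<noteq> p'" "p < M" "p' < M"
  shows "avg q (k * kappa) (\<lambda>V. of_bool (same_end k V p p')) \<le> real (k - 1) / real M + 1 / real m'"
  using assms
proof (induction k arbitrary: p p')
  case (Suc k)
  show ?case
  proof (cases "k = 0")
    case True
    then show ?thesis
      using q avg_end_merge[OF Suc.prems(2-4)] by (simp only: True avg_layers join_simps pos.simps) simp
  next
    case False
    let ?c = "real (k - 1) / real M + 1 / real m'"
    have "avg q (Suc k * kappa) (\<lambda>V. of_bool (same_end (Suc k) V p p'))
      = avg q kappa (\<lambda>V. avg q (k * kappa) (\<lambda>V'. of_bool (same_end k V' (g (hs mu V p mod n)) (g (hs mu V p' mod n)))))"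
      by (simp only: avg_layers join_simps pos.simps)
    also have "\<dots> \<le> avg q kappa (\<lambda>V. of_bool (g (hs mu V p mod n) = g (hs mu V p' mod n)) + ?c)"
    proof (rule avg_mono)
      fix V
      show "avg q (k * kappa) (\<lambda>V'. of_bool (same_end k V' (g (hs mu V p mod n)) (g (hs mu V p' mod n))))
         \<le> of_bool (g (hs mu V p mod n) = g (hs mu V p' mod n)) + ?c"
        using Suc.IH[of "g (hs mu V p mod n)" "g (hs mu V p' mod n)"] False g_less n_pos q
        by (cases "g (hs mu V p mod n) = g (hs mu V p' mod n)") auto
    qed
    also have "\<dots> = real (Suc k - 1) / real M + 1 / real m'"
      using False by (simp only: avg_add avg_merge[OF Suc.prems(2-4)] avg_const[OF q(1)])
        (simp add: of_nat_diff add_divide_distrib[symmetric])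
    finally show ?thesis .
  qed
qed simp

text \<open>Demanding a hit costs a factor \<open>1 / n\<close> on top of the bound of
  \<open>prob_same_end\<close>. If the hit is due in the first layer, the first chain goes on from
  \<open>g x\<close>, and the value of the second chain is still uniform by pairwise independence.
  Otherwise a merge in the first layer has probability \<open>1 / M\<close> and leaves the later hit
  its probability \<open>1 / n\<close>.\<close>

lemma prob_hit_same_end:
  assumes "s < k" "x < n" "p \<noteq> p'" "p < M" "p' < M"
  shows "avg q (k * kappa) (\<lambda>V. of_bool (hit x V p s \<and> same_end k V p p'))
    \<le> (real (k - 1) / real M + 1 / real m') / real n"
  using assms
proof (induction k arbitrary: s p p')
  case (Suc k)
  let ?y = "\<lambda>V p. hs mu V p mod n"
  have y: "g (?y V p) < M" for V p using g_less n_pos by simp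
  have sum_x: "(\<Sum>y<n. \<Sum>z<n. of_bool (y = x) * \<psi> z) = (\<Sum>z<n. \<psi> z)" for \<psi> :: "nat \<Rightarrow> real"
    using Suc.prems(2) by (simp only: sum_distrib_left[symmetric] sum_pick)
  have two_x: "avg q kappa (\<lambda>V. of_bool (?y V p = x) * \<psi> (?y V p')) = (\<Sum>z<n. \<psi> z) / (real n)\<^sup>2" for \<psi> :: "nat \<Rightarrow> real"
    using avg_two[OF Suc.prems(3-5), of "\<lambda>y z. of_bool (y = x) * \<psi> z"] by (simp only: sum_x)
  show ?case
  proof (cases s)
    case s: 0
    have eq: "avg q (Suc k * kappa) (\<lambda>V. of_bool (hit x V p s \<and> same_end (Suc k) V p p')) =
       avg q kappa (\<lambda>V. of_bool (?y V p = x) * avg q (k * kappa) (\<lambda>V'. of_bool (same_end k V' (g x) (g (?y V p')))))"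
      by (simp only: avg_layers join_simps pos.simps s avg_cmult[symmetric]) (intro avg_cong, auto)
    show ?thesis
    proof (cases "k = 0")
      case True
      have "avg q kappa (\<lambda>V. of_bool (?y V p = x) * avg q (k * kappa) (\<lambda>V'. of_bool (same_end k V' (g x) (g (?y V p')))))
        = (\<Sum>z<n. of_bool (g x mod m' = g z mod m')) / (real n)\<^sup>2"
        using True two_x[of "\<lambda>z. of_bool (g x mod m' = g z mod m')"] by simp
      also have "\<dots> = 1 / real m' / real n"
        using sum_congruent'[of "g x"] n_pos by (simp add: power2_eq_square)
      finally show ?thesis unfolding eq using True by simp
    next
      case False
      let ?c = "real (k - 1) / real M + 1 / real m'"
      have "avg q kappa (\<lambda>V. of_bool (?y V p = x) * avg q (k * kappa) (\<lambda>V'. of_bool (same_end k V' (g x) (g (?y V p')))))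
        \<le> avg q kappa (\<lambda>V. of_bool (?y V p = x) * (of_bool (g (?y V p') = g x) + ?c))"
      proof (intro avg_mono mult_left_mono)
        fix V
        show "avg q (k * kappa) (\<lambda>V'. of_bool (same_end k V' (g x) (g (?y V p'))))
           \<le> of_bool (g (?y V p') = g x) + ?c"
          using prob_same_end[of k "g x" "g (?y V p')"] False y g_less Suc.prems(2) q
          by (cases "g (?y V p') = g x") auto
      qed simp
      also have "\<dots> = (\<Sum>z<n. of_bool (g z = g x) + ?c) / (real n)\<^sup>2"
        by (rule two_x)
      also have "\<dots> = (real B + real n * ?c) / (real n)\<^sup>2"
        using sum_fibre[of "g x"] g_less Suc.prems(2) by (simp add: sum.distrib)
      also have "\<dots> = (real (Suc k - 1) / real M + 1 / real m') / real n"
        using False n_pos M_pos B m' by (simp add: M(2) field_simps power2_eq_square of_nat_diff)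
      finally show ?thesis unfolding eq .
    qed
  next
    case s: (Suc s')
    then have k: "k > 0" "s' < k" using Suc.prems by auto
    let ?c = "(real (k - 1) / real M + 1 / real m') / real n"
    have "avg q (Suc k * kappa) (\<lambda>V. of_bool (hit x V p s \<and> same_end (Suc k) V p p')) =
       avg q kappa (\<lambda>V. avg q (k * kappa) (\<lambda>V'. of_bool (hit x V' (g (?y V p)) s' \<and> same_end k V' (g (?y V p)) (g (?y V p')))))"
      by (simp only: avg_layers join_simps pos.simps s)
    also have "\<dots> \<le> avg q kappa (\<lambda>V. (1 / real n) * of_bool (g (?y V p) = g (?y V p')) + ?c)"
    proof (rule avg_mono)
      fix V
      show "avg q (k * kappa) (\<lambda>V'. of_bool (hit x V' (g (?y V p)) s' \<and> same_end k V' (g (?y V p)) (g (?y V p'))))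
          \<le> (1 / real n) * of_bool (g (?y V p) = g (?y V p')) + ?c"
        using Suc.IH[OF k(2) Suc.prems(2), of "g (?y V p)" "g (?y V p')"] y
          prob_hit[OF k(2) Suc.prems(2), of "g (?y V p)"]
        by (cases "g (?y V p) = g (?y V p')") auto
    qed
    also have "\<dots> = (1 / real n) * (1 / real M) + ?c"
      by (simp only: avg_add avg_cmult avg_merge[OF Suc.prems(3-5)] avg_const[OF q(1)])
    also have "\<dots> = (real (Suc k - 1) / real M + 1 / real m') / real n"
      using k n_pos M_pos m' by (simp add: field_simps of_nat_diff)
    finally show ?thesis .
  qed
qed simp

text \<open>Hits in different layers depend on independent words, so their probabilities multiply
  even if the two chains coincide or have merged.\<close>

lemma prob_two_hits:
  assumes "s < s'" "s' < k" "x < n"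
  shows "avg q (k * kappa) (\<lambda>V. of_bool (hit x V p s \<and> hit x V p' s')) = 1 / (real n)\<^sup>2"
  using assms
proof (induction k arbitrary: s s' p p')
  case (Suc k)
  let ?y = "\<lambda>V p. hs mu V p mod n"
  obtain t' where s': "s' = Suc t'" using Suc.prems by (cases s') auto
  show ?case
  proof (cases s)
    case 0
    have "avg q (Suc k * kappa) (\<lambda>V. of_bool (hit x V p s \<and> hit x V p' s')) =
      avg q kappa (\<lambda>V. of_bool (?y V p = x) * avg q (k * kappa) (\<lambda>V'. of_bool (hit x V' (g (?y V p')) t')))"
      by (simp only: avg_layers join_simps pos.simps 0 s' avg_cmult[symmetric]) (intro avg_cong, auto)
    also have "\<dots> = avg q kappa (\<lambda>V. 1 / real n * of_bool (?y V p = x))"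
      using Suc.prems s' by (subst prob_hit) (auto simp: mult.commute)
    also have "\<dots> = 1 / (real n)\<^sup>2"
      using avg_one[of "\<lambda>y. of_bool (y = x)" p] Suc.prems sum_pick(4)[of x n "\<lambda>_. 1"]
      by (simp only: avg_cmult) (simp add: power2_eq_square)
    finally show ?thesis .
  next
    case s: (Suc t)
    have "avg q (k * kappa) (\<lambda>V. of_bool (hit x V p1 t \<and> hit x V p2 t')) = 1 / (real n)\<^sup>2" for p1 p2
      using Suc s s' by simp
    then show ?thesis by (simp only: s s' avg_layers join_simps pos.simps avg_const[OF q(1)])
  qed
qed simp


lemma hit_determines_end:
  assumes "hit x V a s" "hit x V b s" "s < k"
  shows "pos V 0 k a = pos V 0 k b"
proof -
  have "pos V 0 k p = pos V (Suc s) (k - Suc s) (g (hv V s (pos V 0 s p)))" for p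
    using assms(3) pos_add[of V 0 s "Suc (k - Suc s)" p] by simp
  then show ?thesis using assms by simp
qed

text \<open>Since chains overwrite each other's slots, a hit is of use only if the address of the
  chain is shared by no other start. Then the slot is certain to hold \<open>a\<close>.\<close>

definition covered :: "nat \<Rightarrow> nat \<Rightarrow> (nat \<Rightarrow> nat) \<Rightarrow> nat \<Rightarrow> bool" where
  "covered m k V x \<longleftrightarrow> (\<exists>a<m. \<exists>s<k. hit x V a s \<and> (\<forall>b<m. same_end k V b a \<longrightarrow> b = a))"

text \<open>A union bound over the other starts: from the probability of the hit, subtract for each
  of them that of a hit together with a shared address.\<close>

lemma prob_good:
  assumes "a < m" "s < k" "x < n" "m \<le> M"
  shows "avg q (k * kappa) (\<lambda>V. of_bool (hit x V a s \<and> (\<forall>b<m. same_end k V b a \<longrightarrow> b = a)))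
    \<ge> (1 - real m * (real (k - 1) / real M + 1 / real m')) / real n"
proof -
  let ?c = "(real (k - 1) / real M + 1 / real m') / real n"
  have "avg q (k * kappa) (\<lambda>V. of_bool (hit x V a s) - (\<Sum>b\<in>{..<m} - {a}. of_bool (hit x V a s \<and> same_end k V a b)))
    \<le> avg q (k * kappa) (\<lambda>V. of_bool (hit x V a s \<and> (\<forall>b<m. same_end k V b a \<longrightarrow> b = a)))"
  proof (rule avg_mono)
    fix V
    show "of_bool (hit x V a s) - (\<Sum>b\<in>{..<m} - {a}. of_bool (hit x V a s \<and> same_end k V a b))
      \<le> (of_bool (hit x V a s \<and> (\<forall>b<m. same_end k V b a \<longrightarrow> b = a)) :: real)"
    proof (cases "hit x V a s \<and> (\<exists>b<m. same_end k V b a \<and> b \<noteq> a)")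
      case True
      then obtain b where "b \<in> {..<m} - {a}" "same_end k V a b" by auto
      then have "(of_bool (hit x V a s \<and> same_end k V a b) :: real) \<le> (\<Sum>b\<in>{..<m} - {a}. of_bool (hit x V a s \<and> same_end k V a b))"
        by (intro member_le_sum) auto
      then show ?thesis using True \<open>same_end k V a b\<close> by auto
    next
      case False
      have "0 \<le> (\<Sum>b\<in>{..<m} - {a}. of_bool (hit x V a s \<and> same_end k V a b) :: real)"
        by (intro sum_nonneg) auto
      then show ?thesis using False by auto
    qed
  qed
  moreover have "avg q (k * kappa) (\<lambda>V. of_bool (hit x V a s) - (\<Sum>b\<in>{..<m} - {a}. of_bool (hit x V a s \<and> same_end k V a b)))
    = 1 / real n - (\<Sum>b\<in>{..<m} - {a}. avg q (k * kappa) (\<lambda>V. of_bool (hit x V a s \<and> same_end k V a b)))"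
    by (simp only: avg_diff avg_sum prob_hit[OF assms(2,3)])
  moreover have "(\<Sum>b\<in>{..<m} - {a}. avg q (k * kappa) (\<lambda>V. of_bool (hit x V a s \<and> same_end k V a b))) \<le> (\<Sum>b\<in>{..<m} - {a}. ?c)"
    using assms by (intro sum_mono prob_hit_same_end) auto
  moreover have "(\<Sum>b\<in>{..<m} - {a}. ?c) \<le> real m * ?c"
    by (subst sum_constant, intro mult_right_mono) (use assms in \<open>auto simp: card_Diff_singleton\<close>)
  ultimately show ?thesis by (simp add: diff_divide_distrib)
qed

end

text \<open>If \<open>c > 0\<close> indices satisfy \<open>G\<close>, the claim amounts to
  \<open>(c - 1) * (c - 2) \<ge> 0\<close>. The double sum runs over ordered pairs, hence the
  division by 2.\<close>

lemma bonferroni: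
  assumes "finite I"
  shows "of_bool (\<exists>i\<in>I. G i) \<ge> (\<Sum>i\<in>I. of_bool (G i)) - (\<Sum>i\<in>I. \<Sum>j\<in>I - {i}. of_bool (G i \<and> G j)) / (2::real)"
proof -
  define c where "c = card {i\<in>I. G i}"
  have 1: "(\<Sum>i\<in>I. of_bool (G i) :: real) = real c"
    using assms by (simp add: c_def of_bool_def sum.If_cases Collect_conj_eq Int_commute)
  have 2: "(\<Sum>j\<in>I - {i}. of_bool (G i \<and> G j) :: real) = of_bool (G i) * (real c - 1)" if "i \<in> I" for i
  proof -
    have "(\<Sum>j\<in>I - {i}. of_bool (G j) :: real) = real c - of_bool (G i)"
      using sum.remove[OF assms that, of "\<lambda>j. of_bool (G j) :: real"] unfolding 1 by linarith
    then show ?thesis unfolding of_bool_conj sum_distrib_left[symmetric] by (cases "G i") simp_all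
  qed
  have "(\<Sum>i\<in>I. \<Sum>j\<in>I - {i}. of_bool (G i \<and> G j)) = real c * (real c - 1)"
    using 1 2 by (simp only: sum_distrib_right[symmetric] cong: sum.cong)
  moreover have "of_bool (\<exists>i\<in>I. G i) = (of_bool (c > 0) :: real)"
    using assms by (auto simp: c_def card_gt_0_iff)
  moreover have "(of_bool (c > 0) :: real) \<ge> real c - real c * (real c - 1) / 2"
  proof (cases "c = 0 \<or> c = 1")
    case False
    then have "(real c - 1) * (real c - 2) \<ge> 0" by (intro mult_nonneg_nonneg) auto
    moreover have "(real c - 1) * (real c - 2) = real c * (real c - 1) - 2 * real c + 2" by algebra
    ultimately show ?thesis using False by simp
  qed auto
  ultimately show ?thesis using 1 by simp
qed

text \<open>Bonferroni is applied to the \<open>m * k = n / (4 * B)\<close> events that start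
  \<open>a\<close> hits \<open>x\<close> in layer \<open>s\<close> and has its address for itself.
  Each has probability at least \<open>1 / (2 * n)\<close> and each pair at most
  \<open>1 / n ^ 2\<close>, which leaves at least \<open>1 / (8 * B) - 1 / (32 * B)\<close>.\<close>

theorem prob_covered:
  assumes "4 * m * k = M" "x < n" "k > 0"
  shows "avg q (k * kappa) (\<lambda>V. of_bool (covered (4 * m) m k V x)) \<ge> 1 / (16 * real B)"
proof -
  have m: "m > 0" using assms M_pos by (cases m) auto
  have m': "4 * m dvd M" "4 * m > 0" using assms m by auto
  define I where "I = {..<m} \<times> {..<k}"
  define G where "G V i \<longleftrightarrow> hv V (snd i) (pos V 0 (snd i) (fst i)) = x \<and>
      (\<forall>b<m. pos V 0 k b mod (4 * m) = pos V 0 k (fst i) mod (4 * m) \<longrightarrow> b = fst i)" for V i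
  let ?E = "avg q (k * kappa)"
  have fin: "finite I" and card: "card I = m * k" by (simp_all add: I_def)
  have cov: "covered (4 * m) m k V x \<longleftrightarrow> (\<exists>i\<in>I. G V i)" for V
    unfolding covered_def[OF m'] I_def G_def by auto
  have MR: "real M = 4 * real m * real k" using assms(1) by (metis of_nat_mult of_nat_numeral)
  have nR: "real n = 4 * real m * real k * real B" using M MR by simp
  have pos: "real m > 0" "real k > 0" "real B > 0" using m assms B by auto
  have single: "?E (\<lambda>V. of_bool (G V i)) \<ge> 1 / 2 / real n" if "i \<in> I" for i
  proof -
    have "m \<le> M" using assms m by (metis dvd_imp_le M_pos dvd_triv_left dvd_mult_left mult.commute mult.assoc)
    then have "(1 - real m * (real (k - 1) / real M + 1 / real (4 * m))) / real n \<le> ?E (\<lambda>V. of_bool (G V i))"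
      using that assms prob_good[OF m', of "fst i" m "snd i" k x] by (auto simp: I_def G_def)
    \<comment> \<open>Merging costs at most \<open>m * k / M\<close> and an accidental common
      address \<open>m / (4 * m)\<close>. The factors 4 make each of them 1/4.\<close>
    moreover have half: "real m * (real (k - 1) / real M + 1 / real (4 * m)) \<le> 1 / 2"
    proof -
      have "real m * (real (k - 1) / real M) \<le> real m * (real k / real M)"
        by (intro mult_left_mono divide_right_mono) auto
      also have "\<dots> = 1 / 4" using pos by (simp add: MR)
      finally have "real m * (real (k - 1) / real M) \<le> 1 / 4" .
      moreover have "real m * (1 / real (4 * m)) = 1 / 4" using pos by simp
      ultimately show ?thesis unfolding distrib_left by linarith
    qed
    moreover from half have "1 / 2 / real n \<le> (1 - real m * (real (k - 1) / real M + 1 / real (4 * m))) / real n"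
      by (intro divide_right_mono) auto
    ultimately show ?thesis by linarith
  qed
  have pair: "?E (\<lambda>V. of_bool (G V i \<and> G V j)) \<le> 1 / (real n)\<^sup>2" if "i \<in> I" "j \<in> I" "j \<noteq> i" for i j
  proof -
    obtain a s b t where ij: "i = (a, s)" "j = (b, t)" by (metis surj_pair)
    have ab: "a < m" "s < k" "b < m" "t < k" using that by (auto simp: I_def ij)
    let ?H = "\<lambda>V a s. hv V s (pos V 0 s a) = x"
    have "a \<noteq> b \<or> s \<noteq> t" using that(3) ij by auto
    then consider "s < t" | "t < s" | "s = t" "a \<noteq> b" by linarith
    then show ?thesis
    proof cases
      case 1
      have "?E (\<lambda>V. of_bool (G V i \<and> G V j)) \<le> ?E (\<lambda>V. of_bool (?H V a s \<and> ?H V b t))"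
        by (intro avg_mono) (auto simp: G_def ij)
      then show ?thesis using prob_two_hits[OF m' 1 ab(4) assms(2)] by simp
    next
      case 2
      have "?E (\<lambda>V. of_bool (G V i \<and> G V j)) \<le> ?E (\<lambda>V. of_bool (?H V b t \<and> ?H V a s))"
        by (intro avg_mono) (auto simp: G_def ij)
      then show ?thesis using prob_two_hits[OF m' 2 ab(2) assms(2)] by simp
    next
      case 3
      \<comment> \<open>Two different chains through \<open>x\<close> in the same layer have the
        same end, so neither has its address for itself.\<close>
      have "\<not> (G V i \<and> G V j)" for V
        using hit_determines_end[OF m', where V = V and a = a and s = s and x = x and b = b and k = k] 3 ab
        by (auto simp: G_def ij)
      then have "?E (\<lambda>V. of_bool (G V i \<and> G V j)) = ?E (\<lambda>V. 0)"
        by (intro avg_cong) auto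
      then show ?thesis by (simp only: avg_const[OF q(1)]) simp
    qed
  qed
  have "1 / (16 * real B) \<le> real (m * k) * (1 / 2 / real n) - real (m * k) * (real (m * k) * (1 / (real n)\<^sup>2)) / 2"
  proof -
    have "real (m * k) * (1 / 2 / real n) = 1 / (8 * real B)" using pos by (simp add: nR)
    moreover have "real (m * k) * (real (m * k) * (1 / (real n)\<^sup>2)) / 2 = 1 / (32 * real B * real B)"
      using pos by (simp add: nR power2_eq_square)
    moreover have "1 / (32 * real B * real B) \<le> 1 / (32 * real B)"
      using B by (simp add: field_simps)
    moreover have "1 / (8 * real B) - 1 / (32 * real B) \<ge> 1 / (16 * real B)" using pos by (simp add: field_simps)
    ultimately show ?thesis by linarith
  qed
  also have "\<dots> \<le> (\<Sum>i\<in>I. ?E (\<lambda>V. of_bool (G V i))) - (\<Sum>i\<in>I. \<Sum>j\<in>I - {i}. ?E (\<lambda>V. of_bool (G V i \<and> G V j))) / 2"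
  proof (intro diff_mono divide_right_mono)
    show "real (m * k) * (1 / 2 / real n) \<le> (\<Sum>i\<in>I. ?E (\<lambda>V. of_bool (G V i)))"
      using sum_mono[of I "\<lambda>_. 1 / 2 / real n"] single card by simp
    have "(\<Sum>i\<in>I. \<Sum>j\<in>I - {i}. ?E (\<lambda>V. of_bool (G V i \<and> G V j))) \<le> (\<Sum>i\<in>I. \<Sum>j\<in>I. 1 / (real n)\<^sup>2)"
    proof (rule sum_mono)
      fix i assume i: "i \<in> I"
      have "(\<Sum>j\<in>I - {i}. ?E (\<lambda>V. of_bool (G V i \<and> G V j))) \<le> (\<Sum>j\<in>I - {i}. 1 / (real n)\<^sup>2)"
        using pair i by (intro sum_mono) auto
      also have "\<dots> \<le> (\<Sum>j\<in>I. 1 / (real n)\<^sup>2)"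
        using fin by (intro sum_mono2) auto
      finally show "(\<Sum>j\<in>I - {i}. ?E (\<lambda>V. of_bool (G V i \<and> G V j))) \<le> (\<Sum>j\<in>I. 1 / (real n)\<^sup>2)" .
    qed
    then show "(\<Sum>i\<in>I. \<Sum>j\<in>I - {i}. ?E (\<lambda>V. of_bool (G V i \<and> G V j))) \<le> real (m * k) * (real (m * k) * (1 / (real n)\<^sup>2))"
      by (simp add: card)
  qed simp
  also have "\<dots> = ?E (\<lambda>V. (\<Sum>i\<in>I. of_bool (G V i)) - (1 / 2) * (\<Sum>i\<in>I. \<Sum>j\<in>I - {i}. of_bool (G V i \<and> G V j)))"
    by (simp only: avg_diff avg_sum avg_cmult)
  also have "\<dots> \<le> ?E (\<lambda>V. of_bool (covered (4 * m) m k V x))"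
    unfolding cov using bonferroni[OF fin] by (intro avg_mono) simp
  finally show ?thesis .
qed

text \<open>The tables use disjoint blocks of words, so for a fixed \<open>x\<close> their failures
  are independent and multiply. A union bound over \<open>[n]\<close> finishes.\<close>

theorem prob_all_covered:
  assumes "4 * m * k = M" "k > 0"
  shows "avg q (r * (k * kappa)) (\<lambda>V. of_bool (\<exists>x<n. \<forall>t<r. \<not> covered (4 * m) m k (\<lambda>i. V (t * (k * kappa) + i)) x))
    \<le> real n * (1 - 1 / (16 * real B)) ^ r"
proof -
  let ?C = "\<lambda>V x. covered (4 * m) m k V x"
  let ?L = "k * kappa"
  have m': "4 * m dvd M" "4 * m > 0" using assms M_pos by (auto intro: Nat.gr0I)
  have hv_cong: "hv V s p = hv V' s p" if "\<And>i. i < ?L \<Longrightarrow> V i = V' i" "s < k" for V V' s p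
  proof -
    have "s * kappa + i < ?L" if "i \<le> mu" for i
    proof -
      have "s * kappa + i < Suc s * kappa" using that by simp
      also have "\<dots> \<le> ?L" using \<open>s < k\<close> by (intro mult_le_mono1) simp
      finally show ?thesis .
    qed
    then show ?thesis unfolding hv_def using that(1) by (intro arg_cong[of _ _ "\<lambda>x. x mod n"] hs_cong) auto
  qed
  have pos_cong: "pos V s l p = pos V' s l p" if "\<And>i. i < ?L \<Longrightarrow> V i = V' i" "s + l \<le> k" for V V' s l p
    using that(2)
  proof (induction l arbitrary: s p)
    case (Suc l)
    have "hv V s p = hv V' s p" using Suc.prems by (intro hv_cong that(1)) auto
    then show ?case using Suc.prems Suc.IH[of "Suc s" "g (hv V' s p)"] by simp
  qed simp
  \<comment> \<open>A table reads no words beyond its own block; this separates the first table from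
    the others in the induction on \<open>r\<close>.\<close>
  have cov_cong: "?C V x = ?C V' x" if "\<And>i. i < ?L \<Longrightarrow> V i = V' i" for V V' x
  proof -
    have "pos V 0 k a = pos V' 0 k a" for a by (rule pos_cong) (use that in auto)
    moreover have "hv V s (pos V 0 s a) = hv V' s (pos V' 0 s a)" if s: "s < k" for s a
    proof -
      have "pos V 0 s a = pos V' 0 s a" by (rule pos_cong) (use s \<open>\<And>i. i < ?L \<Longrightarrow> V i = V' i\<close> in auto)
      then show ?thesis using hv_cong[of V V' s] s \<open>\<And>i. i < ?L \<Longrightarrow> V i = V' i\<close> by simp
    qed
    ultimately have "(hv V s (pos V 0 s a) = x \<and> (\<forall>b<m. pos V 0 k b mod (4 * m) = pos V 0 k a mod (4 * m) \<longrightarrow> b = a)) =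
       (hv V' s (pos V' 0 s a) = x \<and> (\<forall>b<m. pos V' 0 k b mod (4 * m) = pos V' 0 k a mod (4 * m) \<longrightarrow> b = a))"
      if "s < k" for s a using that by simp
    then show ?thesis unfolding covered_def[OF m']
      by - (rule ex_cong1, rule conj_cong[OF refl], rule ex_cong1, rule conj_cong[OF refl], blast)
  qed
  have one: "avg q (r * ?L) (\<lambda>V. of_bool (\<forall>t<r. \<not> ?C (\<lambda>i. V (t * ?L + i)) x)) \<le> (1 - 1 / (16 * real B)) ^ r"
    if x: "x < n" for x
  proof (induction r)
    case (Suc r)
    have B1: "0 \<le> 1 - 1 / (16 * real B)" using B by (simp add: field_simps)
    have split: "(\<forall>t<Suc r. \<not> ?C (\<lambda>i. join ?L V V' (t * ?L + i)) x) \<longleftrightarrow>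
        \<not> ?C V x \<and> (\<forall>t<r. \<not> ?C (\<lambda>i. V' (t * ?L + i)) x)" for V V'
    proof -
      have 0: "?C (\<lambda>i. join ?L V V' (0 * ?L + i)) x = ?C V x" by (rule cov_cong) simp
      have S: "(\<lambda>i. join ?L V V' (Suc t * ?L + i)) = (\<lambda>i. V' (t * ?L + i))" for t
        by (rule ext) (simp only: mult_Suc add.assoc join_add)
      show ?thesis unfolding All_less_Suc2 0 S ..
    qed
    have "avg q (Suc r * ?L) (\<lambda>V. of_bool (\<forall>t<Suc r. \<not> ?C (\<lambda>i. V (t * ?L + i)) x))
      = avg q ?L (\<lambda>V. avg q (r * ?L) (\<lambda>V'. of_bool (\<not> ?C V x) * of_bool (\<forall>t<r. \<not> ?C (\<lambda>i. V' (t * ?L + i)) x)))"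
      unfolding mult_Suc avg_split split of_bool_conj ..
    also have "\<dots> = avg q (r * ?L) (\<lambda>V. of_bool (\<forall>t<r. \<not> ?C (\<lambda>i. V (t * ?L + i)) x)) *
        avg q ?L (\<lambda>V. of_bool (\<not> ?C V x))"
      unfolding avg_cmult by (subst mult.commute) (simp only: avg_cmult)
    also have "\<dots> \<le> (1 - 1 / (16 * real B)) ^ r * (1 - 1 / (16 * real B))"
    proof (intro mult_mono Suc.IH)
      have "avg q ?L (\<lambda>V. of_bool (\<not> ?C V x)) = avg q ?L (\<lambda>V. 1 - of_bool (?C V x))"
        by (intro avg_cong) auto
      also have "\<dots> \<le> 1 - 1 / (16 * real B)"
        using prob_covered[OF assms(1) x assms(2)] by (simp only: avg_diff avg_const[OF q(1)])
      finally show "avg q ?L (\<lambda>V. of_bool (\<not> ?C V x)) \<le> 1 - 1 / (16 * real B)" .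
    qed (use B1 avg_of_bool_nonneg in auto)
    finally show ?case by (simp add: mult.commute)
  qed simp
  have "avg q (r * ?L) (\<lambda>V. of_bool (\<exists>x<n. \<forall>t<r. \<not> ?C (\<lambda>i. V (t * ?L + i)) x))
    \<le> avg q (r * ?L) (\<lambda>V. \<Sum>x<n. of_bool (\<forall>t<r. \<not> ?C (\<lambda>i. V (t * ?L + i)) x))"
  proof (rule avg_mono)
    fix V
    show "of_bool (\<exists>x<n. \<forall>t<r. \<not> ?C (\<lambda>i. V (t * ?L + i)) x)
        \<le> (\<Sum>x<n. of_bool (\<forall>t<r. \<not> ?C (\<lambda>i. V (t * ?L + i)) x) :: real)"
    proof (cases "\<exists>x<n. \<forall>t<r. \<not> ?C (\<lambda>i. V (t * ?L + i)) x")
      case True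
      then obtain x where x: "x < n" "\<forall>t<r. \<not> ?C (\<lambda>i. V (t * ?L + i)) x" by blast
      then have "of_bool (\<forall>t<r. \<not> ?C (\<lambda>i. V (t * ?L + i)) x) \<le> (\<Sum>x<n. of_bool (\<forall>t<r. \<not> ?C (\<lambda>i. V (t * ?L + i)) x) :: real)"
        by (intro member_le_sum) auto
      then show ?thesis using x by auto
    qed (auto intro: sum_nonneg)
  qed
  also have "\<dots> \<le> (\<Sum>x<n. (1 - 1 / (16 * real B)) ^ r)"
    unfolding avg_sum by (intro sum_mono one) auto
  finally show ?thesis by simp
qed

end

section \<open>Ranks\<close>

locale keyed =
  fixes n :: nat and v :: "nat \<Rightarrow> nat"
begin

text \<open>For \<open>x < n\<close> this encodes the pair \<open>(v x, x)\<close> in lexicographic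
  order. Keys are therefore distinct, and ties in \<open>v\<close> are broken by the index.\<close>

definition ky :: "nat \<Rightarrow> nat" where
  "ky x = v x * n + x"

definition rk :: "nat \<Rightarrow> nat" where
  "rk x = card {x'. x' < n \<and> ky x < ky x'}"

definition el :: "nat \<Rightarrow> nat" where
  "el = inv_into {..<n} rk"

text \<open>The rank in the sense of \<open>is_kth_largest\<close>: it counts values, whereas
  \<open>rk\<close> counts elements.\<close>

definition ds :: "nat \<Rightarrow> nat" where
  "ds x = card {u \<in> v ` {..<n}. v x < u}"

lemma ky_less_iff: "x < n \<Longrightarrow> x' < n \<Longrightarrow> ky x < ky x' \<longleftrightarrow> v x < v x' \<or> v x = v x' \<and> x < x'"
proof -
  assume x: "x < n" "x' < n"
  have *: "ky x < ky x'" if "v x < v x'" "x < n" for x x'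
  proof -
    have "ky x < Suc (v x) * n" using that by (simp add: ky_def)
    also have "\<dots> \<le> v x' * n" using that by (intro mult_le_mono1) simp
    also have "\<dots> \<le> ky x'" by (simp add: ky_def)
    finally show ?thesis .
  qed
  show ?thesis
    using *[of x x'] *[of x' x] x by (cases "v x" "v x'" rule: linorder_cases) (auto simp: ky_def)
qed

lemma ky_eq_iff: "x < n \<Longrightarrow> x' < n \<Longrightarrow> ky x = ky x' \<longleftrightarrow> x = x'"
  using ky_less_iff[of x x'] ky_less_iff[of x' x] by (metis less_irrefl linorder_neqE_nat)

lemma rk_less: "x < n \<Longrightarrow> rk x < n"
  unfolding rk_def by (rule less_le_trans[of _ "card {..<n}"], rule psubset_card_mono) auto

lemma rk_less_iff: "x < n \<Longrightarrow> x' < n \<Longrightarrow> rk x < rk x' \<longleftrightarrow> ky x' < ky x"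
proof -
  have *: "rk x < rk x'" if "ky x' < ky x" "x < n" "x' < n" for x x'
    unfolding rk_def using that by (intro psubset_card_mono psubsetI) auto
  assume "x < n" "x' < n"
  then show ?thesis using *[of x x'] *[of x' x] ky_eq_iff[of x x']
    by (metis less_asym linorder_neqE_nat)
qed

lemma rk_le_iff: "x < n \<Longrightarrow> x' < n \<Longrightarrow> rk x \<le> rk x' \<longleftrightarrow> ky x' \<le> ky x"
  using rk_less_iff[of x' x] by (simp add: linorder_not_less[symmetric])

lemma bij_rk: "bij_betw rk {..<n} {..<n}"
proof -
  have inj: "inj_on rk {..<n}"
    using rk_less_iff ky_eq_iff by (auto simp: inj_on_def) (metis less_irrefl linorder_neqE_nat)
  moreover have "rk ` {..<n} = {..<n}"
    by (rule endo_inj_surj[OF _ _ inj]) (auto intro: rk_less)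
  ultimately show ?thesis by (simp add: bij_betw_def)
qed

lemma el: "p < n \<Longrightarrow> el p < n" "p < n \<Longrightarrow> rk (el p) = p" "x < n \<Longrightarrow> el (rk x) = x"
proof -
  show "p < n \<Longrightarrow> rk (el p) = p"
    unfolding el_def using bij_betw_inv_into_right[OF bij_rk] by simp
  show "x < n \<Longrightarrow> el (rk x) = x"
    unfolding el_def using bij_betw_inv_into_left[OF bij_rk] by simp
  show "p < n \<Longrightarrow> el p < n"
    unfolding el_def using bij_betw_imp_surj_on[OF bij_rk] inv_into_into[of p rk "{..<n}"] by simp
qed

lemma ky_el: "p < n \<Longrightarrow> p' < n \<Longrightarrow> ky (el p) < ky (el p') \<longleftrightarrow> p' < p"
  using rk_less_iff[of "el p'" "el p"] el(1,2)[of p] el(1,2)[of p'] by simp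

lemma v_el_mono: "p \<le> p' \<Longrightarrow> p' < n \<Longrightarrow> v (el p') \<le> v (el p)"
  using ky_el[of p' p] ky_less_iff[of "el p'" "el p"] el(1)[of p] el(1)[of p']
  by (cases "p = p'") auto

text \<open>In a strictly decreasing enumeration, the elements before position \<open>p\<close> are
  precisely those with a larger key.\<close>

lemma sorted_list_el:
  assumes "sorted_wrt (\<lambda>x y. ky y < ky x) xs" "set xs = {..<n}" "length xs = n" "p < n"
  shows "xs ! p = el p"
proof -
  have d: "distinct xs" using assms(2,3) by (simp add: card_distinct)
  have "{x'. x' < n \<and> ky (xs ! p) < ky x'} = (!) xs ` {..<p}"
  proof (intro set_eqI iffI)
    fix x' assume "x' \<in> {x'. x' < n \<and> ky (xs ! p) < ky x'}"
    then have "x' \<in> set xs" "ky (xs ! p) < ky x'" using assms(2) by auto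
    then obtain i where i: "i < n" "x' = xs ! i" "ky (xs ! p) < ky (xs ! i)"
      using assms(3) by (metis in_set_conv_nth)
    have "i < p"
    proof (rule ccontr)
      assume "\<not> i < p"
      then consider "i = p" | "p < i" by linarith
      then show False using sorted_wrt_nth_less[OF assms(1), of p i] i assms(3) by cases auto
    qed
    then show "x' \<in> (!) xs ` {..<p}" using i by auto
  next
    fix x' assume "x' \<in> (!) xs ` {..<p}"
    then obtain i where i: "i < p" "x' = xs ! i" by auto
    moreover have "xs ! i \<in> set xs" using assms(3,4) i(1) by (intro nth_mem) simp
    then have "xs ! i < n" unfolding assms(2) by simp
    ultimately show "x' \<in> {x'. x' < n \<and> ky (xs ! p) < ky x'}"
      using sorted_wrt_nth_less[OF assms(1), of i p] assms(3,4) by simp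
  qed
  moreover have "card ((!) xs ` {..<p}) = p"
    using inj_on_nth[OF d, of "{..<p}"] assms(3,4) by (simp add: card_image)
  ultimately have "rk (xs ! p) = p" by (simp add: rk_def)
  moreover have "xs ! p < n" using assms(2-4) nth_mem[of p xs] by simp
  ultimately show ?thesis using el(3) by metis
qed

definition cnt :: "nat \<Rightarrow> nat" where
  "cnt y = card {x. x < n \<and> y \<le> v x}"

lemma cnt_le: "cnt y \<le> n"
  unfolding cnt_def using card_mono[of "{..<n}" "{x. x < n \<and> y \<le> v x}"] by auto

text \<open>Values decrease weakly along \<open>el\<close>, so the positions with value at least
  \<open>y\<close> form an initial segment, whose length is \<open>cnt y\<close>.\<close>

lemma less_cnt_iff:
  assumes "p < n"
  shows "p < cnt y \<longleftrightarrow> y \<le> v (el p)"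
proof -
  have set: "{x. x < n \<and> y \<le> v x} = el ` {p. p < n \<and> y \<le> v (el p)}"
  proof (intro set_eqI iffI)
    fix x assume "x \<in> {x. x < n \<and> y \<le> v x}"
    then show "x \<in> el ` {p. p < n \<and> y \<le> v (el p)}"
      using rk_less[of x] el(3)[of x] by (intro image_eqI[of _ _ "rk x"]) auto
  qed (use el(1) in auto)
  have inj: "inj_on el {..<n}" using el(2) by (metis inj_onI lessThan_iff)
  have c: "cnt y = card {p. p < n \<and> y \<le> v (el p)}"
    unfolding cnt_def set by (rule card_image) (rule inj_on_subset[OF inj], auto)
  show ?thesis
  proof
    assume "y \<le> v (el p)"
    then have "{..p} \<subseteq> {p. p < n \<and> y \<le> v (el p)}"
      using v_el_mono[OF _ assms] assms by (auto intro: order_trans)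
    then have "card {..p} \<le> cnt y" unfolding c by (intro card_mono) auto
    then show "p < cnt y" by simp
  next
    assume *: "p < cnt y"
    show "y \<le> v (el p)"
    proof (rule ccontr)
      assume "\<not> y \<le> v (el p)"
      then have "p' < p" if "p' < n" "y \<le> v (el p')" for p'
        using v_el_mono[of p p'] that by (cases "p' < p") auto
      then have "{p. p < n \<and> y \<le> v (el p)} \<subseteq> {..<p}" by auto
      then have "cnt y \<le> card {..<p}" unfolding c by (intro card_mono) auto
      then show False using * by simp
    qed
  qed
qed

lemma ds_el_0: "n > 0 \<Longrightarrow> ds (el 0) = 0"
proof -
  assume "n > 0"
  have "v x \<le> v (el 0)" if "x < n" for x
    using v_el_mono[of 0 "rk x"] rk_less[OF that] el(3)[OF that] by simp
  then have "{u \<in> v ` {..<n}. v (el 0) < u} = {}" by (auto simp: not_less)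
  then show ?thesis by (simp add: ds_def)
qed

text \<open>No value lies strictly between those of two neighbours in the sorted order.\<close>

lemma ds_el_Suc:
  assumes "Suc p < n"
  shows "ds (el (Suc p)) = ds (el p) + (if v (el p) = v (el (Suc p)) then 0 else 1)"
proof (cases "v (el p) = v (el (Suc p))")
  case False
  have le: "v (el (Suc p)) < v (el p)" using v_el_mono[of p "Suc p"] assms False by simp
  have "v x \<le> v (el (Suc p)) \<or> v (el p) \<le> v x" if "x < n" for x
    using v_el_mono[of "Suc p" "rk x"] v_el_mono[of "rk x" p] rk_less[OF that] el(3)[OF that] assms
    by (cases "rk x \<le> p") auto
  then have "{u \<in> v ` {..<n}. v (el (Suc p)) < u} = insert (v (el p)) {u \<in> v ` {..<n}. v (el p) < u}"
    using le el(1)[of p] assms by (auto simp: not_le) (metis le_neq_implies_less not_le)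
  then show ?thesis using False by (simp add: ds_def)
qed (simp add: ds_def)

lemma ds_el_mono: "p \<le> p' \<Longrightarrow> p' < n \<Longrightarrow> ds (el p) \<le> ds (el p')"
proof (induction p' rule: dec_induct)
  case (step p')
  then show ?case using ds_el_Suc[of p'] by simp
qed simp

lemma v_eq_of_ds_eq:
  assumes "x < n" "x' < n" "ds x = ds x'"
  shows "v x = v x'"
proof (rule ccontr)
  have *: False if "v x < v x'" "x < n" "x' < n" "ds x = ds x'" for x x'
  proof -
    have "{u \<in> v ` {..<n}. v x' < u} \<subset> {u \<in> v ` {..<n}. v x < u}" using that by auto
    then have "ds x' < ds x" unfolding ds_def by (intro psubset_card_mono) auto
    then show False using that by simp
  qed
  assume "v x \<noteq> v x'"
  then show False using *[of x x'] *[of x' x] assms by (cases "v x < v x'") auto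
qed

lemma bucket_fibre:
  assumes "n = M * B" "j < M"
  shows "{x. x < n \<and> rk x div B = j} = el ` {j * B..<j * B + B}" "card {x. x < n \<and> rk x div B = j} = B"
proof -
  have B: "B > 0 \<or> n = 0" using assms by auto
  have le: "j * B + B \<le> n"
    using assms mult_le_mono1[of "Suc j" M B] by simp
  have *: "p div B = j \<longleftrightarrow> p \<in> {j * B..<j * B + B}" if "p < n" for p
  proof
    assume "p div B = j"
    then show "p \<in> {j * B..<j * B + B}"
      using B that dividend_less_div_times[of B p] by (auto simp: add.commute)
  next
    assume "p \<in> {j * B..<j * B + B}"
    then show "p div B = j" by (intro div_nat_eqI) (auto simp: mult.commute)
  qed
  show set: "{x. x < n \<and> rk x div B = j} = el ` {j * B..<j * B + B}"
  proof (intro set_eqI iffI)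
    fix x assume "x \<in> {x. x < n \<and> rk x div B = j}"
    then have "rk x \<in> {j * B..<j * B + B}" "x = el (rk x)" using *[OF rk_less] el(3) by auto
    then show "x \<in> el ` {j * B..<j * B + B}" by blast
  next
    fix x assume "x \<in> el ` {j * B..<j * B + B}"
    then obtain p where "p \<in> {j * B..<j * B + B}" "x = el p" by auto
    then show "x \<in> {x. x < n \<and> rk x div B = j}" using le *[of p] el(1,2)[of p] by auto
  qed
  have "inj_on el {j * B..<j * B + B}"
    using el(2) le by (intro inj_onI) (metis atLeastLessThan_iff less_le_trans)
  then show "card {x. x < n \<and> rk x div B = j} = B"
    unfolding set by (simp add: card_image)
qed

end

section \<open>The programs\<close>

text \<open>Registers below 50 are temporaries, registers 50 to 69 hold parameters, and the registers from 100 on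
  and the arrays from 10 on belong to the relocated program \<open>F\<close>. Array 0 interleaves five kinds of
  cells, number \<open>i\<close> of kind \<open>k\<close> being cell \<open>5 * i + k\<close>: the first element of a bucket (0), the number of
  distinct values above it (1), the words of the hash functions (2), the recorded starts of the chains (3) and,
  for \<open>i = 0\<close> only, the bucket size (4).\<close>

notation Seq (infixr ";;" 60)

definition Copy :: "reg \<Rightarrow> reg \<Rightarrow> com" where
  "Copy r x = Op Or r x x"

lemma wp_Seq: "wp b inp (c1 ;; c2) Q = wp b inp c1 (\<lambda>n. wp b inp c2 (\<lambda>m. Q (n + m)))"
  by (rule ext) (rule wp_simps)

lemma wp_Copy: "wp b inp (Copy r x) Q \<sigma> = Q 1 (set_reg r (regs \<sigma> x) \<sigma>)"
  by (simp add: Copy_def wp_simps or.idem)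

lemma mod_Copy [simp]: "modr (Copy r x) = {r}" "moda (Copy r x) = {}"
  by (simp_all add: Copy_def)

definition callF :: "com \<Rightarrow> reg \<Rightarrow> com" where
  "callF F x = Copy 100 50 ;; Copy 101 51 ;; Copy 102 x ;; relocate 100 10 F"

text \<open>The second branch realises the extension of \<open>f\<close> by 0 to arguments from
  \<open>N\<close> on.\<close>

definition loadval :: "com \<Rightarrow> array \<Rightarrow> reg \<Rightarrow> com" where
  "loadval F a x = Op Lt 4 x 50 ;;
     IfNZ 4 (callF F x ;; For 5 55 (Load 6 10 5 ;; Store a 5 6)) (For 5 55 (Store a 5 53))"

text \<open>Words are scanned from the least significant one, so a later difference overrides an
  earlier one. Register 7 ends as 0, 1 or 2 for equal, less and greater.\<close>

definition cmp :: "array \<Rightarrow> array \<Rightarrow> com" where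
  "cmp a1 a2 = Const 7 0 ;; For 5 55 (Load 6 a1 5 ;; Load 8 a2 5 ;; Op Lt 9 6 8 ;;
     IfNZ 9 (Copy 7 52) (Op Lt 9 8 6 ;; IfNZ 9 (Copy 7 69) Skip))"

definition keyless :: "com \<Rightarrow> reg \<Rightarrow> reg \<Rightarrow> com" where
  "keyless F x1 x2 = loadval F 3 x1 ;; loadval F 4 x2 ;; cmp 3 4 ;;
     IfNZ 7 (Op Eq 10 7 52) (Op Lt 10 x1 x2)"

abbreviation "Fr \<equiv> {100::nat..}"
abbreviation "Fa \<equiv> {10::nat..}"

lemma relocate_frame: "modr (relocate d e c) \<subseteq> {d..}" "moda (relocate d e c) \<subseteq> {e..}"
  by (induction c) auto

lemma callF_frame: "modr (callF F x) \<subseteq> Fr" "moda (callF F x) \<subseteq> Fa"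
  using relocate_frame[of 100 10 F] by (auto simp: callF_def)

lemma loadval_frame: "modr (loadval F a x) \<subseteq> {3..6} \<union> Fr" "moda (loadval F a x) \<subseteq> {a} \<union> Fa"
  using callF_frame[of F x] by (auto simp: loadval_def)

lemma cmp_frame: "modr (cmp a1 a2) \<subseteq> {3..9}" "moda (cmp a1 a2) \<subseteq> {}"
  by (auto simp: cmp_def)

lemma keyless_frame: "modr (keyless F x1 x2) \<subseteq> {3..10} \<union> Fr" "moda (keyless F x1 x2) \<subseteq> {3, 4} \<union> Fa"
  using loadval_frame[of F 3 x1] loadval_frame[of F 4 x2] cmp_frame[of 3 4] by (auto simp: keyless_def)

definition load_cell :: "nat \<Rightarrow> reg \<Rightarrow> reg \<Rightarrow> com" where
  "load_cell k r i = Op Mul 16 i 67 ;; Const 4 k ;; Op Add 16 16 4 ;; Load r 0 16"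

definition store_cell :: "nat \<Rightarrow> reg \<Rightarrow> reg \<Rightarrow> com" where
  "store_cell k i r = Op Mul 16 i 67 ;; Const 4 k ;; Op Add 16 16 4 ;; Store 0 16 r"

text \<open>Registers in the queries: 11 is a layer, 12 a position, 13 an element, 20 a bucket that
  was found, 28 a number of steps, 30 the number of a candidate, 31 the bucket to be listed, 40 and
  42 the current and the next element, with flags 41 and 43 telling whether they are set.\<close>

definition hash :: com where
  "hash = Op Mul 14 11 61 ;; Copy 15 12 ;; Const 13 0 ;;
     For 5 60 (load_cell 2 17 14 ;; Op Mod 18 15 69 ;; Op Mul 17 17 18 ;; Op Add 13 13 17 ;;
       Op Div 15 15 69 ;; Op Add 14 14 52) ;;
     load_cell 2 17 14 ;; Op Add 13 13 17 ;; Op Mod 13 13 56"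

text \<open>\<open>test\<close> gets a probe in register 21 and reports in register 10 whether the
  answer is at least the probe. Register 22 runs through the powers of two below \<open>M\<close>,
  so the answer is found bit by bit, the highest first.\<close>

definition bsearch :: "com \<Rightarrow> com" where
  "bsearch test = Const 20 0 ;; Copy 22 59 ;; For 23 60 (Op Div 22 22 69 ;; Op Add 21 20 22 ;; test ;;
     IfNZ 10 (Copy 20 21) Skip)"

definition bucket_test :: "com \<Rightarrow> com" where
  "bucket_test F = load_cell 0 25 21 ;; keyless F 25 13 ;; Op Eq 10 10 53"

definition bucket :: "com \<Rightarrow> com" where
  "bucket F = bsearch (bucket_test F)"

definition adv :: "com \<Rightarrow> com" where
  "adv F = For 27 28 (hash ;; bucket F ;; Copy 12 20 ;; Op Add 11 11 52)"

text \<open>Candidate \<open>z = t * ell + s\<close> supposes that the wanted element was hashed in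
  layer \<open>s\<close> of table \<open>t\<close>. The given bucket is then the position after that
  layer: the chain is completed to its address, the start is read there, and the chain is replayed
  up to layer \<open>s\<close>. The final test rejects false candidates. If register 66 is zero, the
  candidates are the numbers \<open>z\<close> themselves.\<close>

definition cand :: "com \<Rightarrow> com" where
  "cand F = IfNZ 66
     (Op Div 33 30 58 ;; Op Mul 34 33 58 ;; Op Sub 35 30 34 ;;
      Copy 12 31 ;; Op Add 11 30 52 ;; Op Sub 28 58 35 ;; Op Sub 28 28 52 ;; adv F ;;
      Op Mod 36 12 62 ;; Op Mul 33 33 62 ;; Op Add 36 36 33 ;; load_cell 3 12 36 ;;
      Copy 11 34 ;; Copy 28 35 ;; adv F ;;
      hash ;; bucket F ;; Op Eq 32 20 31)
     (Copy 13 30 ;; Copy 32 52)"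

text \<open>Candidates arrive unordered and with repetitions. Instead of being collected and sorted
  they are listed afresh by each call, which keeps the largest key below that of the current
  element.\<close>

definition nextc :: "com \<Rightarrow> com" where
  "nextc F = Const 43 0 ;; For 30 65 (cand F ;; IfNZ 32
     (IfNZ 41 (keyless F 13 40) (Copy 10 52) ;;
      IfNZ 10 (IfNZ 43 (keyless F 42 13) (Copy 10 52) ;; IfNZ 10 (Copy 42 13 ;; Copy 43 52) Skip) Skip)
     Skip)"

lemma cell_frame: "modr (load_cell k r i) \<subseteq> {4, 16, r}" "moda (load_cell k r i) \<subseteq> {}"
  "modr (store_cell k i r) \<subseteq> {4, 16}" "moda (store_cell k i r) \<subseteq> {0}"
  by (auto simp: load_cell_def store_cell_def)

lemma hash_frame: "modr hash \<subseteq> {3..5} \<union> {13..18}" "moda hash \<subseteq> {}"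
  using cell_frame(1,2)[of 2 17 14] by (auto simp: hash_def)

lemma bsearch_frame: "modr (bsearch t) \<subseteq> {3, 20, 21, 22, 23} \<union> modr t" "moda (bsearch t) \<subseteq> moda t"
  by (auto simp: bsearch_def)

lemma bucket_test_frame: "modr (bucket_test F) \<subseteq> {3..10} \<union> {16, 25} \<union> Fr" "moda (bucket_test F) \<subseteq> {3, 4} \<union> Fa"
  using cell_frame(1,2)[of 0 25 21] keyless_frame[of F 25 13] by (auto simp: bucket_test_def)

lemma bucket_frame: "modr (bucket F) \<subseteq> {3..10} \<union> {16} \<union> {20..25} \<union> Fr" "moda (bucket F) \<subseteq> {3, 4} \<union> Fa"
  unfolding bucket_def
  subgoal by (rule order_trans[OF bsearch_frame(1)]) (use bucket_test_frame[of F] in auto)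
  subgoal by (rule order_trans[OF bsearch_frame(2) bucket_test_frame(2)])
  done

lemma adv_frame: "modr (adv F) \<subseteq> {3..18} \<union> {20..27} \<union> Fr" "moda (adv F) \<subseteq> {3, 4} \<union> Fa"
  using hash_frame bucket_frame[of F] by (auto simp: adv_def)

lemma cand_frame: "modr (cand F) \<subseteq> {3..28} \<union> {32..36} \<union> Fr" "moda (cand F) \<subseteq> {3, 4} \<union> Fa"
  using adv_frame[of F] hash_frame bucket_frame[of F] cell_frame(1,2)[of 3 12 36] by (auto simp: cand_def)

lemma nextc_frame: "modr (nextc F) \<subseteq> {3..30} \<union> {32..36} \<union> {42, 43} \<union> Fr" "moda (nextc F) \<subseteq> {3, 4} \<union> Fa"
  using cand_frame[of F] keyless_frame[of F 13 40] keyless_frame[of F 42 13] by (auto simp: nextc_def)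

definition words :: "nat \<Rightarrow> nat \<Rightarrow> nat" where
  "words b w = w div b + (if w mod b = 0 then 0 else 1)"

lemma words_eq: "b > 0 \<Longrightarrow> nat \<lceil>real w / real b\<rceil> = words b w"
proof -
  assume b: "b > 0"
  have w: "real w = real b * real (w div b) + real (w mod b)"
    by (metis div_mult_mod_eq mult.commute of_nat_add of_nat_mult)
  have "\<lceil>real w / real b\<rceil> = int (words b w)"
  proof (cases "w mod b = 0")
    case True
    then have "real w / real b = real (w div b)" using b w by simp
    then show ?thesis using True by (simp add: words_def)
  next
    case False
    have "real (w mod b) < real b" using b by simp
    then have "real w / real b \<le> real (w div b) + 1" "real w / real b > real (w div b)"
      using b w False by (auto simp: field_simps)
    then show ?thesis using False by (intro ceiling_unique) (auto simp: words_def)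
  qed
  then show ?thesis by simp
qed

lemma le_mult_words: "b > 0 \<Longrightarrow> w \<le> b * words b w"
proof -
  assume b: "b > 0"
  have w: "w = b * (w div b) + w mod b" by simp
  have "w mod b < b" using b by simp
  then have "w < b * (w div b) + b" using w by linarith
  then show ?thesis unfolding words_def using w by (cases "w mod b = 0") simp_all
qed

section \<open>Evaluating \<open>f\<close> and comparing keys on the machine\<close>

abbreviation T_lv :: "nat \<Rightarrow> nat \<Rightarrow> nat" where "T_lv \<tau> W \<equiv> \<tau> + 5 * W + 20"
abbreviation T_cmp :: "nat \<Rightarrow> nat" where "T_cmp W \<equiv> 10 * W + 10"
abbreviation T_kl :: "nat \<Rightarrow> nat \<Rightarrow> nat" where "T_kl \<tau> W \<equiv> 2 * T_lv \<tau> W + T_cmp W + 5"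

text \<open>Two bits per word are what it takes to represent the constant 2. With one-bit words
  \<open>N < 2 ^ b\<close> leaves only \<open>N = 1\<close>, which the final proof settles
  separately.\<close>

locale machine =
  fixes b :: nat and inp :: "nat \<Rightarrow> nat"
  assumes b2: "b \<ge> 2" and inp: "inp i < 2 ^ b"
begin

abbreviation "run \<equiv> wp b inp"

lemma b0: "b > 0" using b2 by simp

lemma two_less: "2 < (2::nat) ^ b"
  using b2 by (metis One_nat_def less_2_cases_iff not_less_eq_eq numeral_2_eq_2 power_one_right power_strict_increasing_iff rel_simps(49) semiring_norm(76) le_less_trans less_one linorder_not_le nat_less_le)

lemma valid_less: "valid_state b \<sigma> \<Longrightarrow> regs \<sigma> r < 2 ^ b" "valid_state b \<sigma> \<Longrightarrow> mem \<sigma> a i < 2 ^ b"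
  by (simp_all add: valid_state_def)

lemma callI:
  assumes "run c P \<sigma>" "valid_state b \<sigma>" "modr c \<subseteq> R" "moda c \<subseteq> A"
    "\<And>t \<sigma>'. P t \<sigma>' \<Longrightarrow> valid_state b \<sigma>' \<Longrightarrow> agree R A \<sigma> \<sigma>' \<Longrightarrow> Q t \<sigma>'"
  shows "run c Q \<sigma>"
  by (rule wp_conseq[OF assms(1,2) inp b0]) (use assms(3-5) agree_mono in blast)

lemma ForI:
  assumes "valid_state b \<sigma>0" "regs \<sigma>0 52 = 1" "regs \<sigma>0 m = k"
    and frame: "modr c \<subseteq> R" "moda c \<subseteq> A"
    and regs: "i \<notin> insert 3 (insert 52 R)" "m \<notin> insert 3 (insert i R)" "52 \<notin> R"
    and inv0: "I 0 \<sigma>0"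
    and upd: "\<And>j \<sigma> \<sigma>'. I j \<sigma> \<Longrightarrow> agree {3, i} {} \<sigma> \<sigma>' \<Longrightarrow> tape \<sigma>' = tape \<sigma> \<Longrightarrow> I j \<sigma>'"
    and step: "\<And>j \<sigma>. j < k \<Longrightarrow> valid_state b \<sigma> \<Longrightarrow> agree (insert 3 (insert i R)) A \<sigma>0 \<sigma> \<Longrightarrow>
      regs \<sigma> i = j \<Longrightarrow> I j \<sigma> \<Longrightarrow> run c (\<lambda>t \<sigma>'. t \<le> T \<and> I (Suc j) \<sigma>') \<sigma>"
    and post: "\<And>t \<sigma>. t \<le> k * (T + 3) + 3 \<Longrightarrow> valid_state b \<sigma> \<Longrightarrow> agree (insert 3 (insert i R)) A \<sigma>0 \<sigma> \<Longrightarrow>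
      I k \<sigma> \<Longrightarrow> Q t \<sigma>"
  shows "run (For i m c) Q \<sigma>0"
proof (rule callI[where R = "insert 3 (insert i R)" and A = A])
  show "run (For i m c) (\<lambda>t \<sigma>. t \<le> regs \<sigma>0 m * (T + 3) + 3 \<and> I (regs \<sigma>0 m) \<sigma>) \<sigma>0"
  proof (rule wp_For[where I = I])
    fix j \<sigma> assume "j < regs \<sigma>0 m" "valid_state b \<sigma>" "agree ({3, i} \<union> modr c) (moda c) \<sigma>0 \<sigma>" "regs \<sigma> i = j" "I j \<sigma>"
    then show "run c (\<lambda>t \<sigma>'. t \<le> T \<and> I (Suc j) \<sigma>') \<sigma>"
      using frame assms(3) by (intro step) (auto elim: agree_mono)
  qed (use assms inp b0 in blast)+
qed (use assms in auto)

end

text \<open>The contents \<open>par\<close> of the parameter registers are part of the locale, so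
  the programs can be verified independently of how these registers are set up.\<close>

locale ram = machine b inp for b :: nat and inp :: "nat \<Rightarrow> nat" +
  fixes N w :: nat and F :: com and f :: "nat \<Rightarrow> nat"
    and \<tau> n :: nat and par :: "nat \<Rightarrow> nat"
  assumes comp: "computes_within (real \<tau>) b inp F N w f"
    and f_range: "x < N \<Longrightarrow> f x < 2 ^ w"
    and par: "par 50 = N" "par 51 = w" "par 52 = 1" "par 53 = 0" "par 54 = b" "par 55 = words b w"
      "par 56 = n" "par 69 = 2"
    and n: "N \<le> n" "n < 2 ^ b" "n > 0"
begin

definition fx :: "nat \<Rightarrow> nat" where
  "fx x = (if x < N then f x else 0)"

sublocale keyed n fx .

abbreviation "W \<equiv> words b w"

definition env :: "state \<Rightarrow> bool" where
  "env \<sigma> \<longleftrightarrow> valid_state b \<sigma> \<and> (\<forall>r. 50 \<le> r \<longrightarrow> r < 70 \<longrightarrow> regs \<sigma> r = par r)"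

lemma fx_less: "fx x < 2 ^ w"
  using f_range by (simp add: fx_def)

lemma env_valid: "env \<sigma> \<Longrightarrow> valid_state b \<sigma>"
  by (simp add: env_def)

lemma env_regs:
  assumes "env \<sigma>"
  shows "regs \<sigma> 50 = N" "regs \<sigma> 51 = w" "regs \<sigma> 52 = Suc 0" "regs \<sigma> 53 = 0" "regs \<sigma> 54 = b" "regs \<sigma> 55 = W"
    "regs \<sigma> 56 = n" "regs \<sigma> 69 = 2"
  using assms par by (simp_all add: env_def)

lemma env_agree: "env \<sigma> \<Longrightarrow> agree R A \<sigma> \<sigma>' \<Longrightarrow> valid_state b \<sigma>' \<Longrightarrow> R \<inter> {50..<70} = {} \<Longrightarrow> env \<sigma>'"
  by (auto simp: env_def agree_def disjoint_iff)

lemma run_callF: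
  assumes "env \<sigma>" "x < 50" "regs \<sigma> x < N"
  shows "run (callF F x) (\<lambda>t \<sigma>'. t \<le> \<tau> + 3 \<and> holds_int b w (mem \<sigma>' 10) (f (regs \<sigma> x))) \<sigma>"
proof -
  define \<rho> where "\<rho> = set_reg 102 (regs \<sigma> x) (set_reg 101 w (set_reg 100 N \<sigma>))"
  have \<rho>: "run (callF F x) Q \<sigma> = run (relocate 100 10 F) (\<lambda>t. Q (3 + t)) \<rho>" for Q
    using env_regs[OF assms(1)] assms(2) by (simp add: callF_def wp_simps wp_Copy \<rho>_def eval_nat_numeral)
  have "valid_state b (view 100 10 \<rho>)"
    using env_valid[OF assms(1)] env_regs(1,2)[OF assms(1)] unfolding valid_state_def \<rho>_def by (auto simp: view_def)
  moreover have "regs (view 100 10 \<rho>) 0 = N" "regs (view 100 10 \<rho>) 1 = w" "regs (view 100 10 \<rho>) 2 = regs \<sigma> x"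
    by (simp_all add: \<rho>_def)
  ultimately obtain t \<sigma>' where *: "exec b inp F (view 100 10 \<rho>) t \<sigma>'" "t \<le> \<tau>" "holds_int b w (mem \<sigma>' 0) (f (regs \<sigma> x))"
    using comp assms(3) unfolding computes_within_def by (metis of_nat_le_iff)
  obtain \<rho>' where "exec b inp (relocate 100 10 F) \<rho> t \<rho>'" "\<sigma>' = view 100 10 \<rho>'"
    using exec_relocate[OF *(1) refl] by blast
  then show ?thesis
    unfolding \<rho> unfolding wp_def using * by (intro exI[of _ t] exI[of _ \<rho>']) simp
qed

lemma holds_int_iff: "holds_int b w A v \<longleftrightarrow> (\<forall>i<W. A i = (v div (2 ^ b) ^ i) mod 2 ^ b)"
  by (simp add: holds_int_def words_eq b0)

lemma run_loadval:
  assumes e: "env \<sigma>" and x: "x < 50" "x \<notin> {3..6}" and a: "a < 10"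
  shows "run (loadval F a x) (\<lambda>t \<sigma>'. t \<le> T_lv \<tau> W \<and> holds_int b w (mem \<sigma>' a) (fx (regs \<sigma> x))) \<sigma>"
proof -
  note r = env_regs[OF e]
  have x4: "x \<noteq> 4" using x by auto
  let ?v = "regs \<sigma> x"
  define \<sigma>1 where "\<sigma>1 = set_reg 4 (if ?v < N then 1 else 0) \<sigma>"
  have e1: "env \<sigma>1"
    using e two_less by (auto simp: env_def \<sigma>1_def valid_state_def)
  have 1: "run (loadval F a x) Q \<sigma> = (if ?v < N then run (callF F x ;; For 5 55 (Load 6 10 5 ;; Store a 5 6)) (\<lambda>t. Q (Suc (Suc t))) \<sigma>1
      else run (For 5 55 (Store a 5 53)) (\<lambda>t. Q (Suc (Suc t))) \<sigma>1)" for Q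
    using x by (auto simp: loadval_def wp_simps \<sigma>1_def r)
  show ?thesis
  proof (cases "?v < N")
    case True
    have "run (callF F x) (\<lambda>t. run (For 5 55 (Load 6 10 5 ;; Store a 5 6)) (\<lambda>t' \<sigma>'.
        2 + t + t' \<le> T_lv \<tau> W \<and> holds_int b w (mem \<sigma>' a) (f ?v))) \<sigma>1"
    proof (rule callI[OF run_callF[OF e1 x(1)] env_valid[OF e1] callF_frame])
      show "regs \<sigma>1 x < N" using x4 True by (simp add: \<sigma>1_def)
      fix t \<sigma>2 assume P: "t \<le> \<tau> + 3 \<and> holds_int b w (mem \<sigma>2 10) (f (regs \<sigma>1 x))"
        and v: "valid_state b \<sigma>2" and ag: "agree Fr Fa \<sigma>1 \<sigma>2"
      have e2: "env \<sigma>2" by (rule env_agree[OF e1 ag v]) auto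
      note r2 = env_regs[OF e2]
      show "run (For 5 55 (Load 6 10 5 ;; Store a 5 6)) (\<lambda>t' \<sigma>'.
        2 + t + t' \<le> T_lv \<tau> W \<and> holds_int b w (mem \<sigma>' a) (f ?v)) \<sigma>2"
      proof (rule ForI[where R = "{6}" and A = "{a}" and k = W and T = 2 and
            I = "\<lambda>j \<sigma>. \<forall>i<j. mem \<sigma> a i = mem \<sigma>2 10 i"])
        fix j \<sigma> assume "regs \<sigma> 5 = j" "\<forall>i<j. mem \<sigma> a i = mem \<sigma>2 10 i" "agree {3, 5, 6} {a} \<sigma>2 \<sigma>"
        then show "run (Load 6 10 5 ;; Store a 5 6) (\<lambda>t \<sigma>'. t \<le> 2 \<and> (\<forall>i<Suc j. mem \<sigma>' a i = mem \<sigma>2 10 i)) \<sigma>"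
          using a by (auto simp: wp_simps less_Suc_eq agree_def)
      next
        fix t' \<sigma> assume "t' \<le> W * (2 + 3) + 3" "\<forall>i<W. mem \<sigma> a i = mem \<sigma>2 10 i"
        then show "2 + t + t' \<le> T_lv \<tau> W \<and> holds_int b w (mem \<sigma> a) (f ?v)"
          using P x by (auto simp: holds_int_iff \<sigma>1_def)
      qed (use v r2 a in \<open>auto simp: agree_def\<close>)
    qed
    then show ?thesis unfolding 1 using True by (simp add: wp_simps fx_def)
  next
    case False
    note r1 = env_regs[OF e1]
    have "run (For 5 55 (Store a 5 53)) (\<lambda>t \<sigma>'. 2 + t \<le> T_lv \<tau> W \<and> holds_int b w (mem \<sigma>' a) 0) \<sigma>1"
    proof (rule ForI[where R = "{}" and A = "{a}" and k = W and T = 1 and I = "\<lambda>j \<sigma>. \<forall>i<j. mem \<sigma> a i = 0"])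
      fix j \<sigma> assume "regs \<sigma> 5 = j" "\<forall>i<j. mem \<sigma> a i = 0" "agree {3, 5} {a} \<sigma>1 \<sigma>"
      then show "run (Store a 5 53) (\<lambda>t \<sigma>'. t \<le> 1 \<and> (\<forall>i<Suc j. mem \<sigma>' a i = 0)) \<sigma>"
        using a r1 by (auto simp: wp_simps less_Suc_eq agree_def)
    qed (use env_valid[OF e1] r1 a in \<open>auto simp: agree_def holds_int_iff\<close>)
    then show ?thesis unfolding 1 using False by (simp add: fx_def)
  qed
qed

definition cv :: "nat \<Rightarrow> nat \<Rightarrow> nat" where
  "cv x y = (if x < y then 1 else if y < x then 2 else 0)"

lemma cv_append:
  assumes "x1 < q" "y1 < q"
  shows "cv (x1 + q * x2) (y1 + q * y2) = (if x2 < y2 then 1 else if y2 < x2 then 2 else cv x1 y1)"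
proof -
  have *: "x + q * x' < y + q * y'" if "x' < y'" "x < q" for x x' y y'
  proof -
    have "x + q * x' < q * Suc x'" using that by simp
    also have "\<dots> \<le> q * y'" using that by (intro mult_le_mono2) simp
    finally show ?thesis by simp
  qed
  show ?thesis
    using *[of x2 y2 x1 y1] *[of y2 x2 y1 x1] assms
    by (cases x2 y2 rule: linorder_cases) (auto simp: cv_def)
qed

lemma run_cmp:
  assumes e: "env \<sigma>" and v: "v1 < 2 ^ w" "v2 < 2 ^ w" "holds_int b w (mem \<sigma> a1) v1" "holds_int b w (mem \<sigma> a2) v2"
  shows "run (cmp a1 a2) (\<lambda>t \<sigma>'. t \<le> T_cmp W \<and> regs \<sigma>' 7 = cv v1 v2) \<sigma>"
proof -
  note r = env_regs[OF e]
  have v1: "valid_state b (set_reg 7 0 \<sigma>)" using env_valid[OF e] by (auto simp: valid_state_def)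
  let ?q = "\<lambda>j. ((2::nat) ^ b) ^ j"
  let ?body = "Load 6 a1 5 ;; Load 8 a2 5 ;; Op Lt 9 6 8 ;; IfNZ 9 (Copy 7 52) (Op Lt 9 8 6 ;; IfNZ 9 (Copy 7 69) Skip)"
  have "w \<le> b * W" using le_mult_words[OF b0] .
  then have "(2::nat) ^ w \<le> ?q W" by (simp add: power_mult[symmetric] power_increasing)
  then have vW: "v1 < ?q W" "v2 < ?q W" using v by auto
  \<comment> \<open>After \<open>j\<close> rounds register 7 compares the numbers formed by the low
    \<open>j\<close> words. By \<open>vW\<close> the stored words comprise all of \<open>v1\<close>
    and \<open>v2\<close>.\<close>
  have "run (For 5 55 ?body) (\<lambda>t \<sigma>'. 1 + t \<le> T_cmp W \<and> regs \<sigma>' 7 = cv v1 v2) (set_reg 7 0 \<sigma>)"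
  proof (rule ForI[where R = "{6..9}" and A = "{}" and k = W and T = 7 and
        I = "\<lambda>j \<sigma>'. regs \<sigma>' 7 = cv (v1 mod ?q j) (v2 mod ?q j)"])
    fix j \<sigma>' assume j: "j < W" "regs \<sigma>' 5 = j" and ag: "agree (insert 3 (insert 5 {6..9})) {} (set_reg 7 0 \<sigma>) \<sigma>'"
      and I: "regs \<sigma>' 7 = cv (v1 mod ?q j) (v2 mod ?q j)"
    have m: "mem \<sigma>' a1 j = v1 div ?q j mod 2 ^ b" "mem \<sigma>' a2 j = v2 div ?q j mod 2 ^ b"
      using ag v(3,4) j by (auto simp: holds_int_iff agree_def)
    have s: "v mod ?q (Suc j) = v mod ?q j + ?q j * (v div ?q j mod 2 ^ b)" for v :: nat
      using mod_mult2_eq[of v "?q j" "2 ^ b"] by (simp add: mult.commute)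
    have c: "cv (v1 mod ?q (Suc j)) (v2 mod ?q (Suc j)) = (if v1 div ?q j mod 2 ^ b < v2 div ?q j mod 2 ^ b then 1
        else if v2 div ?q j mod 2 ^ b < v1 div ?q j mod 2 ^ b then 2 else cv (v1 mod ?q j) (v2 mod ?q j))"
      unfolding s by (rule cv_append) auto
    have r': "regs \<sigma>' 52 = 1" "regs \<sigma>' 69 = 2" using ag r by (auto simp: agree_def)
    show "run ?body (\<lambda>t \<sigma>'. t \<le> 7 \<and> regs \<sigma>' 7 = cv (v1 mod ?q (Suc j)) (v2 mod ?q (Suc j))) \<sigma>'"
      unfolding c by (simp add: wp_simps wp_Copy j m r' I)
  next
    fix t \<sigma>' assume "t \<le> W * (7 + 3) + 3" "regs \<sigma>' 7 = cv (v1 mod ?q W) (v2 mod ?q W)"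
    then show "1 + t \<le> T_cmp W \<and> regs \<sigma>' 7 = cv v1 v2" using vW by simp
  qed (use v1 r in \<open>auto simp: agree_def cv_def\<close>)
  then show ?thesis by (simp add: cmp_def wp_simps)
qed

lemma run_keyless:
  assumes e: "env \<sigma>" and x: "x1 < 50" "x1 \<notin> {3..10}" "x2 < 50" "x2 \<notin> {3..10}" and xn: "regs \<sigma> x1 < n" "regs \<sigma> x2 < n"
  shows "run (keyless F x1 x2) (\<lambda>t \<sigma>'. t \<le> T_kl \<tau> W \<and> regs \<sigma>' 10 = of_bool (ky (regs \<sigma> x1) < ky (regs \<sigma> x2))) \<sigma>"
proof -
  let ?v1 = "regs \<sigma> x1" and ?v2 = "regs \<sigma> x2"
  have "run (loadval F 3 x1) (\<lambda>t1. run (loadval F 4 x2) (\<lambda>t2. run (cmp 3 4) (\<lambda>t3. run (IfNZ 7 (Op Eq 10 7 52) (Op Lt 10 x1 x2))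
     (\<lambda>t4 \<sigma>'. t1 + (t2 + (t3 + t4)) \<le> T_kl \<tau> W \<and> regs \<sigma>' 10 = of_bool (ky ?v1 < ky ?v2))))) \<sigma>"
  proof (rule callI[OF run_loadval[OF e] env_valid[OF e] loadval_frame])
    fix t1 \<sigma>1 assume 1: "t1 \<le> T_lv \<tau> W \<and> holds_int b w (mem \<sigma>1 3) (fx ?v1)"
      and v1: "valid_state b \<sigma>1" and ag1: "agree ({3..6} \<union> Fr) ({3} \<union> Fa) \<sigma> \<sigma>1"
    have e1: "env \<sigma>1" by (rule env_agree[OF e ag1 v1]) auto
    have x2: "regs \<sigma>1 x2 = ?v2" "regs \<sigma>1 x1 = ?v1" using ag1 x by (auto simp: agree_def)
    show "run (loadval F 4 x2) (\<lambda>t2. run (cmp 3 4) (\<lambda>t3. run (IfNZ 7 (Op Eq 10 7 52) (Op Lt 10 x1 x2))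
     (\<lambda>t4 \<sigma>'. t1 + (t2 + (t3 + t4)) \<le> T_kl \<tau> W \<and> regs \<sigma>' 10 = of_bool (ky ?v1 < ky ?v2)))) \<sigma>1"
    proof (rule callI[OF run_loadval[OF e1] env_valid[OF e1] loadval_frame])
      fix t2 \<sigma>2 assume 2: "t2 \<le> T_lv \<tau> W \<and> holds_int b w (mem \<sigma>2 4) (fx (regs \<sigma>1 x2))"
        and v2: "valid_state b \<sigma>2" and ag2: "agree ({3..6} \<union> Fr) ({4} \<union> Fa) \<sigma>1 \<sigma>2"
      have e2: "env \<sigma>2" by (rule env_agree[OF e1 ag2 v2]) auto
      have m: "holds_int b w (mem \<sigma>2 3) (fx ?v1)" "holds_int b w (mem \<sigma>2 4) (fx ?v2)"
        using 1 2 ag2 x2 by (simp_all add: agree_def)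
      have x3: "regs \<sigma>2 x2 = ?v2" "regs \<sigma>2 x1 = ?v1" using ag2 x x2 by (auto simp: agree_def)
      show "run (cmp 3 4) (\<lambda>t3. run (IfNZ 7 (Op Eq 10 7 52) (Op Lt 10 x1 x2))
        (\<lambda>t4 \<sigma>'. t1 + (t2 + (t3 + t4)) \<le> T_kl \<tau> W \<and> regs \<sigma>' 10 = of_bool (ky ?v1 < ky ?v2))) \<sigma>2"
      proof (rule callI[OF run_cmp[OF e2 fx_less fx_less m] env_valid[OF e2] cmp_frame])
        fix t3 \<sigma>3 assume 3: "t3 \<le> T_cmp W \<and> regs \<sigma>3 7 = cv (fx ?v1) (fx ?v2)" and ag3: "agree {3..9} {} \<sigma>2 \<sigma>3"
        have "regs \<sigma>3 52 = 1" "regs \<sigma>3 x2 = ?v2" "regs \<sigma>3 x1 = ?v1"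
          using ag3 x3 x env_regs(3)[OF e2] by (auto simp: agree_def)
        then show "run (IfNZ 7 (Op Eq 10 7 52) (Op Lt 10 x1 x2))
            (\<lambda>t4 \<sigma>'. t1 + (t2 + (t3 + t4)) \<le> T_kl \<tau> W \<and> regs \<sigma>' 10 = of_bool (ky ?v1 < ky ?v2)) \<sigma>3"
          using 1 2 3 ky_less_iff[OF xn] by (auto simp: wp_simps cv_def)
      qed
    qed (use x in auto)
  qed (use x in auto)
  then show ?thesis by (simp only: keyless_def wp_Seq)
qed

end

section \<open>Hash values, binary search and the bucket of an element\<close>

abbreviation T_hash :: "nat \<Rightarrow> nat" where "T_hash mu \<equiv> 12 * mu + 12"
abbreviation T_bs :: "nat \<Rightarrow> nat \<Rightarrow> nat" where "T_bs mu T \<equiv> mu * (T + 7) + 5"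
abbreviation T_bk :: "nat \<Rightarrow> nat \<Rightarrow> nat \<Rightarrow> nat" where "T_bk mu \<tau> W \<equiv> T_bs mu (T_kl \<tau> W + 5)"
abbreviation T_adv :: "nat \<Rightarrow> nat \<Rightarrow> nat \<Rightarrow> nat \<Rightarrow> nat" where
  "T_adv k mu \<tau> W \<equiv> k * (T_hash mu + T_bk mu \<tau> W + 5) + 3"

text \<open>What large and small \<open>N\<close> have in common: \<open>M\<close> buckets of size
  \<open>B\<close>, and listings of \<open>Z\<close> candidates. Small \<open>N\<close> will be the
  case of a single bucket.\<close>

locale ram_buckets = ram +
  fixes B M Z :: nat
  assumes par_buckets: "par 57 = B" "par 65 = Z"
    and MB: "n = M * B"
begin

lemma B_pos: "B > 0" and M_pos: "M > 0"
  using n MB by (auto intro: Nat.gr0I)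

definition g :: "nat \<Rightarrow> nat" where
  "g x = rk x div B"

lemma g_less: "x < n \<Longrightarrow> g x < M"
  unfolding g_def using rk_less[of x] MB by (simp add: less_mult_imp_div_less)

lemma g_fibre: "j < M \<Longrightarrow> card {x. x < n \<and> g x = j} = B"
  unfolding g_def using bucket_fibre(2)[OF MB] .

end

text \<open>There are \<open>r\<close> tables, each with \<open>m\<close> chains of length
  \<open>ell\<close> and \<open>m'\<close> slots. \<open>Q\<close> bounds the number of cells of
  each kind (pivots, hash words, slots), so \<open>5 * Q + 5\<close> bounds all addresses of the
  interleaved array.\<close>

locale ram_large = ram_buckets +
  fixes mu ell m m' r Q :: nat
  assumes par_large: "par 58 = ell" "par 59 = M" "par 60 = mu" "par 61 = Suc mu" "par 62 = m'" "par 63 = m"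
      "par 64 = r" "par 66 \<noteq> 0" "par 67 = 5"
    and M: "M = 2 ^ mu" and n_dvd: "n dvd 2 ^ b"
    and m': "m' = 4 * m" "M = m' * ell" and Z: "Z = r * ell"
    and fits: "M \<le> Q" "Z * Suc mu \<le> Q" "r * m' \<le> Q" "5 * Q + 5 \<le> 2 ^ b"
begin

sublocale rainbow "2 ^ b" n mu M B g
  by unfold_locales (use n_dvd M MB B_pos g_less g_fibre in auto)

definition keys :: "(nat \<Rightarrow> nat) \<Rightarrow> nat \<Rightarrow> nat" where
  "keys D i = D (5 * i + 2)"

definition pivots_ok :: "(nat \<Rightarrow> nat) \<Rightarrow> bool" where
  "pivots_ok D \<longleftrightarrow> (\<forall>j<M. D (5 * j) = el (j * B))"

lemma env_large:
  assumes "env \<sigma>"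
  shows "regs \<sigma> 57 = B" "regs \<sigma> 65 = Z" "regs \<sigma> 58 = ell" "regs \<sigma> 59 = M" "regs \<sigma> 60 = mu"
    "regs \<sigma> 61 = Suc mu" "regs \<sigma> 62 = m'" "regs \<sigma> 63 = m" "regs \<sigma> 64 = r" "regs \<sigma> 66 \<noteq> 0" "regs \<sigma> 67 = 5"
  using assms par_large par_buckets by (simp_all add: env_def)

lemma five_le: "5 \<le> (2::nat) ^ b"
  using fits(4) by simp

lemma run_load_cell:
  assumes "regs \<sigma> 67 = 5" "regs \<sigma> i < Q" "k < 5" "i \<noteq> 16"
  shows "run (load_cell k r' i) P \<sigma> = P 4 (set_reg r' (mem \<sigma> 0 (5 * regs \<sigma> i + k))
    (set_reg 16 (5 * regs \<sigma> i + k) (set_reg 4 k \<sigma>)))"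
proof -
  have "5 * regs \<sigma> i + k < 2 ^ b" using assms(2,3) fits(4) by linarith
  then show ?thesis
    using assms five_le by (simp add: load_cell_def wp_simps eval_nat_numeral mult.commute fun_upd_twist)
qed

lemma run_store_cell:
  assumes "regs \<sigma> 67 = 5" "regs \<sigma> i < Q" "k < 5" "i \<noteq> 16" "r' \<noteq> 16" "r' \<noteq> 4"
  shows "run (store_cell k i r') P \<sigma> = P 4 ((set_reg 16 (5 * regs \<sigma> i + k) (set_reg 4 k \<sigma>))
     \<lparr>mem := (mem \<sigma>)(0 := (mem \<sigma> 0)(5 * regs \<sigma> i + k := regs \<sigma> r'))\<rparr>)"
proof -
  have "5 * regs \<sigma> i + k < 2 ^ b" using assms(2,3) fits(4) by linarith
  then show ?thesis
    using assms five_le by (simp add: store_cell_def wp_simps eval_nat_numeral mult.commute fun_upd_twist)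
qed

lemma run_hash:
  assumes e: "env \<sigma>" and z: "regs \<sigma> 11 < Z"
  shows "run hash (\<lambda>t \<sigma>'. t \<le> T_hash mu \<and> regs \<sigma>' 13 = hv (keys (mem \<sigma> 0)) (regs \<sigma> 11) (regs \<sigma> 12)) \<sigma>"
proof -
  note r = env_regs[OF e] and l = env_large[OF e]
  let ?V = "keys (mem \<sigma> 0)" and ?z = "regs \<sigma> 11" and ?q = "(2::nat) ^ b" and ?p = "regs \<sigma> 12"
  have "?z * Suc mu + mu < Suc ?z * Suc mu" by simp
  also have "\<dots> \<le> Z * Suc mu" using z by (intro mult_le_mono1) simp
  finally have zQ: "?z * Suc mu + mu < Q" using fits(2) by linarith
  then have zb: "?z * Suc mu + mu < ?q" using fits(4) by linarith
  define \<sigma>1 where "\<sigma>1 = set_reg 13 0 (set_reg 15 ?p (set_reg 14 (?z * Suc mu) \<sigma>))"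
  let ?body = "load_cell 2 17 14 ;; Op Mod 18 15 69 ;; Op Mul 17 17 18 ;; Op Add 13 13 17 ;; Op Div 15 15 69 ;; Op Add 14 14 52"
  let ?rest = "load_cell 2 17 14 ;; Op Add 13 13 17 ;; Op Mod 13 13 56"
  let ?H = "\<lambda>j x. hs (mu - j) (\<lambda>i. ?V (?z * Suc mu + j + i)) x"
  let ?T = "hs mu (\<lambda>i. ?V (?z * Suc mu + i)) ?p"
  have v1: "valid_state b \<sigma>1"
    using env_valid[OF e] zb unfolding \<sigma>1_def valid_state_def by auto
  \<comment> \<open>Sums wrap around modulo \<open>2 ^ b\<close>, so the invariant is a congruence
    for the partial sum plus the hash of the bits still to come. The final reduction modulo
    \<open>n\<close> respects it because \<open>n\<close> divides \<open>2 ^ b\<close>.\<close>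
  have "run (For 5 60 ?body) (\<lambda>t. run ?rest (\<lambda>t' \<sigma>'. 3 + (t + t') \<le> T_hash mu \<and> regs \<sigma>' 13 = ?T mod n)) \<sigma>1"
  proof (rule ForI[where R = "{4} \<union> {13..18}" and A = "{}" and k = mu and T = 9 and
      I = "\<lambda>j \<sigma>'. regs \<sigma>' 14 = ?z * Suc mu + j \<and> (regs \<sigma>' 13 + ?H j (regs \<sigma>' 15)) mod ?q = ?T mod ?q"])
    fix j \<sigma>' assume j: "j < mu" and ag: "agree (insert 3 (insert 5 ({4} \<union> {13..18}))) {} \<sigma>1 \<sigma>'"
      and I: "regs \<sigma>' 14 = ?z * Suc mu + j \<and> (regs \<sigma>' 13 + ?H j (regs \<sigma>' 15)) mod ?q = ?T mod ?q"
    let ?x = "regs \<sigma>' 15" and ?y = "regs \<sigma>' 13"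
    have r': "regs \<sigma>' 52 = 1" "regs \<sigma>' 69 = 2" "regs \<sigma>' 67 = 5" "mem \<sigma>' 0 = mem \<sigma> 0"
      using ag r l by (auto simp: agree_def \<sigma>1_def)
    have jQ: "?z * Suc mu + j < Q" "Suc (?z * Suc mu + j) < ?q" using zQ zb j by auto
    obtain d where d: "mu - j = Suc d" "mu - Suc j = d" using j by (cases "mu - j") auto
    have H: "?H j ?x = (?x mod 2) * ?V (?z * Suc mu + j) + ?H (Suc j) (?x div 2)"
      unfolding d by simp
    have "((?y + ?V (?z * Suc mu + j) * (?x mod 2) mod ?q) mod ?q + ?H (Suc j) (?x div 2)) mod ?q = ?T mod ?q"
      using I unfolding H by (simp add: mod_simps ac_simps)
    then show "run ?body (\<lambda>t \<sigma>'. t \<le> 9 \<and> regs \<sigma>' 14 = ?z * Suc mu + Suc j \<and>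
        (regs \<sigma>' 13 + ?H (Suc j) (regs \<sigma>' 15)) mod ?q = ?T mod ?q) \<sigma>'"
      using jQ I r' by (simp add: wp_simps run_load_cell keys_def)
  next
    fix t \<sigma>' assume t: "t \<le> mu * (9 + 3) + 3" and ag: "agree (insert 3 (insert 5 ({4} \<union> {13..18}))) {} \<sigma>1 \<sigma>'"
      and I: "regs \<sigma>' 14 = ?z * Suc mu + mu \<and> (regs \<sigma>' 13 + ?H mu (regs \<sigma>' 15)) mod ?q = ?T mod ?q"
    have r': "regs \<sigma>' 52 = 1" "regs \<sigma>' 56 = n" "regs \<sigma>' 67 = 5" "mem \<sigma>' 0 = mem \<sigma> 0"
      using ag r l by (auto simp: agree_def \<sigma>1_def)
    have "(regs \<sigma>' 13 + ?V (?z * Suc mu + mu)) mod ?q mod n = ?T mod n"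
      using I n_dvd by (simp add: mod_mod_cancel)
    then show "run ?rest (\<lambda>t' \<sigma>'. 3 + (t + t') \<le> T_hash mu \<and> regs \<sigma>' 13 = ?T mod n) \<sigma>'"
      using t I r' zQ by (simp add: wp_simps run_load_cell keys_def)
  qed (use v1 r l in \<open>auto simp: agree_def \<sigma>1_def load_cell_def\<close>)
  then show ?thesis
    using l zb by (simp add: hash_def wp_Seq wp_simps wp_Copy \<sigma>1_def hv_def eval_nat_numeral)
qed

text \<open>After \<open>j\<close> rounds register 20 is \<open>G\<close> rounded down to a multiple
  of \<open>2 ^ (mu - j)\<close>, and the next comparison decides one more bit. Probes are always
  positive, and the specification of \<open>test\<close> is restricted accordingly.\<close>

lemma run_bsearch:
  assumes e: "env \<sigma>0" and frame: "modr test \<subseteq> R" "moda test \<subseteq> A" "R \<inter> ({20..23} \<union> {50..<70}) = {}"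
    and G: "G < M"
    and test: "\<And>\<sigma>. env \<sigma> \<Longrightarrow> agree ({3, 20, 21, 22, 23} \<union> R) A \<sigma>0 \<sigma> \<Longrightarrow> 0 < regs \<sigma> 21 \<Longrightarrow> regs \<sigma> 21 < M \<Longrightarrow>
      run test (\<lambda>t \<sigma>'. t \<le> T \<and> (regs \<sigma>' 10 \<noteq> 0 \<longleftrightarrow> regs \<sigma> 21 \<le> G)) \<sigma>"
  shows "run (bsearch test) (\<lambda>t \<sigma>'. t \<le> T_bs mu T \<and> regs \<sigma>' 20 = G) \<sigma>0"
proof -
  note r = env_regs[OF e] and l = env_large[OF e]
  have Mb: "M < 2 ^ b" using fits(1,4) by linarith
  define \<sigma>1 where "\<sigma>1 = set_reg 22 M (set_reg 20 0 \<sigma>0)"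
  have e1: "env \<sigma>1" using e Mb by (auto simp: env_def \<sigma>1_def valid_state_def)
  let ?body = "Op Div 22 22 69 ;; Op Add 21 20 22 ;; test ;; IfNZ 10 (Copy 20 21) Skip"
  let ?R = "{20, 21, 22} \<union> R"
  have "run (For 23 60 ?body) (\<lambda>t \<sigma>'. 2 + t \<le> T_bs mu T \<and> regs \<sigma>' 20 = G) \<sigma>1"
  proof (rule ForI[where R = ?R and A = A and k = mu and T = "T + 4" and
      I = "\<lambda>j \<sigma>'. regs \<sigma>' 22 = 2 ^ (mu - j) \<and> regs \<sigma>' 20 = G div 2 ^ (mu - j) * 2 ^ (mu - j)"])
    fix j \<sigma> assume j: "j < mu" and v: "valid_state b \<sigma>" and ag: "agree (insert 3 (insert 23 ?R)) A \<sigma>1 \<sigma>"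
      and I: "regs \<sigma> 22 = 2 ^ (mu - j) \<and> regs \<sigma> 20 = G div 2 ^ (mu - j) * 2 ^ (mu - j)"
    have e\<sigma>: "env \<sigma>" by (rule env_agree[OF e1 ag v]) (use frame(3) in auto)
    note r\<sigma> = env_regs[OF e\<sigma>]
    define s q where "s = (2::nat) ^ (mu - Suc j)" and "q = G div (2 * s)"
    have s: "2 ^ (mu - j) = 2 * s" "s > 0" using j by (simp_all add: s_def Suc_diff_Suc[symmetric])
    have M2: "M = 2 * s * 2 ^ j"
      unfolding M s(1)[symmetric] power_add[symmetric] using j by simp
    have "q < 2 ^ j" unfolding q_def using G M2 by (simp add: less_mult_imp_div_less mult.commute)
    then have "Suc q * (2 * s) \<le> 2 ^ j * (2 * s)" by (intro mult_le_mono1) simp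
    then have mid: "q * (2 * s) + s < M" using M2 s(2) by (simp add: mult.commute)
    have Gs: "G = q * (2 * s) + G mod (2 * s)" unfolding q_def by (rule div_mult_mod_eq[symmetric])
    have step: "G div s * s = (if q * (2 * s) + s \<le> G then q * (2 * s) + s else q * (2 * s))"
    proof (cases "q * (2 * s) + s \<le> G")
      case True
      have "G mod (2 * s) < 2 * s" using s(2) by simp
      then have "G div s = 2 * q + 1" using True Gs by (intro div_nat_eqI) (auto simp: algebra_simps)
      then show ?thesis using True by (simp add: algebra_simps)
    next
      case False
      then have "G div s = 2 * q" using Gs by (intro div_nat_eqI) (auto simp: algebra_simps)
      then show ?thesis using False by (simp add: algebra_simps)
    qed
    define \<sigma>2 where "\<sigma>2 = set_reg 21 (q * (2 * s) + s) (set_reg 22 s \<sigma>)"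
    have eq: "run ?body P \<sigma> = run (test ;; IfNZ 10 (Copy 20 21) Skip) (\<lambda>t. P (Suc (Suc t))) \<sigma>2" for P
      using I mid Mb unfolding s(1) by (simp add: wp_simps r\<sigma> \<sigma>2_def q_def)
    have e2: "env \<sigma>2" using e\<sigma> mid Mb s(2) by (auto simp: env_def \<sigma>2_def valid_state_def)
    have ag2: "agree ({3, 20, 21, 22, 23} \<union> R) A \<sigma>0 \<sigma>2"
      using ag by (auto simp: agree_def \<sigma>1_def \<sigma>2_def)
    have "run test (\<lambda>t. run (IfNZ 10 (Copy 20 21) Skip) (\<lambda>t' \<sigma>'. 2 + (t + t') \<le> T + 4 \<and>
        regs \<sigma>' 22 = s \<and> regs \<sigma>' 20 = G div s * s)) \<sigma>2"
    proof (rule callI[OF test[OF e2 ag2] env_valid[OF e2] frame(1,2)])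
      fix t \<sigma>' assume P: "t \<le> T \<and> (regs \<sigma>' 10 \<noteq> 0 \<longleftrightarrow> regs \<sigma>2 21 \<le> G)" and ag': "agree R A \<sigma>2 \<sigma>'"
      have "20 \<notin> R" "21 \<notin> R" "22 \<notin> R" using frame(3) by auto
      then have "regs \<sigma>' 20 = q * (2 * s)" "regs \<sigma>' 21 = q * (2 * s) + s" "regs \<sigma>' 22 = s"
        using ag' I s(1) by (auto simp: agree_def \<sigma>2_def q_def)
      then show "run (IfNZ 10 (Copy 20 21) Skip) (\<lambda>t' \<sigma>'. 2 + (t + t') \<le> T + 4 \<and>
          regs \<sigma>' 22 = s \<and> regs \<sigma>' 20 = G div s * s) \<sigma>'"
        unfolding step using P by (auto simp: wp_simps wp_Copy \<sigma>2_def)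
    qed (use s(2) mid in \<open>auto simp: \<sigma>2_def\<close>)
    then show "run ?body (\<lambda>t \<sigma>'. t \<le> T + 4 \<and> regs \<sigma>' 22 = 2 ^ (mu - Suc j) \<and>
       regs \<sigma>' 20 = G div 2 ^ (mu - Suc j) * 2 ^ (mu - Suc j)) \<sigma>"
      unfolding s_def[symmetric] unfolding eq unfolding wp_Seq by simp
  next
    fix t \<sigma> assume "t \<le> mu * (T + 4 + 3) + 3"
      and "regs \<sigma> 22 = 2 ^ (mu - mu) \<and> regs \<sigma> 20 = G div 2 ^ (mu - mu) * 2 ^ (mu - mu)"
    then show "2 + t \<le> T_bs mu T \<and> regs \<sigma> 20 = G" by (simp add: add.assoc)
  qed (use env_valid[OF e1] env_regs[OF e1] env_large[OF e1] frame G M in \<open>auto simp: agree_def \<sigma>1_def\<close>)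
  then show ?thesis using l by (simp add: bsearch_def wp_simps wp_Copy \<sigma>1_def eval_nat_numeral)
qed

text \<open>The first element of bucket \<open>j\<close> has rank \<open>j * B\<close>. Its key is
  at least that of \<open>x\<close> iff \<open>j * B \<le> rk x\<close>, that is,
  \<open>j \<le> g x\<close>, so comparisons with the stored pivots evaluate \<open>g\<close>
  although ranks are not stored.\<close>

lemma run_bucket:
  assumes e: "env \<sigma>" and x: "regs \<sigma> 13 < n" and p: "pivots_ok (mem \<sigma> 0)"
  shows "run (bucket F) (\<lambda>t \<sigma>'. t \<le> T_bk mu \<tau> W \<and> regs \<sigma>' 20 = g (regs \<sigma> 13)) \<sigma>"
  unfolding bucket_def
proof (rule run_bsearch[OF e bucket_test_frame _ g_less[OF x]])
  let ?x = "regs \<sigma> 13"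
  fix \<sigma>1 assume e1: "env \<sigma>1" and ag: "agree ({3, 20, 21, 22, 23} \<union> ({3..10} \<union> {16, 25} \<union> Fr)) ({3, 4} \<union> Fa) \<sigma> \<sigma>1"
    and j: "0 < regs \<sigma>1 21" "regs \<sigma>1 21 < M"
  let ?j = "regs \<sigma>1 21"
  have x1: "regs \<sigma>1 13 = ?x" and m1: "mem \<sigma>1 0 = mem \<sigma> 0" using ag by (auto simp: agree_def)
  have "Suc ?j * B \<le> M * B" using j by (intro mult_le_mono1) simp
  moreover have "?j * B < Suc ?j * B" using B_pos by simp
  ultimately have jB: "?j * B < n" unfolding MB by linarith
  define \<sigma>2 where "\<sigma>2 = set_reg 25 (el (?j * B)) (set_reg 16 (5 * ?j + 0) (set_reg 4 0 \<sigma>1))"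
  have jQ: "?j < Q" using j fits(1) by simp
  have eq: "run (bucket_test F) P \<sigma>1 = run (keyless F 25 13 ;; Op Eq 10 10 53) (\<lambda>t. P (4 + t)) \<sigma>2" for P
    unfolding bucket_test_def wp_Seq[of b inp "load_cell 0 25 21"]
    using p j by (subst run_load_cell) (simp_all add: env_large[OF e1] jQ \<sigma>2_def pivots_ok_def m1)
  have e2: "env \<sigma>2"
    using e1 el(1)[OF jB] n(2) jQ fits(4) by (auto simp: env_def \<sigma>2_def valid_state_def)
  have r2: "regs \<sigma>2 25 = el (?j * B)" "regs \<sigma>2 13 = ?x" using x1 by (auto simp: \<sigma>2_def)
  have iff: "\<not> ky (el (?j * B)) < ky ?x \<longleftrightarrow> ?j \<le> g ?x"
    using rk_le_iff[OF el(1)[OF jB] x] el(2)[OF jB] B_pos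
    by (simp add: g_def less_eq_div_iff_mult_less_eq not_less)
  have "run (keyless F 25 13) (\<lambda>t. run (Op Eq 10 10 53) (\<lambda>t' \<sigma>'. 4 + (t + t') \<le> T_kl \<tau> W + 5 \<and> (regs \<sigma>' 10 \<noteq> 0) = (?j \<le> g ?x))) \<sigma>2"
  proof (rule callI[OF run_keyless[OF e2] env_valid[OF e2] keyless_frame])
    fix t \<sigma>3 assume P: "t \<le> T_kl \<tau> W \<and> regs \<sigma>3 10 = of_bool (ky (regs \<sigma>2 25) < ky (regs \<sigma>2 13))"
      and ag3: "agree ({3..10} \<union> Fr) ({3, 4} \<union> Fa) \<sigma>2 \<sigma>3"
    have "regs \<sigma>3 53 = 0" using ag3 env_regs(4)[OF e2] by (auto simp: agree_def)
    then show "run (Op Eq 10 10 53) (\<lambda>t' \<sigma>'. 4 + (t + t') \<le> T_kl \<tau> W + 5 \<and> (regs \<sigma>' 10 \<noteq> 0) = (?j \<le> g ?x)) \<sigma>3"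
      using P iff r2 by (auto simp: wp_simps)
  qed (use el(1)[OF jB] x r2 in auto)
  then show "run (bucket_test F) (\<lambda>t \<sigma>'. t \<le> T_kl \<tau> W + 5 \<and> (regs \<sigma>' 10 \<noteq> 0) = (?j \<le> g ?x)) \<sigma>1"
    unfolding eq wp_Seq .
qed auto

end

section \<open>Following chains and inverting the map from elements to buckets\<close>

abbreviation T_cand :: "nat \<Rightarrow> nat \<Rightarrow> nat \<Rightarrow> nat \<Rightarrow> nat" where
  "T_cand ell mu \<tau> W \<equiv> 2 * T_adv ell mu \<tau> W + T_hash mu + T_bk mu \<tau> W + 30"

lemma sub_mod: "y \<le> x \<Longrightarrow> x < q \<Longrightarrow> (x + q - y) mod q = x - y" for q :: nat
proof -
  assume *: "y \<le> x" "x < q"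
  then have eq: "x + q - y = (x - y) + q" by simp
  have "x - y < q" using * by simp
  then show ?thesis unfolding eq mod_add_self2 by (rule mod_less)
qed

definition rank_body :: "com \<Rightarrow> com" where
  "rank_body F = nextc F ;; Copy 40 42 ;; Copy 41 52 ;; loadval F 3 40 ;; cmp 3 1 ;;
     Op Eq 10 7 52 ;; IfNZ 10 Skip (Op Add 45 45 52)"

text \<open>Register 45 is the number of distinct values above the current element, 46 the wanted
  rank, 47 the answer and 48 its flag. The comparison with register 50 excludes the padding elements
  from \<open>N\<close> on.\<close>

definition select_body :: "com \<Rightarrow> com" where
  "select_body F = nextc F ;;
     IfNZ 41 (loadval F 3 40 ;; loadval F 4 42 ;; cmp 3 4 ;; IfNZ 7 (Op Add 45 45 52) Skip) Skip ;;
     Copy 40 42 ;; Copy 41 52 ;; Op Eq 10 45 46 ;;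
     IfNZ 10 (Op Lt 10 40 50 ;; IfNZ 10 (Copy 47 40 ;; Copy 48 52) Skip) Skip"

lemma rank_body_frame: "modr (rank_body F) \<subseteq> {3..30} \<union> {32..36} \<union> {40..43} \<union> {45} \<union> Fr" "moda (rank_body F) \<subseteq> {3, 4} \<union> Fa"
  using nextc_frame[of F] loadval_frame[of F 3 40] cmp_frame[of 3 1] by (auto simp: rank_body_def)

lemma select_body_frame: "modr (select_body F) \<subseteq> {3..30} \<union> {32..36} \<union> {40..43} \<union> {45, 47, 48} \<union> Fr" "moda (select_body F) \<subseteq> {3, 4} \<union> Fa"
  using nextc_frame[of F] loadval_frame[of F 3 40] loadval_frame[of F 4 42] cmp_frame[of 3 4] by (auto simp: select_body_def)

context ram_large
begin

lemma run_adv: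
  assumes e: "env \<sigma>" and p: "pivots_ok (mem \<sigma> 0)" and z: "regs \<sigma> 11 + regs \<sigma> 28 \<le> Z"
  shows "run (adv F) (\<lambda>t \<sigma>'. t \<le> T_adv (regs \<sigma> 28) mu \<tau> W \<and> regs \<sigma>' 11 = regs \<sigma> 11 + regs \<sigma> 28 \<and>
     regs \<sigma>' 12 = pos (keys (mem \<sigma> 0)) (regs \<sigma> 11) (regs \<sigma> 28) (regs \<sigma> 12)) \<sigma>"
proof -
  let ?V = "keys (mem \<sigma> 0)" and ?z = "regs \<sigma> 11" and ?p = "regs \<sigma> 12" and ?k = "regs \<sigma> 28"
  let ?R = "{3..18} \<union> {20..25} \<union> Fr" and ?A = "{3, 4} \<union> Fa"
  let ?body = "hash ;; bucket F ;; Copy 12 20 ;; Op Add 11 11 52"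
  have Zb: "Z < 2 ^ b"
  proof -
    have "Z \<le> Z * Suc mu" by simp
    then show ?thesis using fits(2,4) by linarith
  qed
  show ?thesis unfolding adv_def
  proof (rule ForI[where R = ?R and A = ?A and k = ?k and T = "T_hash mu + T_bk mu \<tau> W + 2" and
      I = "\<lambda>j \<sigma>'. regs \<sigma>' 11 = ?z + j \<and> regs \<sigma>' 12 = pos ?V ?z j ?p"])
    fix j \<sigma>1 assume j: "j < ?k" and v1: "valid_state b \<sigma>1" and ag: "agree (insert 3 (insert 27 ?R)) ?A \<sigma> \<sigma>1"
      and I: "regs \<sigma>1 11 = ?z + j \<and> regs \<sigma>1 12 = pos ?V ?z j ?p"
    have e1: "env \<sigma>1" by (rule env_agree[OF e ag v1]) auto
    have m1: "mem \<sigma>1 0 = mem \<sigma> 0" using ag by (auto simp: agree_def)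
    let ?x = "hv ?V (?z + j) (pos ?V ?z j ?p)"
    have pS: "pos ?V ?z (Suc j) ?p = g ?x" using pos_add[of ?V ?z j 1 ?p] by simp
    have "run hash (\<lambda>t. run (bucket F) (\<lambda>t'. run (Copy 12 20 ;; Op Add 11 11 52) (\<lambda>t'' \<sigma>'.
       t + (t' + t'') \<le> T_hash mu + T_bk mu \<tau> W + 2 \<and> regs \<sigma>' 11 = ?z + Suc j \<and> regs \<sigma>' 12 = pos ?V ?z (Suc j) ?p))) \<sigma>1"
    proof (rule callI[OF run_hash[OF e1] v1 hash_frame])
      show "regs \<sigma>1 11 < Z" using I j z by simp
      fix t \<sigma>2 assume 2: "t \<le> T_hash mu \<and> regs \<sigma>2 13 = hv (keys (mem \<sigma>1 0)) (regs \<sigma>1 11) (regs \<sigma>1 12)"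
        and v2: "valid_state b \<sigma>2" and ag2: "agree ({3..5} \<union> {13..18}) {} \<sigma>1 \<sigma>2"
      have e2: "env \<sigma>2" by (rule env_agree[OF e1 ag2 v2]) auto
      have m2: "mem \<sigma>2 0 = mem \<sigma> 0" using ag2 m1 by (auto simp: agree_def)
      have x: "regs \<sigma>2 13 = ?x" using 2 I m1 by simp
      show "run (bucket F) (\<lambda>t'. run (Copy 12 20 ;; Op Add 11 11 52) (\<lambda>t'' \<sigma>'.
        t + (t' + t'') \<le> T_hash mu + T_bk mu \<tau> W + 2 \<and> regs \<sigma>' 11 = ?z + Suc j \<and> regs \<sigma>' 12 = pos ?V ?z (Suc j) ?p)) \<sigma>2"
      proof (rule callI[OF run_bucket[OF e2] v2 bucket_frame])
        show "regs \<sigma>2 13 < n" unfolding x by (rule hv_less)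
        fix t' \<sigma>3 assume 3: "t' \<le> T_bk mu \<tau> W \<and> regs \<sigma>3 20 = g (regs \<sigma>2 13)"
          and ag3: "agree ({3..10} \<union> {16} \<union> {20..25} \<union> Fr) ({3, 4} \<union> Fa) \<sigma>2 \<sigma>3" and v3: "valid_state b \<sigma>3"
        have "env \<sigma>3" by (rule env_agree[OF e2 ag3 v3]) auto
        note r3 = env_regs(3)[OF this]
        have zz: "Suc (?z + j) < 2 ^ b" using j z Zb by simp
        have "regs \<sigma>3 11 = ?z + j"
        proof -
          have "regs \<sigma>3 11 = regs \<sigma>2 11" using ag3 by (auto simp: agree_def)
          also have "\<dots> = ?z + j" using ag2 I by (auto simp: agree_def)
          finally show ?thesis .
        qed
        then show "run (Copy 12 20 ;; Op Add 11 11 52) (\<lambda>t'' \<sigma>'.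
          t + (t' + t'') \<le> T_hash mu + T_bk mu \<tau> W + 2 \<and> regs \<sigma>' 11 = ?z + Suc j \<and> regs \<sigma>' 12 = pos ?V ?z (Suc j) ?p) \<sigma>3"
          using 2 3 r3 zz pS x by (simp add: wp_simps wp_Copy)
      qed (use p m2 in auto)
    qed
    then show "run ?body (\<lambda>t \<sigma>'. t \<le> T_hash mu + T_bk mu \<tau> W + 2 \<and> regs \<sigma>' 11 = ?z + Suc j \<and> regs \<sigma>' 12 = pos ?V ?z (Suc j) ?p) \<sigma>1"
      by (simp only: wp_Seq)
  next
    have eq: "T_hash mu + T_bk mu \<tau> W + 2 + 3 = T_hash mu + T_bk mu \<tau> W + 5" by simp
    fix t \<sigma>' assume "t \<le> ?k * (T_hash mu + T_bk mu \<tau> W + 2 + 3) + 3" "regs \<sigma>' 11 = ?z + ?k \<and> regs \<sigma>' 12 = pos ?V ?z ?k ?p"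
    then show "t \<le> T_adv ?k mu \<tau> W \<and> regs \<sigma>' 11 = ?z + ?k \<and> regs \<sigma>' 12 = pos ?V ?z ?k ?p"
      unfolding eq by blast
  qed (use env_valid[OF e] env_regs(3)[OF e] hash_frame bucket_frame[of F] in \<open>auto simp: agree_def\<close>)
qed

definition slots :: "(nat \<Rightarrow> nat) \<Rightarrow> nat \<Rightarrow> nat" where
  "slots D i = D (5 * i + 3)"

text \<open>If a chain with an unshared address hits \<open>x\<close> in layer \<open>s\<close> of
  table \<open>t\<close>, then \<open>g x\<close> is its position after that layer, and from there
  the rest of the chain leads to the slot that holds its start. Hence
  \<open>candx D (g x) (t * ell + s) = x\<close>.\<close>

definition candx :: "(nat \<Rightarrow> nat) \<Rightarrow> nat \<Rightarrow> nat \<Rightarrow> nat" where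
  "candx D J z = (let t = z div ell; s = z mod ell; V = keys D;
     a = slots D (t * m' + pos V (Suc z) (ell - s - 1) J mod m')
   in hv V z (pos V (t * ell) s a))"

lemma run_cand_large:
  assumes e: "env \<sigma>" and p: "pivots_ok (mem \<sigma> 0)" and z: "regs \<sigma> 30 < Z"
  shows "run (cand F) (\<lambda>t \<sigma>'. t \<le> T_cand ell mu \<tau> W \<and> regs \<sigma>' 13 = candx (mem \<sigma> 0) (regs \<sigma> 31) (regs \<sigma> 30) \<and>
     (regs \<sigma>' 32 \<noteq> 0 \<longleftrightarrow> g (candx (mem \<sigma> 0) (regs \<sigma> 31) (regs \<sigma> 30)) = regs \<sigma> 31)) \<sigma>"
proof -
  note r = env_regs[OF e] and l = env_large[OF e]
  let ?D = "mem \<sigma> 0" and ?z = "regs \<sigma> 30" and ?J = "regs \<sigma> 31"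
  let ?V = "keys ?D"
  define t s where "t = ?z div ell" and "s = ?z mod ell"
  have ell: "ell > 0" using z Z by (auto intro: Nat.gr0I)
  have zts: "?z = t * ell + s" "s < ell" using ell by (simp_all add: t_def s_def)
  have t: "t < r" using z Z by (simp add: t_def less_mult_imp_div_less)
  have tl: "Suc t * ell \<le> Z" unfolding Z using t by (intro mult_le_mono1) simp
  have Zb: "Z < 2 ^ b"
  proof -
    have "Z \<le> Z * Suc mu" by simp
    then show ?thesis using fits(2,4) by linarith
  qed
  have ellb: "ell < 2 ^ b" using tl Zb by simp
  define \<sigma>1 where "\<sigma>1 = set_reg 28 (ell - s - 1) (set_reg 11 (Suc ?z) (set_reg 12 ?J (set_reg 35 s
     (set_reg 34 (t * ell) (set_reg 33 t \<sigma>)))))"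
  let ?c4 = "hash ;; bucket F ;; Op Eq 32 20 31"
  let ?c3 = "Copy 11 34 ;; Copy 28 35 ;; adv F ;; ?c4"
  let ?c2 = "Op Mod 36 12 62 ;; Op Mul 33 33 62 ;; Op Add 36 36 33 ;; load_cell 3 12 36 ;; ?c3"
  have s_le: "s \<le> ?z" "t * ell \<le> ?z" "?z - t * ell = s" "?z < 2 ^ b" "Suc ?z < 2 ^ b"
    using zts z tl Zb by auto
  have eq1: "run (cand F) P \<sigma> = run (adv F ;; ?c2) (\<lambda>n. P (n + 8)) \<sigma>1" for P
  proof -
    have "t * ell < 2 ^ b" using s_le by linarith
    then have "?z div ell = t" "t * ell mod 2 ^ b = t * ell" by (simp_all add: t_def)
    moreover have "(ell + 2 ^ b - s) mod 2 ^ b = ell - s" "(ell - s + 2 ^ b - Suc 0) mod 2 ^ b = ell - s - 1"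
      using zts(2) ellb by (auto intro!: sub_mod)
    moreover have "(?z + 2 ^ b - t * ell) mod 2 ^ b = s" using sub_mod[OF s_le(2,4)] s_le(3) by simp
    ultimately have "run (cand F) P \<sigma> = run (adv F ;; ?c2) (\<lambda>n. P (Suc (Suc (Suc (Suc (Suc (Suc (Suc (Suc n))))))))) \<sigma>1"
      using s_le by (simp add: cand_def wp_simps wp_Copy l r \<sigma>1_def)
    then show ?thesis by (simp add: eval_nat_numeral)
  qed
  have "t \<le> ?z" by (simp add: t_def)
  then have tb: "t < 2 ^ b" using s_le by linarith
  have e1: "env \<sigma>1" using e tb ellb s_le Zb zts valid_less(1)[OF env_valid[OF e], of 31] tl t
    unfolding env_def \<sigma>1_def valid_state_def by auto
  \<comment> \<open>Both parts of the chain, after and before layer \<open>s\<close>, are charged as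
    a full chain.\<close>
  have T_adv_mono: "T_adv k mu \<tau> W \<le> T_adv ell mu \<tau> W" if "k \<le> ell" for k
    using that by (simp add: mult_le_mono1)
  let ?u = "pos ?V (Suc ?z) (ell - s - 1) ?J"
  let ?a = "slots ?D (t * m' + ?u mod m')"
  let ?y = "pos ?V (t * ell) s ?a"
  let ?x = "hv ?V ?z ?y"
  have x: "candx ?D ?J ?z = ?x" by (simp add: candx_def t_def s_def Let_def)
  have m'_pos: "m' > 0" using m'(2) M_pos by (auto intro: Nat.gr0I)
  have uQ: "t * m' + ?u mod m' < Q"
  proof -
    have "t * m' + ?u mod m' < Suc t * m'" using m'_pos by simp
    also have "\<dots> \<le> r * m'" using t by (intro mult_le_mono1) simp
    finally show ?thesis using fits(3) by linarith
  qed
  have Qb: "Q < 2 ^ b" using fits(4) by linarith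
  let ?P = "\<lambda>n0 n \<sigma>'. n0 + n + 8 \<le> T_cand ell mu \<tau> W \<and> regs \<sigma>' 13 = ?x \<and> (regs \<sigma>' 32 \<noteq> 0 \<longleftrightarrow> g ?x = ?J)"
  have "run (adv F) (\<lambda>n. run ?c2 (?P n)) \<sigma>1"
  proof (rule callI[OF run_adv[OF e1] env_valid[OF e1] adv_frame])
    show "pivots_ok (mem \<sigma>1 0)" using p by (simp add: \<sigma>1_def)
    show "regs \<sigma>1 11 + regs \<sigma>1 28 \<le> Z" using tl zts by (simp add: \<sigma>1_def)
    fix n1 \<sigma>2 assume 2: "n1 \<le> T_adv (regs \<sigma>1 28) mu \<tau> W \<and> regs \<sigma>2 11 = regs \<sigma>1 11 + regs \<sigma>1 28 \<and>
         regs \<sigma>2 12 = pos (keys (mem \<sigma>1 0)) (regs \<sigma>1 11) (regs \<sigma>1 28) (regs \<sigma>1 12)"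
      and v2: "valid_state b \<sigma>2" and ag2: "agree ({3..18} \<union> {20..27} \<union> Fr) ({3, 4} \<union> Fa) \<sigma>1 \<sigma>2"
    have e2: "env \<sigma>2" by (rule env_agree[OF e1 ag2 v2]) auto
    note l2 = env_large[OF e2]
    have r2: "regs \<sigma>2 12 = ?u" "regs \<sigma>2 33 = t" "regs \<sigma>2 34 = t * ell" "regs \<sigma>2 35 = s"
      "regs \<sigma>2 31 = ?J" "mem \<sigma>2 0 = ?D"
      using 2 ag2 by (auto simp: agree_def \<sigma>1_def)
    have n1: "n1 \<le> T_adv ell mu \<tau> W" using 2 T_adv_mono[of "ell - s - 1"] by (auto simp: \<sigma>1_def intro: order_trans)
    define \<sigma>3 where "\<sigma>3 = set_reg 28 s (set_reg 11 (t * ell) (set_reg 12 ?a (set_reg 16 (5 * (t * m' + ?u mod m') + 3)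
      (set_reg 4 3 (set_reg 36 (t * m' + ?u mod m') (set_reg 33 (t * m') \<sigma>2))))))"
    have fit: "t * m' < 2 ^ b" "t * m' + ?u mod m' < 2 ^ b" "?u mod m' < 2 ^ b" using uQ Qb by auto
    have eq2: "run ?c2 P \<sigma>2 = run (adv F ;; ?c4) (\<lambda>n. P (n + 9)) \<sigma>3" for P
    proof -
      let ?\<sigma> = "set_reg 36 (t * m' + ?u mod m') (set_reg 33 (t * m') \<sigma>2)"
      have "run ?c2 P \<sigma>2 = run (load_cell 3 12 36 ;; ?c3) (\<lambda>n. P (Suc (Suc (Suc n))))
        (set_reg 36 (t * m' + ?u mod m') (set_reg 33 (t * m') (set_reg 36 (?u mod m') \<sigma>2)))"
        using fit by (simp add: wp_simps l2 r2 add.commute)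
      also have "(set_reg 36 (t * m' + ?u mod m') (set_reg 33 (t * m') (set_reg 36 (?u mod m') \<sigma>2))) = ?\<sigma>"
        by (simp add: fun_upd_twist)
      also have "run (load_cell 3 12 36 ;; ?c3) (\<lambda>n. P (Suc (Suc (Suc n)))) ?\<sigma> = run (adv F ;; ?c4) (\<lambda>n. P (n + 9)) \<sigma>3"
        using uQ l2(11) r2 unfolding wp_Seq[of b inp "load_cell 3 12 36"]
        by (subst run_load_cell) (simp_all add: wp_simps wp_Copy slots_def \<sigma>3_def eval_nat_numeral)
      finally show ?thesis .
    qed
    have e3: "env \<sigma>3"
    proof -
      have "5 * i + 3 < 2 ^ b" if "i < Q" for i using that fits(4) by linarith
      from this[OF uQ] have "5 * (t * m' + ?u mod m') + 3 < 2 ^ b" .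
      moreover have "?a < 2 ^ b" using valid_less(2)[OF env_valid[OF e]] by (simp add: slots_def)
      moreover have "s < 2 ^ b" "t * ell < 2 ^ b" "3 < (2::nat) ^ b" using s_le fits(4) by auto
      ultimately show ?thesis using e2 fit unfolding env_def \<sigma>3_def valid_state_def by auto
    qed
    show "run ?c2 (?P n1) \<sigma>2"
      unfolding eq2 wp_Seq[of b inp "adv F"]
    proof (rule callI[OF run_adv[OF e3] env_valid[OF e3] adv_frame])
      show "pivots_ok (mem \<sigma>3 0)" using p r2 by (simp add: \<sigma>3_def)
      show "regs \<sigma>3 11 + regs \<sigma>3 28 \<le> Z" using tl zts by (simp add: \<sigma>3_def)
      fix n2 \<sigma>4 assume 4: "n2 \<le> T_adv (regs \<sigma>3 28) mu \<tau> W \<and> regs \<sigma>4 11 = regs \<sigma>3 11 + regs \<sigma>3 28 \<and>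
           regs \<sigma>4 12 = pos (keys (mem \<sigma>3 0)) (regs \<sigma>3 11) (regs \<sigma>3 28) (regs \<sigma>3 12)"
        and v4: "valid_state b \<sigma>4" and ag4: "agree ({3..18} \<union> {20..27} \<union> Fr) ({3, 4} \<union> Fa) \<sigma>3 \<sigma>4"
      have e4: "env \<sigma>4" by (rule env_agree[OF e3 ag4 v4]) auto
      have r4: "regs \<sigma>4 12 = ?y" "regs \<sigma>4 11 = ?z" "regs \<sigma>4 31 = ?J" "mem \<sigma>4 0 = ?D"
        using 4 ag4 r2 zts by (auto simp: agree_def \<sigma>3_def)
      have n2: "n2 \<le> T_adv ell mu \<tau> W" using 4 T_adv_mono[of s] zts by (auto simp: \<sigma>3_def intro: order_trans)
      show "run ?c4 (\<lambda>n. ?P n1 (n2 + n + 9)) \<sigma>4"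
        unfolding wp_Seq[of b inp hash]
      proof (rule callI[OF run_hash[OF e4] v4 hash_frame])
        show "regs \<sigma>4 11 < Z" using r4 z by simp
        fix n3 \<sigma>5 assume 5: "n3 \<le> T_hash mu \<and> regs \<sigma>5 13 = hv (keys (mem \<sigma>4 0)) (regs \<sigma>4 11) (regs \<sigma>4 12)"
          and v5: "valid_state b \<sigma>5" and ag5: "agree ({3..5} \<union> {13..18}) {} \<sigma>4 \<sigma>5"
        have e5: "env \<sigma>5" by (rule env_agree[OF e4 ag5 v5]) auto
        have r5: "regs \<sigma>5 13 = ?x" "regs \<sigma>5 31 = ?J" "mem \<sigma>5 0 = ?D"
          using 5 ag5 r4 by (auto simp: agree_def)
        show "run (bucket F ;; Op Eq 32 20 31) (\<lambda>n. ?P n1 (n2 + (n3 + n) + 9)) \<sigma>5"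
          unfolding wp_Seq
        proof (rule callI[OF run_bucket[OF e5] v5 bucket_frame])
          show "regs \<sigma>5 13 < n" unfolding r5 by (rule hv_less)
          show "pivots_ok (mem \<sigma>5 0)" using p r5 by simp
          fix n4 \<sigma>6 assume 6: "n4 \<le> T_bk mu \<tau> W \<and> regs \<sigma>6 20 = g (regs \<sigma>5 13)"
            and ag6: "agree ({3..10} \<union> {16} \<union> {20..25} \<union> Fr) ({3, 4} \<union> Fa) \<sigma>5 \<sigma>6"
          have "regs \<sigma>6 13 = ?x" "regs \<sigma>6 31 = ?J" using ag6 r5 by (auto simp: agree_def)
          then show "run (Op Eq 32 20 31) (\<lambda>n. ?P n1 (n2 + (n3 + (n4 + n)) + 9)) \<sigma>6"
            using 6 r5 n1 n2 5 by (simp add: wp_simps)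
        qed
      qed
    qed
  qed
  then show ?thesis
    unfolding eq1 x wp_Seq[of b inp "adv F"] by (simp only: add.assoc)
qed

end

section \<open>Listing a bucket in decreasing order\<close>

context ram_buckets
begin

text \<open>The interface between producing and using candidates: \<open>cf z\<close> is candidate
  \<open>z\<close> for bucket \<open>J\<close>, computed in time \<open>T\<close>. Rainbow tables
  and exhaustive search both provide it, so the walks are verified only once. That the listing is
  complete is a separate assumption.\<close>

definition cand_ok :: "(nat \<Rightarrow> nat) \<Rightarrow> nat \<Rightarrow> (nat \<Rightarrow> nat) \<Rightarrow> nat \<Rightarrow> bool" where
  "cand_ok D J cf T \<longleftrightarrow> (\<forall>z<Z. cf z < n) \<and> (\<forall>\<sigma>. env \<sigma> \<longrightarrow> mem \<sigma> 0 = D \<longrightarrow> regs \<sigma> 30 < Z \<longrightarrow> regs \<sigma> 31 = J \<longrightarrow>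
     run (cand F) (\<lambda>t \<sigma>'. t \<le> T \<and> regs \<sigma>' 13 = cf (regs \<sigma> 30) \<and> (regs \<sigma>' 32 \<noteq> 0 \<longleftrightarrow> g (cf (regs \<sigma> 30)) = J)) \<sigma>)"

text \<open>An unset element, with flag \<open>c\<close> zero, passes the comparison. This covers
  both the start of a walk, without a current element, and the start of a listing, without a best
  candidate.\<close>

lemma run_guarded_less:
  assumes e: "env \<sigma>" and x: "x1 < 50" "x1 \<notin> {3..10}" "x2 < 50" "x2 \<notin> {3..10}"
    and xn: "regs \<sigma> c \<noteq> 0 \<Longrightarrow> regs \<sigma> x1 < n" "regs \<sigma> c \<noteq> 0 \<Longrightarrow> regs \<sigma> x2 < n"
  shows "run (IfNZ c (keyless F x1 x2) (Copy 10 52)) (\<lambda>t \<sigma>'. t \<le> T_kl \<tau> W + 1 \<and> valid_state b \<sigma>' \<and>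
     agree ({3..10} \<union> Fr) ({3, 4} \<union> Fa) \<sigma> \<sigma>' \<and>
     (regs \<sigma>' 10 \<noteq> 0 \<longleftrightarrow> (regs \<sigma> c \<noteq> 0 \<longrightarrow> ky (regs \<sigma> x1) < ky (regs \<sigma> x2)))) \<sigma>"
proof (cases "regs \<sigma> c = 0")
  case True
  then show ?thesis using env_regs(3)[OF e] env_valid[OF e] two_less
    by (auto simp: wp_simps wp_Copy agree_def valid_state_def)
next
  case False
  have "run (keyless F x1 x2) (\<lambda>t \<sigma>'. Suc t \<le> T_kl \<tau> W + 1 \<and> valid_state b \<sigma>' \<and>
     agree ({3..10} \<union> Fr) ({3, 4} \<union> Fa) \<sigma> \<sigma>' \<and>
     (regs \<sigma>' 10 \<noteq> 0 \<longleftrightarrow> (regs \<sigma> c \<noteq> 0 \<longrightarrow> ky (regs \<sigma> x1) < ky (regs \<sigma> x2)))) \<sigma>"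
    by (rule callI[OF run_keyless[OF e x] env_valid[OF e] keyless_frame]) (use False xn in auto)
  then show ?thesis using False by (simp add: wp_simps)
qed

abbreviation T_next :: "nat \<Rightarrow> nat" where "T_next T \<equiv> Z * (T + 2 * T_kl \<tau> W + 12) + 5"

lemma run_nextc:
  assumes e: "env \<sigma>" and c: "cand_ok (mem \<sigma> 0) (regs \<sigma> 31) cf T"
    and cur: "regs \<sigma> 41 \<noteq> 0 \<Longrightarrow> regs \<sigma> 40 < n"
    and S: "S = {x \<in> cf ` {..<Z}. g x = regs \<sigma> 31 \<and> (regs \<sigma> 41 \<noteq> 0 \<longrightarrow> ky x < ky (regs \<sigma> 40))}" "S \<noteq> {}"
  shows "run (nextc F) (\<lambda>t \<sigma>'. t \<le> T_next T \<and> regs \<sigma>' 42 \<in> S \<and> (\<forall>x\<in>S. ky x \<le> ky (regs \<sigma>' 42))) \<sigma>"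
proof -
  let ?J = "regs \<sigma> 31" and ?D = "mem \<sigma> 0"
  let ?R = "{3..28} \<union> {32..36} \<union> {42, 43} \<union> Fr" and ?A = "{3, 4} \<union> Fa"
  define ok where "ok x \<longleftrightarrow> g x = ?J \<and> (regs \<sigma> 41 \<noteq> 0 \<longrightarrow> ky x < ky (regs \<sigma> 40))" for x
  \<comment> \<open>\<open>h\<close> is the flag in register 43. While it is 0, no candidate so far
    is admissible and register 42 is meaningless; afterwards \<open>v\<close> has the largest key
    among the admissible ones.\<close>
  define best where "best j h v \<longleftrightarrow> (if h = (0::nat) then \<forall>z<j. \<not> ok (cf z)
     else (\<exists>z<j. v = cf z \<and> ok v) \<and> (\<forall>z<j. ok (cf z) \<longrightarrow> ky (cf z) \<le> ky v))" for j h v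
  define \<sigma>0 where "\<sigma>0 = set_reg 43 0 \<sigma>"
  have e0: "env \<sigma>0" using e by (auto simp: env_def \<sigma>0_def valid_state_def)
  let ?upd = "IfNZ 10 (Copy 42 13 ;; Copy 43 52) Skip"
  let ?upd2 = "IfNZ 10 (IfNZ 43 (keyless F 42 13) (Copy 10 52) ;; ?upd) Skip"
  let ?upd3 = "IfNZ 41 (keyless F 13 40) (Copy 10 52) ;; ?upd2"
  let ?body = "cand F ;; IfNZ 32 ?upd3 Skip"
  let ?B = "T + 2 * T_kl \<tau> W + 9"
  have "run (For 30 65 ?body) (\<lambda>t \<sigma>'. 1 + t \<le> T_next T \<and> regs \<sigma>' 42 \<in> S \<and> (\<forall>x\<in>S. ky x \<le> ky (regs \<sigma>' 42))) \<sigma>0"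
  proof (rule ForI[where R = ?R and A = ?A and k = Z and T = ?B and I = "\<lambda>j \<sigma>'. best j (regs \<sigma>' 43) (regs \<sigma>' 42)"])
    fix j \<sigma>1 assume j: "j < Z" and v1: "valid_state b \<sigma>1" and ag1: "agree (insert 3 (insert 30 ?R)) ?A \<sigma>0 \<sigma>1"
      and z: "regs \<sigma>1 30 = j" and I: "best j (regs \<sigma>1 43) (regs \<sigma>1 42)"
    have e1: "env \<sigma>1" by (rule env_agree[OF e0 ag1 v1]) auto
    have r1: "mem \<sigma>1 0 = ?D" "regs \<sigma>1 31 = ?J" "regs \<sigma>1 40 = regs \<sigma> 40" "regs \<sigma>1 41 = regs \<sigma> 41"
      using ag1 by (auto simp: agree_def \<sigma>0_def)
    let ?x = "cf j" and ?v = "regs \<sigma>1 42" and ?h = "regs \<sigma>1 43"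
    have xn: "?x < n" using c j by (auto simp: cand_ok_def)
    have vn: "?v < n" if "?h \<noteq> 0" using I that c j by (auto simp: best_def cand_ok_def)
    let ?Q = "\<lambda>t \<sigma>'. t \<le> ?B \<and> best (Suc j) (regs \<sigma>' 43) (regs \<sigma>' 42)"
    have no: "best (Suc j) ?h ?v" if "\<not> ok ?x" using I that by (auto simp: best_def less_Suc_eq)
    have no2: "best (Suc j) ?h ?v" if "?h \<noteq> 0" "\<not> ky ?v < ky ?x" using I that by (auto simp: best_def less_Suc_eq)
    have yes: "best (Suc j) 1 ?x" if "ok ?x" "?h \<noteq> 0 \<longrightarrow> ky ?v < ky ?x"
    proof (cases "?h = 0")
      case True
      then show ?thesis using I that by (auto simp: best_def less_Suc_eq)
    next
      case False
      then have "ky (cf z) \<le> ky ?x" if "z < j" "ok (cf z)" for z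
        using I that \<open>?h \<noteq> 0 \<longrightarrow> ky ?v < ky ?x\<close> unfolding best_def by (metis less_imp_le order_trans)
      then show ?thesis using that(1) by (auto simp: best_def less_Suc_eq)
    qed
    have "run (cand F) (\<lambda>t. run (IfNZ 32 ?upd3 Skip) (\<lambda>t'. ?Q (t + t'))) \<sigma>1"
    proof (rule callI[OF _ v1 cand_frame])
      show "run (cand F) (\<lambda>t \<sigma>'. t \<le> T \<and> regs \<sigma>' 13 = ?x \<and> (regs \<sigma>' 32 \<noteq> 0 \<longleftrightarrow> g ?x = ?J)) \<sigma>1"
        using c e1 r1 z j unfolding cand_ok_def by auto
      fix t2 \<sigma>2 assume 2: "t2 \<le> T \<and> regs \<sigma>2 13 = ?x \<and> (regs \<sigma>2 32 \<noteq> 0 \<longleftrightarrow> g ?x = ?J)"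
        and v2: "valid_state b \<sigma>2" and ag2: "agree ({3..28} \<union> {32..36} \<union> Fr) ({3, 4} \<union> Fa) \<sigma>1 \<sigma>2"
      have e2: "env \<sigma>2" by (rule env_agree[OF e1 ag2 v2]) auto
      have r2: "regs \<sigma>2 40 = regs \<sigma> 40" "regs \<sigma>2 41 = regs \<sigma> 41" "regs \<sigma>2 42 = ?v" "regs \<sigma>2 43 = ?h" "regs \<sigma>2 13 = ?x"
        using ag2 r1 2 by (auto simp: agree_def)
      show "run (IfNZ 32 ?upd3 Skip) (\<lambda>t'. ?Q (t2 + t')) \<sigma>2"
      proof (cases "g ?x = ?J")
        case False
        then have "\<not> ok ?x" by (simp add: ok_def)
        then show ?thesis using False 2 r2 no by (simp add: wp_simps)
      next
        case gx: True
        have "run (IfNZ 41 (keyless F 13 40) (Copy 10 52)) (\<lambda>t. run ?upd2 (\<lambda>t'. ?Q (t2 + Suc (t + t')))) \<sigma>2"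
        proof (rule wp_mono[OF run_guarded_less[OF e2]])
          fix t3 \<sigma>3 assume 3: "t3 \<le> T_kl \<tau> W + 1 \<and> valid_state b \<sigma>3 \<and> agree ({3..10} \<union> Fr) ({3, 4} \<union> Fa) \<sigma>2 \<sigma>3 \<and>
             (regs \<sigma>3 10 \<noteq> 0 \<longleftrightarrow> (regs \<sigma>2 41 \<noteq> 0 \<longrightarrow> ky (regs \<sigma>2 13) < ky (regs \<sigma>2 40)))"
          have e3: "env \<sigma>3" by (rule env_agree[OF e2, of "{3..10} \<union> Fr" "{3, 4} \<union> Fa"]) (use 3 in auto)
          have r3: "regs \<sigma>3 42 = ?v" "regs \<sigma>3 43 = ?h" "regs \<sigma>3 13 = ?x" "regs \<sigma>3 10 \<noteq> 0 \<longleftrightarrow> ok ?x"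
            using 3 r2 gx by (auto simp: agree_def ok_def)
          show "run ?upd2 (\<lambda>t'. ?Q (t2 + Suc (t3 + t'))) \<sigma>3"
          proof (cases "ok ?x")
            case False
            then show ?thesis using r3 no 2 3 by (simp add: wp_simps)
          next
            case okx: True
            have "run (IfNZ 43 (keyless F 42 13) (Copy 10 52)) (\<lambda>t. run ?upd (\<lambda>t'. ?Q (t2 + Suc (t3 + Suc (t + t'))))) \<sigma>3"
            proof (rule wp_mono[OF run_guarded_less[OF e3]])
              fix t4 \<sigma>4 assume 4: "t4 \<le> T_kl \<tau> W + 1 \<and> valid_state b \<sigma>4 \<and> agree ({3..10} \<union> Fr) ({3, 4} \<union> Fa) \<sigma>3 \<sigma>4 \<and>
                 (regs \<sigma>4 10 \<noteq> 0 \<longleftrightarrow> (regs \<sigma>3 43 \<noteq> 0 \<longrightarrow> ky (regs \<sigma>3 42) < ky (regs \<sigma>3 13)))"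
              have r4: "regs \<sigma>4 42 = ?v" "regs \<sigma>4 43 = ?h" "regs \<sigma>4 13 = ?x" "regs \<sigma>4 52 = 1"
                  "regs \<sigma>4 10 \<noteq> 0 \<longleftrightarrow> (?h \<noteq> 0 \<longrightarrow> ky ?v < ky ?x)"
                using 4 r3 env_regs(3)[OF e3] by (auto simp: agree_def)
              have tm: "t2 + Suc (t3 + Suc (t4 + Suc 2)) \<le> ?B"
              proof -
                have "t2 \<le> T" "t3 \<le> T_kl \<tau> W + 1" "t4 \<le> T_kl \<tau> W + 1" using 2 3 4 by blast+
                moreover have "t2 + Suc (t3 + Suc (t4 + Suc 2)) \<le> T + 2 * K + 9" if "t2 \<le> T" "t3 \<le> K + 1" "t4 \<le> K + 1" for K
                  using that by linarith
                ultimately show ?thesis by blast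
              qed
              show "run ?upd (\<lambda>t'. ?Q (t2 + Suc (t3 + Suc (t4 + t')))) \<sigma>4"
              proof (cases "?h \<noteq> 0 \<longrightarrow> ky ?v < ky ?x")
                case True
                then show ?thesis using r4 yes[OF okx True] tm by (simp add: wp_simps wp_Copy)
              next
                case False
                then show ?thesis using r4 no2 tm by (simp add: wp_simps)
              qed
            qed (use r3 xn vn in auto)
            then show ?thesis using r3 okx by (simp add: wp_simps)
          qed
        qed (use r2 xn cur in auto)
        then show ?thesis using 2 gx by (simp add: wp_simps)
      qed
    qed
    then show "run ?body ?Q \<sigma>1" by (simp only: wp_Seq)
  next
    fix t \<sigma>' assume t: "t \<le> Z * (?B + 3) + 3" and I: "best Z (regs \<sigma>' 43) (regs \<sigma>' 42)"
    have "S = {x \<in> cf ` {..<Z}. ok x}" using S(1) by (simp add: ok_def)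
    then have "regs \<sigma>' 42 \<in> S \<and> (\<forall>x\<in>S. ky x \<le> ky (regs \<sigma>' 42))"
      using I S(2) by (auto simp: best_def split: if_splits)
    then show "1 + t \<le> T_next T \<and> regs \<sigma>' 42 \<in> S \<and> (\<forall>x\<in>S. ky x \<le> ky (regs \<sigma>' 42))"
      using t by (simp add: add.assoc)
  next
    show "modr ?body \<subseteq> ?R" "moda ?body \<subseteq> ?A"
      using cand_frame[of F] keyless_frame[of F 13 40] keyless_frame[of F 42 13] by auto
  qed (use env_valid[OF e0] env_regs(3)[OF e0] e0 par_buckets in \<open>auto simp: agree_def \<sigma>0_def best_def env_def\<close>)
  then show ?thesis by (simp add: nextc_def wp_simps \<sigma>0_def)
qed

text \<open>With a complete listing, the candidates of bucket \<open>J\<close> below the current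
  element are exactly those of ranks \<open>J * B + j\<close> to the end of the bucket, and the
  largest key among them is the next in order. Repeated and foreign candidates are filtered out by
  the strict comparison and by \<open>g\<close>.\<close>

lemma run_next_el:
  assumes e: "env \<sigma>" and c: "cand_ok (mem \<sigma> 0) J cf T" and J: "regs \<sigma> 31 = J" "J < M"
    and complete: "\<And>x. x < n \<Longrightarrow> g x = J \<Longrightarrow> x \<in> cf ` {..<Z}"
    and j: "j < B" and cur: "if j = 0 then regs \<sigma> 41 = 0 else regs \<sigma> 41 \<noteq> 0 \<and> regs \<sigma> 40 = el (J * B + j - 1)"
  shows "run (nextc F) (\<lambda>t \<sigma>'. t \<le> T_next T \<and> regs \<sigma>' 42 = el (J * B + j)) \<sigma>"
proof -
  have "Suc J * B \<le> M * B" using J by (intro mult_le_mono1) simp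
  then have JB: "J * B + B \<le> n" using MB by simp
  define S where "S = {x \<in> cf ` {..<Z}. g x = J \<and> (regs \<sigma> 41 \<noteq> 0 \<longrightarrow> ky x < ky (regs \<sigma> 40))}"
  have cf: "x < n" if "x \<in> cf ` {..<Z}" for x using c that by (auto simp: cand_ok_def)
  have gel: "g (el p) = J" if "p \<in> {J * B..<J * B + B}" for p
  proof -
    have "el p \<in> {x. x < n \<and> rk x div B = J}" unfolding bucket_fibre(1)[OF MB J(2)] using that by blast
    then show ?thesis by (simp add: g_def)
  qed
  have inS: "el p \<in> S" if "p \<in> {J * B + j..<J * B + B}" for p
  proof -
    have "el p < n" using el(1) that JB by auto
    moreover have "ky (el p) < ky (regs \<sigma> 40)" if "regs \<sigma> 41 \<noteq> 0"
      using cur that ky_el[of p "J * B + j - 1"] \<open>p \<in> _\<close> JB by (auto split: if_splits)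
    ultimately show ?thesis using complete gel[of p] that by (auto simp: S_def)
  qed
  have S_el: "rk x \<in> {J * B + j..<J * B + B} \<and> x < n" if "x \<in> S" for x
  proof -
    have x: "x < n" "g x = J" using that cf by (auto simp: S_def)
    then have "x \<in> el ` {J * B..<J * B + B}" using bucket_fibre(1)[OF MB J(2)] by (auto simp: g_def)
    then obtain p where p: "p \<in> {J * B..<J * B + B}" "x = el p" by auto
    have rk: "rk x = p" using p el(2)[of p] JB by auto
    have "J * B + j \<le> p"
    proof (cases "j = 0")
      case False
      then have "ky (el p) < ky (el (J * B + j - 1))" using that cur p by (auto simp: S_def)
      moreover have "J * B + j - 1 < n" "p < n" using JB j p by auto
      ultimately have "J * B + j - 1 < p" using ky_el[of p "J * B + j - 1"] by blast
      then show ?thesis using False by linarith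
    qed (use p in simp)
    then show ?thesis using rk p x by auto
  qed
  have ne: "S \<noteq> {}" using inS[of "J * B + j"] j by auto
  show ?thesis
  proof (rule wp_mono[OF run_nextc[OF e, of cf T S]])
    fix t \<sigma>' assume *: "t \<le> T_next T \<and> regs \<sigma>' 42 \<in> S \<and> (\<forall>x\<in>S. ky x \<le> ky (regs \<sigma>' 42))"
    let ?x = "regs \<sigma>' 42"
    have x: "rk ?x \<ge> J * B + j" "?x < n" using * S_el by auto
    have "ky (el (J * B + j)) \<le> ky ?x" using * inS[of "J * B + j"] j by auto
    then have "rk ?x \<le> rk (el (J * B + j))"
      using rk_le_iff[OF x(2), of "el (J * B + j)"] el(1)[of "J * B + j"] j JB by auto
    then have "rk ?x = J * B + j" using x el(2)[of "J * B + j"] j JB by auto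
    then have "?x = el (J * B + j)" using el(3)[OF x(2)] by simp
    then show "t \<le> T_next T \<and> ?x = el (J * B + j)" using * by simp
  next
    assume "regs \<sigma> 41 \<noteq> 0"
    then have "j \<noteq> 0" "regs \<sigma> 40 = el (J * B + j - 1)" using cur by (auto split: if_splits)
    then show "regs \<sigma> 40 < n" using el(1)[of "J * B + j - 1"] j JB by simp
  qed (use c J ne in \<open>auto simp: S_def\<close>)
qed

section \<open>Walking through one bucket\<close>

context
  fixes D cf :: "nat \<Rightarrow> nat" and J T :: nat
  assumes c: "cand_ok D J cf T" and J: "J < M" and complete: "\<And>x. x < n \<Longrightarrow> g x = J \<Longrightarrow> x \<in> cf ` {..<Z}"
begin

lemma JB: "J * B + B \<le> n"
proof -
  have "Suc J * B \<le> M * B" using J by (intro mult_le_mono1) simp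
  then show ?thesis using MB by simp
qed

lemma run_rank_body:
  assumes e: "env \<sigma>" and m: "mem \<sigma> 0 = D" "holds_int b w (mem \<sigma> 1) y" "y < 2 ^ w" and r31: "regs \<sigma> 31 = J"
    and j: "j < B" and cur: "if j = 0 then regs \<sigma> 41 = 0 else regs \<sigma> 41 \<noteq> 0 \<and> regs \<sigma> 40 = el (J * B + j - 1)"
    and cnt: "regs \<sigma> 45 < n"
  shows "run (rank_body F) (\<lambda>t \<sigma>'. t \<le> T_next T + T_lv \<tau> W + T_cmp W + 5 \<and> regs \<sigma>' 41 \<noteq> 0 \<and> regs \<sigma>' 40 = el (J * B + j) \<and>
     regs \<sigma>' 45 = regs \<sigma> 45 + of_bool (y \<le> fx (el (J * B + j)))) \<sigma>"
proof -
  let ?x = "el (J * B + j)"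
  let ?P = "\<lambda>t \<sigma>'. t \<le> T_next T + T_lv \<tau> W + T_cmp W + 5 \<and> regs \<sigma>' 41 \<noteq> 0 \<and> regs \<sigma>' 40 = ?x \<and>
     regs \<sigma>' 45 = regs \<sigma> 45 + of_bool (y \<le> fx ?x)"
  let ?c3 = "Op Eq 10 7 52 ;; IfNZ 10 Skip (Op Add 45 45 52)"
  let ?c1 = "Copy 40 42 ;; Copy 41 52 ;; loadval F 3 40 ;; cmp 3 1 ;; ?c3"
  have "run (nextc F) (\<lambda>t. run ?c1 (\<lambda>t'. ?P (t + t'))) \<sigma>"
  proof (rule callI[OF run_next_el[OF e _ r31 J complete j cur] env_valid[OF e] nextc_frame])
    show "cand_ok (mem \<sigma> 0) J cf T" using c m by simp
    fix t1 \<sigma>1 assume 1: "t1 \<le> T_next T \<and> regs \<sigma>1 42 = ?x"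
      and v1: "valid_state b \<sigma>1" and ag1: "agree ({3..30} \<union> {32..36} \<union> {42, 43} \<union> Fr) ({3, 4} \<union> Fa) \<sigma> \<sigma>1"
    have e1: "env \<sigma>1" by (rule env_agree[OF e ag1 v1]) auto
    define \<sigma>2 where "\<sigma>2 = set_reg 41 1 (set_reg 40 ?x \<sigma>1)"
    have e2: "env \<sigma>2" using e1 two_less valid_less(1)[OF v1, of 42] 1
      by (auto simp: env_def \<sigma>2_def valid_state_def)
    have r2: "regs \<sigma>2 40 = ?x" "mem \<sigma>2 1 = mem \<sigma> 1" "regs \<sigma>2 45 = regs \<sigma> 45"
      using ag1 by (auto simp: \<sigma>2_def agree_def)
    have eq: "run ?c1 Q \<sigma>1 = run (loadval F 3 40 ;; cmp 3 1 ;; ?c3) (\<lambda>t. Q (Suc (Suc t))) \<sigma>2" for Q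
      using 1 env_regs(3)[OF e1] by (simp add: wp_simps wp_Copy \<sigma>2_def)
    show "run ?c1 (\<lambda>t'. ?P (t1 + t')) \<sigma>1"
      unfolding eq wp_Seq[of b inp "loadval F 3 40"]
    proof (rule callI[OF run_loadval[OF e2] env_valid[OF e2] loadval_frame])
      fix t3 \<sigma>3 assume 3: "t3 \<le> T_lv \<tau> W \<and> holds_int b w (mem \<sigma>3 3) (fx (regs \<sigma>2 40))"
        and v3: "valid_state b \<sigma>3" and ag3: "agree ({3..6} \<union> Fr) ({3} \<union> Fa) \<sigma>2 \<sigma>3"
      have e3: "env \<sigma>3" by (rule env_agree[OF e2 ag3 v3]) auto
      have m3: "holds_int b w (mem \<sigma>3 3) (fx ?x)" "holds_int b w (mem \<sigma>3 1) y"
        using 3 r2 m ag3 by (auto simp: agree_def)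
      show "run (cmp 3 1 ;; ?c3) (\<lambda>t. ?P (t1 + Suc (Suc (t3 + t)))) \<sigma>3"
        unfolding wp_Seq[of b inp "cmp 3 1"]
      proof (rule callI[OF run_cmp[OF e3 fx_less m(3) m3] v3 cmp_frame])
        fix t4 \<sigma>4 assume 4: "t4 \<le> T_cmp W \<and> regs \<sigma>4 7 = cv (fx ?x) y" and ag4: "agree {3..9} {} \<sigma>3 \<sigma>4"
          and v4: "valid_state b \<sigma>4"
        have e4: "env \<sigma>4" by (rule env_agree[OF e3 ag4 v4]) auto
        have "regs \<sigma>4 40 = ?x" "regs \<sigma>4 45 = regs \<sigma> 45" "regs \<sigma>4 41 = 1" "regs \<sigma>4 52 = 1"
          using ag4 ag3 r2 env_regs(3)[OF e4] by (auto simp: agree_def \<sigma>2_def)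
        then show "run ?c3 (\<lambda>t. ?P (t1 + Suc (Suc (t3 + (t4 + t))))) \<sigma>4"
          using 1 3 4 cnt n(2) by (auto simp: wp_simps cv_def)
      qed
    qed auto
  qed
  then show ?thesis by (simp only: rank_body_def wp_Seq)
qed

text \<open>All \<open>J * B\<close> elements before the bucket have value at least \<open>y\<close>
  and none behind it has, so counting inside the bucket suffices. The positions to be counted form
  an initial segment, which makes the running count \<open>min (cnt y) (J * B + j)\<close>.\<close>

lemma run_rank_walk:
  assumes e: "env \<sigma>" and m: "mem \<sigma> 0 = D" "holds_int b w (mem \<sigma> 1) y" "y < 2 ^ w" and r: "regs \<sigma> 31 = J"
      "regs \<sigma> 41 = 0" "regs \<sigma> 45 = J * B"
    and cnt: "J * B \<le> cnt y" "cnt y \<le> J * B + B"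
  shows "run (For 44 57 (rank_body F)) (\<lambda>t \<sigma>'. t \<le> B * (T_next T + T_lv \<tau> W + T_cmp W + 8) + 3 \<and> regs \<sigma>' 45 = cnt y) \<sigma>"
proof (rule ForI[where R = "{3..30} \<union> {32..36} \<union> {40..43} \<union> {45} \<union> Fr" and A = "{3, 4} \<union> Fa" and k = B
      and T = "T_next T + T_lv \<tau> W + T_cmp W + 5" and
      I = "\<lambda>j \<sigma>'. regs \<sigma>' 45 = min (cnt y) (J * B + j) \<and>
        (if j = 0 then regs \<sigma>' 41 = 0 else regs \<sigma>' 41 \<noteq> 0 \<and> regs \<sigma>' 40 = el (J * B + j - 1))"])
  let ?R = "{3..30} \<union> {32..36} \<union> {40..43} \<union> {45} \<union> Fr"
  fix j \<sigma>1 assume j: "j < B" and v1: "valid_state b \<sigma>1" and ag: "agree (insert 3 (insert 44 ?R)) ({3, 4} \<union> Fa) \<sigma> \<sigma>1"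
    and I: "regs \<sigma>1 45 = min (cnt y) (J * B + j) \<and>
        (if j = 0 then regs \<sigma>1 41 = 0 else regs \<sigma>1 41 \<noteq> 0 \<and> regs \<sigma>1 40 = el (J * B + j - 1))"
  have e1: "env \<sigma>1" by (rule env_agree[OF e ag v1]) auto
  have p: "J * B + j < n" using j JB by simp
  show "run (rank_body F) (\<lambda>t \<sigma>'. t \<le> T_next T + T_lv \<tau> W + T_cmp W + 5 \<and> (regs \<sigma>' 45 = min (cnt y) (J * B + Suc j) \<and>
        (if Suc j = 0 then regs \<sigma>' 41 = 0 else regs \<sigma>' 41 \<noteq> 0 \<and> regs \<sigma>' 40 = el (J * B + Suc j - 1)))) \<sigma>1"
  proof (rule wp_mono[OF run_rank_body[OF e1 _ _ m(3) _ j]])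
    show "holds_int b w (mem \<sigma>1 1) y" using ag m by (auto simp: agree_def)
    show "regs \<sigma>1 45 < n" using I p by simp
    fix t \<sigma>' assume *: "t \<le> T_next T + T_lv \<tau> W + T_cmp W + 5 \<and> regs \<sigma>' 41 \<noteq> 0 \<and> regs \<sigma>' 40 = el (J * B + j) \<and>
       regs \<sigma>' 45 = regs \<sigma>1 45 + of_bool (y \<le> fx (el (J * B + j)))"
    have "regs \<sigma>' 45 = min (cnt y) (J * B + Suc j)"
      using * I less_cnt_iff[OF p, of y] by auto
    then show "t \<le> T_next T + T_lv \<tau> W + T_cmp W + 5 \<and> (regs \<sigma>' 45 = min (cnt y) (J * B + Suc j) \<and>
        (if Suc j = 0 then regs \<sigma>' 41 = 0 else regs \<sigma>' 41 \<noteq> 0 \<and> regs \<sigma>' 40 = el (J * B + Suc j - 1)))"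
      using * by simp
  qed (use ag m r I in \<open>auto simp: agree_def\<close>)
next
  fix t \<sigma>' assume t: "t \<le> B * (T_next T + T_lv \<tau> W + T_cmp W + 5 + 3) + 3"
    and I: "regs \<sigma>' 45 = min (cnt y) (J * B + B) \<and>
        (if B = 0 then regs \<sigma>' 41 = 0 else regs \<sigma>' 41 \<noteq> 0 \<and> regs \<sigma>' 40 = el (J * B + B - 1))"
  have eq: "T_next T + T_lv \<tau> W + T_cmp W + 5 + 3 = T_next T + T_lv \<tau> W + T_cmp W + 8" by simp
  show "t \<le> B * (T_next T + T_lv \<tau> W + T_cmp W + 8) + 3 \<and> regs \<sigma>' 45 = cnt y"
    using t I cnt unfolding eq by simp
next
  show "modr (rank_body F) \<subseteq> {3..30} \<union> {32..36} \<union> {40..43} \<union> {45} \<union> Fr" "moda (rank_body F) \<subseteq> {3, 4} \<union> Fa"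
    by (rule rank_body_frame)+
qed (use env_valid[OF e] env_regs(3)[OF e] e par_buckets r cnt in \<open>auto simp: agree_def env_def\<close>)

text \<open>Before the walk register 45 already holds the count of the first element of the bucket,
  so the first round leaves it alone. From the second round on it grows whenever the value
  changes.\<close>

lemma run_select_body:
  assumes e: "env \<sigma>" and m: "mem \<sigma> 0 = D" and r31: "regs \<sigma> 31 = J"
    and j: "j < B" and cur: "if j = 0 then regs \<sigma> 41 = 0 else regs \<sigma> 41 \<noteq> 0 \<and> regs \<sigma> 40 = el (J * B + j - 1)"
    and d: "regs \<sigma> 45 = ds (el (if j = 0 then J * B else J * B + j - 1))"
  shows "run (select_body F) (\<lambda>t \<sigma>'. t \<le> T_next T + 2 * T_lv \<tau> W + T_cmp W + 20 \<and> regs \<sigma>' 41 \<noteq> 0 \<and> regs \<sigma>' 40 = el (J * B + j) \<and>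
     regs \<sigma>' 45 = ds (el (J * B + j)) \<and>
     (if ds (el (J * B + j)) = regs \<sigma> 46 \<and> el (J * B + j) < N then regs \<sigma>' 48 = 1 \<and> regs \<sigma>' 47 = el (J * B + j)
      else regs \<sigma>' 48 = regs \<sigma> 48 \<and> regs \<sigma>' 47 = regs \<sigma> 47)) \<sigma>"
proof -
  let ?x = "el (J * B + j)" and ?xp = "el (J * B + j - 1)"
  let ?P = "\<lambda>t \<sigma>'. t \<le> T_next T + 2 * T_lv \<tau> W + T_cmp W + 20 \<and> regs \<sigma>' 41 \<noteq> 0 \<and> regs \<sigma>' 40 = ?x \<and>
     regs \<sigma>' 45 = ds ?x \<and>
     (if ds ?x = regs \<sigma> 46 \<and> ?x < N then regs \<sigma>' 48 = 1 \<and> regs \<sigma>' 47 = ?x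
      else regs \<sigma>' 48 = regs \<sigma> 48 \<and> regs \<sigma>' 47 = regs \<sigma> 47)"
  let ?c4 = "Copy 40 42 ;; Copy 41 52 ;; Op Eq 10 45 46 ;;
     IfNZ 10 (Op Lt 10 40 50 ;; IfNZ 10 (Copy 47 40 ;; Copy 48 52) Skip) Skip"
  let ?c3 = "IfNZ 7 (Op Add 45 45 52) Skip"
  let ?c2 = "loadval F 3 40 ;; loadval F 4 42 ;; cmp 3 4 ;; ?c3"
  have p: "J * B + j < n" using j JB by simp
  have dsn: "ds x < n" if "x < n" for x
  proof -
    have "ds x < card (fx ` {..<n})"
      unfolding ds_def using that by (intro psubset_card_mono) auto
    also have "\<dots> \<le> n" using card_image_le[of "{..<n}" fx] by simp
    finally show ?thesis .
  qed
  \<comment> \<open>The common end of the first and the later rounds, entered once register 45 is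
    right for the new element.\<close>
  have final: "run ?c4 (\<lambda>t. ?P (t0 + t)) \<rho>"
    if "env \<rho>" "regs \<rho> 42 = ?x" "regs \<rho> 45 = ds ?x" "regs \<rho> 46 = regs \<sigma> 46" "regs \<rho> 47 = regs \<sigma> 47" "regs \<rho> 48 = regs \<sigma> 48"
      "t0 \<le> T_next T + 2 * T_lv \<tau> W + T_cmp W + 10" for t0 \<rho>
    using that env_regs[OF that(1)] by (auto simp: wp_simps wp_Copy)
  have "run (nextc F) (\<lambda>t. run (IfNZ 41 ?c2 Skip) (\<lambda>t'. run ?c4 (\<lambda>t''. ?P (t + (t' + t''))))) \<sigma>"
  proof (rule callI[OF run_next_el[OF e _ r31 J complete j cur] env_valid[OF e] nextc_frame])
    show "cand_ok (mem \<sigma> 0) J cf T" using c m by simp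
    fix t1 \<sigma>1 assume 1: "t1 \<le> T_next T \<and> regs \<sigma>1 42 = ?x"
      and v1: "valid_state b \<sigma>1" and ag1: "agree ({3..30} \<union> {32..36} \<union> {42, 43} \<union> Fr) ({3, 4} \<union> Fa) \<sigma> \<sigma>1"
    have e1: "env \<sigma>1" by (rule env_agree[OF e ag1 v1]) auto
    have r1: "regs \<sigma>1 41 = regs \<sigma> 41" "regs \<sigma>1 40 = regs \<sigma> 40" "regs \<sigma>1 45 = regs \<sigma> 45" "regs \<sigma>1 46 = regs \<sigma> 46"
      "regs \<sigma>1 47 = regs \<sigma> 47" "regs \<sigma>1 48 = regs \<sigma> 48"
      using ag1 by (auto simp: agree_def)
    show "run (IfNZ 41 ?c2 Skip) (\<lambda>t'. run ?c4 (\<lambda>t''. ?P (t1 + (t' + t'')))) \<sigma>1"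
    proof (cases "j = 0")
      case True
      have "run ?c4 (\<lambda>t. ?P (t1 + 2 + t)) \<sigma>1"
        by (rule final[OF e1]) (use 1 r1 True d in auto)
      then show ?thesis using True cur r1 by (simp add: wp_simps(1,8))
    next
      case False
      then have cur': "regs \<sigma>1 41 \<noteq> 0" "regs \<sigma>1 40 = ?xp" using cur r1 by auto
      have "run (loadval F 3 40) (\<lambda>s. run (loadval F 4 42) (\<lambda>s'. run (cmp 3 4) (\<lambda>s''. run ?c3
         (\<lambda>sx. run ?c4 (\<lambda>t. ?P (t1 + (Suc (s + (s' + (s'' + sx))) + t))))))) \<sigma>1"
      proof (rule callI[OF run_loadval[OF e1] v1 loadval_frame])
        fix t2 \<sigma>2 assume 2: "t2 \<le> T_lv \<tau> W \<and> holds_int b w (mem \<sigma>2 3) (fx (regs \<sigma>1 40))"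
          and v2: "valid_state b \<sigma>2" and ag2: "agree ({3..6} \<union> Fr) ({3} \<union> Fa) \<sigma>1 \<sigma>2"
        have e2: "env \<sigma>2" by (rule env_agree[OF e1 ag2 v2]) auto
        show "run (loadval F 4 42) (\<lambda>s'. run (cmp 3 4) (\<lambda>s''. run ?c3
         (\<lambda>sx. run ?c4 (\<lambda>t. ?P (t1 + (Suc (t2 + (s' + (s'' + sx))) + t)))))) \<sigma>2"
        proof (rule callI[OF run_loadval[OF e2] v2 loadval_frame])
          fix t3 \<sigma>3 assume 3: "t3 \<le> T_lv \<tau> W \<and> holds_int b w (mem \<sigma>3 4) (fx (regs \<sigma>2 42))"
            and v3: "valid_state b \<sigma>3" and ag3: "agree ({3..6} \<union> Fr) ({4} \<union> Fa) \<sigma>2 \<sigma>3"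
          have e3: "env \<sigma>3" by (rule env_agree[OF e2 ag3 v3]) auto
          have "regs \<sigma>2 42 = ?x" using ag2 1 by (auto simp: agree_def)
          then have m3: "holds_int b w (mem \<sigma>3 3) (fx ?xp)" "holds_int b w (mem \<sigma>3 4) (fx ?x)"
            using 2 3 cur' ag3 by (auto simp: agree_def)
          show "run (cmp 3 4) (\<lambda>s''. run ?c3 (\<lambda>sx. run ?c4 (\<lambda>t. ?P (t1 + (Suc (t2 + (t3 + (s'' + sx))) + t))))) \<sigma>3"
          proof (rule callI[OF run_cmp[OF e3 fx_less fx_less m3] v3 cmp_frame])
            fix t4 \<sigma>4 assume 4: "t4 \<le> T_cmp W \<and> regs \<sigma>4 7 = cv (fx ?xp) (fx ?x)" and ag4: "agree {3..9} {} \<sigma>3 \<sigma>4"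
              and v4: "valid_state b \<sigma>4"
            have e4: "env \<sigma>4" by (rule env_agree[OF e3 ag4 v4]) auto
            have r4: "regs \<sigma>4 42 = ?x" "regs \<sigma>4 45 = ds ?xp" "regs \<sigma>4 46 = regs \<sigma> 46" "regs \<sigma>4 47 = regs \<sigma> 47"
              "regs \<sigma>4 48 = regs \<sigma> 48"
              using ag4 ag3 ag2 r1 1 d False by (auto simp: agree_def)
            have dS: "ds ?x = ds ?xp + (if fx ?xp = fx ?x then 0 else 1)"
              using ds_el_Suc[of "J * B + j - 1"] p False by simp
            have dsb: "ds ?x < 2 ^ b" using dsn[OF el(1)[OF p]] n(2) by simp
            define \<sigma>5 where "\<sigma>5 = set_reg 45 (ds ?x) \<sigma>4"
            have e5: "env \<sigma>5" using e4 dsb by (auto simp: env_def \<sigma>5_def valid_state_def)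
            have t: "Suc (t2 + (t3 + (t4 + 2))) + t1 \<le> T_next T + 2 * T_lv \<tau> W + T_cmp W + 10"
              using 1 2 3 4 by auto
            have f: "run ?c4 (\<lambda>t. ?P (t1 + (Suc (t2 + (t3 + (t4 + Suc 1))) + t))) \<sigma>5"
              unfolding add.assoc[symmetric, of t1]
              by (rule final[OF e5]) (use r4 t in \<open>auto simp: \<sigma>5_def\<close>)
            have c3: "run ?c3 R \<sigma>4 = R (Suc 1) \<sigma>5" for R
            proof (cases "fx ?xp = fx ?x")
              case True
              then have "regs \<sigma>4 7 = 0" using 4 by (simp add: cv_def)
              moreover have "\<sigma>5 = \<sigma>4" using r4 dS True by (intro state.equality) (auto simp: \<sigma>5_def fun_upd_idem)
              ultimately show ?thesis by (simp add: wp_simps(1,8))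
            next
              case False
              then have "regs \<sigma>4 7 \<noteq> 0" using 4 by (auto simp: cv_def)
              moreover have "set_reg 45 (Suc (ds ?xp) mod 2 ^ b) \<sigma>4 = \<sigma>5" using dS dsb False by (simp add: \<sigma>5_def)
              ultimately show ?thesis using r4(2) env_regs(3)[OF e4] by (simp add: wp_simps(3,8))
            qed
            show "run ?c3 (\<lambda>sx. run ?c4 (\<lambda>t. ?P (t1 + (Suc (t2 + (t3 + (t4 + sx))) + t)))) \<sigma>4"
              unfolding c3 by (rule f)
          qed
        qed auto
      qed auto
      moreover have "run (IfNZ 41 ?c2 Skip) R \<sigma>1 = run ?c2 (\<lambda>n. R (Suc n)) \<sigma>1" for R
        using cur' by (simp add: wp_simps(8))
      ultimately show ?thesis by (simp only: wp_Seq[of b inp "loadval F _ _"] wp_Seq[of b inp "cmp 3 4"])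
    qed
  qed
  then show ?thesis by (simp only: select_body_def wp_Seq)
qed

end

end

section \<open>Parameters and the query programs\<close>

primrec halves :: "nat \<Rightarrow> com" where
  "halves 0 = Skip"
| "halves (Suc k) = Op Div 66 66 69 ;; halves k"

text \<open>Register 66 is nonzero unless \<open>N < 2 ^ k0\<close>. It is computed by repeated halving
  because \<open>2 ^ k0\<close> need not fit into a word.\<close>

definition prelude :: "nat \<Rightarrow> com" where
  "prelude k0 = Copy 50 0 ;; Copy 51 1 ;; Const 52 1 ;; Const 53 0 ;; Const 69 2 ;; Const 67 5 ;;
     Const 54 0 ;; Copy 4 52 ;; WhileNZ 4 (Op Add 4 4 4 ;; Op Add 54 54 52) ;;
     Op Div 55 51 54 ;; Op Mod 4 51 54 ;; IfNZ 4 (Op Add 55 55 52) Skip ;;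
     Copy 66 50 ;; halves k0"

text \<open>Computes the least power of two that is at least \<open>x\<close>, with its exponent.
  The loop always takes \<open>b\<close> rounds; once the power is reached the test just
  fails.\<close>

definition lg :: "reg \<Rightarrow> reg \<Rightarrow> reg \<Rightarrow> com" where
  "lg p e x = Copy p 52 ;; Copy e 53 ;; For 5 54 (Op Lt 4 p x ;; IfNZ 4 (Op Add p p p ;; Op Add e e 52) Skip)"

text \<open>All sizes are recomputed from \<open>N\<close> and the bucket size in register 58. The
  number of tables is \<open>16 * C * nu\<close> times the bucket size: against a covering
  probability of \<open>1 / (16 * B)\<close> this leaves each element uncovered with probability at
  most \<open>exp (- C * nu)\<close>.\<close>

definition params :: "nat \<Rightarrow> com" where
  "params C = lg 56 68 50 ;; Copy 57 58 ;; Op Div 59 56 57 ;; lg 7 60 59 ;; Op Add 61 60 52 ;;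
     Op Div 62 59 58 ;; Const 4 4 ;; Op Div 63 62 4 ;; Const 4 (16 * C) ;; Op Mul 64 4 68 ;;
     Op Mul 64 64 57 ;; Op Mul 65 64 58"

text \<open>One bucket with all \<open>N\<close> elements, and \<open>N\<close> candidates. Nothing
  is hashed, so \<open>n = N\<close> is used without rounding up to a power of two.\<close>

definition small_params :: com where
  "small_params = Copy 56 50 ;; Copy 57 50 ;; Copy 65 50"

definition rank_test :: "com \<Rightarrow> com" where
  "rank_test F = load_cell 0 25 21 ;; loadval F 3 25 ;; cmp 3 1 ;; Op Eq 10 7 52 ;; Op Eq 10 10 53"

definition select_test :: com where
  "select_test = load_cell 1 25 21 ;; Op Lt 10 46 25 ;; Op Eq 10 10 53"

definition rank_find :: "com \<Rightarrow> com" where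
  "rank_find F = bsearch (rank_test F) ;; Op Mul 45 20 57 ;; Copy 31 20"

definition select_find :: com where
  "select_find = bsearch select_test ;; load_cell 1 45 20 ;; Copy 31 20"

text \<open>Register 45 ends as the number of values that are at least \<open>y\<close>. The answer
  is its difference from \<open>N\<close>, cut off at 0 because padding elements may have been
  counted.\<close>

definition rank_walk :: "com \<Rightarrow> com" where
  "rank_walk F = Const 41 0 ;; For 44 57 (rank_body F) ;; Op Lt 4 45 50 ;; IfNZ 4 (Op Sub 0 50 45) (Const 0 0)"

definition select_walk :: "com \<Rightarrow> com" where
  "select_walk F = Const 48 0 ;; Const 41 0 ;; For 44 57 (select_body F) ;; Copy 0 48 ;; Copy 1 47"

text \<open>A query is not given \<open>\<lfloor>N powr \<alpha>\<rfloor>\<close>, so it reads the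
  bucket size from cell 4 of the structure. The branch for small \<open>N\<close> does not consult
  the structure.\<close>

definition rankp :: "nat \<Rightarrow> nat \<Rightarrow> com \<Rightarrow> com" where
  "rankp k0 C F = prelude k0 ;; IfNZ 66 (Const 4 4 ;; Load 58 0 4 ;; params C ;; rank_find F ;; rank_walk F)
     (small_params ;; Const 45 0 ;; Const 31 0 ;; rank_walk F)"

definition selectp :: "nat \<Rightarrow> nat \<Rightarrow> com \<Rightarrow> com" where
  "selectp k0 C F = Copy 46 2 ;; prelude k0 ;;
     IfNZ 66 (Const 4 4 ;; Load 58 0 4 ;; params C ;; select_find ;; select_walk F)
     (small_params ;; Const 45 0 ;; Const 31 0 ;; select_walk F)"

lemma modr_halves: "modr (halves k) \<subseteq> {66}" and moda_halves: "moda (halves k) = {}"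
  by (induction k) auto

lemma prelude_frame: "modr (prelude k0) \<subseteq> {4} \<union> {50..<70}" "moda (prelude k0) \<subseteq> {}"
  using modr_halves[of k0] moda_halves[of k0] by (auto simp: prelude_def)

lemma lg_frame: "modr (lg p e x) \<subseteq> {3, 4, 5, p, e}" "moda (lg p e x) \<subseteq> {}"
  by (auto simp: lg_def)

lemma params_frame: "modr (params C) \<subseteq> {3, 4, 5, 7} \<union> {56..<66} \<union> {68}" "moda (params C) \<subseteq> {}"
  using lg_frame[of 56 68 50] lg_frame[of 7 60 59] by (auto simp: params_def)

lemma rank_test_frame: "modr (rank_test F) \<subseteq> {3..10} \<union> {16, 25} \<union> Fr" "moda (rank_test F) \<subseteq> {3} \<union> Fa"
  using cell_frame(1,2)[of 0 25 21] loadval_frame[of F 3 25] cmp_frame[of 3 1] by (auto simp: rank_test_def)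

lemma select_test_frame: "modr select_test \<subseteq> {4, 10, 16, 25}" "moda select_test \<subseteq> {}"
  using cell_frame(1,2)[of 1 25 21] by (auto simp: select_test_def)

lemma moda_rankp: "moda (rankp k0 C F) \<subseteq> {3, 4} \<union> Fa"
proof -
  have "moda (rank_find F) \<subseteq> {3, 4} \<union> Fa"
    using bsearch_frame(2)[of "rank_test F"] rank_test_frame(2)[of F] by (auto simp: rank_find_def)
  moreover have "moda (rank_walk F) \<subseteq> {3, 4} \<union> Fa"
    using rank_body_frame(2)[of F] by (auto simp: rank_walk_def)
  ultimately show ?thesis
    using prelude_frame(2)[of k0] params_frame(2)[of C] by (auto simp: rankp_def small_params_def)
qed

lemma moda_selectp: "moda (selectp k0 C F) \<subseteq> {3, 4} \<union> Fa"
proof -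
  have "moda select_find \<subseteq> {3, 4} \<union> Fa"
    using bsearch_frame(2)[of select_test] select_test_frame(2) cell_frame(2)[of 1 45 20] by (auto simp: select_find_def)
  moreover have "moda (select_walk F) \<subseteq> {3, 4} \<union> Fa"
    using select_body_frame(2)[of F] by (auto simp: select_walk_def)
  ultimately show ?thesis
    using prelude_frame(2)[of k0] params_frame(2)[of C] by (auto simp: selectp_def small_params_def)
qed

subsection \<open>Setting up the parameters\<close>

context machine
begin

lemma run_halves:
  "regs \<sigma> 69 = 2 \<Longrightarrow> run (halves k) Q \<sigma> = Q (Suc k) (set_reg 66 (regs \<sigma> 66 div 2 ^ k) \<sigma>)"
proof (induction k arbitrary: \<sigma> Q)
  case 0
  have "set_reg 66 (regs \<sigma> 66) \<sigma> = \<sigma>" by (rule state.equality) auto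
  then show ?case by (simp add: wp_simps)
next
  case (Suc k)
  define \<sigma>1 where "\<sigma>1 = set_reg 66 (regs \<sigma> 66 div 2) \<sigma>"
  have "run (halves (Suc k)) Q \<sigma> = run (halves k) (\<lambda>m. Q (Suc m)) \<sigma>1"
    using Suc.prems by (simp add: wp_simps \<sigma>1_def)
  also have "\<dots> = Q (Suc (Suc k)) (set_reg 66 (regs \<sigma>1 66 div 2 ^ k) \<sigma>1)"
    using Suc.prems by (intro Suc.IH) (simp add: \<sigma>1_def)
  also have "set_reg 66 (regs \<sigma>1 66 div 2 ^ k) \<sigma>1 = set_reg 66 (regs \<sigma> 66 div 2 ^ Suc k) \<sigma>"
    by (simp add: \<sigma>1_def div_mult2_eq)
  finally show ?case .
qed

definition base :: "nat \<Rightarrow> nat \<Rightarrow> nat \<Rightarrow> state \<Rightarrow> bool" where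
  "base k0 N w \<sigma> \<longleftrightarrow> valid_state b \<sigma> \<and> regs \<sigma> 50 = N \<and> regs \<sigma> 51 = w \<and> regs \<sigma> 52 = 1 \<and> regs \<sigma> 53 = 0 \<and>
     regs \<sigma> 54 = b \<and> regs \<sigma> 55 = words b w \<and> regs \<sigma> 66 = N div 2 ^ k0 \<and> regs \<sigma> 67 = 5 mod 2 ^ b \<and> regs \<sigma> 69 = 2"

text \<open>Programs are not told the word length. Doubling 1 until it wraps to 0 takes exactly
  \<open>b\<close> rounds, which register 54 counts.\<close>

lemma run_bits:
  assumes "j \<le> b" "regs \<sigma> 4 = 2 ^ j mod 2 ^ b" "regs \<sigma> 54 = j" "regs \<sigma> 52 = 1"
  shows "run (WhileNZ 4 (Op Add 4 4 4 ;; Op Add 54 54 52)) (\<lambda>t \<sigma>'. t \<le> 3 * (b - j) + 1 \<and> \<sigma>' = set_reg 54 b (set_reg 4 0 \<sigma>)) \<sigma>"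
  using assms
proof (induction "b - j" arbitrary: j \<sigma>)
  case 0
  then have "j = b" by simp
  then have z: "regs \<sigma> 4 = 0" and "regs \<sigma> 54 = b" using 0 by simp_all
  then have eq: "set_reg 54 b (set_reg 4 0 \<sigma>) = \<sigma>"
    by (intro state.equality) (simp_all add: fun_eq_iff)
  show ?case by (rule wp_while_done[OF z]) (simp only: eq, simp)
next
  case (Suc d)
  then have j: "j < b" "d = b - Suc j" by auto
  define \<sigma>1 where "\<sigma>1 = set_reg 54 (Suc j) (set_reg 4 (2 ^ Suc j mod 2 ^ b) \<sigma>)"
  have nz: "regs \<sigma> 4 \<noteq> 0" using Suc.prems j by (simp add: power_strict_increasing)
  have "b < 2 ^ b" by (rule less_exp)
  then have jb: "Suc j < 2 ^ b" using j by linarith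
  have eq: "run (Op Add 4 4 4 ;; Op Add 54 54 52) Q \<sigma> = Q 2 \<sigma>1" for Q
    using Suc.prems jb by (simp add: wp_simps \<sigma>1_def mod_simps numeral_2_eq_2)
  have "run (WhileNZ 4 (Op Add 4 4 4 ;; Op Add 54 54 52)) (\<lambda>t \<sigma>'. t \<le> 3 * (b - Suc j) + 1 \<and> \<sigma>' = set_reg 54 b (set_reg 4 0 \<sigma>1)) \<sigma>1"
    using j Suc.prems by (intro Suc.hyps(1)) (auto simp: \<sigma>1_def)
  moreover have "set_reg 54 b (set_reg 4 0 \<sigma>1) = set_reg 54 b (set_reg 4 0 \<sigma>)"
    by (rule state.equality) (auto simp: \<sigma>1_def)
  ultimately show ?case
    using j by (intro wp_while_step nz) (auto simp: eq elim!: wp_mono)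
qed

lemma run_prelude:
  assumes v: "valid_state b \<sigma>" and r: "regs \<sigma> 0 = N" "regs \<sigma> 1 = w"
  shows "run (prelude k0) (\<lambda>t \<sigma>'. t \<le> 3 * b + k0 + 20 \<and> base k0 N w \<sigma>') \<sigma>"
proof -
  let ?c3 = "Op Div 55 51 54 ;; Op Mod 4 51 54 ;; IfNZ 4 (Op Add 55 55 52) Skip ;; Copy 66 50 ;; halves k0"
  let ?c2 = "WhileNZ 4 (Op Add 4 4 4 ;; Op Add 54 54 52)"
  define \<sigma>1 where "\<sigma>1 = set_reg 4 1 (set_reg 54 0 (set_reg 67 (5 mod 2 ^ b) (set_reg 69 2 (set_reg 53 0
     (set_reg 52 1 (set_reg 51 w (set_reg 50 N \<sigma>)))))))"
  have one: "Suc 0 < 2 ^ b" using Suc_0_less_two_power[OF b0] .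
  have eq: "run (prelude k0) Q \<sigma> = run (?c2 ;; ?c3) (\<lambda>t. Q (Suc (Suc (Suc (Suc (Suc (Suc (Suc (Suc t))))))))) \<sigma>1" for Q
    using r one two_less b0 by (simp add: prelude_def wp_simps wp_Copy \<sigma>1_def)
  have N: "N < 2 ^ b" "w < 2 ^ b" using v r by (auto simp: valid_state_def)
  have v1: "valid_state b \<sigma>1" using v one two_less N by (auto simp: \<sigma>1_def valid_state_def)
  have W: "words b w < 2 ^ b"
  proof -
    have "w div b \<le> w div 2" using b2 by (intro div_le_mono2) auto
    moreover have "w div 2 + 1 < 2 ^ b" using N two_less by linarith
    ultimately show ?thesis by (simp add: words_def)
  qed
  have b: "b < 2 ^ b" by (rule less_exp)
  have "run ?c2 (\<lambda>t. run ?c3 (\<lambda>t' \<sigma>'. Suc (Suc (Suc (Suc (Suc (Suc (Suc (Suc (t + t')))))))) \<le> 3 * b + k0 + 20 \<and> base k0 N w \<sigma>')) \<sigma>1"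
  proof (rule callI[OF run_bits[of 0] v1, where R = "{4, 54}" and A = "{}"])
    fix t \<sigma>2 assume 2: "t \<le> 3 * (b - 0) + 1 \<and> \<sigma>2 = set_reg 54 b (set_reg 4 0 \<sigma>1)" and v2: "valid_state b \<sigma>2"
    show "run ?c3 (\<lambda>t' \<sigma>'. Suc (Suc (Suc (Suc (Suc (Suc (Suc (Suc (t + t')))))))) \<le> 3 * b + k0 + 20 \<and> base k0 N w \<sigma>') \<sigma>2"
    proof (rule callI[where R = UNIV and A = UNIV, OF _ v2])
      show "run ?c3 (\<lambda>t' \<sigma>'. t' \<le> k0 + 6 \<and> regs \<sigma>' 50 = N \<and> regs \<sigma>' 51 = w \<and> regs \<sigma>' 52 = 1 \<and> regs \<sigma>' 53 = 0 \<and>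
        regs \<sigma>' 54 = b \<and> regs \<sigma>' 55 = words b w \<and> regs \<sigma>' 66 = N div 2 ^ k0 \<and> regs \<sigma>' 67 = 5 mod 2 ^ b \<and> regs \<sigma>' 69 = 2) \<sigma>2"
      proof (cases "w mod b = 0")
        case True
        then show ?thesis using 2 by (simp add: wp_simps wp_Copy run_halves \<sigma>1_def words_def)
      next
        case False
        then have "Suc (w div b) < 2 ^ b" using W by (simp add: words_def)
        then show ?thesis using 2 False by (simp add: wp_simps wp_Copy run_halves \<sigma>1_def words_def)
      qed
    qed (use 2 in \<open>auto simp: base_def\<close>)
  qed (auto simp: \<sigma>1_def one b0)
  then show ?thesis unfolding eq wp_Seq[of b inp ?c2] .
qed

lemma run_lg:
  assumes v: "valid_state b \<sigma>" "regs \<sigma> 52 = 1" "regs \<sigma> 53 = 0" "regs \<sigma> 54 = b"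
    and d: "distinct [3, 4, 5, 52, 53, 54, p, e, x]"
    and k: "regs \<sigma> x \<le> 2 ^ k" "\<And>i. i < k \<Longrightarrow> 2 ^ i < regs \<sigma> x" "k < b"
  shows "run (lg p e x) (\<lambda>t \<sigma>'. t \<le> 7 * b + 10 \<and> regs \<sigma>' p = 2 ^ k \<and> regs \<sigma>' e = k) \<sigma>"
proof -
  define \<sigma>1 where "\<sigma>1 = set_reg e 0 (set_reg p 1 \<sigma>)"
  have v1: "valid_state b \<sigma>1" using v(1) Suc_0_less_two_power[OF b0] by (auto simp: \<sigma>1_def valid_state_def)
  have ne: "e \<noteq> p" "x \<noteq> p" "x \<noteq> e" "p \<noteq> e" "p \<noteq> x" "e \<noteq> x" using d by auto
  have kb: "i \<le> k \<Longrightarrow> (2::nat) ^ i < 2 ^ b" for i using k(3) by simp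
  let ?body = "Op Lt 4 p x ;; IfNZ 4 (Op Add p p p ;; Op Add e e 52) Skip"
  have "run (For 5 54 ?body) (\<lambda>t \<sigma>'. 2 + t \<le> 7 * b + 10 \<and> regs \<sigma>' p = 2 ^ k \<and> regs \<sigma>' e = k) \<sigma>1"
  proof (rule ForI[where R = "{4, p, e}" and A = "{}" and k = b and T = 4 and
        I = "\<lambda>j \<sigma>'. regs \<sigma>' p = 2 ^ min j k \<and> regs \<sigma>' e = min j k"])
    fix j \<sigma>' assume j: "j < b" "regs \<sigma>' 5 = j" and ag: "agree (insert 3 (insert 5 {4, p, e})) {} \<sigma>1 \<sigma>'"
      and I: "regs \<sigma>' p = 2 ^ min j k \<and> regs \<sigma>' e = min j k"
    have r: "regs \<sigma>' x = regs \<sigma> x" "regs \<sigma>' 52 = 1" using ag d v by (auto simp: agree_def \<sigma>1_def)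
    show "run ?body (\<lambda>t \<sigma>'. t \<le> 4 \<and> (regs \<sigma>' p = 2 ^ min (Suc j) k \<and> regs \<sigma>' e = min (Suc j) k)) \<sigma>'"
    proof (cases "j < k")
      case True
      then have "2 ^ j < regs \<sigma> x" "2 ^ Suc j < (2::nat) ^ b" using k(2) kb[of "Suc j"] by auto
      moreover have "Suc j < 2 ^ b" using True k(3) less_exp[of b] by linarith
      ultimately show ?thesis using I True r d ne by (simp add: wp_simps mult_2[symmetric])
    next
      case False
      then have "\<not> 2 ^ k < regs \<sigma> x" using k(1) by simp
      then show ?thesis using I False r d ne by (simp add: wp_simps)
    qed
  qed (use v1 v d k(3) in \<open>auto simp: agree_def \<sigma>1_def\<close>)
  then show ?thesis using v d by (simp add: lg_def wp_simps wp_Copy \<sigma>1_def)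
qed

end

text \<open>\<open>nu\<close> and \<open>lam\<close> are the exponents of \<open>n\<close> and of
  the bucket size. The condition \<open>2 * lam + 2 \<le> nu\<close> lets
  \<open>m = 2 ^ (nu - 2 * lam - 2)\<close> be an exact quarter of the
  \<open>2 ^ (nu - 2 * lam)\<close> slots.\<close>

locale large_instance = machine b inp for b :: nat and inp :: "nat \<Rightarrow> nat" +
  fixes N w k0 C lam nu Q :: nat
  assumes nu: "N \<le> 2 ^ nu" "\<And>i. i < nu \<Longrightarrow> 2 ^ i < N" "nu < b" "2 * lam + 2 \<le> nu" and C: "C > 0"
    and Q: "2 ^ (nu - lam) \<le> Q" "16 * C * nu * 2 ^ lam * 2 ^ lam * Suc (nu - lam) \<le> Q"
      "16 * C * nu * 2 ^ lam * 2 ^ (nu - 2 * lam) \<le> Q" "5 * Q + 5 \<le> 2 ^ b"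
    and big: "N div 2 ^ k0 \<noteq> 0"
begin

abbreviation "rr \<equiv> 16 * C * nu * 2 ^ lam"

definition lparams :: "state \<Rightarrow> bool" where
  "lparams \<sigma> \<longleftrightarrow> base k0 N w \<sigma> \<and> regs \<sigma> 56 = 2 ^ nu \<and> regs \<sigma> 57 = 2 ^ lam \<and> regs \<sigma> 58 = 2 ^ lam \<and>
     regs \<sigma> 59 = 2 ^ (nu - lam) \<and> regs \<sigma> 60 = nu - lam \<and> regs \<sigma> 61 = Suc (nu - lam) \<and>
     regs \<sigma> 62 = 2 ^ (nu - 2 * lam) \<and> regs \<sigma> 63 = 2 ^ (nu - 2 * lam - 2) \<and>
     regs \<sigma> 64 = rr \<and> regs \<sigma> 65 = rr * 2 ^ lam"

lemma run_params:
  assumes base: "base k0 N w \<sigma>" and ell: "regs \<sigma> 58 = 2 ^ lam"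
  shows "run (params C) (\<lambda>t \<sigma>'. t \<le> 14 * b + 40 \<and> lparams \<sigma>') \<sigma>"
proof -
  have s: "valid_state b \<sigma>" "regs \<sigma> 50 = N" "regs \<sigma> 52 = 1" "regs \<sigma> 53 = 0" "regs \<sigma> 54 = b"
    using base by (auto simp: base_def)
  let ?c2 = "Op Add 61 60 52 ;;
     Op Div 62 59 58 ;; Const 4 4 ;; Op Div 63 62 4 ;; Const 4 (16 * C) ;; Op Mul 64 4 68 ;;
     Op Mul 64 64 57 ;; Op Mul 65 64 58"
  let ?c1 = "Copy 57 58 ;; Op Div 59 56 57 ;; lg 7 60 59 ;; ?c2"
  let ?P = "\<lambda>t \<sigma>'. t \<le> 14 * b + 40 \<and> lparams \<sigma>'"
  have "rr * 2 ^ lam \<le> rr * 2 ^ lam * Suc (nu - lam)" by simp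
  then have Z: "rr * 2 ^ lam \<le> Q" using Q(2) by linarith
  have "run (lg 56 68 50) (\<lambda>t. run ?c1 (\<lambda>t'. ?P (t + t'))) \<sigma>"
  proof (rule callI[OF run_lg s(1) lg_frame])
    fix t1 \<sigma>1 assume 1: "t1 \<le> 7 * b + 10 \<and> regs \<sigma>1 56 = 2 ^ nu \<and> regs \<sigma>1 68 = nu"
      and v1: "valid_state b \<sigma>1" and ag1: "agree {3, 4, 5, 56, 68} {} \<sigma> \<sigma>1"
    define \<sigma>2 where "\<sigma>2 = set_reg 59 (2 ^ (nu - lam)) (set_reg 57 (2 ^ lam) \<sigma>1)"
    have r1: "regs \<sigma>1 58 = 2 ^ lam" using ag1 ell by (auto simp: agree_def)
    have div: "(2::nat) ^ nu div 2 ^ lam = 2 ^ (nu - lam)" "(2::nat) ^ (nu - lam) div 2 ^ lam = 2 ^ (nu - 2 * lam)"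
      "(2::nat) ^ (nu - 2 * lam) div 4 = 2 ^ (nu - 2 * lam - 2)"
    proof -
      have lam: "lam \<le> nu" "lam \<le> nu - lam" "2 \<le> nu - 2 * lam" using nu(4) by auto
      show "(2::nat) ^ nu div 2 ^ lam = 2 ^ (nu - lam)" using lam by (simp add: power_diff)
      have "nu - lam - lam = nu - 2 * lam" by simp
      then show "(2::nat) ^ (nu - lam) div 2 ^ lam = 2 ^ (nu - 2 * lam)"
        using power_diff[of "2::nat" lam "nu - lam"] lam by simp
      show "(2::nat) ^ (nu - 2 * lam) div 4 = 2 ^ (nu - 2 * lam - 2)"
        using power_diff[of "2::nat" 2 "nu - 2 * lam"] lam by simp
    qed
    have eq: "run ?c1 R \<sigma>1 = run (lg 7 60 59 ;; ?c2) (\<lambda>t. R (Suc (Suc t))) \<sigma>2" for R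
      using 1 r1 div by (simp add: wp_simps wp_Copy \<sigma>2_def)
    have pb: "i \<le> nu \<Longrightarrow> (2::nat) ^ i < 2 ^ b" for i using nu(3) by simp
    have v2: "valid_state b \<sigma>2" using v1 pb[of "nu - lam"] pb[of lam] nu(4) by (auto simp: \<sigma>2_def valid_state_def)
    have base2: "base k0 N w \<sigma>2" using base ag1 v2 by (auto simp: base_def agree_def \<sigma>2_def)
    show "run ?c1 (\<lambda>t'. ?P (t1 + t')) \<sigma>1"
      unfolding eq wp_Seq[of b inp "lg 7 60 59"]
    proof (rule callI[OF run_lg[where k = "nu - lam"] v2 lg_frame])
      fix t3 \<sigma>3 assume 3: "t3 \<le> 7 * b + 10 \<and> regs \<sigma>3 7 = 2 ^ (nu - lam) \<and> regs \<sigma>3 60 = nu - lam"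
        and v3: "valid_state b \<sigma>3" and ag3: "agree {3, 4, 5, 7, 60} {} \<sigma>2 \<sigma>3"
      have base3: "base k0 N w \<sigma>3" using base2 ag3 v3 by (auto simp: base_def agree_def)
      have r3: "regs \<sigma>3 56 = 2 ^ nu" "regs \<sigma>3 57 = 2 ^ lam" "regs \<sigma>3 58 = 2 ^ lam" "regs \<sigma>3 59 = 2 ^ (nu - lam)"
        "regs \<sigma>3 68 = nu" "regs \<sigma>3 52 = 1"
        using ag3 ag1 1 r1 base3 by (auto simp: agree_def \<sigma>2_def base_def)
      define \<sigma>4 where "\<sigma>4 = set_reg 65 (rr * 2 ^ lam) (set_reg 64 rr (set_reg 4 (16 * C) (set_reg 63 (2 ^ (nu - 2 * lam - 2))
         (set_reg 62 (2 ^ (nu - 2 * lam)) (set_reg 61 (Suc (nu - lam)) \<sigma>3)))))"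
      have Qb: "Q < 2 ^ b" using Q(4) by linarith
      have fit: "Suc (nu - lam) < 2 ^ b" "4 < (2::nat) ^ b" "16 * C < 2 ^ b" "16 * C * nu < 2 ^ b" "rr < 2 ^ b" "rr * 2 ^ lam < 2 ^ b"
      proof -
        show "Suc (nu - lam) < 2 ^ b" using nu(3) less_exp[of b] by linarith
        show "4 < (2::nat) ^ b" using Q(4) by linarith
        show z: "rr * 2 ^ lam < 2 ^ b" using Z Qb by linarith
        have "rr \<le> rr * 2 ^ lam" by simp
        then show r: "rr < 2 ^ b" using z by linarith
        have "16 * C * nu \<le> rr" by simp
        then show c: "16 * C * nu < 2 ^ b" using r by linarith
        have "16 * C \<le> 16 * C * nu" using nu(4) by simp
        then show "16 * C < 2 ^ b" using c by linarith
      qed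
      have eq3: "run ?c2 R \<sigma>3 = R (Suc (Suc (Suc (Suc (Suc (Suc (Suc (Suc 0)))))))) \<sigma>4" for R
      proof -
        have "run ?c2 R \<sigma>3 = R (Suc (Suc (Suc (Suc (Suc (Suc (Suc (Suc 0))))))))
          (set_reg 65 (rr * 2 ^ lam) (set_reg 64 rr (set_reg 64 (16 * C * nu) (set_reg 4 (16 * C) (set_reg 63 (2 ^ (nu - 2 * lam - 2)) (set_reg 4 4
         (set_reg 62 (2 ^ (nu - 2 * lam)) (set_reg 61 (Suc (nu - lam)) \<sigma>3))))))))"
          using r3 3 fit div by (simp add: wp_simps)
        also have "(set_reg 65 (rr * 2 ^ lam) (set_reg 64 rr (set_reg 64 (16 * C * nu) (set_reg 4 (16 * C) (set_reg 63 (2 ^ (nu - 2 * lam - 2)) (set_reg 4 4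
         (set_reg 62 (2 ^ (nu - 2 * lam)) (set_reg 61 (Suc (nu - lam)) \<sigma>3)))))))) = \<sigma>4"
          unfolding \<sigma>4_def by (rule state.equality) (auto simp: fun_eq_iff)
        finally show ?thesis .
      qed
      have "valid_state b \<sigma>4"
        using v3 fit pb[of "nu - 2 * lam"] pb[of "nu - 2 * lam - 2"] by (auto simp: \<sigma>4_def valid_state_def)
      then have "lparams \<sigma>4" using base3 r3 3 by (auto simp: \<sigma>4_def lparams_def base_def)
      then show "run ?c2 (\<lambda>t. ?P (t1 + Suc (Suc (t3 + t)))) \<sigma>3"
        unfolding eq3 using 1 3 by auto
    qed (use base2 nu in \<open>auto simp: base_def \<sigma>2_def\<close>)
  qed (use s nu in auto)
  then show ?thesis by (simp only: params_def wp_Seq)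
qed

end

subsection \<open>Queries\<close>

context ram_buckets
begin

text \<open>For \<open>y > 0\<close> the padding elements, of value 0, are not counted, and
  \<open>cnt y\<close> is the size of the complement of the wanted set. For \<open>y = 0\<close>
  they are, \<open>cnt y\<close> is \<open>n\<close>, and the cut-off yields 0.\<close>

lemma rank_result:
  "(if cnt y < N then N - cnt y else 0) = card {x \<in> {..<N}. f x < y}"
proof (cases "y = 0")
  case True
  then have "cnt y = n" by (simp add: cnt_def)
  then show ?thesis using n True by simp
next
  case False
  have "{x. x < n \<and> y \<le> fx x} = {x \<in> {..<N}. y \<le> f x}"
    using n False by (auto simp: fx_def split: if_splits)
  then have c: "cnt y = card {x \<in> {..<N}. y \<le> f x}" by (simp add: cnt_def)
  have "card {..<N} = card ({x \<in> {..<N}. f x < y} \<union> {x \<in> {..<N}. y \<le> f x})"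
    by (intro arg_cong[of _ _ card]) auto
  also have "\<dots> = card {x \<in> {..<N}. f x < y} + cnt y"
    unfolding c by (intro card_Un_disjoint) auto
  finally have "N = card {x \<in> {..<N}. f x < y} + cnt y" by simp
  moreover have "(if c < N then N - c else 0) = a" if "N = a + c" for a c :: nat using that by auto
  ultimately show ?thesis by blast
qed

text \<open>Padding can add only the value 0, which is strictly above nothing.\<close>

lemma ds_eq: "x < N \<Longrightarrow> ds x = card {v \<in> f ` {..<N}. f x < v}"
proof -
  assume x: "x < N"
  have "{u \<in> fx ` {..<n}. fx x < u} = {v \<in> f ` {..<N}. f x < v}"
    using n x by (force simp: fx_def split: if_splits)
  then show ?thesis by (simp add: ds_def)
qed

lemma is_kth_largest_iff: "is_kth_largest f N k x \<longleftrightarrow> x < N \<and> ds x = k"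
  using ds_eq by (auto simp: is_kth_largest_def)

text \<open>Ties are ordered by decreasing index, so the last element of a class of equal values is
  the least index, which is below \<open>N\<close> whenever some index of the class is.\<close>

lemma bucket_of_kth:
  assumes J: "J < M" "\<And>j. j < M \<Longrightarrow> ds (el (j * B)) \<le> k \<longleftrightarrow> j \<le> J" and x: "x < N" "ds x = k"
  shows "\<exists>p\<in>{J * B..<J * B + B}. ds (el p) = k \<and> el p < N"
proof -
  define P where "P = {p. p < n \<and> ds (el p) = k}"
  have xn: "x < n" using x n by simp
  have rkP: "rk x \<in> P" using rk_less[OF xn] el(3)[OF xn] x by (simp add: P_def)
  have fin: "finite P" by (simp add: P_def)
  define p where "p = Max P"
  have pP: "p \<in> P" and pmax: "\<And>p'. p' \<in> P \<Longrightarrow> p' \<le> p"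
    using rkP fin by (auto simp: p_def intro: Max_in)
  have p: "p < n" "ds (el p) = k" using pP by (auto simp: P_def)
  have le: "rk x \<le> rk (el p)" using pmax[OF rkP] el(2)[OF p(1)] by simp
  then have "ky (el p) \<le> ky x" using rk_le_iff[OF xn el(1)[OF p(1)]] by simp
  moreover have "fx (el p) = fx x" using v_eq_of_ds_eq[OF el(1)[OF p(1)] xn] p x by simp
  ultimately have "el p < N" using x(1) by (simp add: ky_def)
  \<comment> \<open>If \<open>p\<close> came before bucket \<open>J\<close>, the first element of
    that bucket would by monotonicity also have count \<open>k\<close>, against the maximality of
    \<open>p\<close>.\<close>
  moreover have "J * B \<le> p"
  proof (rule ccontr)
    assume "\<not> J * B \<le> p"
    moreover have JBn: "J * B < n"
      using J B_pos MB by simp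
    ultimately have "k \<le> ds (el (J * B))" using ds_el_mono[of p "J * B"] p by simp
    then have "ds (el (J * B)) = k" using J(2)[OF J(1)] by simp
    then have "J * B \<in> P" using JBn by (simp add: P_def)
    then show False using pmax \<open>\<not> J * B \<le> p\<close> by blast
  qed
  moreover have "p < J * B + B"
  proof (rule ccontr)
    assume c: "\<not> p < J * B + B"
    then have "Suc J * B \<le> p" by simp
    then have "Suc J * B < M * B" using p MB by simp
    then have "Suc J < M" by (simp only: mult_less_cancel2)
    then have "\<not> ds (el (Suc J * B)) \<le> k" using J(2)[of "Suc J"] by simp
    then show False using ds_el_mono[OF \<open>Suc J * B \<le> p\<close> p(1)] p by simp
  qed
  ultimately show ?thesis using p by auto
qed

abbreviation T_rwalk :: "nat \<Rightarrow> nat" where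
  "T_rwalk T \<equiv> B * (T_next T + T_lv \<tau> W + T_cmp W + 8) + 10"

abbreviation T_swalk :: "nat \<Rightarrow> nat" where
  "T_swalk T \<equiv> B * (T_next T + 2 * T_lv \<tau> W + T_cmp W + 23) + 10"

context
  fixes D cf :: "nat \<Rightarrow> nat" and J T :: nat
  assumes c: "cand_ok D J cf T" and J: "J < M" and complete: "\<And>x. x < n \<Longrightarrow> g x = J \<Longrightarrow> x \<in> cf ` {..<Z}"
begin

lemma run_rank_walkp:
  assumes e: "env \<sigma>" and m: "mem \<sigma> 0 = D" "holds_int b w (mem \<sigma> 1) y" "y < 2 ^ w" and r: "regs \<sigma> 31 = J"
      "regs \<sigma> 45 = J * B" and cnt: "J * B \<le> cnt y" "cnt y \<le> J * B + B"
  shows "run (rank_walk F) (\<lambda>t \<sigma>'. t \<le> T_rwalk T \<and> regs \<sigma>' 0 = card {x \<in> {..<N}. f x < y}) \<sigma>"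
proof -
  define \<sigma>1 where "\<sigma>1 = set_reg 41 0 \<sigma>"
  have e1: "env \<sigma>1" using e by (auto simp: env_def \<sigma>1_def valid_state_def)
  let ?c = "Op Lt 4 45 50 ;; IfNZ 4 (Op Sub 0 50 45) (Const 0 0)"
  have "run (For 44 57 (rank_body F)) (\<lambda>t. run ?c (\<lambda>t' \<sigma>'. 1 + (t + t') \<le> T_rwalk T \<and> regs \<sigma>' 0 = card {x \<in> {..<N}. f x < y})) \<sigma>1"
  proof (rule callI[OF run_rank_walk[OF c J complete e1] env_valid[OF e1]])
    show "modr (For 44 57 (rank_body F)) \<subseteq> {3..45} \<union> Fr" "moda (For 44 57 (rank_body F)) \<subseteq> UNIV"
      using rank_body_frame[of F] by auto
    fix t \<sigma>2 assume 2: "t \<le> B * (T_next T + T_lv \<tau> W + T_cmp W + 8) + 3 \<and> regs \<sigma>2 45 = cnt y"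
      and v2: "valid_state b \<sigma>2" and ag: "agree ({3..45} \<union> Fr) UNIV \<sigma>1 \<sigma>2"
    have e2: "env \<sigma>2" by (rule env_agree[OF e1 ag v2]) auto
    have "N < 2 ^ b" using n by simp
    then show "run ?c (\<lambda>t' \<sigma>'. 1 + (t + t') \<le> T_rwalk T \<and> regs \<sigma>' 0 = card {x \<in> {..<N}. f x < y}) \<sigma>2"
      using 2 env_regs(1)[OF e2] sub_mod[of "cnt y" N "2 ^ b"] unfolding rank_result[symmetric]
      by (auto simp: wp_simps)
  qed (use m r cnt in \<open>auto simp: \<sigma>1_def\<close>)
  then show ?thesis by (simp add: rank_walk_def wp_Seq wp_simps \<sigma>1_def)
qed

lemma run_select_walkp:
  assumes e: "env \<sigma>" and m: "mem \<sigma> 0 = D" and r: "regs \<sigma> 31 = J" "regs \<sigma> 45 = ds (el (J * B))"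
    and k: "\<And>j. j < M \<Longrightarrow> ds (el (j * B)) \<le> regs \<sigma> 46 \<longleftrightarrow> j \<le> J"
  shows "run (select_walk F) (\<lambda>t \<sigma>'. t \<le> T_swalk T \<and>
     (if \<exists>x. is_kth_largest f N (regs \<sigma> 46) x then regs \<sigma>' 0 = 1 \<and> is_kth_largest f N (regs \<sigma> 46) (regs \<sigma>' 1)
      else regs \<sigma>' 0 = 0)) \<sigma>"
proof -
  let ?k = "regs \<sigma> 46"
  define \<sigma>1 where "\<sigma>1 = set_reg 41 0 (set_reg 48 0 \<sigma>)"
  have e1: "env \<sigma>1" using e by (auto simp: env_def \<sigma>1_def valid_state_def)
  let ?c = "Copy 0 48 ;; Copy 1 47"
  let ?P = "\<lambda>\<sigma>'. if \<exists>x. is_kth_largest f N ?k x then regs \<sigma>' 0 = 1 \<and> is_kth_largest f N ?k (regs \<sigma>' 1) else regs \<sigma>' 0 = 0"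
  let ?R = "{3..30} \<union> {32..36} \<union> {40..43} \<union> {45, 47, 48} \<union> Fr"
  let ?I = "\<lambda>j \<sigma>'. regs \<sigma>' 45 = ds (el (if j = 0 then J * B else J * B + j - 1)) \<and>
        (if j = 0 then regs \<sigma>' 41 = 0 else regs \<sigma>' 41 \<noteq> 0 \<and> regs \<sigma>' 40 = el (J * B + j - 1)) \<and>
        (if \<exists>p\<in>{J * B..<J * B + j}. ds (el p) = ?k \<and> el p < N then regs \<sigma>' 48 = 1 \<and> ds (regs \<sigma>' 47) = ?k \<and> regs \<sigma>' 47 < N
         else regs \<sigma>' 48 = 0)"
  have "run (For 44 57 (select_body F)) (\<lambda>t. run ?c (\<lambda>t' \<sigma>'. 2 + (t + t') \<le> T_swalk T \<and> ?P \<sigma>')) \<sigma>1"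
  proof (rule ForI[where R = ?R and A = "{3, 4} \<union> Fa" and k = B and I = ?I and
        T = "T_next T + 2 * T_lv \<tau> W + T_cmp W + 20"])
    fix j \<sigma>2 assume j: "j < B" and v2: "valid_state b \<sigma>2" and ag: "agree (insert 3 (insert 44 ?R)) ({3, 4} \<union> Fa) \<sigma>1 \<sigma>2"
      and I: "?I j \<sigma>2"
    have e2: "env \<sigma>2" by (rule env_agree[OF e1 ag v2]) auto
    have r2: "mem \<sigma>2 0 = D" "regs \<sigma>2 31 = J" "regs \<sigma>2 46 = ?k" using ag m r by (auto simp: agree_def \<sigma>1_def)
    show "run (select_body F) (\<lambda>t \<sigma>'. t \<le> T_next T + 2 * T_lv \<tau> W + T_cmp W + 20 \<and> ?I (Suc j) \<sigma>') \<sigma>2"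
    proof (rule wp_mono[OF run_select_body[OF c J complete e2 r2(1,2) j]])
      fix t \<sigma>' assume *: "t \<le> T_next T + 2 * T_lv \<tau> W + T_cmp W + 20 \<and> regs \<sigma>' 41 \<noteq> 0 \<and> regs \<sigma>' 40 = el (J * B + j) \<and>
       regs \<sigma>' 45 = ds (el (J * B + j)) \<and>
       (if ds (el (J * B + j)) = regs \<sigma>2 46 \<and> el (J * B + j) < N then regs \<sigma>' 48 = 1 \<and> regs \<sigma>' 47 = el (J * B + j)
        else regs \<sigma>' 48 = regs \<sigma>2 48 \<and> regs \<sigma>' 47 = regs \<sigma>2 47)"
      have ex: "(\<exists>p\<in>{J * B..<J * B + Suc j}. ds (el p) = ?k \<and> el p < N) \<longleftrightarrow>
         (ds (el (J * B + j)) = ?k \<and> el (J * B + j) < N) \<or> (\<exists>p\<in>{J * B..<J * B + j}. ds (el p) = ?k \<and> el p < N)"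
        by (auto simp: less_Suc_eq)
      have "if \<exists>p\<in>{J * B..<J * B + Suc j}. ds (el p) = ?k \<and> el p < N then regs \<sigma>' 48 = 1 \<and> ds (regs \<sigma>' 47) = ?k \<and> regs \<sigma>' 47 < N
         else regs \<sigma>' 48 = 0"
      proof (cases "ds (el (J * B + j)) = ?k \<and> el (J * B + j) < N")
        case True
        then show ?thesis unfolding ex using * r2(3) by simp
      next
        case False
        then have "regs \<sigma>' 48 = regs \<sigma>2 48" "regs \<sigma>' 47 = regs \<sigma>2 47" using * r2(3) by auto
        moreover have "(\<exists>p\<in>{J * B..<J * B + Suc j}. ds (el p) = ?k \<and> el p < N) \<longleftrightarrow>
            (\<exists>p\<in>{J * B..<J * B + j}. ds (el p) = ?k \<and> el p < N)"
          using ex False by blast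
        ultimately show ?thesis using I by presburger
      qed
      then show "t \<le> T_next T + 2 * T_lv \<tau> W + T_cmp W + 20 \<and> ?I (Suc j) \<sigma>'"
        using * by simp
    qed (use I in auto)
  next
    fix t :: nat and \<sigma>2 :: state assume t: "t \<le> B * (T_next T + 2 * T_lv \<tau> W + T_cmp W + 20 + 3) + 3" and I: "?I B \<sigma>2"
    have eq: "T_next T + 2 * T_lv \<tau> W + T_cmp W + 20 + 3 = T_next T + 2 * T_lv \<tau> W + T_cmp W + 23" by simp
    have "(\<exists>x. is_kth_largest f N ?k x) \<longleftrightarrow> (\<exists>p\<in>{J * B..<J * B + B}. ds (el p) = ?k \<and> el p < N)"
      unfolding is_kth_largest_iff using bucket_of_kth[OF J k] by blast
    then have "if \<exists>x. is_kth_largest f N ?k x then regs \<sigma>2 48 = 1 \<and> is_kth_largest f N ?k (regs \<sigma>2 47) else regs \<sigma>2 48 = 0"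
      using I by (simp add: is_kth_largest_iff)
    then show "run ?c (\<lambda>t' \<sigma>'. 2 + (t + t') \<le> T_swalk T \<and> ?P \<sigma>') \<sigma>2"
      using t unfolding eq by (simp add: wp_simps wp_Copy)
  next
    show "modr (select_body F) \<subseteq> ?R" "moda (select_body F) \<subseteq> {3, 4} \<union> Fa" by (rule select_body_frame)+
    show "?I j \<sigma>'" if "?I j \<sigma>" "agree {3, 44} {} \<sigma> \<sigma>'" for j \<sigma> \<sigma>'
      using that by (simp add: agree_def)
    show "?I 0 \<sigma>1" using r by (simp add: \<sigma>1_def)
  qed (use env_valid[OF e1] env_regs(3)[OF e1] e1 par_buckets in \<open>auto simp: env_def\<close>)
  then show ?thesis by (simp add: select_walk_def wp_Seq wp_simps \<sigma>1_def)
qed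

end

end

section \<open>Complete queries, through the structure and by exhaustive search\<close>

lemma antimono_threshold:
  fixes P :: "nat \<Rightarrow> bool"
  assumes "M > 0" "P 0" "\<And>i j. i \<le> j \<Longrightarrow> j < M \<Longrightarrow> P j \<Longrightarrow> P i"
  obtains G where "G < M" "\<And>j. j < M \<Longrightarrow> P j \<longleftrightarrow> j \<le> G"
proof -
  define G where "G = Max {j. j < M \<and> P j}"
  have G: "G \<in> {j. j < M \<and> P j}" unfolding G_def using assms(1,2) by (intro Max_in) auto
  moreover have "j \<le> G" if "j < M" "P j" for j unfolding G_def using that by (intro Max_ge) auto
  ultimately show ?thesis using assms(3) by (intro that[of G]) auto
qed

lemma rank_bsearch_frame: "modr (bsearch (rank_test F)) \<subseteq> {3..25} \<union> Fr" "moda (bsearch (rank_test F)) \<subseteq> {3} \<union> Fa"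
  subgoal by (rule order_trans[OF bsearch_frame(1)]) (use rank_test_frame[of F] in auto)
  subgoal by (rule order_trans[OF bsearch_frame(2) rank_test_frame(2)])
  done

lemma select_bsearch_frame: "modr (bsearch select_test) \<subseteq> {3..25}" "moda (bsearch select_test) \<subseteq> {}"
  subgoal by (rule order_trans[OF bsearch_frame(1)]) (use select_test_frame in auto)
  subgoal by (rule order_trans[OF bsearch_frame(2) select_test_frame(2)])
  done

context ram_large
begin

text \<open>The last conjunct is what the random tables have to achieve: every element occurs among
  the candidates of its own bucket.\<close>

definition ds_ok :: "(nat \<Rightarrow> nat) \<Rightarrow> bool" where
  "ds_ok D \<longleftrightarrow> pivots_ok D \<and> (\<forall>j<M. D (5 * j + 1) = ds (el (j * B))) \<and> (\<forall>x<n. \<exists>z<Z. candx D (g x) z = x)"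

abbreviation "T_cd \<equiv> T_cand ell mu \<tau> W"

lemma cand_ok_large:
  assumes "ds_ok D"
  shows "cand_ok D J (candx D J) T_cd"
  using assms run_cand_large hv_less unfolding cand_ok_def ds_ok_def
  by (auto simp: candx_def Let_def)

lemma pivot_less: "j < M \<Longrightarrow> j * B < n"
  using MB B_pos by simp

lemma run_rank_test:
  assumes e: "env \<sigma>1" and p: "pivots_ok (mem \<sigma>1 0)" and y: "holds_int b w (mem \<sigma>1 1) y" "y < 2 ^ w" and j: "regs \<sigma>1 21 < M"
  shows "run (rank_test F) (\<lambda>t \<sigma>'. t \<le> T_lv \<tau> W + T_cmp W + 6 \<and> (regs \<sigma>' 10 \<noteq> 0 \<longleftrightarrow> regs \<sigma>1 21 * B < cnt y)) \<sigma>1"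
proof -
  let ?j = "regs \<sigma>1 21"
  note jB = pivot_less[OF j]
  define \<sigma>2 where "\<sigma>2 = set_reg 25 (el (?j * B)) (set_reg 16 (5 * ?j + 0) (set_reg 4 0 \<sigma>1))"
  have jQ: "?j < Q" using j fits(1) by simp
  let ?c = "Op Eq 10 7 52 ;; Op Eq 10 10 53"
  have eq: "run (rank_test F) P \<sigma>1 = run (loadval F 3 25 ;; cmp 3 1 ;; ?c) (\<lambda>t. P (4 + t)) \<sigma>2" for P
    unfolding rank_test_def wp_Seq[of b inp "load_cell 0 25 21"]
    using p j by (subst run_load_cell) (simp_all add: env_large[OF e] jQ \<sigma>2_def pivots_ok_def)
  have e2: "env \<sigma>2"
    using e el(1)[OF jB] n(2) jQ fits(4) by (auto simp: env_def \<sigma>2_def valid_state_def)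
  have "run (loadval F 3 25) (\<lambda>t. run (cmp 3 1) (\<lambda>t'. run ?c (\<lambda>t'' \<sigma>'. 4 + (t + (t' + t'')) \<le> T_lv \<tau> W + T_cmp W + 6 \<and>
     (regs \<sigma>' 10 \<noteq> 0 \<longleftrightarrow> ?j * B < cnt y)))) \<sigma>2"
  proof (rule callI[OF run_loadval[OF e2] env_valid[OF e2] loadval_frame])
    fix t \<sigma>3 assume 3: "t \<le> T_lv \<tau> W \<and> holds_int b w (mem \<sigma>3 3) (fx (regs \<sigma>2 25))"
      and v3: "valid_state b \<sigma>3" and ag3: "agree ({3..6} \<union> Fr) ({3} \<union> Fa) \<sigma>2 \<sigma>3"
    have e3: "env \<sigma>3" by (rule env_agree[OF e2 ag3 v3]) auto
    have m3: "holds_int b w (mem \<sigma>3 3) (fx (el (?j * B)))" "holds_int b w (mem \<sigma>3 1) y"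
      using 3 ag3 y by (auto simp: agree_def \<sigma>2_def)
    show "run (cmp 3 1) (\<lambda>t'. run ?c (\<lambda>t'' \<sigma>'. 4 + (t + (t' + t'')) \<le> T_lv \<tau> W + T_cmp W + 6 \<and>
      (regs \<sigma>' 10 \<noteq> 0 \<longleftrightarrow> ?j * B < cnt y))) \<sigma>3"
    proof (rule callI[OF run_cmp[OF e3 fx_less y(2) m3] v3 cmp_frame])
      fix t' \<sigma>4 assume 4: "t' \<le> T_cmp W \<and> regs \<sigma>4 7 = cv (fx (el (?j * B))) y" and ag4: "agree {3..9} {} \<sigma>3 \<sigma>4"
        and v4: "valid_state b \<sigma>4"
      have e4: "env \<sigma>4" by (rule env_agree[OF e3 ag4 v4]) auto
      show "run ?c (\<lambda>t'' \<sigma>'. 4 + (t + (t' + t'')) \<le> T_lv \<tau> W + T_cmp W + 6 \<and>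
        (regs \<sigma>' 10 \<noteq> 0 \<longleftrightarrow> ?j * B < cnt y)) \<sigma>4"
        using 3 4 env_regs(3,4)[OF e4] less_cnt_iff[OF jB, of y] by (auto simp: wp_simps cv_def)
    qed
  qed auto
  then show ?thesis unfolding eq by (simp only: wp_Seq)
qed

abbreviation "T_rfind \<equiv> T_bs mu (T_lv \<tau> W + T_cmp W + 6) + 2"
abbreviation "T_sfind \<equiv> T_bs mu 6 + 5"

lemma run_rank_large:
  assumes e: "env \<sigma>" and D: "ds_ok (mem \<sigma> 0)" and y: "holds_int b w (mem \<sigma> 1) y" "y < 2 ^ w"
  shows "run (rank_find F ;; rank_walk F) (\<lambda>t \<sigma>'. t \<le> T_rfind + T_rwalk T_cd \<and>
     regs \<sigma>' 0 = card {x \<in> {..<N}. f x < y}) \<sigma>"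
proof -
  let ?D = "mem \<sigma> 0"
  have p: "pivots_ok ?D" using D by (simp add: ds_ok_def)
  \<comment> \<open>The last bucket whose first element has value at least \<open>y\<close>. If
    \<open>cnt y = 0\<close>, truncated subtraction gives bucket 0, whose walk counts nothing; in
    that case the equivalence \<open>iff\<close> would fail at \<open>j = 0\<close>.\<close>
  define G where "G = (cnt y - 1) div B"
  have G: "G < M"
  proof -
    have "cnt y - 1 < n" using cnt_le[of y] n(3) by linarith
    then have "cnt y - 1 < M * B" by (rule ord_less_eq_trans[OF _ MB])
    then show ?thesis by (simp add: G_def less_mult_imp_div_less)
  qed
  have iff: "j * B < cnt y \<longleftrightarrow> j \<le> G" if "0 < j" for j
  proof -
    have "j \<le> G \<longleftrightarrow> j * B \<le> cnt y - 1" using B_pos by (simp add: G_def less_eq_div_iff_mult_less_eq)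
    moreover have "j * B > 0" using that B_pos by simp
    ultimately show ?thesis by linarith
  qed
  have cnt: "G * B \<le> cnt y" "cnt y \<le> G * B + B"
  proof -
    have "G * B \<le> cnt y - 1" by (simp add: G_def)
    then show "G * B \<le> cnt y" by linarith
    have "cnt y - 1 < G * B + B" using dividend_less_div_times[OF B_pos, of "cnt y - 1"] by (simp add: G_def add.commute)
    then show "cnt y \<le> G * B + B" by linarith
  qed
  have GB: "G * B < 2 ^ b" using pivot_less[OF G] n(2) by simp
  let ?c = "Op Mul 45 20 57 ;; Copy 31 20"
  have "run (bsearch (rank_test F)) (\<lambda>t. run ?c (\<lambda>t'. run (rank_walk F) (\<lambda>t'' \<sigma>'.
     t + t' + t'' \<le> T_rfind + T_rwalk T_cd \<and> regs \<sigma>' 0 = card {x \<in> {..<N}. f x < y}))) \<sigma>"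
  proof (rule callI[OF run_bsearch[OF e rank_test_frame _ G] env_valid[OF e]])
    fix \<sigma>1 assume e1: "env \<sigma>1" and ag1: "agree ({3, 20, 21, 22, 23} \<union> ({3..10} \<union> {16, 25} \<union> Fr)) ({3} \<union> Fa) \<sigma> \<sigma>1"
      and j: "0 < regs \<sigma>1 21" "regs \<sigma>1 21 < M"
    show "run (rank_test F) (\<lambda>t \<sigma>'. t \<le> T_lv \<tau> W + T_cmp W + 6 \<and> (regs \<sigma>' 10 \<noteq> 0 \<longleftrightarrow> regs \<sigma>1 21 \<le> G)) \<sigma>1"
      unfolding iff[OF j(1), symmetric]
      by (rule run_rank_test[OF e1 _ _ y(2) j(2)]) (use p y ag1 in \<open>auto simp: agree_def\<close>)
  next
    show "modr (bsearch (rank_test F)) \<subseteq> {3..25} \<union> Fr" "moda (bsearch (rank_test F)) \<subseteq> {3} \<union> Fa"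
      by (rule rank_bsearch_frame)+
    fix t \<sigma>1 assume 1: "t \<le> T_bs mu (T_lv \<tau> W + T_cmp W + 6) \<and> regs \<sigma>1 20 = G"
      and v1: "valid_state b \<sigma>1" and ag1: "agree ({3..25} \<union> Fr) ({3} \<union> Fa) \<sigma> \<sigma>1"
    have e1: "env \<sigma>1" by (rule env_agree[OF e ag1 v1]) auto
    define \<sigma>2 where "\<sigma>2 = set_reg 31 G (set_reg 45 (G * B) \<sigma>1)"
    have e2: "env \<sigma>2" using e1 GB G fits(1,4) by (auto simp: env_def \<sigma>2_def valid_state_def)
    have eq: "run ?c P \<sigma>1 = P 2 \<sigma>2" for P
      using 1 GB env_large(1)[OF e1] by (simp add: wp_simps wp_Copy \<sigma>2_def numeral_2_eq_2)
    show "run ?c (\<lambda>t'. run (rank_walk F) (\<lambda>t'' \<sigma>'.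
       t + t' + t'' \<le> T_rfind + T_rwalk T_cd \<and> regs \<sigma>' 0 = card {x \<in> {..<N}. f x < y})) \<sigma>1"
      unfolding eq
    proof (rule wp_mono[OF run_rank_walkp[OF cand_ok_large[OF D] G _ e2 _ _ y(2)]])
      fix x assume x: "x < n" "g x = G"
      then obtain z where "z < Z" "candx ?D (g x) z = x" using D unfolding ds_ok_def by blast
      then show "x \<in> candx ?D G ` {..<Z}" using x(2) by (intro image_eqI[of _ _ z]) auto
    qed (use 1 ag1 y cnt in \<open>auto simp: agree_def \<sigma>2_def\<close>)
  qed auto
  then show ?thesis unfolding rank_find_def wp_Seq by (simp only: add.assoc)
qed

lemma run_select_large:
  assumes e: "env \<sigma>" and D: "ds_ok (mem \<sigma> 0)"
  shows "run (select_find ;; select_walk F) (\<lambda>t \<sigma>'. t \<le> T_sfind + T_swalk T_cd \<and>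
     (if \<exists>x. is_kth_largest f N (regs \<sigma> 46) x then regs \<sigma>' 0 = 1 \<and> is_kth_largest f N (regs \<sigma> 46) (regs \<sigma>' 1)
      else regs \<sigma>' 0 = 0)) \<sigma>"
proof -
  let ?D = "mem \<sigma> 0" and ?k = "regs \<sigma> 46"
  have p: "\<And>j. j < M \<Longrightarrow> ?D (5 * j + 1) = ds (el (j * B))" using D by (simp add: ds_ok_def)
  \<comment> \<open>The last bucket whose first element has at most \<open>?k\<close> distinct
    values above it. Bucket 0 qualifies, since its first element is a maximum.\<close>
  obtain G where G: "G < M" and iff: "\<And>j. j < M \<Longrightarrow> ds (el (j * B)) \<le> ?k \<longleftrightarrow> j \<le> G"
  proof (rule antimono_threshold[of M "\<lambda>j. ds (el (j * B)) \<le> ?k"])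
    show "ds (el (0 * B)) \<le> ?k" using ds_el_0[OF n(3)] by simp
    fix i j assume "i \<le> j" "j < M" "ds (el (j * B)) \<le> ?k"
    then show "ds (el (i * B)) \<le> ?k"
      using ds_el_mono[of "i * B" "j * B"] pivot_less[of j] by auto
  qed (use M_pos in auto)
  let ?c = "load_cell 1 45 20 ;; Copy 31 20"
  let ?P = "\<lambda>\<sigma>'. if \<exists>x. is_kth_largest f N ?k x then regs \<sigma>' 0 = 1 \<and> is_kth_largest f N ?k (regs \<sigma>' 1) else regs \<sigma>' 0 = 0"
  have Qb: "5 * j + k < 2 ^ b" if "j < M" "k < 5" for j k using that fits(1,4) by linarith
  have "run (bsearch select_test) (\<lambda>t. run ?c (\<lambda>t'. run (select_walk F) (\<lambda>t'' \<sigma>'.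
     t + t' + t'' \<le> T_sfind + T_swalk T_cd \<and> ?P \<sigma>'))) \<sigma>"
  proof (rule callI[OF run_bsearch[OF e select_test_frame _ G] env_valid[OF e]])
    fix \<sigma>1 assume e1: "env \<sigma>1" and ag1: "agree ({3, 20, 21, 22, 23} \<union> {4, 10, 16, 25}) {} \<sigma> \<sigma>1"
      and j: "0 < regs \<sigma>1 21" "regs \<sigma>1 21 < M"
    have r1: "regs \<sigma>1 46 = ?k" "mem \<sigma>1 0 = ?D" using ag1 by (auto simp: agree_def)
    have jQ: "regs \<sigma>1 21 < Q" using j fits(1) by simp
    show "run select_test (\<lambda>t \<sigma>'. t \<le> 6 \<and> (regs \<sigma>' 10 \<noteq> 0 \<longleftrightarrow> regs \<sigma>1 21 \<le> G)) \<sigma>1"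
      unfolding select_test_def wp_Seq[of b inp "load_cell 1 25 21"]
      using j r1 jQ iff[OF j(2)] p[OF j(2)] env_large[OF e1] env_regs(4)[OF e1]
      by (subst run_load_cell) (auto simp: wp_simps)
  next
    show "modr (bsearch select_test) \<subseteq> {3..25}" "moda (bsearch select_test) \<subseteq> {}"
      by (rule select_bsearch_frame)+
    fix t \<sigma>1 assume 1: "t \<le> T_bs mu 6 \<and> regs \<sigma>1 20 = G"
      and v1: "valid_state b \<sigma>1" and ag1: "agree {3..25} {} \<sigma> \<sigma>1"
    have e1: "env \<sigma>1" by (rule env_agree[OF e ag1 v1]) auto
    have m1: "mem \<sigma>1 0 = ?D" "regs \<sigma>1 46 = ?k" using ag1 by (auto simp: agree_def)
    define \<sigma>2 where "\<sigma>2 = set_reg 31 G (set_reg 45 (ds (el (G * B))) (set_reg 16 (5 * G + 1) (set_reg 4 1 \<sigma>1)))"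
    have "?D (5 * G + 1) < 2 ^ b" using valid_less(2)[OF env_valid[OF e]] .
    then have e2: "env \<sigma>2" using e1 G Qb[of G 0] Qb[of G 1] p[OF G] two_less by (auto simp: env_def \<sigma>2_def valid_state_def)
    have GQ: "G < Q" using G fits(1) by simp
    have eq: "run ?c P \<sigma>1 = P 5 \<sigma>2" for P
      unfolding wp_Seq[of b inp "load_cell 1 45 20"] using 1 GQ p[OF G] env_large[OF e1] m1
      by (subst run_load_cell) (simp_all add: wp_Copy \<sigma>2_def)
    show "run ?c (\<lambda>t'. run (select_walk F) (\<lambda>t'' \<sigma>'. t + t' + t'' \<le> T_sfind + T_swalk T_cd \<and> ?P \<sigma>')) \<sigma>1"
      unfolding eq
    proof (rule wp_mono[OF run_select_walkp[OF cand_ok_large[OF D] G _ e2]])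
      fix x assume x: "x < n" "g x = G"
      then obtain z where "z < Z" "candx ?D (g x) z = x" using D unfolding ds_ok_def by blast
      then show "x \<in> candx ?D G ` {..<Z}" using x(2) by (intro image_eqI[of _ _ z]) auto
    next
      fix t3 \<sigma>3
      have k2: "regs \<sigma>2 46 = ?k" using m1 by (simp add: \<sigma>2_def)
      assume "t3 \<le> T_swalk T_cd \<and>
         (if \<exists>x. is_kth_largest f N (regs \<sigma>2 46) x
          then regs \<sigma>3 0 = 1 \<and> is_kth_largest f N (regs \<sigma>2 46) (regs \<sigma>3 1)
          else regs \<sigma>3 0 = 0)"
      then have "t3 \<le> T_swalk T_cd" and P: "?P \<sigma>3" unfolding k2 by (blast, blast)
      then have "t + 5 + t3 \<le> T_sfind + T_swalk T_cd" using 1 by simp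
      then show "t + 5 + t3 \<le> T_sfind + T_swalk T_cd \<and> ?P \<sigma>3" using P by blast
    qed (use m1 iff in \<open>auto simp: \<sigma>2_def\<close>)
  qed auto
  then show ?thesis unfolding select_find_def wp_Seq by (simp only: add.assoc)
qed

end

locale ram_small = ram_buckets +
  assumes small: "par 66 = 0" "M = 1" "Z = n"
begin

lemma g_small: "x < n \<Longrightarrow> g x = 0"
  using g_less[of x] small(2) by simp

text \<open>Exhaustive search: candidate \<open>z\<close> is the element \<open>z\<close>, and with
  a single bucket every candidate is genuine.\<close>

lemma cand_ok_small: "cand_ok D 0 (\<lambda>z. z) 5"
proof -
  have "run (cand F) (\<lambda>t \<sigma>'. t \<le> 5 \<and> regs \<sigma>' 13 = regs \<sigma> 30 \<and> (regs \<sigma>' 32 \<noteq> 0 \<longleftrightarrow> g (regs \<sigma> 30) = 0)) \<sigma>"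
    if "env \<sigma>" "regs \<sigma> 30 < n" for \<sigma>
  proof -
    have "regs \<sigma> 66 = 0" using that(1) small by (simp add: env_def)
    then show ?thesis using that g_small env_regs(3)[OF that(1)] by (simp add: cand_def wp_simps wp_Copy)
  qed
  then show ?thesis unfolding cand_ok_def unfolding small(3) by simp
qed

lemma run_rank_small:
  assumes e: "env \<sigma>" and y: "holds_int b w (mem \<sigma> 1) y" "y < 2 ^ w" and r: "regs \<sigma> 31 = 0" "regs \<sigma> 45 = 0"
  shows "run (rank_walk F) (\<lambda>t \<sigma>'. t \<le> T_rwalk 5 \<and> regs \<sigma>' 0 = card {x \<in> {..<N}. f x < y}) \<sigma>"
  by (rule run_rank_walkp[OF cand_ok_small[of "mem \<sigma> 0"] _ _ e])
    (use assms small cnt_le[of y] MB in auto)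

lemma run_select_small:
  assumes e: "env \<sigma>" and r: "regs \<sigma> 31 = 0" "regs \<sigma> 45 = 0"
  shows "run (select_walk F) (\<lambda>t \<sigma>'. t \<le> T_swalk 5 \<and>
     (if \<exists>x. is_kth_largest f N (regs \<sigma> 46) x then regs \<sigma>' 0 = 1 \<and> is_kth_largest f N (regs \<sigma> 46) (regs \<sigma>' 1)
      else regs \<sigma>' 0 = 0)) \<sigma>"
  by (rule run_select_walkp[OF cand_ok_small[of "mem \<sigma> 0"] _ _ e])
    (use assms small ds_el_0[OF n(3)] in auto)

end

subsection \<open>Construction\<close>

text \<open>The covering event speaks of the tape as it is at the very start, so all programs that
  run before \<open>fill\<close> must be known to draw no random words.\<close>

fun norand :: "com \<Rightarrow> bool" where
  "norand (Rand r) = False"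
| "norand (c1 ;; c2) = (norand c1 \<and> norand c2)"
| "norand (IfNZ r c1 c2) = (norand c1 \<and> norand c2)"
| "norand (WhileNZ r c) = norand c"
| "norand _ = True"

lemma exec_norand: "exec b inp c \<sigma> n \<sigma>' \<Longrightarrow> norand c \<Longrightarrow> tape \<sigma>' = tape \<sigma>"
  by (induction rule: exec.induct) auto

lemma wp_norand: "wp b inp c P \<sigma> \<Longrightarrow> norand c \<Longrightarrow> wp b inp c (\<lambda>t \<sigma>'. P t \<sigma>' \<and> tape \<sigma>' = tape \<sigma>) \<sigma>"
  unfolding wp_def using exec_norand by blast

lemma norand_simps [simp]: "norand (For i k c) = norand c" "norand (Copy x y)" "norand (halves k)"
  by (simp_all add: For_def Copy_def) (induction k, simp_all)

lemma norand_prelude: "norand (prelude k0)" and norand_params: "norand (params C)"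
  by (simp_all add: prelude_def params_def lg_def)

text \<open>Register 2 holds \<open>\<lfloor>N powr \<alpha>\<rfloor>\<close>. Dividing it by 16 as
  long as possible while doubling register 58 gives its fourth root, rounded down to a power of
  two.\<close>

definition find_ell :: com where
  "find_ell = Copy 58 52 ;; Copy 6 2 ;; Const 7 16 ;;
     For 5 54 (Op Lt 4 6 7 ;; IfNZ 4 Skip (Op Div 6 6 7 ;; Op Add 58 58 58))"

definition fill :: com where
  "fill = Op Mul 29 65 61 ;; For 30 29 (Rand 6 ;; store_cell 2 30 6)"

text \<open>Radix sort on the bits of \<open>f\<close>, the least significant bit first and ones before zeros. It is stable, so
  starting from decreasing indices it breaks ties as \<open>ky\<close> does.\<close>

definition sweep :: "com \<Rightarrow> bool \<Rightarrow> com" where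
  "sweep F bl = For 30 56 (Load 40 2 30 ;; loadval F 3 40 ;; Load 36 3 33 ;; Op Shr 36 36 34 ;; Op Mod 36 36 69 ;;
     (if bl then IfNZ 36 (Store 5 35 40 ;; Op Add 35 35 52) Skip
      else IfNZ 36 Skip (Store 5 35 40 ;; Op Add 35 35 52)))"

definition pass :: "com \<Rightarrow> com" where
  "pass F = Op Div 33 31 54 ;; Op Mod 34 31 54 ;; Const 35 0 ;; sweep F True ;; sweep F False ;;
     For 30 56 (Load 40 5 30 ;; Store 2 30 40)"

definition sortp :: "com \<Rightarrow> com" where
  "sortp F = For 30 56 (Op Sub 4 56 30 ;; Op Sub 4 4 52 ;; Store 2 30 4) ;; For 31 51 (pass F)"

definition pivots :: "com \<Rightarrow> com" where
  "pivots F = Const 45 0 ;; For 30 56 (Load 40 2 30 ;;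
     IfNZ 30 (Op Sub 41 30 52 ;; Load 42 2 41 ;; loadval F 3 42 ;; loadval F 4 40 ;; cmp 3 4 ;;
       IfNZ 7 (Op Add 45 45 52) Skip) Skip ;;
     Op Mod 41 30 57 ;; IfNZ 41 Skip (Op Div 41 30 57 ;; store_cell 0 41 40 ;; store_cell 1 41 45))"

text \<open>The start is written without looking whether the slot is taken, so a later chain with
  the same address replaces an earlier one.\<close>

definition chain :: "com \<Rightarrow> com" where
  "chain F = Op Mul 11 46 58 ;; Copy 12 47 ;; Copy 28 58 ;; adv F ;;
     Op Mod 36 12 62 ;; Op Mul 41 46 62 ;; Op Add 36 36 41 ;; store_cell 3 36 47"

definition chains :: "com \<Rightarrow> com" where
  "chains F = For 46 64 (For 47 63 (chain F))"

definition buildp :: "nat \<Rightarrow> nat \<Rightarrow> com \<Rightarrow> com" where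
  "buildp k0 C F = prelude k0 ;; IfNZ 66
     (find_ell ;; Const 4 4 ;; Store 0 4 58 ;; params C ;; fill ;; sortp F ;; pivots F ;; chains F) Skip"

lemma norand_find_ell: "norand find_ell"
  by (simp add: find_ell_def)

lemma find_ell_frame: "modr find_ell \<subseteq> {3, 4, 5, 6, 7, 58}" "moda find_ell \<subseteq> {}"
  by (auto simp: find_ell_def)

lemma sweep_frame: "modr (sweep F bl) \<subseteq> {3..6} \<union> {30, 35, 36, 40} \<union> Fr" "moda (sweep F bl) \<subseteq> {3, 5} \<union> Fa"
  using loadval_frame[of F 3 40] by (auto simp: sweep_def)

lemma pass_frame: "modr (pass F) \<subseteq> {3..6} \<union> {30, 33, 34, 35, 36, 40} \<union> Fr" "moda (pass F) \<subseteq> {2, 3, 5} \<union> Fa"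
  using sweep_frame[of F True] sweep_frame[of F False] by (auto simp: pass_def)

lemma sortp_frame: "modr (sortp F) \<subseteq> {3..6} \<union> {30..40} \<union> Fr" "moda (sortp F) \<subseteq> {2, 3, 5} \<union> Fa"
  using pass_frame[of F] by (auto simp: sortp_def)

lemma pivots_frame: "modr (pivots F) \<subseteq> {3..9} \<union> {16, 30, 40, 41, 42, 45} \<union> Fr" "moda (pivots F) \<subseteq> {0, 3, 4} \<union> Fa"
  using loadval_frame[of F 3 42] loadval_frame[of F 4 40] cmp_frame[of 3 4] cell_frame(3,4)[of 0 41 40] cell_frame(3,4)[of 1 41 45]
  by (auto simp: pivots_def)

lemma chain_frame: "modr (chain F) \<subseteq> {3..28} \<union> {36, 41} \<union> Fr" "moda (chain F) \<subseteq> {0, 3, 4} \<union> Fa"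
  using adv_frame[of F] cell_frame(3,4)[of 3 36 47] by (auto simp: chain_def)

lemma (in machine) run_find_ell:
  assumes v: "valid_state b \<sigma>" "regs \<sigma> 52 = 1" "regs \<sigma> 54 = b"
    and A: "16 ^ lam \<le> regs \<sigma> 2" "regs \<sigma> 2 < 16 ^ Suc lam" "lam < b" "16 < (2::nat) ^ b"
  shows "run find_ell (\<lambda>t \<sigma>'. t \<le> 7 * b + 10 \<and> regs \<sigma>' 58 = 2 ^ lam) \<sigma>"
proof -
  let ?A = "regs \<sigma> 2"
  define \<sigma>1 where "\<sigma>1 = set_reg 7 16 (set_reg 6 ?A (set_reg 58 1 \<sigma>))"
  have v1: "valid_state b \<sigma>1" using v(1) Suc_0_less_two_power[OF b0] A(4) by (auto simp: \<sigma>1_def valid_state_def)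
  let ?body = "Op Lt 4 6 7 ;; IfNZ 4 Skip (Op Div 6 6 7 ;; Op Add 58 58 58)"
  have "run (For 5 54 ?body) (\<lambda>t \<sigma>'. 3 + t \<le> 7 * b + 10 \<and> regs \<sigma>' 58 = 2 ^ lam) \<sigma>1"
  proof (rule ForI[where R = "{4, 6, 58}" and A = "{}" and k = b and T = 4 and
        I = "\<lambda>j \<sigma>'. regs \<sigma>' 6 = ?A div 16 ^ min j lam \<and> regs \<sigma>' 58 = 2 ^ min j lam"])
    fix j \<sigma>' assume j: "j < b" and ag: "agree (insert 3 (insert 5 {4, 6, 58})) {} \<sigma>1 \<sigma>'"
      and I: "regs \<sigma>' 6 = ?A div 16 ^ min j lam \<and> regs \<sigma>' 58 = 2 ^ min j lam"
    have r: "regs \<sigma>' 7 = 16" using ag by (auto simp: agree_def \<sigma>1_def)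
    show "run ?body (\<lambda>t \<sigma>'. t \<le> 4 \<and> (regs \<sigma>' 6 = ?A div 16 ^ min (Suc j) lam \<and> regs \<sigma>' 58 = 2 ^ min (Suc j) lam)) \<sigma>'"
    proof (cases "j < lam")
      case True
      have "(16::nat) ^ Suc j \<le> 16 ^ lam" using True by (intro power_increasing) auto
      then have "16 * 16 ^ j \<le> ?A" using A(1) by simp
      then have "\<not> ?A div 16 ^ j < 16" by (simp add: less_eq_div_iff_mult_less_eq not_less)
      moreover have "(2::nat) ^ Suc j < 2 ^ b" using True A(3) by (intro power_strict_increasing) auto
      ultimately show ?thesis using I True r
        by (simp add: wp_simps mult_2[symmetric] div_mult2_eq[symmetric] mult.commute)
    next
      case False
      have "?A div 16 ^ lam < 16" using A(2) by (simp add: less_mult_imp_div_less)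
      then show ?thesis using I False r by (simp add: wp_simps)
    qed
  qed (use v1 v A(3) in \<open>auto simp: agree_def \<sigma>1_def\<close>)
  then show ?thesis using v A(4) by (simp add: find_ell_def wp_simps wp_Copy \<sigma>1_def)
qed

text \<open>Ones come first because the order is decreasing. A one in bit \<open>k\<close> outweighs
  all lower bits together with the index, and inside each half the given order persists.\<close>

lemma sorted_radix_step:
  fixes v :: "nat \<Rightarrow> nat"
  assumes "sorted_wrt (\<lambda>x y. v y mod 2 ^ k * n + y < v x mod 2 ^ k * n + x) xs" "set xs \<subseteq> {..<n}"
  defines "P \<equiv> \<lambda>x. odd (v x div 2 ^ k)"
  shows "sorted_wrt (\<lambda>x y. v y mod 2 ^ Suc k * n + y < v x mod 2 ^ Suc k * n + x) (filter P xs @ filter (\<lambda>x. \<not> P x) xs)"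
proof -
  have m: "v x mod 2 ^ Suc k = (if P x then 2 ^ k else 0) + v x mod 2 ^ k" for x
  proof -
    have "v x mod 2 ^ Suc k = 2 ^ k * (v x div 2 ^ k mod 2) + v x mod 2 ^ k"
      using mod_mult2_eq[of "v x" "2 ^ k" 2] by (simp add: mult.commute)
    then show ?thesis by (simp add: P_def odd_iff_mod_2_eq_one)
  qed
  have "v y mod 2 ^ Suc k * n + y < v x mod 2 ^ Suc k * n + x" if "P x" "\<not> P y" "y < n" for x y
  proof -
    have "v y mod 2 ^ Suc k * n + y < Suc (v y mod 2 ^ k) * n" using that m[of y] by simp
    also have "\<dots> \<le> 2 ^ k * n" by (intro mult_le_mono1) (simp add: Suc_leI)
    also have "\<dots> \<le> v x mod 2 ^ Suc k * n" using that m[of x] by (intro mult_le_mono1) simp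
    finally show ?thesis by simp
  qed
  moreover have sw: "sorted_wrt (\<lambda>x y. v y mod 2 ^ Suc k * n + y < v x mod 2 ^ Suc k * n + x) (filter R xs)"
    if "\<And>x y. R x \<Longrightarrow> R y \<Longrightarrow> P x = P y" for R
  proof (rule sorted_wrt_mono_rel[OF _ sorted_wrt_filter[OF assms(1)]])
    fix x y assume "x \<in> set (filter R xs)" "y \<in> set (filter R xs)"
      "v y mod 2 ^ k * n + y < v x mod 2 ^ k * n + x"
    then show "v y mod 2 ^ Suc k * n + y < v x mod 2 ^ Suc k * n + x"
      using that[of x y] unfolding m by (auto simp: algebra_simps)
  qed
  ultimately show ?thesis using assms(2) sw[of P] sw[of "\<lambda>x. \<not> P x"]
    unfolding sorted_wrt_append by auto
qed

definition arr :: "state \<Rightarrow> array \<Rightarrow> nat list \<Rightarrow> bool" where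
  "arr \<sigma> a xs \<longleftrightarrow> (\<forall>p<length xs. mem \<sigma> a p = xs ! p)"

lemma arr_cong: "mem \<sigma>' a = mem \<sigma> a \<Longrightarrow> arr \<sigma> a xs \<Longrightarrow> arr \<sigma>' a xs"
  by (simp add: arr_def)

lemma arr_snoc:
  "arr \<sigma> a xs \<Longrightarrow> mem \<sigma>' a = (mem \<sigma> a)(length xs := x) \<Longrightarrow> arr \<sigma>' a (xs @ [x])"
  by (auto simp: arr_def nth_append less_Suc_eq)

section \<open>Random words, sorting and pivots\<close>

context ram_large
begin

lemma keys_less: "z < Z \<Longrightarrow> i \<le> mu \<Longrightarrow> z * Suc mu + i < Z * Suc mu"
proof -
  assume "z < Z" "i \<le> mu"
  then have "z * Suc mu + i < Suc z * Suc mu" by simp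
  also have "\<dots> \<le> Z * Suc mu" using \<open>z < Z\<close> by (intro mult_le_mono1) simp
  finally show ?thesis .
qed

lemma run_fill:
  assumes e: "env \<sigma>"
  shows "run fill (\<lambda>t \<sigma>'. t \<le> 8 * (Z * Suc mu) + 4 \<and> (\<forall>i<Z * Suc mu. keys (mem \<sigma>' 0) i = tape \<sigma> !! i) \<and>
     mem \<sigma>' 0 4 = mem \<sigma> 0 4) \<sigma>"
proof -
  define \<sigma>1 where "\<sigma>1 = set_reg 29 (Z * Suc mu) \<sigma>"
  have Kb: "Z * Suc mu < 2 ^ b" using fits(2,4) by linarith
  have e1: "env \<sigma>1" using e Kb by (auto simp: env_def \<sigma>1_def valid_state_def)
  let ?body = "Rand 6 ;; store_cell 2 30 6"
  let ?I = "\<lambda>j \<sigma>'. (\<forall>i<j. keys (mem \<sigma>' 0) i = tape \<sigma> !! i) \<and> tape \<sigma>' = sdrop j (tape \<sigma>) \<and> mem \<sigma>' 0 4 = mem \<sigma> 0 4"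
  have "run (For 30 29 ?body) (\<lambda>t \<sigma>'. 1 + t \<le> 8 * (Z * Suc mu) + 4 \<and> (\<forall>i<Z * Suc mu. keys (mem \<sigma>' 0) i = tape \<sigma> !! i) \<and>
     mem \<sigma>' 0 4 = mem \<sigma> 0 4) \<sigma>1"
  proof (rule ForI[where R = "{4, 6, 16}" and A = "{0}" and k = "Z * Suc mu" and T = 5 and I = ?I])
    fix j \<sigma>2 assume j: "j < Z * Suc mu" "regs \<sigma>2 30 = j" and v2: "valid_state b \<sigma>2"
      and ag: "agree (insert 3 (insert 30 {4, 6, 16})) {0} \<sigma>1 \<sigma>2" and I: "?I j \<sigma>2"
    have e2: "env \<sigma>2" by (rule env_agree[OF e1 ag v2]) auto
    have jQ: "j < Q" using j fits(2) by simp
    have "shd (tape \<sigma>2) = tape \<sigma> !! j" "stl (tape \<sigma>2) = sdrop (Suc j) (tape \<sigma>)" using I by (simp_all add: sdrop_simps)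
    \<comment> \<open>Cell 4 with the bucket size is of another kind than the hash words and
      survives.\<close>
    moreover have "5 * j + 2 \<noteq> 4" by presburger
    ultimately show "run ?body (\<lambda>t \<sigma>'. t \<le> 5 \<and> ?I (Suc j) \<sigma>') \<sigma>2"
      using I j jQ env_large(11)[OF e2] unfolding wp_Seq
      by (simp only: wp_simps) (subst run_store_cell, auto simp: keys_def less_Suc_eq)
  next
    show "modr ?body \<subseteq> {4, 6, 16}" "moda ?body \<subseteq> {0}" using cell_frame(3,4)[of 2 30 6] by auto
  qed (use env_valid[OF e1] env_regs(3)[OF e1] in \<open>auto simp: agree_def \<sigma>1_def\<close>)
  then show ?thesis using env_large[OF e] Kb by (simp add: fill_def wp_simps \<sigma>1_def)
qed

abbreviation T_sweep :: nat where "T_sweep \<equiv> n * (T_lv \<tau> W + 10) + 3"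

text \<open>\<open>ys\<close> is the output of an earlier sweep, so that the sweep for zeros appends
  to the one for ones. The bound on the lengths keeps the write index within a word.\<close>

lemma run_sweep:
  assumes e: "env \<sigma>" and k: "regs \<sigma> 33 = k div b" "regs \<sigma> 34 = k mod b" "k < w"
    and xs: "arr \<sigma> 2 xs" "length xs = n" "set xs \<subseteq> {..<n}"
    and ys: "arr \<sigma> 5 ys" "regs \<sigma> 35 = length ys" "length ys + length (filter (\<lambda>x. odd (fx x div 2 ^ k) = bl) xs) \<le> n"
  shows "run (sweep F bl) (\<lambda>t \<sigma>'. t \<le> T_sweep \<and> arr \<sigma>' 5 (ys @ filter (\<lambda>x. odd (fx x div 2 ^ k) = bl) xs) \<and>
     regs \<sigma>' 35 = length (ys @ filter (\<lambda>x. odd (fx x div 2 ^ k) = bl) xs)) \<sigma>"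
proof -
  let ?P = "\<lambda>x. odd (fx x div 2 ^ k) = bl"
  let ?R = "{3..6} \<union> {35, 36, 40} \<union> Fr"
  let ?I = "\<lambda>j \<sigma>'. arr \<sigma>' 5 (ys @ filter ?P (take j xs)) \<and> regs \<sigma>' 35 = length (ys @ filter ?P (take j xs))"
  let ?c3 = "if bl then IfNZ 36 (Store 5 35 40 ;; Op Add 35 35 52) Skip
      else IfNZ 36 Skip (Store 5 35 40 ;; Op Add 35 35 52)"
  let ?c2 = "Load 36 3 33 ;; Op Shr 36 36 34 ;; Op Mod 36 36 69 ;; ?c3"
  let ?body = "Load 40 2 30 ;; loadval F 3 40 ;; ?c2"
  show ?thesis unfolding sweep_def
  proof (rule ForI[where R = ?R and A = "{3, 5} \<union> Fa" and k = n and T = "T_lv \<tau> W + 7" and I = ?I])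
    fix j \<sigma>1 assume j: "j < n" "regs \<sigma>1 30 = j" and v1: "valid_state b \<sigma>1"
      and ag: "agree (insert 3 (insert 30 ?R)) ({3, 5} \<union> Fa) \<sigma> \<sigma>1" and I: "?I j \<sigma>1"
    have e1: "env \<sigma>1" by (rule env_agree[OF e ag v1]) auto
    let ?x = "xs ! j"
    have x: "?x < n" using xs j by (meson lessThan_iff nth_mem subsetD)
    have m1: "mem \<sigma>1 2 j = ?x" "regs \<sigma>1 33 = k div b" "regs \<sigma>1 34 = k mod b"
      using ag xs j k by (auto simp: agree_def arr_def)
    define \<sigma>2 where "\<sigma>2 = set_reg 40 ?x \<sigma>1"
    have e2: "env \<sigma>2" using e1 x n(2) by (auto simp: env_def \<sigma>2_def valid_state_def)
    have tk: "filter ?P (take (Suc j) xs) = filter ?P (take j xs) @ (if ?P ?x then [?x] else [])"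
      using j xs(2) by (simp add: take_Suc_conv_app_nth)
    have len: "length ys + length (filter ?P (take (Suc j) xs)) \<le> n"
    proof -
      have "length (filter ?P xs) = length (filter ?P (take (Suc j) xs)) + length (filter ?P (drop (Suc j) xs))"
        by (metis append_take_drop_id filter_append length_append)
      then show ?thesis using ys(3) by linarith
    qed
    let ?len = "length (ys @ filter ?P (take j xs))"
    have lb: "?P ?x \<Longrightarrow> Suc ?len < 2 ^ b" using len n(2) unfolding tk by simp
    have "run (loadval F 3 40) (\<lambda>t. run ?c2 (\<lambda>t' \<sigma>'. 1 + (t + t') \<le> T_lv \<tau> W + 7 \<and> ?I (Suc j) \<sigma>')) \<sigma>2"
    proof (rule callI[OF run_loadval[OF e2] env_valid[OF e2] loadval_frame])
      fix t \<sigma>3 assume 3: "t \<le> T_lv \<tau> W \<and> holds_int b w (mem \<sigma>3 3) (fx (regs \<sigma>2 40))"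
        and v3: "valid_state b \<sigma>3" and ag3: "agree ({3..6} \<union> Fr) ({3} \<union> Fa) \<sigma>2 \<sigma>3"
      have e3: "env \<sigma>3" by (rule env_agree[OF e2 ag3 v3]) auto
      have r3: "regs \<sigma>3 33 = k div b" "regs \<sigma>3 34 = k mod b" "regs \<sigma>3 40 = ?x" "regs \<sigma>3 35 = ?len" "mem \<sigma>3 5 = mem \<sigma>1 5"
        using ag3 m1 I by (auto simp: agree_def \<sigma>2_def)
      have kW: "k div b < W"
      proof -
        have "k < b * W" using k(3) le_mult_words[OF b0, of w] by linarith
        then show ?thesis by (simp add: less_mult_imp_div_less mult.commute)
      qed
      have "mem \<sigma>3 3 (k div b) = (fx ?x div (2 ^ b) ^ (k div b)) mod 2 ^ b"
        using 3 kW by (simp add: holds_int_iff \<sigma>2_def)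
      \<comment> \<open>Bit \<open>k\<close> of the value is bit \<open>k mod b\<close> of its word
        number \<open>k div b\<close>; cutting that word off at \<open>b\<close> bits does not
        affect it.\<close>
      then have bit: "mem \<sigma>3 3 (k div b) div 2 ^ (k mod b) mod 2 = fx ?x div 2 ^ k mod 2"
      proof -
        have kb: "k mod b < b" using b0 by simp
        have "(a mod 2 ^ b) div 2 ^ i mod 2 = a div 2 ^ i mod 2" if "i < b" for a i :: nat
        proof -
          have "(a mod 2 ^ b) div 2 ^ i = a div 2 ^ i mod 2 ^ (b - i)"
            using drop_bit_take_bit[of i b a] by (simp add: drop_bit_eq_div take_bit_eq_mod)
          moreover have "(2::nat) dvd 2 ^ (b - i)" using that by simp
          ultimately show ?thesis by (simp add: mod_mod_cancel)
        qed
        moreover have "fx ?x div (2 ^ b) ^ (k div b) div 2 ^ (k mod b) = fx ?x div 2 ^ k"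
          by (simp add: div_mult2_eq[symmetric] power_mult[symmetric] power_add[symmetric])
        ultimately show ?thesis using kb \<open>mem \<sigma>3 3 (k div b) = _\<close> by simp
      qed
      have o: "(mem \<sigma>3 3 (k div b) div 2 ^ (k mod b) mod 2 \<noteq> 0) = odd (fx ?x div 2 ^ k)"
        unfolding bit by (simp add: odd_iff_mod_2_eq_one)
      define \<sigma>4 where "\<sigma>4 = set_reg 36 (mem \<sigma>3 3 (k div b) div 2 ^ (k mod b) mod 2) \<sigma>3"
      have eq: "run ?c2 Q' \<sigma>3 = run ?c3 (\<lambda>t. Q' (Suc (Suc (Suc t)))) \<sigma>4" for Q'
        using r3 env_regs(8)[OF e3] by (simp add: wp_simps(3,4,7) \<sigma>4_def)
      have I': "arr \<sigma>4 5 (ys @ filter ?P (take j xs))" by (rule arr_cong[of _ _ \<sigma>1]) (use r3 I in \<open>auto simp: \<sigma>4_def\<close>)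
      have snoc: "arr \<sigma>' 5 ((ys @ filter ?P (take j xs)) @ [?x])" if "mem \<sigma>' 5 = (mem \<sigma>4 5)(?len := ?x)" for \<sigma>'
        using that by (intro arr_snoc[OF I']) simp
      have r4: "regs \<sigma>4 35 = ?len" "regs \<sigma>4 40 = ?x" "regs \<sigma>4 52 = 1" "regs \<sigma>4 36 \<noteq> 0 \<longleftrightarrow> odd (fx ?x div 2 ^ k)"
        using r3 env_regs(3)[OF e3] o by (auto simp: \<sigma>4_def)
      show "run ?c2 (\<lambda>t' \<sigma>'. 1 + (t + t') \<le> T_lv \<tau> W + 7 \<and> ?I (Suc j) \<sigma>') \<sigma>3"
        unfolding eq
      proof (cases "?P ?x")
        case True
        have "run (Store 5 35 40 ;; Op Add 35 35 52) (\<lambda>t' \<sigma>'. 1 + (t + Suc (Suc (Suc (Suc t')))) \<le> T_lv \<tau> W + 7 \<and> ?I (Suc j) \<sigma>') \<sigma>4"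
          unfolding tk using True 3 r4 lb[OF True] snoc by (simp add: wp_simps)
        moreover have "run ?c3 R \<sigma>4 = run (Store 5 35 40 ;; Op Add 35 35 52) (\<lambda>t. R (Suc t)) \<sigma>4" for R
          using True r4(4) by (cases bl) (simp_all add: wp_simps(8))
        ultimately show "run ?c3 (\<lambda>t' \<sigma>'. 1 + (t + Suc (Suc (Suc t'))) \<le> T_lv \<tau> W + 7 \<and> ?I (Suc j) \<sigma>') \<sigma>4"
          by blast
      next
        case False
        have "1 + (t + Suc (Suc (Suc (Suc 1)))) \<le> T_lv \<tau> W + 7 \<and> ?I (Suc j) \<sigma>4"
          unfolding tk using False 3 r4 I' by simp
        moreover have "run ?c3 R \<sigma>4 = R (Suc 1) \<sigma>4" for R
          using False r4(4) by (cases bl) (simp_all add: wp_simps(1,8))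
        ultimately show "run ?c3 (\<lambda>t' \<sigma>'. 1 + (t + Suc (Suc (Suc t'))) \<le> T_lv \<tau> W + 7 \<and> ?I (Suc j) \<sigma>') \<sigma>4"
          by blast
      qed
    qed auto
    then show "run ?body (\<lambda>t \<sigma>'. t \<le> T_lv \<tau> W + 7 \<and> ?I (Suc j) \<sigma>') \<sigma>1"
      using m1 j unfolding wp_Seq[of b inp "Load 40 2 30"] wp_Seq[of b inp "loadval F 3 40"]
      by (simp add: wp_simps(4) \<sigma>2_def)
  next
    fix t \<sigma>' assume t: "t \<le> n * (T_lv \<tau> W + 7 + 3) + 3" and I: "?I n \<sigma>'"
    have eq: "T_lv \<tau> W + 7 + 3 = T_lv \<tau> W + 10" by simp
    show "t \<le> T_sweep \<and> arr \<sigma>' 5 (ys @ filter ?P xs) \<and> regs \<sigma>' 35 = length (ys @ filter ?P xs)"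
      using t I xs(2) unfolding eq by simp
  next
    show "modr ?body \<subseteq> ?R" "moda ?body \<subseteq> {3, 5} \<union> Fa"
      using loadval_frame[of F 3 40] by auto
    show "?I j \<sigma>''" if "?I j \<sigma>'" "agree {3, 30} {} \<sigma>' \<sigma>''" for j \<sigma>' \<sigma>''
      using that by (auto simp: agree_def arr_def)
  qed (use env_valid[OF e] env_regs[OF e] ys in auto)
qed

lemma run_pass:
  assumes e: "env \<sigma>" and k: "regs \<sigma> 31 = k" "k < w" and xs: "arr \<sigma> 2 xs" "length xs = n" "set xs \<subseteq> {..<n}"
  defines "ys \<equiv> filter (\<lambda>x. odd (fx x div 2 ^ k)) xs @ filter (\<lambda>x. \<not> odd (fx x div 2 ^ k)) xs"
  shows "run (pass F) (\<lambda>t \<sigma>'. t \<le> 2 * T_sweep + 5 * n + 6 \<and> arr \<sigma>' 2 ys) \<sigma>"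
proof -
  let ?P = "\<lambda>x. odd (fx x div 2 ^ k)"
  note r = env_regs[OF e]
  define \<sigma>1 where "\<sigma>1 = set_reg 35 0 (set_reg 34 (k mod b) (set_reg 33 (k div b) \<sigma>))"
  have kb: "k div b < 2 ^ b" "k mod b < 2 ^ b"
    using valid_less(1)[OF env_valid[OF e], of 31] k by (meson div_le_dividend le_less_trans mod_less_eq_dividend)+
  have e1: "env \<sigma>1" using e kb by (auto simp: env_def \<sigma>1_def valid_state_def)
  let ?copy = "For 30 56 (Load 40 5 30 ;; Store 2 30 40)"
  have len: "length ys = n" unfolding ys_def using xs(2) sum_length_filter_compl[of ?P xs] by simp
  have set: "set ys \<subseteq> {..<n}" using xs(3) by (auto simp: ys_def)
  have fl: "filter (\<lambda>x. ?P x = True) xs = filter ?P xs" "filter (\<lambda>x. ?P x = False) xs = filter (\<lambda>x. \<not> ?P x) xs" by simp_all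
  have "run (sweep F True) (\<lambda>t. run (sweep F False) (\<lambda>t'. run ?copy (\<lambda>t'' \<sigma>'. 3 + (t + (t' + t'')) \<le> 2 * T_sweep + 5 * n + 6 \<and> arr \<sigma>' 2 ys))) \<sigma>1"
  proof (rule callI[OF run_sweep[OF e1, of k xs "[]" True] env_valid[OF e1] sweep_frame])
    show "arr \<sigma>1 2 xs" using xs(1) by (simp add: arr_def \<sigma>1_def)
    fix t \<sigma>2 assume 2: "t \<le> T_sweep \<and> arr \<sigma>2 5 ([] @ filter (\<lambda>x. ?P x = True) xs) \<and>
         regs \<sigma>2 35 = length ([] @ filter (\<lambda>x. ?P x = True) xs)"
      and v2: "valid_state b \<sigma>2" and ag2: "agree ({3..6} \<union> {30, 35, 36, 40} \<union> Fr) ({3, 5} \<union> Fa) \<sigma>1 \<sigma>2"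
    have e2: "env \<sigma>2" by (rule env_agree[OF e1 ag2 v2]) auto
    show "run (sweep F False) (\<lambda>t'. run ?copy (\<lambda>t'' \<sigma>'. 3 + (t + (t' + t'')) \<le> 2 * T_sweep + 5 * n + 6 \<and> arr \<sigma>' 2 ys)) \<sigma>2"
    proof (rule callI[OF run_sweep[OF e2, of k xs "filter ?P xs" False] v2 sweep_frame])
      show "arr \<sigma>2 2 xs" using xs(1) ag2 by (simp add: arr_def \<sigma>1_def agree_def)
      show "regs \<sigma>2 33 = k div b" "regs \<sigma>2 34 = k mod b" using ag2 by (simp_all add: agree_def \<sigma>1_def)
      show "length (filter ?P xs) + length (filter (\<lambda>x. ?P x = False) xs) \<le> n"
        using len unfolding ys_def by simp
      fix t' \<sigma>3 assume 3: "t' \<le> T_sweep \<and> arr \<sigma>3 5 (filter ?P xs @ filter (\<lambda>x. ?P x = False) xs) \<and>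
           regs \<sigma>3 35 = length (filter ?P xs @ filter (\<lambda>x. ?P x = False) xs)"
        and v3: "valid_state b \<sigma>3" and ag3: "agree ({3..6} \<union> {30, 35, 36, 40} \<union> Fr) ({3, 5} \<union> Fa) \<sigma>2 \<sigma>3"
      have e3: "env \<sigma>3" by (rule env_agree[OF e2 ag3 v3]) auto
      have y: "arr \<sigma>3 5 ys" using 3 by (simp add: ys_def)
      show "run ?copy (\<lambda>t'' \<sigma>'. 3 + (t + (t' + t'')) \<le> 2 * T_sweep + 5 * n + 6 \<and> arr \<sigma>' 2 ys) \<sigma>3"
      proof (rule ForI[where R = "{40}" and A = "{2}" and k = n and T = 2 and I = "\<lambda>j \<sigma>'. \<forall>i<j. mem \<sigma>' 2 i = ys ! i"])
        fix j \<sigma>4 assume "j < n" "regs \<sigma>4 30 = j" "\<forall>i<j. mem \<sigma>4 2 i = ys ! i" "agree (insert 3 (insert 30 {40})) {2} \<sigma>3 \<sigma>4"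
        then show "run (Load 40 5 30 ;; Store 2 30 40) (\<lambda>t \<sigma>'. t \<le> 2 \<and> (\<forall>i<Suc j. mem \<sigma>' 2 i = ys ! i)) \<sigma>4"
          using y len by (auto simp: wp_simps less_Suc_eq agree_def arr_def)
      qed (use v3 env_regs[OF e3] 2 3 len in \<open>auto simp: agree_def arr_def\<close>)
    qed (use 2 k xs in auto)
  qed (use k xs in \<open>auto simp: \<sigma>1_def arr_def\<close>)
  then show ?thesis using k r by (simp add: pass_def wp_Seq wp_simps \<sigma>1_def)
qed

abbreviation T_sort :: nat where "T_sort \<equiv> w * (2 * T_sweep + 5 * n + 9) + 6 * n + 6"

lemma run_sortp:
  assumes e: "env \<sigma>"
  shows "run (sortp F) (\<lambda>t \<sigma>'. t \<le> T_sort \<and> (\<forall>p<n. mem \<sigma>' 2 p = el p)) \<sigma>"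
proof -
  let ?c1 = "For 30 56 (Op Sub 4 56 30 ;; Op Sub 4 4 52 ;; Store 2 30 4)"
  \<comment> \<open>Sorted decreasingly by the low \<open>k\<close> bits of the value, with ties by
    decreasing index. For \<open>k = 0\<close> this is the decreasing list of indices, and for
    \<open>k = w\<close> it is the order of \<open>ky\<close>.\<close>
  let ?S = "\<lambda>k xs. length xs = n \<and> set xs = {..<n} \<and> sorted_wrt (\<lambda>x y. fx y mod 2 ^ k * n + y < fx x mod 2 ^ k * n + x) xs"
  have "run ?c1 (\<lambda>t. run (For 31 51 (pass F)) (\<lambda>t' \<sigma>'. t + t' \<le> T_sort \<and> (\<forall>p<n. mem \<sigma>' 2 p = el p))) \<sigma>"
  proof (rule ForI[where R = "{4}" and A = "{2}" and k = n and T = 3 and I = "\<lambda>j \<sigma>'. \<forall>i<j. mem \<sigma>' 2 i = n - i - 1"])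
    fix j \<sigma>1 assume j: "j < n" "regs \<sigma>1 30 = j" "\<forall>i<j. mem \<sigma>1 2 i = n - i - 1" and ag: "agree (insert 3 (insert 30 {4})) {2} \<sigma> \<sigma>1"
    have "(n + 2 ^ b - j) mod 2 ^ b = n - j" "(n - j + 2 ^ b - Suc 0) mod 2 ^ b = n - j - 1"
      using j n by (auto intro!: sub_mod)
    moreover have "regs \<sigma>1 56 = n" "regs \<sigma>1 52 = 1" using ag env_regs[OF e] by (auto simp: agree_def)
    ultimately show "run (Op Sub 4 56 30 ;; Op Sub 4 4 52 ;; Store 2 30 4) (\<lambda>t \<sigma>'. t \<le> 3 \<and> (\<forall>i<Suc j. mem \<sigma>' 2 i = n - i - 1)) \<sigma>1"
      using j by (auto simp: wp_simps less_Suc_eq)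
  next
    fix t \<sigma>1 assume t: "t \<le> n * (3 + 3) + 3" and v1: "valid_state b \<sigma>1" and ag1: "agree (insert 3 (insert 30 {4})) {2} \<sigma> \<sigma>1"
      and I: "\<forall>i<n. mem \<sigma>1 2 i = n - i - 1"
    have e1: "env \<sigma>1" by (rule env_agree[OF e ag1 v1]) auto
    show "run (For 31 51 (pass F)) (\<lambda>t' \<sigma>'. t + t' \<le> T_sort \<and> (\<forall>p<n. mem \<sigma>' 2 p = el p)) \<sigma>1"
    proof (rule ForI[where R = "{3..6} \<union> {30, 33, 34, 35, 36, 40} \<union> Fr" and A = "{2, 3, 5} \<union> Fa" and k = w and
          T = "2 * T_sweep + 5 * n + 6" and I = "\<lambda>k \<sigma>'. \<exists>xs. arr \<sigma>' 2 xs \<and> ?S k xs"])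
      have "arr \<sigma>1 2 (rev [0..<n])" using I by (simp add: arr_def rev_nth)
      moreover have "?S 0 (rev [0..<n])" by (auto simp: sorted_wrt_rev)
      ultimately show "\<exists>xs. arr \<sigma>1 2 xs \<and> ?S 0 xs" by blast
    next
      fix k \<sigma>2 assume k: "k < w" "regs \<sigma>2 31 = k" and v2: "valid_state b \<sigma>2"
        and ag2: "agree (insert 3 (insert 31 ({3..6} \<union> {30, 33, 34, 35, 36, 40} \<union> Fr))) ({2, 3, 5} \<union> Fa) \<sigma>1 \<sigma>2"
        and ex: "\<exists>xs. arr \<sigma>2 2 xs \<and> ?S k xs"
      have e2: "env \<sigma>2" by (rule env_agree[OF e1 ag2 v2]) auto
      obtain xs where xs: "arr \<sigma>2 2 xs" "?S k xs" using ex by blast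
      let ?ys = "filter (\<lambda>x. odd (fx x div 2 ^ k)) xs @ filter (\<lambda>x. \<not> odd (fx x div 2 ^ k)) xs"
      have S: "?S (Suc k) ?ys"
      proof (intro conjI)
        show "length ?ys = n" using xs(2) sum_length_filter_compl[of "\<lambda>x. odd (fx x div 2 ^ k)" xs] by simp
        show "set ?ys = {..<n}" using xs(2) by auto
        show "sorted_wrt (\<lambda>x y. fx y mod 2 ^ Suc k * n + y < fx x mod 2 ^ Suc k * n + x) ?ys"
          by (rule sorted_radix_step) (use xs(2) in auto)
      qed
      have sub: "length xs = n" "set xs \<subseteq> {..<n}" using xs(2) by blast+
      show "run (pass F) (\<lambda>t \<sigma>'. t \<le> 2 * T_sweep + 5 * n + 6 \<and> (\<exists>xs. arr \<sigma>' 2 xs \<and> ?S (Suc k) xs)) \<sigma>2"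
        by (rule wp_mono[OF run_pass[OF e2 k(2,1) xs(1) sub]]) (use S in blast)
    next
      fix t' \<sigma>' assume t': "t' \<le> w * (2 * T_sweep + 5 * n + 6 + 3) + 3" and ex: "\<exists>xs. arr \<sigma>' 2 xs \<and> ?S w xs"
      obtain xs where xs: "arr \<sigma>' 2 xs" "?S w xs" using ex by blast
      have eq: "2 * T_sweep + 5 * n + 6 + 3 = 2 * T_sweep + 5 * n + 9" by simp
      have "fx x mod 2 ^ w = fx x" for x using fx_less by simp
      then have "sorted_wrt (\<lambda>x y. ky y < ky x) xs" using xs(2) unfolding ky_def by simp
      then have "xs ! p = el p" if "p < n" for p using sorted_list_el[of xs p] xs(2) that by simp
      then have "\<forall>p<n. mem \<sigma>' 2 p = el p" using xs by (simp add: arr_def)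
      moreover have "t + t' \<le> T_sort"
      proof -
        have "t + t' \<le> X + 6 * n + 6" if "t' \<le> X + 3" for X using t that by simp
        then show ?thesis using t' unfolding eq by blast
      qed
      ultimately show "t + t' \<le> T_sort \<and> (\<forall>p<n. mem \<sigma>' 2 p = el p)" by blast
    next
      show "modr (pass F) \<subseteq> {3..6} \<union> {30, 33, 34, 35, 36, 40} \<union> Fr" "moda (pass F) \<subseteq> {2, 3, 5} \<union> Fa"
        by (rule pass_frame)+
      show "\<exists>xs. arr \<sigma>'' 2 xs \<and> ?S k xs" if "\<exists>xs. arr \<sigma>' 2 xs \<and> ?S k xs" "agree {3, 31} {} \<sigma>' \<sigma>''" for k \<sigma>' \<sigma>''
        using that by (auto simp: agree_def arr_def)
    qed (use v1 env_regs[OF e1] in auto)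
  qed (use env_valid[OF e] env_regs[OF e] in \<open>auto simp: agree_def\<close>)
  then show ?thesis by (simp only: sortp_def wp_Seq)
qed

text \<open>All kinds of cells share array 0, which makes \<open>moda\<close> too coarse. Residues
  modulo 5 give the finer frame; \<open>K\<close> contains the kinds that may have changed.\<close>

definition others_eq :: "(nat \<Rightarrow> nat) \<Rightarrow> (nat \<Rightarrow> nat) \<Rightarrow> nat set \<Rightarrow> bool" where
  "others_eq D D' K \<longleftrightarrow> (\<forall>i. i mod 5 \<notin> K \<longrightarrow> D' i = D i)"

lemma cell_mod: "k < 5 \<Longrightarrow> (5 * i + k) mod 5 = (k::nat)"
  by simp

abbreviation T_piv :: nat where "T_piv \<equiv> n * (2 * T_lv \<tau> W + T_cmp W + 30) + 4"

lemma ds_less: "x < n \<Longrightarrow> ds x < n"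
proof -
  assume "x < n"
  then have "ds x < card (fx ` {..<n})"
    unfolding ds_def by (intro psubset_card_mono) auto
  also have "\<dots> \<le> n" using card_image_le[of "{..<n}" fx] by simp
  finally show ?thesis .
qed

lemma run_pivots:
  assumes e: "env \<sigma>" and A: "\<forall>p<n. mem \<sigma> 2 p = el p"
  shows "run (pivots F) (\<lambda>t \<sigma>'. t \<le> T_piv \<and> pivots_ok (mem \<sigma>' 0) \<and> (\<forall>j<M. mem \<sigma>' 0 (5 * j + 1) = ds (el (j * B))) \<and>
     others_eq (mem \<sigma> 0) (mem \<sigma>' 0) {0, 1}) \<sigma>"
proof -
  define \<sigma>0 where "\<sigma>0 = set_reg 45 0 \<sigma>"
  have e0: "env \<sigma>0" using e by (auto simp: env_def \<sigma>0_def valid_state_def)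
  let ?R = "{3..9} \<union> {16, 40, 41, 42, 45} \<union> Fr" and ?A = "{0, 3, 4} \<union> Fa"
  \<comment> \<open>Truncated subtraction makes the invariant hold at \<open>j = 0\<close> too,
    where register 45 and \<open>ds (el 0)\<close> are both 0. The condition
    \<open>i * B < j\<close> says that the first element of bucket \<open>i\<close> has been
    passed.\<close>
  let ?I = "\<lambda>j \<sigma>'. regs \<sigma>' 45 = ds (el (j - 1)) \<and> (\<forall>i. i * B < j \<longrightarrow> mem \<sigma>' 0 (5 * i) = el (i * B) \<and> mem \<sigma>' 0 (5 * i + 1) = ds (el (i * B))) \<and>
     others_eq (mem \<sigma> 0) (mem \<sigma>' 0) {0, 1}"
  let ?T = "2 * T_lv \<tau> W + T_cmp W + 27"
  let ?d = "IfNZ 7 (Op Add 45 45 52) Skip"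
  let ?c1 = "Op Sub 41 30 52 ;; Load 42 2 41 ;; loadval F 3 42 ;; loadval F 4 40 ;; cmp 3 4 ;; ?d"
  let ?st = "Op Div 41 30 57 ;; store_cell 0 41 40 ;; store_cell 1 41 45"
  let ?c2 = "Op Mod 41 30 57 ;; IfNZ 41 Skip ?st"
  let ?body = "Load 40 2 30 ;; IfNZ 30 ?c1 Skip ;; ?c2"
  have "run (For 30 56 ?body) (\<lambda>t \<sigma>'. 1 + t \<le> T_piv \<and> pivots_ok (mem \<sigma>' 0) \<and> (\<forall>j<M. mem \<sigma>' 0 (5 * j + 1) = ds (el (j * B))) \<and>
     others_eq (mem \<sigma> 0) (mem \<sigma>' 0) {0, 1}) \<sigma>0"
  proof (rule ForI[where R = ?R and A = ?A and k = n and T = ?T and I = ?I])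
    fix j \<sigma>1 assume j: "j < n" "regs \<sigma>1 30 = j" and v1: "valid_state b \<sigma>1"
      and ag: "agree (insert 3 (insert 30 ?R)) ?A \<sigma>0 \<sigma>1" and I: "?I j \<sigma>1"
    have e1: "env \<sigma>1" by (rule env_agree[OF e0 ag v1]) auto
    have m1: "mem \<sigma>1 2 p = el p" if "p < n" for p using ag A that by (auto simp: agree_def \<sigma>0_def)
    let ?x = "el j"
    have x: "?x < n" using el(1) j by simp
    define \<sigma>2 where "\<sigma>2 = set_reg 40 ?x \<sigma>1"
    have e2: "env \<sigma>2" using e1 x n(2) by (auto simp: env_def \<sigma>2_def valid_state_def)
    let ?Q = "\<lambda>t \<sigma>'. t \<le> ?T \<and> ?I (Suc j) \<sigma>'"
    have final: "run ?c2 (\<lambda>t. ?Q (1 + (t0 + t))) \<rho>" if \<rho>: "env \<rho>" "regs \<rho> 40 = ?x" "regs \<rho> 45 = ds ?x" "regs \<rho> 30 = j"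
       "mem \<rho> 0 = mem \<sigma>1 0" and t0: "t0 \<le> 2 * T_lv \<tau> W + T_cmp W + 10" for t0 \<rho>
    proof (cases "j mod B = 0")
      case False
      have "i * B < Suc j \<longleftrightarrow> i * B < j" for i using False by (auto simp: less_Suc_eq)
      then show ?thesis using \<rho> I t0 False env_large(1)[OF \<rho>(1)] by (simp add: wp_simps)
    next
      case True
      let ?i = "j div B"
      have iB: "?i * B = j" using True by (metis add.right_neutral div_mult_mod_eq)
      have "?i < M" using j MB by (simp add: less_mult_imp_div_less)
      then have iQ: "?i < Q" using fits(1) by simp
      have io: "i * B < Suc j \<longleftrightarrow> i * B < j \<or> i = ?i" for i using iB B_pos by (auto simp: less_Suc_eq)
      define \<rho>1 where "\<rho>1 = set_reg 41 ?i \<rho>"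
      define \<rho>2 where "\<rho>2 = (set_reg 16 (5 * ?i + 0) (set_reg 4 0 \<rho>1)) \<lparr>mem := (mem \<rho>1)(0 := (mem \<rho>1 0)(5 * ?i + 0 := ?x))\<rparr>"
      define \<rho>3 where "\<rho>3 = (set_reg 16 (5 * ?i + 1) (set_reg 4 1 \<rho>2)) \<lparr>mem := (mem \<rho>2)(0 := (mem \<rho>2 0)(5 * ?i + 1 := ds ?x))\<rparr>"
      have 1: "run (store_cell 0 41 40 ;; store_cell 1 41 45) P \<rho>1 = P (4 + 4) \<rho>3" for P
      proof -
        have "run (store_cell 0 41 40) P' \<rho>1 = P' 4 \<rho>2" for P'
          using \<rho> iQ env_large(11)[OF \<rho>(1)] by (subst run_store_cell) (auto simp: \<rho>1_def \<rho>2_def)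
        moreover have "run (store_cell 1 41 45) P' \<rho>2 = P' 4 \<rho>3" for P'
          using \<rho> iQ env_large(11)[OF \<rho>(1)] by (subst run_store_cell) (auto simp: \<rho>1_def \<rho>2_def \<rho>3_def)
        ultimately show ?thesis by (simp only: wp_Seq)
      qed
      have eq: "run ?c2 P \<rho> = P (1 + Suc (1 + (4 + 4))) \<rho>3" for P
      proof -
        have "set_reg 41 (j div B) (set_reg 41 0 \<rho>) = \<rho>1" by (simp add: \<rho>1_def)
        then have "run ?c2 P \<rho> = run (store_cell 0 41 40 ;; store_cell 1 41 45) (\<lambda>t. P (1 + Suc (1 + t))) \<rho>1"
          unfolding wp_Seq[of b inp "Op Mod 41 30 57"] wp_Seq[of b inp "Op Div 41 30 57"] wp_simps(3,8)
          using \<rho> True env_large(1)[OF \<rho>(1)] by (simp add: wp_simps(3,8) wp_Seq[of b inp "Op Div 41 30 57"])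
        then show ?thesis using 1 by simp
      qed
      have m3: "mem \<rho>3 0 = (mem \<sigma>1 0)(5 * ?i := ?x, 5 * ?i + 1 := ds ?x)"
        using \<rho> by (simp add: \<rho>3_def \<rho>2_def \<rho>1_def)
      have ne: "5 * i \<noteq> 5 * i' + 1" "5 * i + 1 \<noteq> 5 * i'" for i i' :: nat by presburger+
      have "\<forall>i. i * B < Suc j \<longrightarrow> mem \<rho>3 0 (5 * i) = el (i * B) \<and> mem \<rho>3 0 (5 * i + 1) = ds (el (i * B))"
        unfolding io m3 using I iB ne by auto
      moreover have "others_eq (mem \<sigma> 0) (mem \<rho>3 0) {0, 1}"
        using I unfolding others_eq_def m3 by auto
      moreover have "regs \<rho>3 45 = ds ?x" using \<rho> by (simp add: \<rho>3_def \<rho>2_def \<rho>1_def)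
      ultimately show ?thesis unfolding eq using t0 by simp
    qed
    have "run (IfNZ 30 ?c1 Skip) (\<lambda>t. run ?c2 (\<lambda>t'. ?Q (1 + (t + t')))) \<sigma>2"
    proof (cases "j = 0")
      case True
      have "run ?c2 (\<lambda>t. ?Q (1 + (Suc 1 + t))) \<sigma>2"
        by (rule final[OF e2]) (use I True j in \<open>auto simp: \<sigma>2_def\<close>)
      moreover have "run (IfNZ 30 ?c1 Skip) P \<sigma>2 = P (Suc 1) \<sigma>2" for P
        using True j by (simp add: wp_simps(1,8) \<sigma>2_def)
      ultimately show ?thesis by (simp only:)
    next
      case False
      let ?xp = "el (j - 1)"
      have xp: "?xp < n" using el(1)[of "j - 1"] j by simp
      define \<sigma>3 where "\<sigma>3 = set_reg 42 ?xp (set_reg 41 (j - 1) \<sigma>2)"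
      have e3: "env \<sigma>3" using e2 xp j n(2) by (auto simp: env_def \<sigma>3_def valid_state_def)
      have jm: "(j + 2 ^ b - Suc 0) mod 2 ^ b = j - Suc 0" using False j n(2) by (intro sub_mod) auto
      have eq: "run (IfNZ 30 ?c1 Skip) P \<sigma>2 = run (loadval F 3 42 ;; loadval F 4 40 ;; cmp 3 4 ;; ?d) (\<lambda>t. P (Suc (Suc (Suc t)))) \<sigma>3" for P
        using False j m1[of "j - 1"] jm env_regs(3)[OF e2] by (simp add: wp_simps(3,4,7,8) \<sigma>2_def \<sigma>3_def)
      have "run (loadval F 3 42) (\<lambda>s. run (loadval F 4 40) (\<lambda>s'. run (cmp 3 4) (\<lambda>s''. run ?d
         (\<lambda>sx. run ?c2 (\<lambda>t. ?Q (1 + (Suc (Suc (Suc (s + (s' + (s'' + sx))))) + t))))))) \<sigma>3"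
      proof (rule callI[OF run_loadval[OF e3] env_valid[OF e3] loadval_frame])
        fix t4 \<sigma>4 assume 4: "t4 \<le> T_lv \<tau> W \<and> holds_int b w (mem \<sigma>4 3) (fx (regs \<sigma>3 42))"
          and v4: "valid_state b \<sigma>4" and ag4: "agree ({3..6} \<union> Fr) ({3} \<union> Fa) \<sigma>3 \<sigma>4"
        have e4: "env \<sigma>4" by (rule env_agree[OF e3 ag4 v4]) auto
        show "run (loadval F 4 40) (\<lambda>s'. run (cmp 3 4) (\<lambda>s''. run ?d
         (\<lambda>sx. run ?c2 (\<lambda>t. ?Q (1 + (Suc (Suc (Suc (t4 + (s' + (s'' + sx))))) + t)))))) \<sigma>4"
        proof (rule callI[OF run_loadval[OF e4] v4 loadval_frame])
          fix t5 \<sigma>5 assume 5: "t5 \<le> T_lv \<tau> W \<and> holds_int b w (mem \<sigma>5 4) (fx (regs \<sigma>4 40))"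
            and v5: "valid_state b \<sigma>5" and ag5: "agree ({3..6} \<union> Fr) ({4} \<union> Fa) \<sigma>4 \<sigma>5"
          have e5: "env \<sigma>5" by (rule env_agree[OF e4 ag5 v5]) auto
          have "regs \<sigma>4 40 = ?x" using ag4 by (auto simp: agree_def \<sigma>3_def \<sigma>2_def)
          then have m5: "holds_int b w (mem \<sigma>5 3) (fx ?xp)" "holds_int b w (mem \<sigma>5 4) (fx ?x)"
            using 4 5 ag5 by (auto simp: agree_def \<sigma>3_def)
          show "run (cmp 3 4) (\<lambda>s''. run ?d
            (\<lambda>sx. run ?c2 (\<lambda>t. ?Q (1 + (Suc (Suc (Suc (t4 + (t5 + (s'' + sx))))) + t))))) \<sigma>5"
          proof (rule callI[OF run_cmp[OF e5 fx_less fx_less m5] v5 cmp_frame])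
            fix t6 \<sigma>6 assume 6: "t6 \<le> T_cmp W \<and> regs \<sigma>6 7 = cv (fx ?xp) (fx ?x)" and ag6: "agree {3..9} {} \<sigma>5 \<sigma>6"
              and v6: "valid_state b \<sigma>6"
            have e6: "env \<sigma>6" by (rule env_agree[OF e5 ag6 v6]) auto
            have r6: "regs \<sigma>6 40 = ?x" "regs \<sigma>6 45 = ds ?xp" "regs \<sigma>6 30 = j" "mem \<sigma>6 0 = mem \<sigma>1 0"
              using ag6 ag5 ag4 I j by (auto simp: agree_def \<sigma>3_def \<sigma>2_def)
            have dS: "ds ?x = ds ?xp + (if fx ?xp = fx ?x then 0 else 1)"
              using ds_el_Suc[of "j - 1"] j False by simp
            have dsb: "ds ?x < 2 ^ b" using ds_less[OF x] n(2) by simp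
            define \<sigma>7 where "\<sigma>7 = set_reg 45 (ds ?x) \<sigma>6"
            have e7: "env \<sigma>7" using e6 dsb by (auto simp: env_def \<sigma>7_def valid_state_def)
            have d: "run ?d P \<sigma>6 = P (Suc 1) \<sigma>7" for P
            proof (cases "fx ?xp = fx ?x")
              case True
              then have "regs \<sigma>6 7 = 0" using 6 by (simp add: cv_def)
              moreover have "\<sigma>7 = \<sigma>6" using r6 dS True by (intro state.equality) (auto simp: \<sigma>7_def fun_upd_idem)
              ultimately show ?thesis by (simp add: wp_simps(1,8))
            next
              case False
              then have "regs \<sigma>6 7 \<noteq> 0" using 6 by (auto simp: cv_def)
              moreover have "set_reg 45 (Suc (ds ?xp) mod 2 ^ b) \<sigma>6 = \<sigma>7" using dS dsb False by (simp add: \<sigma>7_def)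
              ultimately show ?thesis using r6(2) env_regs(3)[OF e6] by (simp add: wp_simps(3,8))
            qed
            show "run ?d (\<lambda>sx. run ?c2 (\<lambda>t. ?Q (1 + (Suc (Suc (Suc (t4 + (t5 + (t6 + sx))))) + t)))) \<sigma>6"
              unfolding d by (rule final[OF e7]) (use r6 4 5 6 in \<open>auto simp: \<sigma>7_def\<close>)
          qed
        qed auto
      qed auto
      then show ?thesis unfolding eq by (simp only: wp_Seq[of b inp "loadval F _ _"] wp_Seq[of b inp "cmp 3 4"])
    qed
    then show "run ?body ?Q \<sigma>1"
      using m1[OF j(1)] j(2) unfolding wp_Seq[of b inp "Load 40 2 30"] wp_Seq[of b inp "IfNZ 30 ?c1 Skip"]
      by (simp only: wp_simps(4) \<sigma>2_def)
  next
    fix t \<sigma>' assume t: "t \<le> n * (?T + 3) + 3" and I: "?I n \<sigma>'"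
    have eq: "?T + 3 = 2 * T_lv \<tau> W + T_cmp W + 30" by simp
    show "1 + t \<le> T_piv \<and> pivots_ok (mem \<sigma>' 0) \<and> (\<forall>j<M. mem \<sigma>' 0 (5 * j + 1) = ds (el (j * B))) \<and>
       others_eq (mem \<sigma> 0) (mem \<sigma>' 0) {0, 1}"
      using t I pivot_less unfolding eq pivots_ok_def by simp
  next
    show "modr ?body \<subseteq> ?R" "moda ?body \<subseteq> ?A"
      using loadval_frame[of F 3 42] loadval_frame[of F 4 40] cmp_frame[of 3 4] cell_frame(3,4)[of 0 41 40] cell_frame(3,4)[of 1 41 45]
      by auto
    show "?I j \<sigma>''" if "?I j \<sigma>'" "agree {3, 30} {} \<sigma>' \<sigma>''" for j \<sigma>' \<sigma>''
      using that by (auto simp: agree_def)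
    show "?I 0 \<sigma>0" using ds_el_0[OF n(3)] by (simp add: \<sigma>0_def others_eq_def)
  qed (use env_valid[OF e0] env_regs[OF e0] in auto)
  then show ?thesis by (simp add: pivots_def wp_simps \<sigma>0_def)
qed

lemma others_eq_trans: "others_eq D1 D2 K \<Longrightarrow> others_eq D2 D3 K' \<Longrightarrow> K \<subseteq> L \<Longrightarrow> K' \<subseteq> L \<Longrightarrow> others_eq D1 D3 L"
  unfolding others_eq_def by (metis subsetD)

lemma others_eq_keys: "others_eq D D' K \<Longrightarrow> 2 \<notin> K \<Longrightarrow> keys D' = keys D"
  unfolding others_eq_def keys_def fun_eq_iff using cell_mod[of 2] by simp

section \<open>Chains, slots and coverage\<close>

definition chain_end :: "(nat \<Rightarrow> nat) \<Rightarrow> nat \<Rightarrow> nat \<Rightarrow> nat" where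
  "chain_end V t a = pos V (t * ell) ell a mod m'"

abbreviation T_chain :: nat where "T_chain \<equiv> T_adv ell mu \<tau> W + 10"

lemma m'_pos: "m' > 0" and ell_pos: "ell > 0"
  using m'(2) M_pos by (auto intro: Nat.gr0I)

lemma slot_less: "t < r \<Longrightarrow> u < m' \<Longrightarrow> t * m' + u < Q"
proof -
  assume "t < r" "u < m'"
  then have "t * m' + u < Suc t * m'" by simp
  also have "\<dots> \<le> r * m'" using \<open>t < r\<close> by (intro mult_le_mono1) simp
  finally show ?thesis using fits(3) by linarith
qed

lemma layer_le: "t < r \<Longrightarrow> t * ell + ell \<le> Z"
  using mult_le_mono1[of "Suc t" r ell] Z by simp

lemma run_chain:
  assumes e: "env \<sigma>" and p: "pivots_ok (mem \<sigma> 0)" and t: "regs \<sigma> 46 < r" and a: "regs \<sigma> 47 < m"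
  shows "run (chain F) (\<lambda>k \<sigma>'. k \<le> T_chain \<and> mem \<sigma>' 0 =
    (mem \<sigma> 0)(5 * (regs \<sigma> 46 * m' + chain_end (keys (mem \<sigma> 0)) (regs \<sigma> 46) (regs \<sigma> 47)) + 3 := regs \<sigma> 47)) \<sigma>"
proof -
  let ?t = "regs \<sigma> 46" and ?a = "regs \<sigma> 47" and ?D = "mem \<sigma> 0"
  let ?V = "keys ?D"
  note l = env_large[OF e]
  have Zb: "Z < 2 ^ b"
  proof -
    have "Z \<le> Z * Suc mu" by simp
    then show ?thesis using fits(2,4) by linarith
  qed
  have tl: "?t * ell < 2 ^ b" "ell < 2 ^ b" using layer_le[OF t] Zb by auto
  define \<sigma>1 where "\<sigma>1 = set_reg 28 ell (set_reg 12 ?a (set_reg 11 (?t * ell) \<sigma>))"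
  have ab: "?a < 2 ^ b" using valid_less(1)[OF env_valid[OF e]] .
  have e1: "env \<sigma>1" using e tl ab by (auto simp: env_def \<sigma>1_def valid_state_def)
  let ?c = "Op Mod 36 12 62 ;; Op Mul 41 46 62 ;; Op Add 36 36 41 ;; store_cell 3 36 47"
  have eq: "run (chain F) P \<sigma> = run (adv F ;; ?c) (\<lambda>k. P (Suc (Suc (Suc k)))) \<sigma>1" for P
    using tl l by (simp add: chain_def wp_simps wp_Copy \<sigma>1_def)
  let ?u = "chain_end ?V ?t ?a"
  let ?P = "\<lambda>k \<sigma>'. k \<le> T_chain \<and> mem \<sigma>' 0 = ?D(5 * (?t * m' + ?u) + 3 := ?a)"
  have "run (adv F) (\<lambda>k. run ?c (\<lambda>k'. ?P (Suc (Suc (Suc (k + k')))))) \<sigma>1"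
  proof (rule callI[OF run_adv[OF e1] env_valid[OF e1] adv_frame])
    show "pivots_ok (mem \<sigma>1 0)" using p by (simp add: \<sigma>1_def)
    show "regs \<sigma>1 11 + regs \<sigma>1 28 \<le> Z" using layer_le[OF t] by (simp add: \<sigma>1_def)
    fix k \<sigma>2 assume 2: "k \<le> T_adv (regs \<sigma>1 28) mu \<tau> W \<and> regs \<sigma>2 11 = regs \<sigma>1 11 + regs \<sigma>1 28 \<and>
         regs \<sigma>2 12 = pos (keys (mem \<sigma>1 0)) (regs \<sigma>1 11) (regs \<sigma>1 28) (regs \<sigma>1 12)"
      and v2: "valid_state b \<sigma>2" and ag: "agree ({3..18} \<union> {20..27} \<union> Fr) ({3, 4} \<union> Fa) \<sigma>1 \<sigma>2"
    have e2: "env \<sigma>2" by (rule env_agree[OF e1 ag v2]) auto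
    note l2 = env_large[OF e2]
    have r2: "regs \<sigma>2 12 mod m' = ?u" "regs \<sigma>2 46 = ?t" "regs \<sigma>2 47 = ?a" "mem \<sigma>2 0 = ?D"
      using 2 ag by (auto simp: agree_def \<sigma>1_def chain_end_def)
    have u: "?u < m'" using m'_pos by (simp add: chain_end_def)
    have sQ: "?t * m' + ?u < Q" using slot_less[OF t u] .
    then have sb: "?t * m' + ?u < 2 ^ b" using fits(4) by linarith
    then have tmb: "?t * m' < 2 ^ b" by linarith
    let ?\<sigma> = "set_reg 36 (?t * m' + ?u) (set_reg 41 (?t * m') \<sigma>2)"
    have "run ?c P \<sigma>2 = run (store_cell 3 36 47) (\<lambda>k. P (Suc (Suc (Suc k)))) ?\<sigma>" for P
    proof -
      have "run ?c P \<sigma>2 = run (store_cell 3 36 47) (\<lambda>k. P (Suc (Suc (Suc k)))) (set_reg 36 (?t * m' + ?u) (set_reg 41 (?t * m') (set_reg 36 ?u \<sigma>2)))"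
        using l2 r2 sb tmb by (simp add: wp_simps add.commute)
      also have "set_reg 36 (?t * m' + ?u) (set_reg 41 (?t * m') (set_reg 36 ?u \<sigma>2)) = ?\<sigma>"
        by (simp add: fun_upd_twist)
      finally show ?thesis .
    qed
    then show "run ?c (\<lambda>k'. ?P (Suc (Suc (Suc (k + k'))))) \<sigma>2"
      using sQ l2(11) r2 2 by (simp only:) (subst run_store_cell, auto simp: \<sigma>1_def)
  qed
  then show ?thesis unfolding eq by (simp only: wp_Seq[of b inp "adv F"])
qed

abbreviation T_chains :: nat where "T_chains \<equiv> r * (m * (T_chain + 3) + 6) + 3"

text \<open>The slot at the address of a chain holds some start with this address, in fact the last
  one written, and hence \<open>a\<close> itself if the address is unshared. About slots that no
  chain reaches nothing is said, since memory is not initialised.\<close>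

definition slots_ok :: "(nat \<Rightarrow> nat) \<Rightarrow> (nat \<Rightarrow> nat) \<Rightarrow> nat \<Rightarrow> nat \<Rightarrow> bool" where
  "slots_ok V D t k \<longleftrightarrow> (\<forall>a<k. \<exists>a'<k. chain_end V t a' = chain_end V t a \<and> slots D (t * m' + chain_end V t a) = a')"

lemma chain_end_less: "chain_end V t a < m'"
  using m'_pos by (simp add: chain_end_def)

lemma slot_inject: "u < m' \<Longrightarrow> u' < m' \<Longrightarrow> t * m' + u = t' * m' + u' \<longleftrightarrow> t = t' \<and> u = u'"
proof -
  assume u: "u < m'" "u' < m'"
  have "(t * m' + u) div m' = t" "(t' * m' + u') div m' = t'" using u by auto
  then show ?thesis by auto
qed

lemma run_chains:
  assumes e: "env \<sigma>" and p: "pivots_ok (mem \<sigma> 0)"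
  shows "run (chains F) (\<lambda>k \<sigma>'. k \<le> T_chains \<and> others_eq (mem \<sigma> 0) (mem \<sigma>' 0) {3} \<and>
     (\<forall>t<r. slots_ok (keys (mem \<sigma> 0)) (mem \<sigma>' 0) t m)) \<sigma>"
proof -
  let ?D = "mem \<sigma> 0" and ?V = "keys (mem \<sigma> 0)"
  let ?R = "{3..28} \<union> {36, 41} \<union> Fr" and ?A = "{0, 3, 4} \<union> Fa"
  let ?I = "\<lambda>t \<sigma>'. others_eq ?D (mem \<sigma>' 0) {3} \<and> (\<forall>t'<t. slots_ok ?V (mem \<sigma>' 0) t' m)"
  let ?J = "\<lambda>t a \<sigma>'. ?I t \<sigma>' \<and> slots_ok ?V (mem \<sigma>' 0) t a"
  show ?thesis unfolding chains_def
  proof (rule ForI[where R = "{47} \<union> ?R" and A = ?A and k = r and T = "m * (T_chain + 3) + 3" and I = ?I])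
    fix t \<sigma>1 assume t: "t < r" "regs \<sigma>1 46 = t" and v1: "valid_state b \<sigma>1"
      and ag1: "agree (insert 3 (insert 46 ({47} \<union> ?R))) ?A \<sigma> \<sigma>1" and I: "?I t \<sigma>1"
    have e1: "env \<sigma>1" by (rule env_agree[OF e ag1 v1]) auto
    show "run (For 47 63 (chain F)) (\<lambda>k \<sigma>'. k \<le> m * (T_chain + 3) + 3 \<and> ?I (Suc t) \<sigma>') \<sigma>1"
    proof (rule ForI[where R = ?R and A = ?A and k = m and T = T_chain and I = "?J t"])
      fix a \<sigma>2 assume a: "a < m" "regs \<sigma>2 47 = a" and v2: "valid_state b \<sigma>2"
        and ag2: "agree (insert 3 (insert 47 ?R)) ?A \<sigma>1 \<sigma>2" and J: "?J t a \<sigma>2"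
      have e2: "env \<sigma>2" by (rule env_agree[OF e1 ag2 v2]) auto
      have r2: "regs \<sigma>2 46 = t" using ag2 t by (auto simp: agree_def)
      have V: "keys (mem \<sigma>2 0) = ?V" using J others_eq_keys[of ?D "mem \<sigma>2 0" "{3}"] by simp
      have p2: "pivots_ok (mem \<sigma>2 0)"
      proof -
        have "(5 * j) mod 5 \<notin> {3::nat}" for j by simp
        then have "mem \<sigma>2 0 (5 * j) = ?D (5 * j)" for j using J unfolding others_eq_def by blast
        then show ?thesis using p by (simp add: pivots_ok_def)
      qed
      show "run (chain F) (\<lambda>k \<sigma>'. k \<le> T_chain \<and> ?J t (Suc a) \<sigma>') \<sigma>2"
      proof (rule wp_mono[OF run_chain[OF e2 p2]])
        fix k \<sigma>'
        let ?u = "chain_end ?V t a"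
        assume "k \<le> T_chain \<and> mem \<sigma>' 0 =
          (mem \<sigma>2 0)(5 * (regs \<sigma>2 46 * m' + chain_end (keys (mem \<sigma>2 0)) (regs \<sigma>2 46) (regs \<sigma>2 47)) + 3 := regs \<sigma>2 47)"
        then have k: "k \<le> T_chain" and m: "mem \<sigma>' 0 = (mem \<sigma>2 0)(5 * (t * m' + ?u) + 3 := a)"
          unfolding V r2 a by auto
        have sl: "slots (mem \<sigma>' 0) i = (if i = t * m' + ?u then a else slots (mem \<sigma>2 0) i)" for i
          unfolding m slots_def by auto
        have "others_eq (mem \<sigma>2 0) (mem \<sigma>' 0) {3}"
        proof -
          have "i \<noteq> 5 * j + 3" if "i mod 5 \<notin> {3}" for i j :: nat using that cell_mod[of 3 j] by auto
          then show ?thesis unfolding others_eq_def m fun_upd_apply by meson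
        qed
        then have 1: "others_eq ?D (mem \<sigma>' 0) {3}" using J others_eq_trans by blast
        \<comment> \<open>Slots of different tables occupy disjoint ranges, so earlier tables are
          unaffected.\<close>
        have 2: "slots_ok ?V (mem \<sigma>' 0) t' m" if t': "t' < t" for t'
        proof -
          have "t' * m' + chain_end ?V t' a' \<noteq> t * m' + ?u" for a'
            using slot_inject[OF chain_end_less chain_end_less] t' by auto
          then have "slots (mem \<sigma>' 0) (t' * m' + chain_end ?V t' a') = slots (mem \<sigma>2 0) (t' * m' + chain_end ?V t' a')" for a'
            unfolding sl by simp
          then show ?thesis using J t' unfolding slots_ok_def by simp
        qed
        have 3: "slots_ok ?V (mem \<sigma>' 0) t (Suc a)"
          unfolding slots_ok_def
        proof (intro allI impI)
          fix c assume c: "c < Suc a"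
          show "\<exists>a'<Suc a. chain_end ?V t a' = chain_end ?V t c \<and> slots (mem \<sigma>' 0) (t * m' + chain_end ?V t c) = a'"
          proof (cases "chain_end ?V t c = ?u")
            case True
            then show ?thesis unfolding sl by auto
          next
            case False
            then have "c < a" using c by (auto simp: less_Suc_eq)
            then obtain a' where "a' < a" "chain_end ?V t a' = chain_end ?V t c" "slots (mem \<sigma>2 0) (t * m' + chain_end ?V t c) = a'"
              using J unfolding slots_ok_def by blast
            then show ?thesis unfolding sl using False by (intro exI[of _ a']) auto
          qed
        qed
        show "k \<le> T_chain \<and> ?J t (Suc a) \<sigma>'" using k 1 2 3 by blast
      qed (use r2 t a in auto)
    next
      fix k \<sigma>' assume "k \<le> m * (T_chain + 3) + 3" "?J t m \<sigma>'"
      then show "k \<le> m * (T_chain + 3) + 3 \<and> ?I (Suc t) \<sigma>'" by (auto simp: less_Suc_eq)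
    next
      show "modr (chain F) \<subseteq> ?R" "moda (chain F) \<subseteq> ?A" by (rule chain_frame)+
      show "?J t j \<sigma>''" if "?J t j \<sigma>'" "agree {3, 47} {} \<sigma>' \<sigma>''" for j \<sigma>' \<sigma>''
        using that by (simp add: agree_def)
    qed (use v1 env_regs[OF e1] env_large[OF e1] I in \<open>auto simp: slots_ok_def\<close>)
  next
    fix k \<sigma>' assume k: "k \<le> r * (m * (T_chain + 3) + 3 + 3) + 3" and I: "?I r \<sigma>'"
    have eq: "m * (T_chain + 3) + 3 + 3 = m * (T_chain + 3) + 6" by simp
    show "k \<le> T_chains \<and> others_eq ?D (mem \<sigma>' 0) {3} \<and> (\<forall>t<r. slots_ok ?V (mem \<sigma>' 0) t m)"
      using k I unfolding eq by blast
  next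
    show "modr (For 47 63 (chain F)) \<subseteq> {47} \<union> ?R" "moda (For 47 63 (chain F)) \<subseteq> ?A"
      using chain_frame[of F] by auto
    show "?I j \<sigma>''" if "?I j \<sigma>'" "agree {3, 46} {} \<sigma>' \<sigma>''" for j \<sigma>' \<sigma>''
      using that by (simp add: agree_def)
  qed (use env_valid[OF e] env_regs[OF e] env_large[OF e] in \<open>auto simp: others_eq_def\<close>)
qed

definition all_covered :: "(nat \<Rightarrow> nat) \<Rightarrow> bool" where
  "all_covered V \<longleftrightarrow> (\<forall>x<n. \<exists>t<r. covered m' m ell (\<lambda>i. V (t * (ell * Suc mu) + i)) x)"

text \<open>Translates between blocks of words, in which the probability bound is phrased, and the
  layer numbers running through all tables, which the programs use.\<close>

lemma shift_keys:
  "hv (\<lambda>i. V (t * (ell * Suc mu) + i)) s p = hv V (t * ell + s) p"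
  "pos (\<lambda>i. V (t * (ell * Suc mu) + i)) s k p = pos V (t * ell + s) k p"
proof -
  show hv: "hv (\<lambda>i. V (t * (ell * Suc mu) + i)) s p = hv V (t * ell + s) p" for s p
    by (simp add: hv_def algebra_simps)
  show "pos (\<lambda>i. V (t * (ell * Suc mu) + i)) s k p = pos V (t * ell + s) k p"
  proof (induction k arbitrary: s p)
    case (Suc k)
    show ?case unfolding pos.simps hv Suc.IH by simp
  qed simp
qed

text \<open>The stored hash words agree with the tape only on this initial part. The same locality
  makes coverage a measurable event.\<close>

lemma all_covered_cong:
  assumes V: "\<And>i. i < Z * Suc mu \<Longrightarrow> V i = V' i"
  shows "all_covered V = all_covered V'"
proof -
  have "covered m' m ell (\<lambda>i. V (t * (ell * Suc mu) + i)) x = covered m' m ell (\<lambda>i. V' (t * (ell * Suc mu) + i)) x"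
    if t: "t < r" for t x
  proof -
    have m'2: "m' dvd M" "m' > 0" using m'(2) m'_pos by auto
    have hv: "hv V z p = hv V' z p" if "z < Z" for z p
      unfolding hv_def using V keys_less[OF that] by (intro arg_cong[of _ _ "\<lambda>x. x mod n"] hs_cong) auto
    have pos: "pos V z l p = pos V' z l p" if "z + l \<le> Z" for z l p
      using that by (induction l arbitrary: z p) (simp_all add: hv)
    have p1: "pos V (t * ell + 0) l p = pos V' (t * ell + 0) l p" if "l \<le> ell" for l p
      using layer_le[OF t] that by (intro pos) linarith
    have h1: "hv V (t * ell + s) p = hv V' (t * ell + s) p" if "s < ell" for s p
      using layer_le[OF t] that by (intro hv) linarith
    show ?thesis
      unfolding covered_def[OF m'2] shift_keys[of V] shift_keys[of V']
      using p1 h1 by (simp cong: conj_cong)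
  qed
  then show ?thesis unfolding all_covered_def by blast
qed

text \<open>Here chance turns into correctness: coverage provides a chain through \<open>x\<close>
  with an unshared address, its slot therefore holds its own start, and the candidate for the layer
  of the hit is \<open>x\<close>.\<close>

lemma ds_ok_of_covered:
  assumes p: "pivots_ok D" "\<forall>j<M. D (5 * j + 1) = ds (el (j * B))"
    and s: "\<And>t. t < r \<Longrightarrow> slots_ok (keys D) D t m" and cov: "all_covered (keys D)"
  shows "ds_ok D"
  unfolding ds_ok_def
proof (intro conjI allI impI p(1))
  show "D (5 * j + 1) = ds (el (j * B))" if "j < M" for j using p(2) that by blast
  fix x assume x: "x < n"
  let ?V = "keys D"
  have m'2: "m' dvd M" "m' > 0" using m'(2) m'_pos by auto
  obtain t where t: "t < r" "covered m' m ell (\<lambda>i. ?V (t * (ell * Suc mu) + i)) x"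
    using cov x unfolding all_covered_def by blast
  then obtain a k where a: "a < m" "k < ell" "hv ?V (t * ell + k) (pos ?V (t * ell) k a) = x"
    "\<And>b. b < m \<Longrightarrow> chain_end ?V t b = chain_end ?V t a \<Longrightarrow> b = a"
    unfolding covered_def[OF m'2] shift_keys chain_end_def by auto
  let ?z = "t * ell + k"
  have z: "?z < Z" using layer_le[OF t(1)] a(2) by linarith
  have dm: "?z div ell = t" "?z mod ell = k" using a(2) by auto
  have "pos ?V (t * ell) ell a = pos ?V (t * ell + k) (ell - k) (pos ?V (t * ell) k a)"
    using pos_add[of ?V "t * ell" k "ell - k" a] a(2) by simp
  also have "ell - k = Suc (ell - k - 1)" using a(2) by simp
  finally have "pos ?V (Suc ?z) (ell - k - 1) (g x) = pos ?V (t * ell) ell a" using a(3) by simp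
  then have u: "pos ?V (Suc ?z) (ell - k - 1) (g x) mod m' = chain_end ?V t a" by (simp add: chain_end_def)
  obtain a' where "a' < m" "chain_end ?V t a' = chain_end ?V t a" "slots D (t * m' + chain_end ?V t a) = a'"
    using s[OF t(1)] a(1) unfolding slots_ok_def by blast
  then have "slots D (t * m' + chain_end ?V t a) = a" using a(4) by blast
  then have "candx D (g x) ?z = x"
    unfolding candx_def Let_def dm u using a(3) by simp
  then show "\<exists>z<Z. candx D (g x) z = x" using z by blast
qed

text \<open>A query is promised only the words of the structure itself, with arbitrary contents
  behind them, so its candidates must not depend on cells from \<open>5 * Q + 5\<close> on.\<close>

lemma candx_cong:
  assumes "\<And>i. i < 5 * Q + 5 \<Longrightarrow> D' i = D i" "z < Z"
  shows "candx D' J z = candx D J z"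
proof -
  let ?t = "z div ell" and ?s = "z mod ell"
  have t: "?t < r" using assms(2) Z by (simp add: less_mult_imp_div_less)
  have zts: "z = ?t * ell + ?s" "?s < ell" using ell_pos by simp_all
  have k: "keys D' i = keys D i" if "i < Z * Suc mu" for i
    using assms(1)[of "5 * i + 2"] that fits(2) by (simp add: keys_def)
  have hv: "hv (keys D') z' p = hv (keys D) z' p" if "z' < Z" for z' p
    unfolding hv_def using k keys_less[OF that] by (intro arg_cong[of _ _ "\<lambda>x. x mod n"] hs_cong) auto
  have pos: "pos (keys D') z' l p = pos (keys D) z' l p" if "z' + l \<le> Z" for z' l p
    using that by (induction l arbitrary: z' p) (simp_all add: hv)
  have 1: "pos (keys D') (Suc z) (ell - ?s - 1) J = pos (keys D) (Suc z) (ell - ?s - 1) J"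
    using layer_le[OF t] zts by (intro pos) linarith
  have 2: "slots D' (?t * m' + u mod m') = slots D (?t * m' + u mod m')" for u
    using assms(1)[of "5 * (?t * m' + u mod m') + 3"] slot_less[OF t, of "u mod m'"] m'_pos by (simp add: slots_def)
  have 3: "pos (keys D') (?t * ell) ?s a = pos (keys D) (?t * ell) ?s a" for a
    using layer_le[OF t] zts by (intro pos) linarith
  show ?thesis unfolding candx_def Let_def 1 2 3 hv[OF assms(2)] ..
qed

lemma ds_ok_cong:
  assumes "\<And>i. i < 5 * Q + 5 \<Longrightarrow> D' i = D i" "ds_ok D"
  shows "ds_ok D'"
proof -
  have "D' (5 * j) = D (5 * j)" "D' (5 * j + 1) = D (5 * j + 1)" if "j < M" for j
    using assms(1)[of "5 * j"] assms(1)[of "5 * j + 1"] that fits(1) by auto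
  moreover have cd: "candx D' J z = candx D J z" if "z < Z" for J z
    by (rule candx_cong) (use assms(1) that in auto)
  ultimately show ?thesis
    using assms(2) unfolding ds_ok_def pivots_ok_def by (metis (no_types, lifting))
qed

abbreviation T_large :: nat where "T_large \<equiv> 8 * (Z * Suc mu) + 4 + T_sort + T_piv + T_chains"

text \<open>Pivots have to precede chains: each step of a chain evaluates \<open>g\<close> by a
  search among the pivots.\<close>

lemma run_construct:
  assumes e: "env \<sigma>" and cov: "all_covered (\<lambda>i. tape \<sigma> !! i)"
  shows "run (fill ;; sortp F ;; pivots F ;; chains F) (\<lambda>t \<sigma>'. t \<le> T_large \<and> ds_ok (mem \<sigma>' 0) \<and> mem \<sigma>' 0 4 = mem \<sigma> 0 4) \<sigma>"
proof -
  let ?P = "\<lambda>t \<sigma>'. t \<le> T_large \<and> ds_ok (mem \<sigma>' 0) \<and> mem \<sigma>' 0 4 = mem \<sigma> 0 4"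
  have "run fill (\<lambda>t1. run (sortp F) (\<lambda>t2. run (pivots F) (\<lambda>t3. run (chains F) (\<lambda>t4. ?P (t1 + (t2 + (t3 + t4))))))) \<sigma>"
  proof (rule callI[OF run_fill[OF e] env_valid[OF e], where R = "{3, 4, 6, 16, 29, 30}" and A = "{0}"])
    show "modr fill \<subseteq> {3, 4, 6, 16, 29, 30}" "moda fill \<subseteq> {0}"
      using cell_frame(3,4)[of 2 30 6] by (auto simp: fill_def)
    fix t1 \<sigma>1 assume 1: "t1 \<le> 8 * (Z * Suc mu) + 4 \<and> (\<forall>i<Z * Suc mu. keys (mem \<sigma>1 0) i = tape \<sigma> !! i) \<and> mem \<sigma>1 0 4 = mem \<sigma> 0 4"
      and v1: "valid_state b \<sigma>1" and ag1: "agree {3, 4, 6, 16, 29, 30} {0} \<sigma> \<sigma>1"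
    have e1: "env \<sigma>1" by (rule env_agree[OF e ag1 v1]) auto
    show "run (sortp F) (\<lambda>t2. run (pivots F) (\<lambda>t3. run (chains F) (\<lambda>t4. ?P (t1 + (t2 + (t3 + t4)))))) \<sigma>1"
    proof (rule callI[OF run_sortp[OF e1] v1 sortp_frame])
      fix t2 \<sigma>2 assume 2: "t2 \<le> T_sort \<and> (\<forall>p<n. mem \<sigma>2 2 p = el p)"
        and v2: "valid_state b \<sigma>2" and ag2: "agree ({3..6} \<union> {30..40} \<union> Fr) ({2, 3, 5} \<union> Fa) \<sigma>1 \<sigma>2"
      have e2: "env \<sigma>2" by (rule env_agree[OF e1 ag2 v2]) auto
      have m2: "mem \<sigma>2 0 = mem \<sigma>1 0" using ag2 by (simp add: agree_def)
      show "run (pivots F) (\<lambda>t3. run (chains F) (\<lambda>t4. ?P (t1 + (t2 + (t3 + t4))))) \<sigma>2"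
      proof (rule callI[OF run_pivots[OF e2] v2 pivots_frame])
        show "\<forall>p<n. mem \<sigma>2 2 p = el p" using 2 by blast
        fix t3 \<sigma>3 assume 3: "t3 \<le> T_piv \<and> pivots_ok (mem \<sigma>3 0) \<and> (\<forall>j<M. mem \<sigma>3 0 (5 * j + 1) = ds (el (j * B))) \<and>
            others_eq (mem \<sigma>2 0) (mem \<sigma>3 0) {0, 1}"
          and v3: "valid_state b \<sigma>3" and ag3: "agree ({3..9} \<union> {16, 30, 40, 41, 42, 45} \<union> Fr) ({0, 3, 4} \<union> Fa) \<sigma>2 \<sigma>3"
        have e3: "env \<sigma>3" by (rule env_agree[OF e2 ag3 v3]) auto
        show "run (chains F) (\<lambda>t4. ?P (t1 + (t2 + (t3 + t4)))) \<sigma>3"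
        proof (rule wp_mono[OF run_chains[OF e3]])
          show "pivots_ok (mem \<sigma>3 0)" using 3 by blast
          fix t4 \<sigma>4 assume 4: "t4 \<le> T_chains \<and> others_eq (mem \<sigma>3 0) (mem \<sigma>4 0) {3} \<and>
              (\<forall>t<r. slots_ok (keys (mem \<sigma>3 0)) (mem \<sigma>4 0) t m)"
          have o: "mem \<sigma>4 0 i = mem \<sigma>3 0 i" if "i mod 5 \<noteq> 3" for i using 4 that by (auto simp: others_eq_def)
          have o3: "mem \<sigma>3 0 i = mem \<sigma>2 0 i" if "i mod 5 \<notin> {0, 1}" for i using 3 that by (auto simp: others_eq_def)
          have V: "keys (mem \<sigma>4 0) = keys (mem \<sigma>3 0)" "keys (mem \<sigma>3 0) = keys (mem \<sigma>1 0)"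
            using cell_mod[of 2] o o3 unfolding keys_def m2[symmetric] by simp_all
          have "all_covered (keys (mem \<sigma>1 0))"
            using cov 1 all_covered_cong[of "keys (mem \<sigma>1 0)" "\<lambda>i. tape \<sigma> !! i"] by blast
          then have "ds_ok (mem \<sigma>4 0)"
            using 3 4 o V by (intro ds_ok_of_covered) (auto simp: pivots_ok_def)
          moreover have "mem \<sigma>4 0 4 = mem \<sigma> 0 4" using o[of 4] o3[of 4] m2 1 by simp
          moreover have "t1 + (t2 + (t3 + t4)) \<le> T_large"
          proof -
            have "t1 \<le> 8 * (Z * Suc mu) + 4" "t2 \<le> T_sort" "t3 \<le> T_piv" "t4 \<le> T_chains" using 1 2 3 4 by blast+
            moreover have "t1 + (t2 + (t3 + t4)) \<le> a + c + d + e" if "t1 \<le> a" "t2 \<le> c" "t3 \<le> d" "t4 \<le> e" for a c d e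
              using that by linarith
            ultimately show ?thesis by blast
          qed
          ultimately show "?P (t1 + (t2 + (t3 + t4))) \<sigma>4" by blast
        qed
      qed
    qed
  qed
  then show ?thesis by (simp only: wp_Seq)
qed

end

subsection \<open>The whole programs\<close>

text \<open>The bounds as functions of plain numbers, in which the growth rates can be discussed
  outside the locales.\<close>

definition construct_time :: "nat \<Rightarrow> nat \<Rightarrow> nat \<Rightarrow> nat \<Rightarrow> nat \<Rightarrow> nat \<Rightarrow> nat" where
  "construct_time w nu lam r \<tau> W = 8 * (r * 2 ^ lam * Suc (nu - lam)) + 4 +
     (w * (2 * (2 ^ nu * (T_lv \<tau> W + 10) + 3) + 5 * 2 ^ nu + 9) + 6 * 2 ^ nu + 6) +
     (2 ^ nu * (2 * T_lv \<tau> W + T_cmp W + 30) + 4) +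
     (r * (2 ^ (nu - 2 * lam - 2) * (T_adv (2 ^ lam) (nu - lam) \<tau> W + 10 + 3) + 6) + 3)"

definition build_time :: "nat \<Rightarrow> nat \<Rightarrow> nat \<Rightarrow> nat \<Rightarrow> nat \<Rightarrow> nat \<Rightarrow> nat \<Rightarrow> nat \<Rightarrow> nat" where
  "build_time b k0 w nu lam r \<tau> W = 24 * b + k0 + 80 + construct_time w nu lam r \<tau> W"

definition walk_time :: "nat \<Rightarrow> nat \<Rightarrow> nat \<Rightarrow> nat \<Rightarrow> nat \<Rightarrow> nat" where
  "walk_time B Z T \<tau> W = B * (Z * (T + 2 * T_kl \<tau> W + 12) + 5 + 2 * T_lv \<tau> W + T_cmp W + 23) + 10"

definition query_time :: "nat \<Rightarrow> nat \<Rightarrow> nat \<Rightarrow> nat \<Rightarrow> nat \<Rightarrow> nat \<Rightarrow> nat \<Rightarrow> nat" where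
  "query_time b k0 nu lam r \<tau> W = 17 * b + k0 + 80 + T_bs (nu - lam) (T_lv \<tau> W + T_cmp W + 6) +
     walk_time (2 ^ lam) (r * 2 ^ lam) (T_cand (2 ^ lam) (nu - lam) \<tau> W) \<tau> W"

locale large_problem = large_instance b inp N w k0 C lam nu Q
  for b :: nat and inp :: "nat \<Rightarrow> nat" and N w k0 C lam nu Q :: nat +
  fixes F :: com and f :: "nat \<Rightarrow> nat" and \<tau> :: nat
  assumes comp: "computes_within (real \<tau>) b inp F N w f" and f_range: "x < N \<Longrightarrow> f x < 2 ^ w"
begin

lemma instance_of_par:
  assumes "par 50 = N" "par 51 = w" "par 52 = 1" "par 53 = 0" "par 54 = b" "par 55 = words b w"
    "par 56 = 2 ^ nu" "par 57 = 2 ^ lam" "par 58 = 2 ^ lam" "par 59 = 2 ^ (nu - lam)" "par 60 = nu - lam"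
    "par 61 = Suc (nu - lam)" "par 62 = 2 ^ (nu - 2 * lam)" "par 63 = 2 ^ (nu - 2 * lam - 2)" "par 64 = rr"
    "par 65 = rr * 2 ^ lam" "par 66 = N div 2 ^ k0" "par 67 = 5" "par 69 = 2"
  shows "ram_large b inp N w F f \<tau> (2 ^ nu) par (2 ^ lam) (2 ^ (nu - lam)) (rr * 2 ^ lam) (nu - lam) (2 ^ lam)
    (2 ^ (nu - 2 * lam - 2)) (2 ^ (nu - 2 * lam)) rr Q"
proof -
  have "(2::nat) ^ (nu - lam) * 2 ^ lam = 2 ^ (nu - lam + lam)" by (rule power_add[symmetric])
  then have n: "(2::nat) ^ nu = 2 ^ (nu - lam) * 2 ^ lam" using nu(4) by simp
  have "(2::nat) ^ (nu - 2 * lam) * 2 ^ lam = 2 ^ (nu - 2 * lam + lam)" by (rule power_add[symmetric])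
  then have M: "(2::nat) ^ (nu - lam) = 2 ^ (nu - 2 * lam) * 2 ^ lam" using nu(4) by (simp add: mult_2)
  have "(2::nat) ^ 2 * 2 ^ (nu - 2 * lam - 2) = 2 ^ (2 + (nu - 2 * lam - 2))" by (rule power_add[symmetric])
  moreover have "2 + (nu - 2 * lam - 2) = nu - 2 * lam" using nu(4) by simp
  ultimately have m: "(2::nat) ^ (nu - 2 * lam) = 4 * 2 ^ (nu - 2 * lam - 2)" by (simp only: power2_eq_square)
  have "(2::nat) ^ nu < 2 ^ b" "(2::nat) ^ nu dvd 2 ^ b" using nu(3) by (auto intro: le_imp_power_dvd)
  note nb = this
  show ?thesis
  proof unfold_locales
    show "(2::nat) ^ nu = 2 ^ (nu - lam) * 2 ^ lam" by (rule n)
    show "(2::nat) ^ (nu - 2 * lam) = 4 * 2 ^ (nu - 2 * lam - 2)" by (rule m)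
    show "(2::nat) ^ (nu - lam) = 2 ^ (nu - 2 * lam) * 2 ^ lam" by (rule M)
  qed (use comp f_range nu(1) nb Q big assms in auto)
qed

lemma lparams_instance:
  assumes "lparams \<sigma>"
  shows "ram_large b inp N w F f \<tau> (2 ^ nu) (regs \<sigma>) (2 ^ lam) (2 ^ (nu - lam)) (rr * 2 ^ lam) (nu - lam) (2 ^ lam)
    (2 ^ (nu - 2 * lam - 2)) (2 ^ (nu - 2 * lam)) rr Q" (is ?L)
    and "ram.env b (regs \<sigma>) \<sigma>"
proof -
  have "5 < (2::nat) ^ b"
  proof -
    have "(2::nat) ^ (nu - lam) > 0" by simp
    then show ?thesis using Q(1,4) by linarith
  qed
  then show L: ?L using assms by (intro instance_of_par) (auto simp: lparams_def base_def)
  then interpret ram_large b inp N w F f \<tau> "2 ^ nu" "regs \<sigma>" "2 ^ lam" "2 ^ (nu - lam)" "rr * 2 ^ lam" "nu - lam" "2 ^ lam"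
    "2 ^ (nu - 2 * lam - 2)" "2 ^ (nu - 2 * lam)" rr Q .
  show "env \<sigma>" using assms by (auto simp: env_def lparams_def base_def)
qed

text \<open>Every run has its own instance of \<open>ram_large\<close>, with the register contents
  of that moment. The constants used here do not take these contents as arguments, so
  \<open>cov\<close> and \<open>good\<close> mean the same in all runs.\<close>

definition cov :: "(nat \<Rightarrow> nat) \<Rightarrow> bool" where
  "cov = ram_large.all_covered N f (2 ^ nu) (2 ^ lam) (nu - lam) (2 ^ lam) (2 ^ (nu - 2 * lam - 2)) (2 ^ (nu - 2 * lam)) rr"

definition good :: "(nat \<Rightarrow> nat) \<Rightarrow> bool" where
  "good D \<longleftrightarrow> D 4 = 2 ^ lam \<and> ram_large.ds_ok N f (2 ^ nu) (2 ^ lam) (2 ^ (nu - lam)) (rr * 2 ^ lam) (nu - lam)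
     (2 ^ lam) (2 ^ (nu - 2 * lam)) D"

abbreviation "W \<equiv> words b w"

lemma run_build_large:
  assumes v: "valid_state b \<sigma>" and r: "regs \<sigma> 0 = N" "regs \<sigma> 1 = w" "16 ^ lam \<le> regs \<sigma> 2" "regs \<sigma> 2 < 16 ^ Suc lam"
    and cov: "cov (\<lambda>i. tape \<sigma> !! i)"
  shows "run (buildp k0 C F) (\<lambda>t \<sigma>'. t \<le> build_time b k0 w nu lam rr \<tau> W \<and> good (mem \<sigma>' 0)) \<sigma>"
proof -
  let ?c4 = "fill ;; sortp F ;; pivots F ;; chains F"
  let ?c3 = "Const 4 4 ;; Store 0 4 58 ;; params C ;; ?c4"
  let ?P = "\<lambda>t \<sigma>'. t \<le> build_time b k0 w nu lam rr \<tau> W \<and> good (mem \<sigma>' 0)"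
  have "(0::nat) < 2 ^ (nu - lam)" by simp
  then have b4: "4 < (2::nat) ^ b" using Q(1,4) by linarith
  \<comment> \<open>\<open>find_ell\<close> uses the constant 16. The number \<open>rr\<close> of
    tables is at least 16 and at most \<open>Q\<close>, so 16 fits into a word.\<close>
  have b16: "(16::nat) < 2 ^ b"
  proof -
    have "rr * 2 ^ (nu - 2 * lam) \<le> Q" by (rule Q(3))
    moreover have "1 * 1 \<le> rr * 2 ^ (nu - 2 * lam)" using C nu(4) by (intro mult_le_mono) simp_all
    moreover have "16 * 1 * 1 \<le> rr" using C nu(4) by (intro mult_le_mono) simp_all
    moreover have "rr * 1 \<le> rr * 2 ^ (nu - 2 * lam)" by (intro mult_le_mono) simp_all
    ultimately show ?thesis using Q(4) by linarith
  qed
  have "run (prelude k0) (\<lambda>t1. run (IfNZ 66 (find_ell ;; ?c3) Skip) (\<lambda>t2. ?P (t1 + t2))) \<sigma>"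
  proof (rule callI[OF wp_norand[OF run_prelude[OF v r(1,2)] norand_prelude] v prelude_frame])
    fix t1 \<sigma>1 assume 1: "(t1 \<le> 3 * b + k0 + 20 \<and> base k0 N w \<sigma>1) \<and> tape \<sigma>1 = tape \<sigma>"
      and v1: "valid_state b \<sigma>1" and ag1: "agree ({4} \<union> {50..<70}) {} \<sigma> \<sigma>1"
    have r1: "regs \<sigma>1 2 = regs \<sigma> 2" "regs \<sigma>1 66 \<noteq> 0" "regs \<sigma>1 52 = 1" "regs \<sigma>1 54 = b"
      using ag1 1 big by (auto simp: agree_def base_def)
    have "run find_ell (\<lambda>t2. run ?c3 (\<lambda>t3. ?P (t1 + Suc (t2 + t3)))) \<sigma>1"
    proof (rule callI[OF wp_norand[OF run_find_ell norand_find_ell] v1 find_ell_frame])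
      fix t2 \<sigma>2 assume 2: "(t2 \<le> 7 * b + 10 \<and> regs \<sigma>2 58 = 2 ^ lam) \<and> tape \<sigma>2 = tape \<sigma>1"
        and v2: "valid_state b \<sigma>2" and ag2: "agree {3, 4, 5, 6, 7, 58} {} \<sigma>1 \<sigma>2"
      define \<sigma>3 where "\<sigma>3 = (set_reg 4 4 \<sigma>2)\<lparr>mem := (mem \<sigma>2)(0 := (mem \<sigma>2 0)(4 := 2 ^ lam))\<rparr>"
      have "(2::nat) ^ lam < 2 ^ b" using nu(3,4) by (intro power_strict_increasing) auto
      then have v3: "valid_state b \<sigma>3" using v2 b4 by (auto simp: \<sigma>3_def valid_state_def)
      have base3: "base k0 N w \<sigma>3" using 1 ag2 v3 by (auto simp: base_def agree_def \<sigma>3_def)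
      have eq: "run ?c3 R \<sigma>2 = run (params C ;; ?c4) (\<lambda>t. R (Suc (Suc t))) \<sigma>3" for R
        using b4 2 unfolding wp_Seq[of _ _ "params C"] by (simp add: wp_simps \<sigma>3_def)
      show "run ?c3 (\<lambda>t3. ?P (t1 + Suc (t2 + t3))) \<sigma>2"
        unfolding eq wp_Seq[of _ _ "params C"]
      proof (rule callI[OF wp_norand[OF run_params[OF base3] norand_params] v3 params_frame])
        fix t4 \<sigma>4 assume 4: "(t4 \<le> 14 * b + 40 \<and> lparams \<sigma>4) \<and> tape \<sigma>4 = tape \<sigma>3"
          and ag4: "agree ({3, 4, 5, 7} \<union> {56..<66} \<union> {68}) {} \<sigma>3 \<sigma>4"
        have lp: "lparams \<sigma>4" using 4 by blast
        have tape: "tape \<sigma>4 = tape \<sigma>" using 1 2 4 by (simp add: \<sigma>3_def)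
        have m4: "mem \<sigma>4 0 4 = 2 ^ lam" using ag4 by (simp add: agree_def \<sigma>3_def)
        show "run ?c4 (\<lambda>t. ?P (t1 + Suc (t2 + Suc (Suc (t4 + t))))) \<sigma>4"
        proof (rule wp_mono[OF ram_large.run_construct[OF lparams_instance[OF lp], folded construct_time_def]])
          fix t \<sigma>5 assume 5: "t \<le> construct_time w nu lam rr \<tau> W \<and>
            ram_large.ds_ok N f (2 ^ nu) (2 ^ lam) (2 ^ (nu - lam)) (rr * 2 ^ lam) (nu - lam) (2 ^ lam) (2 ^ (nu - 2 * lam)) (mem \<sigma>5 0) \<and>
            mem \<sigma>5 0 4 = mem \<sigma>4 0 4"
          then show "?P (t1 + Suc (t2 + Suc (Suc (t4 + t)))) \<sigma>5"
            using 1 2 4 m4 unfolding good_def build_time_def by auto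
        qed (use cov tape in \<open>simp add: cov_def\<close>)
      qed (use 2 in \<open>simp add: \<sigma>3_def\<close>)
    qed (use v1 r r1 b16 nu in auto)
    then show "run (IfNZ 66 (find_ell ;; ?c3) Skip) (\<lambda>t2. ?P (t1 + t2)) \<sigma>1"
      using r1 by (simp add: wp_Seq wp_simps)
  qed
  then show ?thesis by (simp only: buildp_def wp_Seq[of _ _ "prelude k0"])
qed

text \<open>The common beginning of both queries. The remaining program \<open>c\<close> starts with
  all parameters restored from cell 4 and with a memory that contains a correct structure.\<close>

lemma run_query_large:
  assumes v: "valid_state b \<sigma>" and r: "regs \<sigma> 0 = N" "regs \<sigma> 1 = w"
    and D: "good D" "\<And>i. i < 5 * Q + 5 \<Longrightarrow> mem \<sigma> 0 i = D i"
    and c: "\<And>\<sigma>'. lparams \<sigma>' \<Longrightarrow> mem \<sigma>' = mem \<sigma> \<Longrightarrow> regs \<sigma>' 46 = regs \<sigma> 46 \<Longrightarrow>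
      ram_large.ds_ok N f (2 ^ nu) (2 ^ lam) (2 ^ (nu - lam)) (rr * 2 ^ lam) (nu - lam) (2 ^ lam) (2 ^ (nu - 2 * lam)) (mem \<sigma>' 0) \<Longrightarrow>
      run c (\<lambda>t \<sigma>''. t \<le> T \<and> P \<sigma>'') \<sigma>'"
  shows "run (prelude k0 ;; IfNZ 66 (Const 4 4 ;; Load 58 0 4 ;; params C ;; c) c')
    (\<lambda>t \<sigma>'. t \<le> 17 * b + k0 + 70 + T \<and> P \<sigma>') \<sigma>"
proof -
  let ?P = "\<lambda>t \<sigma>'. t \<le> 17 * b + k0 + 70 + T \<and> P \<sigma>'"
  have "(0::nat) < 2 ^ (nu - lam)" by simp
  then have b4: "4 < (2::nat) ^ b" using Q(1,4) by linarith
  have "run (prelude k0) (\<lambda>t1. run (IfNZ 66 (Const 4 4 ;; Load 58 0 4 ;; params C ;; c) c') (\<lambda>t2. ?P (t1 + t2))) \<sigma>"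
  proof (rule callI[OF run_prelude[OF v r] v prelude_frame])
    fix t1 \<sigma>1 assume 1: "t1 \<le> 3 * b + k0 + 20 \<and> base k0 N w \<sigma>1"
      and v1: "valid_state b \<sigma>1" and ag1: "agree ({4} \<union> {50..<70}) {} \<sigma> \<sigma>1"
    have m1: "mem \<sigma>1 = mem \<sigma>" "regs \<sigma>1 46 = regs \<sigma> 46" using ag1 by (auto simp: agree_def)
    have r1: "regs \<sigma>1 66 \<noteq> 0" using 1 big by (simp add: base_def)
    have D4: "mem \<sigma> 0 4 = 2 ^ lam" using D by (simp add: good_def)
    define \<sigma>2 where "\<sigma>2 = set_reg 58 (2 ^ lam) (set_reg 4 4 \<sigma>1)"
    have "(2::nat) ^ lam < 2 ^ b" using nu(3,4) by (intro power_strict_increasing) auto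
    then have v2: "valid_state b \<sigma>2" using v1 b4 by (auto simp: \<sigma>2_def valid_state_def)
    have base2: "base k0 N w \<sigma>2" using 1 v2 by (auto simp: base_def \<sigma>2_def)
    have "run (params C) (\<lambda>t2. run c (\<lambda>t. ?P (t1 + Suc (Suc (Suc (t2 + t)))))) \<sigma>2"
    proof (rule callI[OF run_params[OF base2] v2 params_frame])
      fix t3 \<sigma>3 assume 3: "t3 \<le> 14 * b + 40 \<and> lparams \<sigma>3"
        and ag3: "agree ({3, 4, 5, 7} \<union> {56..<66} \<union> {68}) {} \<sigma>2 \<sigma>3"
      have lp: "lparams \<sigma>3" using 3 by blast
      have m3: "mem \<sigma>3 = mem \<sigma>" "regs \<sigma>3 46 = regs \<sigma> 46" using ag3 m1 by (auto simp: agree_def \<sigma>2_def)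
      show "run c (\<lambda>t. ?P (t1 + Suc (Suc (Suc (t3 + t))))) \<sigma>3"
      proof (rule wp_mono[OF c[OF lp m3]])
        show "ram_large.ds_ok N f (2 ^ nu) (2 ^ lam) (2 ^ (nu - lam)) (rr * 2 ^ lam) (nu - lam) (2 ^ lam) (2 ^ (nu - 2 * lam)) (mem \<sigma>3 0)"
          using D unfolding m3 good_def by (intro ram_large.ds_ok_cong[OF lparams_instance(1)[OF lp], of "mem \<sigma> 0" D]) auto
      qed (use 1 3 in auto)
    qed (simp add: \<sigma>2_def)
    then show "run (IfNZ 66 (Const 4 4 ;; Load 58 0 4 ;; params C ;; c) c') (\<lambda>t2. ?P (t1 + t2)) \<sigma>1"
      unfolding wp_simps wp_Seq using r1 b4 D4 m1 by (simp add: \<sigma>2_def)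
  qed
  then show ?thesis by (simp only: wp_Seq[of _ _ "prelude k0"])
qed

lemma run_rankp_large:
  assumes v: "valid_state b \<sigma>" and r: "regs \<sigma> 0 = N" "regs \<sigma> 1 = w"
    and D: "good D" "\<And>i. i < 5 * Q + 5 \<Longrightarrow> mem \<sigma> 0 i = D i"
    and y: "holds_int b w (mem \<sigma> 1) y" "y < 2 ^ w"
  shows "run (rankp k0 C F) (\<lambda>t \<sigma>'. t \<le> query_time b k0 nu lam rr \<tau> W \<and> regs \<sigma>' 0 = card {x \<in> {..<N}. f x < y}) \<sigma>"
proof -
  let ?T = "T_bs (nu - lam) (T_lv \<tau> W + T_cmp W + 6) + 10 +
     walk_time (2 ^ lam) (rr * 2 ^ lam) (T_cand (2 ^ lam) (nu - lam) \<tau> W) \<tau> W"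
  have T: "T_bs (nu - lam) (T_lv \<tau> W + T_cmp W + 6) + 2 +
      (2 ^ lam * (rr * 2 ^ lam * (T_cand (2 ^ lam) (nu - lam) \<tau> W + 2 * T_kl \<tau> W + 12) + 5 + T_lv \<tau> W + T_cmp W + 8) + 10) \<le> ?T"
    unfolding walk_time_def by (intro add_mono mult_le_mono order_refl) simp_all
  have "run (prelude k0 ;; IfNZ 66 (Const 4 4 ;; Load 58 0 4 ;; params C ;; rank_find F ;; rank_walk F)
     (small_params ;; Const 45 0 ;; Const 31 0 ;; rank_walk F))
     (\<lambda>t \<sigma>'. t \<le> 17 * b + k0 + 70 + ?T \<and> regs \<sigma>' 0 = card {x \<in> {..<N}. f x < y}) \<sigma>"
  proof (rule run_query_large[OF v r D])
    fix \<sigma>' assume lp: "lparams \<sigma>'" and m: "mem \<sigma>' = mem \<sigma>"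
      and ds: "ram_large.ds_ok N f (2 ^ nu) (2 ^ lam) (2 ^ (nu - lam)) (rr * 2 ^ lam) (nu - lam) (2 ^ lam) (2 ^ (nu - 2 * lam)) (mem \<sigma>' 0)"
    show "run (rank_find F ;; rank_walk F) (\<lambda>t \<sigma>''. t \<le> ?T \<and> regs \<sigma>'' 0 = card {x \<in> {..<N}. f x < y}) \<sigma>'"
      by (rule wp_mono[OF ram_large.run_rank_large[OF lparams_instance[OF lp] ds, of y]])
        (use y m le_trans[OF _ T] in \<open>auto simp del: add_mult_distrib add_mult_distrib2\<close>)
  qed
  then show ?thesis unfolding rankp_def by (rule wp_mono) (auto simp: query_time_def)
qed

lemma run_selectp_large:
  assumes v: "valid_state b \<sigma>" and r: "regs \<sigma> 0 = N" "regs \<sigma> 1 = w" "regs \<sigma> 2 = k"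
    and D: "good D" "\<And>i. i < 5 * Q + 5 \<Longrightarrow> mem \<sigma> 0 i = D i"
  shows "run (selectp k0 C F) (\<lambda>t \<sigma>'. t \<le> query_time b k0 nu lam rr \<tau> W \<and>
    (if \<exists>x. is_kth_largest f N k x then regs \<sigma>' 0 = 1 \<and> is_kth_largest f N k (regs \<sigma>' 1) else regs \<sigma>' 0 = 0)) \<sigma>"
proof -
  define P where "P \<sigma>' \<longleftrightarrow> (if \<exists>x. is_kth_largest f N k x then regs \<sigma>' 0 = 1 \<and> is_kth_largest f N k (regs \<sigma>' 1) else regs \<sigma>' 0 = 0)" for \<sigma>' :: state
  define \<sigma>0 where "\<sigma>0 = set_reg 46 k \<sigma>"
  have v0: "valid_state b \<sigma>0" using v r(3) by (auto simp: \<sigma>0_def valid_state_def)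
  let ?T = "T_bs (nu - lam) (T_lv \<tau> W + T_cmp W + 6) + 9 +
     walk_time (2 ^ lam) (rr * 2 ^ lam) (T_cand (2 ^ lam) (nu - lam) \<tau> W) \<tau> W"
  have T: "T_bs (nu - lam) 6 + 5 +
      (2 ^ lam * (rr * 2 ^ lam * (T_cand (2 ^ lam) (nu - lam) \<tau> W + 2 * T_kl \<tau> W + 12) + 5 + 2 * T_lv \<tau> W + T_cmp W + 23) + 10) \<le> ?T"
    unfolding walk_time_def by (intro add_mono mult_le_mono order_refl) simp_all
  have "run (prelude k0 ;; IfNZ 66 (Const 4 4 ;; Load 58 0 4 ;; params C ;; select_find ;; select_walk F)
     (small_params ;; Const 45 0 ;; Const 31 0 ;; select_walk F))
     (\<lambda>t \<sigma>'. t \<le> 17 * b + k0 + 70 + ?T \<and> P \<sigma>') \<sigma>0"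
  proof (rule run_query_large[OF v0 _ _ D(1)])
    fix \<sigma>' assume lp: "lparams \<sigma>'" and k: "regs \<sigma>' 46 = regs \<sigma>0 46"
      and ds: "ram_large.ds_ok N f (2 ^ nu) (2 ^ lam) (2 ^ (nu - lam)) (rr * 2 ^ lam) (nu - lam) (2 ^ lam) (2 ^ (nu - 2 * lam)) (mem \<sigma>' 0)"
    have k: "regs \<sigma>' 46 = k" using k by (simp add: \<sigma>0_def)
    show "run (select_find ;; select_walk F) (\<lambda>t \<sigma>''. t \<le> ?T \<and> P \<sigma>'') \<sigma>'"
      by (rule wp_mono[OF ram_large.run_select_large[OF lparams_instance[OF lp] ds, unfolded k, folded P_def]])
        (use le_trans[OF _ T] in blast)
  qed (use r D in \<open>simp_all add: \<sigma>0_def\<close>)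
  then have "run (Copy 46 2 ;; (prelude k0 ;; IfNZ 66 (Const 4 4 ;; Load 58 0 4 ;; params C ;; select_find ;; select_walk F)
     (small_params ;; Const 45 0 ;; Const 31 0 ;; select_walk F)))
     (\<lambda>t \<sigma>'. t \<le> Suc (17 * b + k0 + 70 + ?T) \<and> P \<sigma>') \<sigma>"
    unfolding wp_Seq[of _ _ "Copy 46 2"] using r by (simp add: wp_Copy \<sigma>0_def)
  then have "run (selectp k0 C F) (\<lambda>t \<sigma>'. t \<le> query_time b k0 nu lam rr \<tau> W \<and> P \<sigma>') \<sigma>"
    unfolding selectp_def by (rule wp_mono) (auto simp: query_time_def)
  then show ?thesis unfolding P_def .
qed

end

locale small_problem = machine b inp for b :: nat and inp :: "nat \<Rightarrow> nat" +
  fixes N w k0 :: nat and F :: com and f :: "nat \<Rightarrow> nat" and \<tau> :: nat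
  assumes comp: "computes_within (real \<tau>) b inp F N w f" and f_range: "x < N \<Longrightarrow> f x < 2 ^ w"
    and small: "N div 2 ^ k0 = 0" "N > 0" "N < 2 ^ b"
begin

lemma run_build_small:
  assumes v: "valid_state b \<sigma>" and r: "regs \<sigma> 0 = N" "regs \<sigma> 1 = w"
  shows "run (buildp k0 C F) (\<lambda>t \<sigma>'. t \<le> 3 * b + k0 + 22) \<sigma>"
proof -
  have "run (prelude k0) (\<lambda>t1. run (IfNZ 66 c Skip) (\<lambda>t2 \<sigma>'. t1 + t2 \<le> 3 * b + k0 + 22)) \<sigma>" for c
    by (rule wp_mono[OF run_prelude[OF v r]]) (use small in \<open>auto simp: base_def wp_simps\<close>)
  then show ?thesis by (simp only: buildp_def wp_Seq[of _ _ "prelude k0"])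
qed

lemma run_query_small:
  assumes v: "valid_state b \<sigma>" and r: "regs \<sigma> 0 = N" "regs \<sigma> 1 = w"
    and c: "\<And>\<sigma>' par. ram_small b inp N w F f \<tau> N par N 1 N \<Longrightarrow> ram.env b par \<sigma>' \<Longrightarrow> mem \<sigma>' = mem \<sigma> \<Longrightarrow>
      regs \<sigma>' 46 = regs \<sigma> 46 \<Longrightarrow> regs \<sigma>' 31 = 0 \<Longrightarrow> regs \<sigma>' 45 = 0 \<Longrightarrow> run c (\<lambda>t \<sigma>''. t \<le> T \<and> P \<sigma>'') \<sigma>'"
  shows "run (prelude k0 ;; IfNZ 66 c' (small_params ;; Const 45 0 ;; Const 31 0 ;; c))
    (\<lambda>t \<sigma>'. t \<le> 3 * b + k0 + 30 + T \<and> P \<sigma>') \<sigma>"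
proof -
  let ?P = "\<lambda>t \<sigma>'. t \<le> 3 * b + k0 + 30 + T \<and> P \<sigma>'"
  have "run (prelude k0) (\<lambda>t1. run (IfNZ 66 c' (small_params ;; Const 45 0 ;; Const 31 0 ;; c)) (\<lambda>t2. ?P (t1 + t2))) \<sigma>"
  proof (rule callI[OF run_prelude[OF v r] v prelude_frame])
    fix t1 \<sigma>1 assume 1: "t1 \<le> 3 * b + k0 + 20 \<and> base k0 N w \<sigma>1"
      and v1: "valid_state b \<sigma>1" and ag1: "agree ({4} \<union> {50..<70}) {} \<sigma> \<sigma>1"
    define \<sigma>2 where "\<sigma>2 = set_reg 31 0 (set_reg 45 0 (set_reg 65 N (set_reg 57 N (set_reg 56 N \<sigma>1))))"
    have v2: "valid_state b \<sigma>2" using v1 small(3) by (auto simp: \<sigma>2_def valid_state_def)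
    have s: "ram_small b inp N w F f \<tau> N (regs \<sigma>2) N 1 N"
      using 1 comp f_range small by unfold_locales (auto simp: base_def \<sigma>2_def)
    have r1: "regs \<sigma>1 66 = 0" "regs \<sigma>1 50 = N" using 1 small by (auto simp: base_def)
    have e: "ram.env b (regs \<sigma>2) \<sigma>2"
      using v2 ram.env_def[OF ram_buckets.axioms(1)[OF ram_small.axioms(1)[OF s]]] by blast
    have m: "mem \<sigma>2 = mem \<sigma>" "regs \<sigma>2 46 = regs \<sigma> 46" using ag1 by (auto simp: agree_def \<sigma>2_def)
    have "run c (\<lambda>t. ?P (t1 + (6 + t))) \<sigma>2"
      by (rule wp_mono[OF c[OF s e m]]) (use 1 in \<open>auto simp: \<sigma>2_def\<close>)
    then show "run (IfNZ 66 c' (small_params ;; Const 45 0 ;; Const 31 0 ;; c)) (\<lambda>t2. ?P (t1 + t2)) \<sigma>1"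
      using r1 by (simp add: wp_simps wp_Copy small_params_def \<sigma>2_def)
  qed
  then show ?thesis by (simp only: wp_Seq[of _ _ "prelude k0"])
qed

abbreviation T_query_small :: nat where
  "T_query_small \<equiv> 3 * b + k0 + 31 + walk_time N N 5 \<tau> (words b w)"

lemma run_rankp_small:
  assumes v: "valid_state b \<sigma>" and r: "regs \<sigma> 0 = N" "regs \<sigma> 1 = w"
    and y: "holds_int b w (mem \<sigma> 1) y" "y < 2 ^ w"
  shows "run (rankp k0 C F) (\<lambda>t \<sigma>'. t \<le> T_query_small \<and> regs \<sigma>' 0 = card {x \<in> {..<N}. f x < y}) \<sigma>"
proof -
  have T: "N * (N * (5 + 2 * T_kl \<tau> (words b w) + 12) + 5 + T_lv \<tau> (words b w) + T_cmp (words b w) + 8) + 10 \<le> walk_time N N 5 \<tau> (words b w)"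
    unfolding walk_time_def by (intro add_mono mult_le_mono order_refl) simp_all
  have "run (rankp k0 C F) (\<lambda>t \<sigma>'. t \<le> 3 * b + k0 + 30 + walk_time N N 5 \<tau> (words b w) \<and> regs \<sigma>' 0 = card {x \<in> {..<N}. f x < y}) \<sigma>"
    unfolding rankp_def
  proof (rule run_query_small[OF v r])
    fix \<sigma>' par assume s: "ram_small b inp N w F f \<tau> N par N 1 N" and e: "ram.env b par \<sigma>'" and m: "mem \<sigma>' = mem \<sigma>"
      and z: "regs \<sigma>' 31 = 0" "regs \<sigma>' 45 = 0"
    show "run (rank_walk F) (\<lambda>t \<sigma>'. t \<le> walk_time N N 5 \<tau> (words b w) \<and> regs \<sigma>' 0 = card {x \<in> {..<N}. f x < y}) \<sigma>'"
      by (rule wp_mono[OF ram_small.run_rank_small[OF s e, of y]]) (use y m z le_trans[OF _ T] in \<open>auto simp del: add_mult_distrib add_mult_distrib2\<close>)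
  qed
  then show ?thesis by (rule wp_mono) auto
qed

lemma run_selectp_small:
  assumes v: "valid_state b \<sigma>" and r: "regs \<sigma> 0 = N" "regs \<sigma> 1 = w" "regs \<sigma> 2 = k"
  shows "run (selectp k0 C F) (\<lambda>t \<sigma>'. t \<le> T_query_small \<and>
    (if \<exists>x. is_kth_largest f N k x then regs \<sigma>' 0 = 1 \<and> is_kth_largest f N k (regs \<sigma>' 1) else regs \<sigma>' 0 = 0)) \<sigma>"
proof -
  define P where "P \<sigma>' \<longleftrightarrow> (if \<exists>x. is_kth_largest f N k x then regs \<sigma>' 0 = 1 \<and> is_kth_largest f N k (regs \<sigma>' 1) else regs \<sigma>' 0 = 0)" for \<sigma>' :: state
  define \<sigma>0 where "\<sigma>0 = set_reg 46 k \<sigma>"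
  have v0: "valid_state b \<sigma>0" using v r(3) by (auto simp: \<sigma>0_def valid_state_def)
  have "run (prelude k0 ;; IfNZ 66 c (small_params ;; Const 45 0 ;; Const 31 0 ;; select_walk F))
     (\<lambda>t \<sigma>'. t \<le> 3 * b + k0 + 30 + walk_time N N 5 \<tau> (words b w) \<and> P \<sigma>') \<sigma>0" for c
  proof (rule run_query_small[OF v0])
    fix \<sigma>' par assume s: "ram_small b inp N w F f \<tau> N par N 1 N" and e: "ram.env b par \<sigma>'"
      and k: "regs \<sigma>' 46 = regs \<sigma>0 46" and z: "regs \<sigma>' 31 = 0" "regs \<sigma>' 45 = 0"
    have k: "regs \<sigma>' 46 = k" using k by (simp add: \<sigma>0_def)
    show "run (select_walk F) (\<lambda>t \<sigma>'. t \<le> walk_time N N 5 \<tau> (words b w) \<and> P \<sigma>') \<sigma>'"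
      by (rule ram_small.run_select_small[OF s e z, unfolded k, folded walk_time_def P_def])
  qed (use r in \<open>simp_all add: \<sigma>0_def\<close>)
  then have "run (prelude k0 ;; IfNZ 66 c (small_params ;; Const 45 0 ;; Const 31 0 ;; select_walk F))
     (\<lambda>t \<sigma>'. Suc t \<le> T_query_small \<and> P \<sigma>') \<sigma>0" for c
    by (rule wp_mono) auto
  then have "run (Copy 46 2 ;; (prelude k0 ;; IfNZ 66 c (small_params ;; Const 45 0 ;; Const 31 0 ;; select_walk F)))
     (\<lambda>t \<sigma>'. t \<le> T_query_small \<and> P \<sigma>') \<sigma>" for c
    unfolding wp_Seq[of _ _ "Copy 46 2"] using r by (simp add: wp_Copy \<sigma>0_def)
  then show ?thesis unfolding selectp_def P_def .
qed

end

section \<open>Support of the queries and the probability of success\<close>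

lemma supports_rankingI:
  assumes "\<And>y \<sigma>. y < 2 ^ w \<Longrightarrow> valid_state b \<sigma> \<Longrightarrow> regs \<sigma> 0 = N \<Longrightarrow> regs \<sigma> 1 = w \<Longrightarrow> (\<And>i. i < s \<Longrightarrow> mem \<sigma> 0 i = D i) \<Longrightarrow>
      holds_int b w (mem \<sigma> 1) y \<Longrightarrow> wp b inp c (\<lambda>t \<sigma>'. t \<le> T \<and> regs \<sigma>' 0 = card {x \<in> {..<N}. f x < y}) \<sigma>"
    and "0 \<notin> moda c" "real T \<le> T'"
  shows "supports_ranking T' b inp c N w f s D"
  unfolding supports_ranking_def
proof (intro allI impI)
  fix y \<sigma> assume y: "y < 2 ^ w" "valid_state b \<sigma>" "regs \<sigma> 0 = N" "regs \<sigma> 1 = w" "\<forall>i<s. mem \<sigma> 0 i = D i"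
    "holds_int b w (mem \<sigma> 1) y"
  then obtain n \<sigma>' where e: "exec b inp c \<sigma> n \<sigma>'" and n: "n \<le> T" "regs \<sigma>' 0 = card {x \<in> {..<N}. f x < y}"
    using assms(1)[of y \<sigma>] unfolding wp_def by blast
  have "mem \<sigma>' 0 = mem \<sigma> 0" using agree_mem[OF exec_agree[OF e] assms(2)] .
  then show "\<exists>n \<sigma>'. exec b inp c \<sigma> n \<sigma>' \<and> real n \<le> T' \<and> (\<forall>i<s. mem \<sigma>' 0 i = D i) \<and>
      regs \<sigma>' 0 = card {x \<in> {..<N}. f x < y}"
    using e n y assms(3) by (intro exI[of _ n] exI[of _ \<sigma>']) auto
qed

lemma supports_selectionI:
  assumes "\<And>k \<sigma>. valid_state b \<sigma> \<Longrightarrow> regs \<sigma> 0 = N \<Longrightarrow> regs \<sigma> 1 = w \<Longrightarrow> regs \<sigma> 2 = k \<Longrightarrow> (\<And>i. i < s \<Longrightarrow> mem \<sigma> 0 i = D i) \<Longrightarrow>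
      wp b inp c (\<lambda>t \<sigma>'. t \<le> T \<and> (if \<exists>x. is_kth_largest f N k x
        then regs \<sigma>' 0 = 1 \<and> is_kth_largest f N k (regs \<sigma>' 1) else regs \<sigma>' 0 = 0)) \<sigma>"
    and "0 \<notin> moda c" "real T \<le> T'"
  shows "supports_selection T' b inp c N w f s D"
  unfolding supports_selection_def
proof (intro allI impI)
  fix k \<sigma> assume k: "valid_state b \<sigma>" "regs \<sigma> 0 = N" "regs \<sigma> 1 = w" "regs \<sigma> 2 = k" "\<forall>i<s. mem \<sigma> 0 i = D i"
  define P where "P \<sigma>' \<longleftrightarrow> (if \<exists>x. is_kth_largest f N k x
        then regs \<sigma>' 0 = 1 \<and> is_kth_largest f N k (regs \<sigma>' 1) else regs \<sigma>' 0 = 0)" for \<sigma>' :: state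
  obtain n \<sigma>' where e: "exec b inp c \<sigma> n \<sigma>'" and n: "n \<le> T" "P \<sigma>'"
    using assms(1)[of \<sigma> k, folded P_def] k unfolding wp_def by blast
  have "mem \<sigma>' 0 = mem \<sigma> 0" using agree_mem[OF exec_agree[OF e] assms(2)] .
  then have "\<exists>n \<sigma>'. exec b inp c \<sigma> n \<sigma>' \<and> real n \<le> T' \<and> (\<forall>i<s. mem \<sigma>' 0 i = D i) \<and> P \<sigma>'"
    using e n k assms(3) by (intro exI[of _ n] exI[of _ \<sigma>']) auto
  then show "\<exists>n \<sigma>'. exec b inp c \<sigma> n \<sigma>' \<and> real n \<le> T' \<and> (\<forall>i<s. mem \<sigma>' 0 i = D i) \<and>
     (if \<exists>x. is_kth_largest f N k x then regs \<sigma>' 0 = 1 \<and> is_kth_largest f N k (regs \<sigma>' 1) else regs \<sigma>' 0 = 0)"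
    unfolding P_def .
qed

lemma zero_notin_moda: "0 \<notin> moda (rankp k0 C F)" "0 \<notin> moda (selectp k0 C F)"
  using moda_rankp[of k0 C F] moda_selectp[of k0 C F] by auto

context large_problem
begin

lemma supports_large:
  assumes "good D" "real (query_time b k0 nu lam rr \<tau> W) \<le> T"
  shows "supports_ranking T b inp (rankp k0 C F) N w f (5 * Q + 5) D"
    and "supports_selection T b inp (selectp k0 C F) N w f (5 * Q + 5) D"
  by (rule supports_rankingI[OF run_rankp_large _ assms(2)] supports_selectionI[OF run_selectp_large _ assms(2)];
      (rule zero_notin_moda assms(1))?; assumption?)+

text \<open>\<open>(1 - 1 / (16 * B)) ^ r\<close> is at most \<open>exp (- r / (16 * B))\<close>,
  and the number \<open>r = 16 * C * nu * B\<close> of tables is chosen to make the exponent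
  \<open>- C * nu\<close>.\<close>

lemma prob_cov: "measure (random_tape b) {\<omega>. cov (\<lambda>i. \<omega> !! i)} \<ge> 1 - 2 ^ nu * exp (- real (C * nu))"
  and sets_cov: "{\<omega>. cov (\<lambda>i. \<omega> !! i)} \<in> sets (random_tape b)"
proof -
  \<comment> \<open>The event involves no machine state, but the locale asks for register contents,
    so a fixed choice with the right parameters is supplied.\<close>
  define par :: "nat \<Rightarrow> nat" where "par = (\<lambda>r. if r = 50 then N else if r = 51 then w else if r = 52 then 1 else if r = 53 then 0
    else if r = 54 then b else if r = 55 then W else if r = 56 then 2 ^ nu else if r = 57 \<or> r = 58 then 2 ^ lam
    else if r = 59 then 2 ^ (nu - lam) else if r = 60 then nu - lam else if r = 61 then Suc (nu - lam)
    else if r = 62 then 2 ^ (nu - 2 * lam) else if r = 63 then 2 ^ (nu - 2 * lam - 2) else if r = 64 then rr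
    else if r = 65 then rr * 2 ^ lam else if r = 66 then N div 2 ^ k0 else if r = 67 then 5 else 2)"
  interpret L: ram_large b inp N w F f \<tau> "2 ^ nu" par "2 ^ lam" "2 ^ (nu - lam)" "rr * 2 ^ lam" "nu - lam" "2 ^ lam"
    "2 ^ (nu - 2 * lam - 2)" "2 ^ (nu - 2 * lam)" rr Q
    by (rule instance_of_par) (simp_all only: par_def, simp_all)
  let ?K = "rr * (2 ^ lam * Suc (nu - lam))"
  have m': "(2::nat) ^ (nu - 2 * lam) dvd 2 ^ (nu - lam)" "(2::nat) ^ (nu - 2 * lam) > 0"
    using L.m'(2) by (metis dvd_triv_left) simp
  have cov: "cov V \<longleftrightarrow> \<not> (\<exists>x<2 ^ nu. \<forall>t<rr. \<not> L.covered (4 * 2 ^ (nu - 2 * lam - 2)) (2 ^ (nu - 2 * lam - 2)) (2 ^ lam)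
      (\<lambda>i. V (t * (2 ^ lam * Suc (nu - lam)) + i)) x)" for V
    unfolding cov_def L.all_covered_def L.m'(1)[symmetric] by blast
  have local: "cov V = cov V'" if V: "\<And>i. i < ?K \<Longrightarrow> V i = V' i" for V V'
    unfolding cov_def using V by (intro L.all_covered_cong) (simp only: mult.assoc)
  show "{\<omega>. cov (\<lambda>i. \<omega> !! i)} \<in> sets (random_tape b)"
    using local by (rule measure_random_tape_prefix)
  have bound: "(1 - 1 / (16 * real (2 ^ lam))) ^ rr \<le> exp (- real (C * nu))"
  proof -
    let ?x = "1 / (16 * real (2 ^ lam))"
    have "1 * 1 \<le> 16 * (2::real) ^ lam" by (intro mult_mono) auto
    then have "?x \<le> 1" by (simp add: divide_le_eq)
    then have "(1 - ?x) ^ rr \<le> exp (- ?x) ^ rr"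
      using exp_ge_add_one_self[of "- ?x"] by (intro power_mono) auto
    also have "\<dots> = exp (real rr * - ?x)" by (rule exp_of_nat_mult[symmetric])
    also have "real rr * - ?x = - real (C * nu)" by (simp add: field_simps)
    finally show ?thesis .
  qed
  have "measure (random_tape b) {\<omega>. cov (\<lambda>i. \<omega> !! i)} = avg (2 ^ b) ?K (\<lambda>V. of_bool (cov V))"
    using local by (rule measure_random_tape_prefix)
  also have "\<dots> = avg (2 ^ b) ?K (\<lambda>V. 1 - of_bool (\<exists>x<2 ^ nu. \<forall>t<rr. \<not> L.covered (4 * 2 ^ (nu - 2 * lam - 2)) (2 ^ (nu - 2 * lam - 2)) (2 ^ lam)
      (\<lambda>i. V (t * (2 ^ lam * Suc (nu - lam)) + i)) x))"
    unfolding cov by (intro avg_cong) simp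
  also have "\<dots> \<ge> 1 - real (2 ^ nu) * (1 - 1 / (16 * real (2 ^ lam))) ^ rr"
    unfolding avg_diff using L.prob_all_covered[of "2 ^ (nu - 2 * lam - 2)" "2 ^ lam" rr] L.m' by simp
  finally show "measure (random_tape b) {\<omega>. cov (\<lambda>i. \<omega> !! i)} \<ge> 1 - 2 ^ nu * exp (- real (C * nu))"
    using mult_left_mono[OF bound of_nat_0_le_iff[of "2 ^ nu"]] unfolding of_nat_power of_nat_numeral by linarith
qed

end

context small_problem
begin

lemma supports_small:
  assumes "real T_query_small \<le> T"
  shows "supports_ranking T b inp (rankp k0 C F) N w f 0 D"
    and "supports_selection T b inp (selectp k0 C F) N w f 0 D"
  by (rule supports_rankingI[OF run_rankp_small _ assms] supports_selectionI[OF run_selectp_small _ assms];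
      (rule zero_notin_moda)?; assumption?)+

end

text \<open>The programs are verified for valid states only, and a random tape is valid almost
  surely.\<close>

lemma AE_valid_tape: "AE \<omega> in random_tape b. sset \<omega> \<subseteq> {..<2 ^ b}"
proof -
  let ?M = "measure_pmf (pmf_of_set {..<(2::nat) ^ b})"
  have "AE x in ?M. x \<in> {..<2 ^ b}" by (subst AE_measure_pmf_iff) (auto simp: set_pmf_of_set lessThan_empty_iff)
  then have "AE \<omega> in random_tape b. stream_all (\<lambda>x. x \<in> {..<2 ^ b}) \<omega>"
    unfolding random_tape_def by (intro prob_space.AE_stream_all[OF measure_pmf.prob_space_axioms]) auto
  then show ?thesis
    by eventually_elim (auto simp: stream_all_def sset_range)
qed

lemma exec_outcome_prefix:
  assumes "exec b inp c (\<sigma>\<lparr>tape := \<omega>\<rparr>) n \<sigma>'" "n \<le> K" "\<And>i. i < K \<Longrightarrow> \<omega> !! i = \<omega>' !! i"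
  shows "\<exists>\<sigma>''. exec b inp c (\<sigma>\<lparr>tape := \<omega>'\<rparr>) n \<sigma>'' \<and> mem \<sigma>'' = mem \<sigma>'"
proof -
  obtain m where m: "m \<le> n" and ex: "\<And>\<omega>'. exec b inp c (\<sigma>\<lparr>tape := stake m \<omega> @- \<omega>'\<rparr>) n (\<sigma>'\<lparr>tape := \<omega>'\<rparr>)"
    using exec_tape_prefix[OF assms(1)] by auto
  have "stake m \<omega> = stake m \<omega>'" using m assms(2,3) by (intro nth_equalityI) auto
  then have "stake m \<omega> @- sdrop m \<omega>' = \<omega>'" by (simp add: stake_sdrop)
  then have "exec b inp c (\<sigma>\<lparr>tape := \<omega>'\<rparr>) n (\<sigma>'\<lparr>tape := sdrop m \<omega>'\<rparr>)" using ex[of "sdrop m \<omega>'"] by simp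
  then show ?thesis by (intro exI[of _ "\<sigma>'\<lparr>tape := sdrop m \<omega>'\<rparr>"]) simp
qed

text \<open>A good outcome within time \<open>T\<close> is decided by the first
  \<open>nat \<lfloor>T\<rfloor>\<close> words, so it is a measurable event and the monotonicity of
  the measure applies. \<open>R\<close> sees only the memory, because the final states also contain
  the remaining tapes, which differ.\<close>

lemma prob_run_ge:
  assumes G: "G \<in> sets (random_tape b)" and v: "valid_state b \<sigma>"
    and run: "\<And>\<omega>. sset \<omega> \<subseteq> {..<2 ^ b} \<Longrightarrow> \<omega> \<in> G \<Longrightarrow> wp b inp c (\<lambda>n \<sigma>'. real n \<le> T \<and> R (mem \<sigma>')) (\<sigma>\<lparr>tape := \<omega>\<rparr>)"
  shows "measure (random_tape b) G \<le> \<P>(\<omega> in random_tape b. \<exists>n \<sigma>'. exec b inp c (\<sigma>\<lparr>tape := \<omega>\<rparr>) n \<sigma>' \<and> real n \<le> T \<and> R (mem \<sigma>'))"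
proof -
  define P where "P \<omega> \<longleftrightarrow> (\<exists>n \<sigma>'. exec b inp c (\<sigma>\<lparr>tape := \<omega>\<rparr>) n \<sigma>' \<and> real n \<le> T \<and> R (mem \<sigma>'))" for \<omega>
  let ?K = "nat \<lfloor>T\<rfloor>"
  have imp: "P \<omega>'" if P: "P \<omega>" and eq: "\<And>i. i < ?K \<Longrightarrow> \<omega> !! i = \<omega>' !! i" for \<omega> \<omega>'
  proof -
    obtain n \<sigma>' where e: "exec b inp c (\<sigma>\<lparr>tape := \<omega>\<rparr>) n \<sigma>'" "real n \<le> T" "R (mem \<sigma>')"
      using P unfolding P_def by blast
    then have "n \<le> ?K" by linarith
    then show ?thesis using exec_outcome_prefix[OF e(1) _ eq] e(2,3) unfolding P_def by metis
  qed
  have to: "to_stream V !! i = V i" for V :: "nat \<Rightarrow> nat" and i by (simp add: to_stream_def)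
  have loc: "P (to_stream V) = P (to_stream V')" if "\<And>i. i < ?K \<Longrightarrow> V i = V' i" for V V'
    using imp[of "to_stream V" "to_stream V'"] imp[of "to_stream V'" "to_stream V"] that to by metis
  have "{\<omega>. P (to_stream (\<lambda>i. \<omega> !! i))} \<in> sets (random_tape b)"
    using loc by (rule measure_random_tape_prefix)
  moreover have "to_stream (\<lambda>i. \<omega> !! i) = \<omega>" for \<omega> :: "nat stream"
    by (simp add: to_stream_def smap_alt)
  moreover have sp: "space (random_tape b) = UNIV" by (simp add: random_tape_def space_stream_space streams_UNIV)
  ultimately have E: "{\<omega> \<in> space (random_tape b). P \<omega>} \<in> sets (random_tape b)" by simp
  interpret prob_space "random_tape b"
    unfolding random_tape_def by (intro prob_space.prob_space_stream_space measure_pmf.prob_space_axioms)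
  show ?thesis
    unfolding P_def[symmetric]
  proof (rule finite_measure_mono_AE[OF _ E])
    show "AE \<omega> in random_tape b. \<omega> \<in> G \<longrightarrow> \<omega> \<in> {\<omega> \<in> space (random_tape b). P \<omega>}"
      using AE_valid_tape[of b] by eventually_elim (use run in \<open>auto simp: sp P_def wp_def\<close>)
  qed
qed

section \<open>Growth rates\<close>

text \<open>From \<open>N = 3\<close> on the logarithm is at least 1. This brings summands with
  different powers of it to a common power.\<close>

lemma ln_power_bigo:
  assumes "k \<le> j"
  shows "(\<lambda>N. h N * ln (real N) ^ k) \<in> O(\<lambda>N. h N * ln (real N) ^ j)"
proof (rule landau_o.big.mult[OF landau_o.big_refl])
  have "eventually (\<lambda>N. norm (ln (real N) ^ k) \<le> norm (ln (real N) ^ j)) sequentially"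
  proof (rule eventually_mono[OF eventually_ge_at_top[of "3::nat"]])
    fix N :: nat assume "N \<ge> 3"
    then have "exp 1 \<le> real N" using exp_le by linarith
    then have "1 \<le> ln (real N)" using ln_mono[of "exp 1" "real N"] by simp
    then show "norm (ln (real N) ^ k) \<le> norm (ln (real N) ^ j)"
      using assms by (simp add: power_increasing)
  qed
  then show "(\<lambda>N. ln (real N) ^ k) \<in> O(\<lambda>N. ln (real N) ^ j)" by (rule landau_o.big_mono)
qed

lemma soft_O_iff: "f \<in> soft_O h \<longleftrightarrow> (\<exists>k. f \<in> O(\<lambda>N. h N * ln (real N) ^ k))"
  by (auto simp: soft_O_def)

lemma soft_O_add: "f \<in> soft_O h \<Longrightarrow> g \<in> soft_O h \<Longrightarrow> (\<lambda>N. f N + g N) \<in> soft_O h"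
  unfolding soft_O_iff
proof (elim exE)
  fix k j assume "f \<in> O(\<lambda>N. h N * ln (real N) ^ k)" "g \<in> O(\<lambda>N. h N * ln (real N) ^ j)"
  then have "f \<in> O(\<lambda>N. h N * ln (real N) ^ max k j)" "g \<in> O(\<lambda>N. h N * ln (real N) ^ max k j)"
    using landau_o.big_trans[OF _ ln_power_bigo] max.cobounded1 max.cobounded2 by blast+
  then show "\<exists>k. (\<lambda>N. f N + g N) \<in> O(\<lambda>N. h N * ln (real N) ^ k)"
    using sum_in_bigo(1) by blast
qed

lemma soft_O_mult: "f \<in> soft_O h \<Longrightarrow> g \<in> soft_O h' \<Longrightarrow> (\<lambda>N. f N * g N) \<in> soft_O (\<lambda>N. h N * h' N)"
  unfolding soft_O_iff
proof (elim exE)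
  fix k j assume "f \<in> O(\<lambda>N. h N * ln (real N) ^ k)" "g \<in> O(\<lambda>N. h' N * ln (real N) ^ j)"
  from landau_o.big.mult[OF this] show "\<exists>k. (\<lambda>N. f N * g N) \<in> O(\<lambda>N. h N * h' N * ln (real N) ^ k)"
    by (intro exI[of _ "k + j"]) (simp add: power_add mult_ac)
qed

lemma soft_O_bigo: "f \<in> O(g) \<Longrightarrow> g \<in> soft_O h \<Longrightarrow> f \<in> soft_O h"
  unfolding soft_O_iff using landau_o.big_trans by blast

lemma soft_O_mono: "f \<in> soft_O h \<Longrightarrow> h \<in> O(h') \<Longrightarrow> f \<in> soft_O h'"
  unfolding soft_O_iff
proof (elim exE)
  fix k assume "f \<in> O(\<lambda>N. h N * ln (real N) ^ k)" "h \<in> O(h')"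
  from landau_o.big_trans[OF this(1) landau_o.big.mult[OF this(2) landau_o.big_refl]]
  show "\<exists>k. f \<in> O(\<lambda>N. h' N * ln (real N) ^ k)" by blast
qed

lemma soft_O_cong: "eventually (\<lambda>N. f N = g N) sequentially \<Longrightarrow> g \<in> soft_O h \<Longrightarrow> f \<in> soft_O h"
  using soft_O_bigo[of f g h] landau_o.big.in_cong[of f g] landau_o.big_refl by blast

text \<open>Soft-O of a power of \<open>N\<close>. Exponents add under products and polylogarithmic
  factors have exponent 0, so each bound below is arithmetic with exponents.\<close>

definition grows :: "real \<Rightarrow> (nat \<Rightarrow> real) \<Rightarrow> bool" where
  "grows a f \<longleftrightarrow> f \<in> soft_O (\<lambda>N. real N powr a)"

lemma grows_polylog: "polylog f \<longleftrightarrow> grows 0 f"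
proof -
  have ev: "eventually (\<lambda>N. 1 = real N powr 0) sequentially"
    by (rule eventually_mono[OF eventually_gt_at_top[of 0]]) simp
  have "(\<lambda>_. 1 :: real) \<in> O(\<lambda>N. real N powr 0)" "(\<lambda>N. real N powr 0) \<in> O(\<lambda>_. 1 :: real)"
    using landau_o.big.cong[OF ev] landau_o.big_refl by blast+
  then show ?thesis unfolding grows_def using soft_O_mono by blast
qed

lemma grows_mono:
  assumes "grows a f" "a \<le> b"
  shows "grows b f"
  unfolding grows_def
proof (rule soft_O_mono[OF assms(1)[unfolded grows_def]])
  have "eventually (\<lambda>N. norm (real N powr a) \<le> norm (real N powr b)) sequentially"
    by (rule eventually_mono[OF eventually_ge_at_top[of 1]]) (use assms(2) in \<open>auto intro: powr_mono\<close>)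
  then show "(\<lambda>N. real N powr a) \<in> O(\<lambda>N. real N powr b)" by (rule landau_o.big_mono)
qed

lemma grows_mult: "grows a f \<Longrightarrow> grows b g \<Longrightarrow> grows (a + b) (\<lambda>N. f N * g N)"
  unfolding grows_def powr_add by (rule soft_O_mult)

lemma grows_add: "grows a f \<Longrightarrow> grows a g \<Longrightarrow> grows a (\<lambda>N. f N + g N)"
  unfolding grows_def by (rule soft_O_add)

lemma grows_mult_le: "grows a f \<Longrightarrow> grows b g \<Longrightarrow> a + b \<le> c \<Longrightarrow> grows c (\<lambda>N. f N * g N)"
  using grows_mult grows_mono by blast

lemma grows_const: "a \<ge> 0 \<Longrightarrow> grows a (\<lambda>_. c)"
proof -
  have "(\<lambda>_. c) \<in> O(\<lambda>_. 1 :: real)" by simp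
  moreover have "polylog (\<lambda>_. 1)" unfolding soft_O_iff by (intro exI[of _ 0]) simp
  ultimately have "grows 0 (\<lambda>_. c)" using soft_O_bigo grows_polylog by blast
  then show "grows a (\<lambda>_. c)" if "a \<ge> 0" using grows_mono that by blast
qed

lemma grows_self: "grows a (\<lambda>N. real N powr a)"
  unfolding grows_def soft_O_iff by (intro exI[of _ 0]) simp

lemma grows_le:
  assumes "grows a g" "\<And>N. N \<ge> 1 \<Longrightarrow> \<bar>f N\<bar> \<le> \<bar>g N\<bar>"
  shows "grows a f"
  unfolding grows_def
proof (rule soft_O_bigo[OF _ assms(1)[unfolded grows_def]])
  have "eventually (\<lambda>N. norm (f N) \<le> norm (g N)) sequentially"
    by (rule eventually_mono[OF eventually_ge_at_top[of 1]]) (use assms(2) in simp)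
  then show "f \<in> O(g)" by (rule landau_o.big_mono)
qed

text \<open>A strictly larger exponent absorbs the constant and the logarithms.\<close>

lemma grows_eventually_le:
  assumes "grows a f" "a < b"
  shows "eventually (\<lambda>N. f N \<le> real N powr b) sequentially"
proof -
  obtain k where k: "f \<in> O(\<lambda>N. real N powr a * ln (real N) ^ k)" using assms(1) unfolding grows_def soft_O_iff by blast
  have "(\<lambda>N. real N powr a * ln (real N) ^ k) \<in> o(\<lambda>N. real N powr b)"
    using assms(2) by (cases "k = 0") real_asymp+
  with k have "f \<in> o(\<lambda>N. real N powr b)" by (rule landau_o.big_small_trans)
  then have "eventually (\<lambda>N. norm (f N) \<le> 1 * norm (real N powr b)) sequentially"
    by (rule landau_o.smallD) simp
  then show ?thesis by (rule eventually_mono) simp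
qed

definition lg_up :: "nat \<Rightarrow> nat" where
  "lg_up N = (LEAST k. N \<le> 2 ^ k)"

lemma lg_up: "N \<le> 2 ^ lg_up N" "i < lg_up N \<Longrightarrow> 2 ^ i < N"
proof -
  have "N \<le> 2 ^ N" using less_exp[of N] by simp
  then show "N \<le> 2 ^ lg_up N" unfolding lg_up_def by (rule LeastI)
  show "2 ^ i < N" if "i < lg_up N" using not_less_Least[of i "\<lambda>k. N \<le> 2 ^ k"] that by (simp add: lg_up_def)
qed

lemma lg_up_le: "N \<ge> 1 \<Longrightarrow> 2 ^ lg_up N \<le> 2 * N"
  using lg_up(2)[of "lg_up N - 1" N] by (cases "lg_up N") auto

text \<open>Phrased by the floor and by powers of 16, so that it is literally what
  \<open>find_ell\<close> computes.\<close>

definition ell_exp :: "real \<Rightarrow> nat \<Rightarrow> nat" where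
  "ell_exp \<alpha> N = (LEAST l. nat \<lfloor>real N powr \<alpha>\<rfloor> < 16 ^ Suc l)"

lemma ell_exp:
  assumes "N \<ge> 1" "\<alpha> > 0"
  shows "16 ^ ell_exp \<alpha> N \<le> nat \<lfloor>real N powr \<alpha>\<rfloor>" "nat \<lfloor>real N powr \<alpha>\<rfloor> < 16 ^ Suc (ell_exp \<alpha> N)"
proof -
  let ?A = "nat \<lfloor>real N powr \<alpha>\<rfloor>"
  have "?A < 2 ^ ?A" by (rule less_exp)
  also have "(2::nat) ^ ?A \<le> 16 ^ ?A" by (intro power_mono) auto
  also have "(16::nat) ^ ?A \<le> 16 ^ Suc ?A" by simp
  finally show "?A < 16 ^ Suc (ell_exp \<alpha> N)" unfolding ell_exp_def by (rule LeastI)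
  have "1 \<le> real N powr \<alpha>" using assms by (simp add: ge_one_powr_ge_zero)
  then have "1 \<le> ?A" by linarith
  moreover have "16 ^ Suc l \<le> ?A" if "ell_exp \<alpha> N = Suc l" for l
    using not_less_Least[of l "\<lambda>l. ?A < 16 ^ Suc l"] that by (simp add: ell_exp_def)
  ultimately show "16 ^ ell_exp \<alpha> N \<le> ?A" by (cases "ell_exp \<alpha> N") auto
qed

text \<open>Fourth roots of the inequalities in \<open>ell_exp\<close>: the bucket size is
  \<open>N powr (\<alpha> / 4)\<close> up to a factor 2.\<close>

lemma ell_exp_powr:
  assumes "N \<ge> 1" "\<alpha> > 0"
  shows "2 ^ ell_exp \<alpha> N \<le> real N powr (\<alpha> / 4)" "real N powr (\<alpha> / 4) \<le> 2 * 2 ^ ell_exp \<alpha> N"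
proof -
  let ?l = "ell_exp \<alpha> N" and ?x = "real N powr (\<alpha> / 4)"
  have x: "?x ^ 4 = real N powr \<alpha>" using assms by (simp add: powr_power)
  have "real (16 ^ ?l) \<le> real (nat \<lfloor>real N powr \<alpha>\<rfloor>)" using ell_exp(1)[OF assms] by (simp only: of_nat_le_iff)
  also have "\<dots> \<le> real N powr \<alpha>" by (simp add: of_nat_floor)
  finally have "real (16 ^ ?l) \<le> real N powr \<alpha>" .
  moreover have p: "((2::real) ^ ?l) ^ 4 = (2 ^ 4) ^ ?l" by (simp only: power_mult[symmetric] mult.commute)
  then have "(2 ^ ?l) ^ 4 = real (16 ^ ?l)" by simp
  ultimately have "(2 ^ ?l) ^ 4 \<le> ?x ^ 4" using x by simp
  then show "2 ^ ?l \<le> ?x" by (subst (asm) power_mono_iff) simp_all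
  have "real N powr \<alpha> < real (Suc (nat \<lfloor>real N powr \<alpha>\<rfloor>))" by linarith
  also have "\<dots> \<le> real (16 ^ Suc ?l)" using ell_exp(2)[OF assms] by (simp only: of_nat_le_iff Suc_le_eq)
  finally have "real N powr \<alpha> < real (16 ^ Suc ?l)" .
  moreover have "(2 * 2 ^ ?l) ^ 4 = real (16 ^ Suc ?l)" using p by (simp add: power_mult_distrib)
  ultimately have "?x ^ 4 \<le> (2 * 2 ^ ?l) ^ 4" using x by simp
  then show "?x \<le> 2 * 2 ^ ?l" by (subst (asm) power_mono_iff) simp_all
qed

lemma ngrows_add: "grows a (\<lambda>N. real (f N)) \<Longrightarrow> grows a (\<lambda>N. real (g N)) \<Longrightarrow> grows a (\<lambda>N. real (f N + g N))"
  using grows_add[of a "\<lambda>N. real (f N)" "\<lambda>N. real (g N)"] by simp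

lemma ngrows_mult: "grows a (\<lambda>N. real (f N)) \<Longrightarrow> grows b (\<lambda>N. real (g N)) \<Longrightarrow> a + b \<le> c \<Longrightarrow> grows c (\<lambda>N. real (f N * g N))"
  using grows_mult_le[of a "\<lambda>N. real (f N)" b "\<lambda>N. real (g N)"] by simp

lemma ngrows_multL: "grows 0 (\<lambda>N. real (f N)) \<Longrightarrow> grows c (\<lambda>N. real (g N)) \<Longrightarrow> grows c (\<lambda>N. real (f N * g N))"
  by (rule ngrows_mult, assumption, assumption, simp)

lemma ngrows_multR: "grows c (\<lambda>N. real (f N)) \<Longrightarrow> grows 0 (\<lambda>N. real (g N)) \<Longrightarrow> grows c (\<lambda>N. real (f N * g N))"
  by (rule ngrows_mult, assumption, assumption, simp)

lemma ngrows_Suc: "a \<ge> 0 \<Longrightarrow> grows a (\<lambda>N. real (f N)) \<Longrightarrow> grows a (\<lambda>N. real (Suc (f N)))"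
  using ngrows_add[of a f "\<lambda>_. 1"] grows_const[of a 1] by simp

lemma ngrows_le: "grows a (\<lambda>N. real (g N)) \<Longrightarrow> (\<And>N. N \<ge> 1 \<Longrightarrow> f N \<le> g N) \<Longrightarrow> grows a (\<lambda>N. real (f N))"
  by (rule grows_le, assumption) simp

locale family =
  fixes b w \<tau> :: "nat \<Rightarrow> nat" and \<alpha> :: real and C :: nat
  assumes fit: "\<And>N. N \<ge> 1 \<Longrightarrow> N < 2 ^ b N"
    and grows_b: "grows 0 (\<lambda>N. real (b N))" and grows_w: "grows 0 (\<lambda>N. real (w N))" and grows_tau: "grows 0 (\<lambda>N. real (\<tau> N))"
    and alpha: "0 < \<alpha>" "\<alpha> < 1"
begin

abbreviation "nu \<equiv> lg_up"
abbreviation "l \<equiv> ell_exp \<alpha>"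
abbreviation "W N \<equiv> words (b N) (w N)"
abbreviation "r N \<equiv> 16 * C * nu N * 2 ^ l N"

definition space_bound :: "nat \<Rightarrow> nat" where
  "space_bound N = 2 ^ (nu N - l N) + r N * 2 ^ l N * Suc (nu N - l N) + r N * 2 ^ (nu N - 2 * l N)"

lemma l_le: "N \<ge> 1 \<Longrightarrow> 2 * l N \<le> nu N"
proof -
  assume N: "N \<ge> 1"
  have "(2::real) ^ (2 * l N) = (2 ^ l N) ^ 2" by (simp only: power_mult[symmetric] mult.commute[of 2])
  also have "\<dots> \<le> (real N powr (\<alpha> / 4)) ^ 2" using ell_exp_powr(1)[OF N alpha(1)] by (intro power_mono) auto
  also have "\<dots> = real N powr (\<alpha> / 2)" using N by (simp add: powr_power)
  also have "\<dots> \<le> real N powr 1" using N alpha by (intro powr_mono) auto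
  also have "\<dots> \<le> real (2 ^ nu N)" using N of_nat_mono[OF lg_up(1)[of N], where 'a = real] by simp
  finally have "real (2 ^ (2 * l N)) \<le> real (2 ^ nu N)" by simp
  then have "(2::nat) ^ (2 * l N) \<le> 2 ^ nu N" unfolding of_nat_le_iff .
  then show ?thesis by simp
qed

lemma grows_n: "grows 1 (\<lambda>N. real (2 ^ nu N))"
proof (rule grows_le)
  show "grows 1 (\<lambda>N. 2 * real N powr 1)"
    by (rule grows_mult_le[OF grows_const[of 0] grows_self]) simp_all
  show "\<bar>real (2 ^ nu N)\<bar> \<le> \<bar>2 * real N powr 1\<bar>" if "N \<ge> 1" for N
    using of_nat_mono[OF lg_up_le[OF that], where 'a = real] that by simp
qed

lemma grows_ell: "grows (\<alpha> / 4) (\<lambda>N. real (2 ^ l N))"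
  by (rule grows_le[OF grows_self]) (use ell_exp_powr(1)[OF _ alpha(1)] in simp)

lemma grows_M: "grows (1 - \<alpha> / 4) (\<lambda>N. real (2 ^ (nu N - l N)))"
proof (rule grows_le)
  show "grows (1 - \<alpha> / 4) (\<lambda>N. 4 * real N powr (1 - \<alpha> / 4))"
    by (rule grows_mult_le[OF grows_const[of 0] grows_self]) simp_all
  fix N :: nat assume N: "N \<ge> 1"
  let ?x = "real N powr (\<alpha> / 4)"
  have "real (2 ^ (nu N - l N)) * ?x \<le> real (2 ^ (nu N - l N)) * (2 * 2 ^ l N)"
    using ell_exp_powr(2)[OF N alpha(1)] by (intro mult_left_mono) auto
  also have "\<dots> = 2 * real (2 ^ (nu N - l N + l N))" by (simp add: power_add)
  also have "\<dots> = 2 * real (2 ^ nu N)" using l_le[OF N] by simp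
  also have "\<dots> \<le> 4 * real N" using of_nat_mono[OF lg_up_le[OF N], where 'a = real] by simp
  also have "\<dots> = 4 * real N powr (1 - \<alpha> / 4) * ?x" using N by (simp add: powr_add[symmetric])
  finally have "real (2 ^ (nu N - l N)) \<le> 4 * real N powr (1 - \<alpha> / 4)" using N by simp
  then show "\<bar>real (2 ^ (nu N - l N))\<bar> \<le> \<bar>4 * real N powr (1 - \<alpha> / 4)\<bar>" by simp
qed

lemma grows_m': "grows (1 - \<alpha> / 2) (\<lambda>N. real (2 ^ (nu N - 2 * l N)))"
proof (rule grows_le)
  show "grows (1 - \<alpha> / 2) (\<lambda>N. 8 * real N powr (1 - \<alpha> / 2))"
    by (rule grows_mult_le[OF grows_const[of 0] grows_self]) simp_all
  fix N :: nat assume N: "N \<ge> 1"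
  let ?x = "real N powr (\<alpha> / 4)"
  have "real (2 ^ (nu N - 2 * l N)) * ?x ^ 2 \<le> real (2 ^ (nu N - 2 * l N)) * (2 * 2 ^ l N) ^ 2"
    using ell_exp_powr(2)[OF N alpha(1)] by (intro mult_left_mono power_mono) auto
  also have "\<dots> = 4 * (2 ^ (nu N - 2 * l N) * 2 ^ (2 * l N))"
    by (simp only: power_mult_distrib power_mult[symmetric] mult.commute[of "l N"] of_nat_power of_nat_numeral) simp
  also have "\<dots> = 4 * real (2 ^ (nu N - 2 * l N + 2 * l N))" by (simp only: power_add of_nat_power of_nat_mult of_nat_numeral)
  also have "\<dots> = 4 * real (2 ^ nu N)" using l_le[OF N] by simp
  also have "\<dots> \<le> 8 * real N" using of_nat_mono[OF lg_up_le[OF N], where 'a = real] by simp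
  also have "\<dots> = 8 * real N powr (1 - \<alpha> / 2) * ?x ^ 2" using N by (simp add: powr_power powr_add[symmetric])
  finally have "real (2 ^ (nu N - 2 * l N)) \<le> 8 * real N powr (1 - \<alpha> / 2)" using N by simp
  then show "\<bar>real (2 ^ (nu N - 2 * l N))\<bar> \<le> \<bar>8 * real N powr (1 - \<alpha> / 2)\<bar>" by simp
qed

lemma grows_m: "grows (1 - \<alpha> / 2) (\<lambda>N. real (2 ^ (nu N - 2 * l N - 2)))"
  by (rule ngrows_le[OF grows_m']) (intro power_increasing, simp_all)

text \<open>\<open>N < 2 ^ b N\<close> bounds the exponent of \<open>n\<close> by the word length,
  which is polylogarithmic.\<close>

lemma grows_nu: "grows 0 (\<lambda>N. real (nu N))"
proof (rule ngrows_le[OF grows_b])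
  fix N :: nat assume "N \<ge> 1"
  then have "N \<le> 2 ^ b N" using fit[of N] by simp
  then show "nu N \<le> b N" unfolding lg_up_def by (rule Least_le)
qed

lemma grows_mu: "grows 0 (\<lambda>N. real (nu N - l N))"
  by (rule ngrows_le[OF grows_nu]) simp

lemma grows_W: "grows 0 (\<lambda>N. real (W N))"
proof (rule ngrows_le)
  show "grows 0 (\<lambda>N. real (w N + 1))" by (intro ngrows_add grows_w grows_const order_refl)
  show "W N \<le> w N + 1" for N by (simp add: words_def div_le_dividend le_SucI)
qed

lemma grows_r: "grows (\<alpha> / 4) (\<lambda>N. real (r N))"
  by (intro ngrows_multL[OF _ grows_ell] ngrows_multL[where c = 0] grows_nu grows_const order_refl)

lemma grows_Z: "grows (\<alpha> / 2) (\<lambda>N. real (r N * 2 ^ l N))"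
  by (rule ngrows_mult[OF grows_r grows_ell]) simp

lemmas polylog_intros = ngrows_add[where a = 0] ngrows_multL[where c = 0] ngrows_Suc[where a = 0] grows_b grows_w grows_tau grows_nu grows_mu grows_W grows_const order_refl

text \<open>The exponents are \<open>1 - \<alpha> / 4\<close> for pivots,
  \<open>\<alpha> / 2\<close> for hash words, which is smaller since \<open>\<alpha> < 1\<close>,
  and \<open>\<alpha> / 4 + (1 - \<alpha> / 2)\<close> for slots. Pivots and tables are in
  balance.\<close>

lemma grows_space: "grows (1 - \<alpha> / 4) (\<lambda>N. real (5 * space_bound N + 5))"
proof -
  have 1: "grows (1 - \<alpha> / 4) (\<lambda>N. real (r N * 2 ^ l N * Suc (nu N - l N)))"
    by (rule ngrows_mult[OF grows_Z ngrows_Suc[OF order_refl grows_mu]]) (use alpha in simp)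
  have 2: "grows (1 - \<alpha> / 4) (\<lambda>N. real (r N * 2 ^ (nu N - 2 * l N)))"
    by (rule ngrows_mult[OF grows_r grows_m']) simp
  show ?thesis unfolding space_bound_def
    by (rule ngrows_add[OF ngrows_multL[OF grows_const[OF order_refl] ngrows_add[OF ngrows_add[OF grows_M 1] 2]] grows_const])
      (use alpha in simp)
qed

lemma grows_adv: "grows (\<alpha> / 4) (\<lambda>N. real (T_adv (2 ^ l N) (nu N - l N) (\<tau> N) (W N)))"
proof (rule ngrows_add[OF ngrows_multR[OF grows_ell] grows_const])
  show "grows 0 (\<lambda>N. real (T_hash (nu N - l N) + T_bk (nu N - l N) (\<tau> N) (W N) + 5))" by (intro polylog_intros)
qed (use alpha in simp)

text \<open>\<open>r * m\<close> chains of \<open>2 ^ l\<close> steps have exponent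
  \<open>\<alpha> / 4 + (1 - \<alpha> / 2) + \<alpha> / 4 = 1\<close>, the same as sorting.\<close>

lemma grows_build: "grows 1 (\<lambda>N. real (build_time (b N) k0 (w N) (nu N) (l N) (r N) (\<tau> N) (W N)))"
proof -
  have 1: "grows 1 (\<lambda>N. real c)" for c :: nat by (rule grows_const) simp
  have 2: "grows 1 (\<lambda>N. real (b N))" by (rule grows_mono[OF grows_b]) simp
  have 3: "grows 1 (\<lambda>N. real (r N * 2 ^ l N * Suc (nu N - l N)))"
    by (rule ngrows_mult[OF grows_Z ngrows_Suc[OF order_refl grows_mu]]) (use alpha in simp)
  have 4: "grows 1 (\<lambda>N. real (2 ^ nu N * (T_lv (\<tau> N) (W N) + 10)))"
    by (rule ngrows_multR[OF grows_n]) (intro polylog_intros)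
  have 5: "grows 1 (\<lambda>N. real (2 ^ nu N * (2 * T_lv (\<tau> N) (W N) + T_cmp (W N) + 30)))"
    by (rule ngrows_multR[OF grows_n]) (intro polylog_intros)
  have 6: "grows (1 - \<alpha> / 4) (\<lambda>N. real (2 ^ (nu N - 2 * l N - 2) * (T_adv (2 ^ l N) (nu N - l N) (\<tau> N) (W N) + 10 + 3)))"
    by (rule ngrows_mult[OF grows_m ngrows_add[OF ngrows_add[OF grows_adv]]]) (use alpha in \<open>auto intro: grows_const\<close>)
  have 8: "grows 1 (\<lambda>N. real (2 * (2 ^ nu N * (T_lv (\<tau> N) (W N) + 10) + 3)))"
    by (rule ngrows_multL[OF grows_const[OF order_refl] ngrows_add[OF 4 1]])
  have 7: "grows 1 (\<lambda>N. real (r N * (2 ^ (nu N - 2 * l N - 2) * (T_adv (2 ^ l N) (nu N - l N) (\<tau> N) (W N) + 10 + 3) + 6)))"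
    by (rule ngrows_mult[OF grows_r ngrows_add[OF 6]]) (use alpha in \<open>auto intro: grows_const\<close>)
  show ?thesis
    unfolding build_time_def construct_time_def
    by (intro ngrows_add 1 5 7 8 ngrows_multL[OF grows_const[OF order_refl] 2] ngrows_multL[OF grows_const[OF order_refl] 3]
        ngrows_multL[OF grows_const[OF order_refl] grows_n] ngrows_multL[OF grows_w])
qed

text \<open>A walk over a bucket, times the candidates of a listing, times the steps for one
  candidate: \<open>\<alpha> / 4 + \<alpha> / 2 + \<alpha> / 4\<close>.\<close>

lemma grows_query: "grows \<alpha> (\<lambda>N. real (query_time (b N) k0 (nu N) (l N) (r N) (\<tau> N) (W N)))"
proof -
  have 0: "grows (\<alpha> / 4) (\<lambda>N. real (f N))" if "grows 0 (\<lambda>N. real (f N))" for f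
    using grows_mono[OF that] alpha by simp
  have polylog_le: "grows \<alpha> (\<lambda>N. real (f N))" if "grows 0 (\<lambda>N. real (f N))" for f
    using grows_mono[OF that] alpha by simp
  have 1: "grows (\<alpha> / 4) (\<lambda>N. real (T_cand (2 ^ l N) (nu N - l N) (\<tau> N) (W N) + 2 * T_kl (\<tau> N) (W N) + 12))"
    by (intro ngrows_add ngrows_multL[OF _ grows_adv] 0 polylog_intros)
  have 2: "grows (3 * \<alpha> / 4) (\<lambda>N. real (r N * 2 ^ l N * (T_cand (2 ^ l N) (nu N - l N) (\<tau> N) (W N) + 2 * T_kl (\<tau> N) (W N) + 12)))"
    by (rule ngrows_mult[OF grows_Z 1]) simp
  have 3: "grows (3 * \<alpha> / 4) (\<lambda>N. real (f N))" if "grows 0 (\<lambda>N. real (f N))" for f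
    using grows_mono[OF that] alpha by simp
  have 4: "grows (3 * \<alpha> / 4) (\<lambda>N. real (r N * 2 ^ l N * (T_cand (2 ^ l N) (nu N - l N) (\<tau> N) (W N) + 2 * T_kl (\<tau> N) (W N) + 12) + 5 + 2 * T_lv (\<tau> N) (W N) + T_cmp (W N) + 23))"
    by (rule ngrows_add[OF ngrows_add[OF ngrows_add[OF ngrows_add[OF 2]]]]; rule 3; intro polylog_intros)
  have 5: "grows \<alpha> (\<lambda>N. real (walk_time (2 ^ l N) (r N * 2 ^ l N) (T_cand (2 ^ l N) (nu N - l N) (\<tau> N) (W N)) (\<tau> N) (W N)))"
    unfolding walk_time_def by (rule ngrows_add[OF ngrows_mult[OF grows_ell 4] polylog_le]) (simp, intro polylog_intros)
  show ?thesis unfolding query_time_def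
    by (rule ngrows_add[OF polylog_le 5]) (intro polylog_intros)
qed

end

text \<open>One of the \<open>C\<close> factors \<open>exp (- k)\<close> pays for the
  \<open>2 ^ k\<close> elements of the union bound. The others leave at most
  \<open>exp (- c * k)\<close>, and \<open>k \<ge> ln N\<close>.\<close>

lemma exp_bound:
  assumes "N \<ge> 1" "N \<le> 2 ^ k" "real C \<ge> c + 1" "c > 0"
  shows "2 ^ k * exp (- real (C * k)) \<le> 1 / real N powr c"
proof -
  have e: "(2::real) ^ k \<le> exp (real k)"
    using power_mono[of 2 "exp 1 :: real" k] exp_ge_add_one_self[of 1] by (simp add: exp_of_nat_mult[symmetric])
  have "2 ^ k * exp (- real (C * k)) \<le> exp (real k) * exp (- real (C * k))"
    using e by (intro mult_right_mono) auto
  also have "\<dots> = exp (- ((real C - 1) * real k))" by (simp add: exp_add[symmetric] algebra_simps)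
  also have "\<dots> \<le> exp (- (c * real k))" using assms(3) by (simp add: mult_right_mono)
  also have "\<dots> \<le> exp (- (c * ln (real N)))"
  proof -
    have "real N \<le> 2 ^ k" using of_nat_mono[OF assms(2), where 'a = real] by simp
    also note e
    finally have "real N \<le> exp (real k)" .
    then have "ln (real N) \<le> real k" using assms(1) using ln_mono[of "real N" "exp (real k)"] by simp
    then show ?thesis using assms(4) by simp
  qed
  also have "\<dots> = 1 / real N powr c" using assms(1) by (simp add: powr_def exp_minus divide_inverse)
  finally show ?thesis .
qed

text \<open>This is where the slack \<open>\<epsilon>\<close> in the word length is spent:
  \<open>n\<close> can be close to \<open>2 * N\<close>, and
  \<open>N powr (1 + \<epsilon>) \<le> 2 ^ b N\<close> makes room for it, and for all addresses,
  once \<open>N\<close> is large.\<close>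

lemma (in family) eventually_fits:
  assumes "\<epsilon> > 0" "\<And>N. N \<ge> 1 \<Longrightarrow> real (b N) \<ge> (1 + \<epsilon>) * log 2 (real N)"
  shows "eventually (\<lambda>N. nu N < b N \<and> 2 * l N + 2 \<le> nu N \<and> 5 * space_bound N + 5 \<le> 2 ^ b N) sequentially"
proof -
  have pow: "real N powr (1 + \<epsilon>) \<le> real (2 ^ b N)" if "N \<ge> 1" for N
  proof -
    have "real N powr (1 + \<epsilon>) = (2 powr log 2 (real N)) powr (1 + \<epsilon>)" using that by simp
    also have "\<dots> = 2 powr ((1 + \<epsilon>) * log 2 (real N))" by (simp only: powr_powr mult.commute)
    also have "\<dots> \<le> 2 powr real (b N)" using assms(2)[OF that] by (intro powr_mono) auto
    also have "\<dots> = real (2 ^ b N)" by (simp add: powr_realpow)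
    finally show ?thesis .
  qed
  have "eventually (\<lambda>N. real (5 * space_bound N + 5) \<le> real N powr (1 + \<epsilon>)) sequentially"
    by (rule grows_eventually_le[OF grows_space]) (use assms alpha in simp)
  moreover have "eventually (\<lambda>N. real (Suc (2 ^ nu N)) \<le> real N powr (1 + \<epsilon>)) sequentially"
    by (rule grows_eventually_le[OF ngrows_Suc[OF _ grows_n]]) (use assms in simp_all)
  moreover have "eventually (\<lambda>N. real (4 * (2 ^ l N * 2 ^ l N)) \<le> real N powr 1) sequentially"
    by (rule grows_eventually_le[OF ngrows_multL[OF grows_const[OF order_refl] ngrows_mult[OF grows_ell grows_ell order_refl]]]) (use alpha in simp)
  ultimately show ?thesis
    using eventually_ge_at_top[of 1]
  proof eventually_elim
    case (elim N)
    have N: "N \<ge> 1" using elim by simp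
    have "real (5 * space_bound N + 5) \<le> real (2 ^ b N)" "real (Suc (2 ^ nu N)) \<le> real (2 ^ b N)"
      using elim pow[OF N] by linarith+
    then have 1: "5 * space_bound N + 5 \<le> 2 ^ b N" "Suc (2 ^ nu N) \<le> 2 ^ b N" unfolding of_nat_le_iff .
    then have "(2::nat) ^ nu N < 2 ^ b N" by linarith
    then have 2: "nu N < b N" by simp
    have "real (4 * (2 ^ l N * 2 ^ l N)) \<le> real N" using elim N by simp
    then have "4 * (2 ^ l N * 2 ^ l N) \<le> N" unfolding of_nat_le_iff .
    also have "N \<le> 2 ^ nu N" by (rule lg_up(1))
    finally have "(2::nat) ^ (2 * l N + 2) \<le> 2 ^ nu N" by (simp add: power_add mult_2 power2_eq_square)
    then have "2 * l N + 2 \<le> nu N" by (simp only: power_increasing_iff one_less_numeral_iff semiring_norm)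
    then show ?case using 1 2 by blast
  qed
qed

lemma computes_within_mono:
  assumes "computes_within t b inp P N w f" "\<And>n. real n \<le> t \<Longrightarrow> real n \<le> t'"
  shows "computes_within t' b inp P N w f"
  unfolding computes_within_def
proof (intro allI impI)
  fix x \<sigma> assume "x < N" "valid_state b \<sigma>" "regs \<sigma> 0 = N" "regs \<sigma> 1 = w" "regs \<sigma> 2 = x"
  then obtain n \<sigma>' where "exec b inp P \<sigma> n \<sigma>' \<and> real n \<le> t \<and> holds_int b w (mem \<sigma>' 0) (f x)"
    using assms(1) unfolding computes_within_def by blast
  then show "\<exists>n \<sigma>'. exec b inp P \<sigma> n \<sigma>' \<and> real n \<le> t' \<and> holds_int b w (mem \<sigma>' 0) (f x)"
    using assms(2) by blast
qed

theorem mainTheorem4: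
  fixes w b :: "nat \<Rightarrow> nat"                \<comment> \<open>bit length of the values; word length\<close>
    and f :: "nat \<Rightarrow> nat \<Rightarrow> nat"
    and inp :: "nat \<Rightarrow> nat \<Rightarrow> nat"         \<comment> \<open>read-only input memory\<close>
    and F :: com and t :: "nat \<Rightarrow> real"
    and \<alpha> \<epsilon> c :: real
  assumes word_length: "\<epsilon> > 0" "\<And>N. N \<ge> 1 \<Longrightarrow> real (b N) \<ge> (1 + \<epsilon>) * log 2 (real N)"
      "polylog (\<lambda>N. real (b N))"
    and params_fit: "\<And>N. N \<ge> 1 \<Longrightarrow> N < 2 ^ b N \<and> w N < 2 ^ b N"
    and inp_words: "\<And>N i. N \<ge> 1 \<Longrightarrow> inp N i < 2 ^ b N"
    and w_polylog: "polylog (\<lambda>N. real (w N))"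
    and f_range: "\<And>N x. N \<ge> 1 \<Longrightarrow> x < N \<Longrightarrow> f N x < 2 ^ w N"
    and f_computable: "polylog t"
      "\<And>N. N \<ge> 1 \<Longrightarrow> computes_within (t N) (b N) (inp N) F N (w N) (f N)"
    and alpha: "0 < \<alpha>" "\<alpha> < 1"
    and c_pos: "c > 0"
  shows "\<exists>(build :: com) (rank :: com) (select :: com).
    \<exists>T_build \<in> soft_O (\<lambda>N. real N).
    \<exists>S \<in> soft_O (\<lambda>N. real N powr (1 - \<alpha> / 4)).
    \<exists>T_query \<in> soft_O (\<lambda>N. real N powr \<alpha>).
    \<forall>N\<ge>1. \<forall>\<sigma>. valid_state (b N) \<sigma> \<longrightarrow> regs \<sigma> 0 = N \<longrightarrow> regs \<sigma> 1 = w N \<longrightarrow>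
      \<comment> \<open>\<open>\<alpha>\<close> may be an uncomputable real, so \<open>build\<close> receives it as \<open>\<lfloor>N powr \<alpha>\<rfloor>\<close>\<close>
      regs \<sigma> 2 = nat \<lfloor>real N powr \<alpha>\<rfloor> \<longrightarrow>
      \<P>(\<omega> in random_tape (b N).
          \<exists>n \<sigma>' s. exec (b N) (inp N) build (\<sigma>\<lparr>tape := \<omega>\<rparr>) n \<sigma>' \<and>
            real n \<le> T_build N \<and> real s \<le> S N \<and>
            supports_ranking (T_query N) (b N) (inp N) rank N (w N) (f N) s (mem \<sigma>' 0) \<and>
            supports_selection (T_query N) (b N) (inp N) select N (w N) (f N) s (mem \<sigma>' 0))
        \<ge> 1 - 1 / real N powr c"
proof -
  define \<tau> where "\<tau> N = nat \<lfloor>t N\<rfloor>" for N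
  \<comment> \<open>One unit for the union bound over \<open>[n]\<close> and \<open>c\<close> units
    for the failure probability.\<close>
  define C where "C = nat \<lceil>c\<rceil> + 1"
  have C: "C > 0" "real C \<ge> c + 1" by (simp_all add: C_def) linarith
  have comp: "computes_within (real (\<tau> N)) (b N) (inp N) F N (w N) (f N)" if "N \<ge> 1" for N
  proof -
    have "real n \<le> t N \<Longrightarrow> real n \<le> real (\<tau> N)" for n unfolding \<tau>_def of_nat_le_iff by (rule le_nat_floor)
    then show ?thesis by (rule computes_within_mono[OF f_computable(2)[OF that]])
  qed
  interpret family b w \<tau> \<alpha> C
  proof
    show "grows 0 (\<lambda>N. real (\<tau> N))"
    proof (rule grows_le)
      show "grows 0 t" using f_computable(1) by (simp only: grows_polylog)
      show "\<bar>real (\<tau> N)\<bar> \<le> \<bar>t N\<bar>" for N unfolding \<tau>_def by linarith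
    qed
  qed (use word_length(3) w_polylog params_fit alpha in \<open>simp_all only: grows_polylog\<close>)
  \<comment> \<open>From \<open>k0\<close> on everything fits into words. The machine tests for
    \<open>2 ^ k0\<close> instead, since \<open>N \<ge> 2 ^ k0\<close> implies
    \<open>N \<ge> k0\<close> and the test is a repeated halving.\<close>
  obtain k0 where k0: "\<And>N. N \<ge> k0 \<Longrightarrow> nu N < b N \<and> 2 * l N + 2 \<le> nu N \<and> 5 * space_bound N + 5 \<le> 2 ^ b N"
    using eventually_fits[OF word_length(1,2)] unfolding eventually_sequentially by blast
  define T_build where "T_build N = (if N < 2 ^ k0 then real (3 * b N + k0 + 22)
    else real (build_time (b N) k0 (w N) (nu N) (l N) (r N) (\<tau> N) (W N)))" for N
  define T_query where "T_query N = (if N < 2 ^ k0 then real (3 * b N + k0 + 31 + walk_time N N 5 (\<tau> N) (W N))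
    else real (query_time (b N) k0 (nu N) (l N) (r N) (\<tau> N) (W N)))" for N
  define S where "S N = real (5 * space_bound N + 5)" for N
  have "eventually (\<lambda>N. \<not> N < 2 ^ k0) sequentially"
    by (rule eventually_mono[OF eventually_ge_at_top[of "2 ^ k0"]]) simp
  then have ev: "eventually (\<lambda>N. (if N < 2 ^ k0 then g N else h N) = h N) sequentially" for g h :: "nat \<Rightarrow> real"
    by (rule eventually_mono) simp
  have "T_build \<in> soft_O (\<lambda>N. real N powr 1)"
    using soft_O_cong[OF ev grows_build[unfolded grows_def]] unfolding T_build_def .
  moreover have "real N powr 1 = real N" for N by simp
  ultimately have 1: "T_build \<in> soft_O (\<lambda>N. real N)" by simp
  have 2: "T_query \<in> soft_O (\<lambda>N. real N powr \<alpha>)"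
    using soft_O_cong[OF ev grows_query[unfolded grows_def]] unfolding T_query_def .
  have 3: "S \<in> soft_O (\<lambda>N. real N powr (1 - \<alpha> / 4))"
    using grows_space unfolding grows_def S_def .
  let ?build = "buildp k0 C F" and ?rank = "rankp k0 C F" and ?select = "selectp k0 C F"
  \<comment> \<open>The size \<open>s\<close> is quantified inside a predicate of the final memory,
    which is the form that \<open>prob_run_ge\<close> expects.\<close>
  define R where "R N \<mu> \<longleftrightarrow> (\<exists>s. real s \<le> S N \<and>
      supports_ranking (T_query N) (b N) (inp N) ?rank N (w N) (f N) s (\<mu> 0) \<and>
      supports_selection (T_query N) (b N) (inp N) ?select N (w N) (f N) s (\<mu> 0))" for N and \<mu> :: "array \<Rightarrow> nat \<Rightarrow> nat"
  have main: "\<P>(\<omega> in random_tape (b N). \<exists>n \<sigma>'. exec (b N) (inp N) ?build (\<sigma>\<lparr>tape := \<omega>\<rparr>) n \<sigma>' \<and>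
      real n \<le> T_build N \<and> R N (mem \<sigma>')) \<ge> 1 - 1 / real N powr c" (is "?prob \<ge> _")
    if N: "N \<ge> 1" and v: "valid_state (b N) \<sigma>" and regs: "regs \<sigma> 0 = N" "regs \<sigma> 1 = w N" "regs \<sigma> 2 = nat \<lfloor>real N powr \<alpha>\<rfloor>"
    for N \<sigma>
  proof (cases "N = 1")
    \<comment> \<open>The required probability is \<open>1 - 1 / 1 = 0\<close>. Here a word may have
      a single bit, which \<open>machine\<close> excludes.\<close>
    case True
    then show ?thesis by simp
  next
    case False
    have "(2::nat) ^ 1 < 2 ^ b N" using params_fit[OF N] False N by simp
    then have b2: "2 \<le> b N" by (simp only: power_strict_increasing_iff one_less_numeral_iff semiring_norm)
    have vt: "valid_state (b N) (\<sigma>\<lparr>tape := \<omega>\<rparr>)" if "sset \<omega> \<subseteq> {..<2 ^ b N}" for \<omega>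
      using v that by (simp add: valid_state_def)
    show ?thesis
    proof (cases "N < 2 ^ k0")
      case True
      interpret L: small_problem "b N" "inp N" N "w N" k0 F "f N" "\<tau> N"
        using b2 inp_words[OF N] comp[OF N] f_range[OF N] True N params_fit[OF N] by unfold_locales auto
      \<comment> \<open>An empty structure, \<open>s = 0\<close>, demands nothing of the memory, so
        the construction succeeds with certainty.\<close>
      have R: "R N \<mu>" for \<mu>
        unfolding R_def by (intro exI[of _ 0] conjI L.supports_small) (simp_all add: S_def T_query_def True)
      have "measure (random_tape (b N)) (space (random_tape (b N))) \<le> ?prob"
      proof (rule prob_run_ge[OF sets.top v])
        show "L.run ?build (\<lambda>n \<sigma>'. real n \<le> T_build N \<and> R N (mem \<sigma>')) (\<sigma>\<lparr>tape := \<omega>\<rparr>)"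
          if "sset \<omega> \<subseteq> {..<2 ^ b N}" for \<omega>
          by (rule wp_mono[OF L.run_build_small[OF vt[OF that]]]) (use regs R True in \<open>auto simp: T_build_def\<close>)
      qed
      moreover have "measure (random_tape (b N)) (space (random_tape (b N))) = 1"
        unfolding random_tape_def by (intro prob_space.prob_space prob_space.prob_space_stream_space measure_pmf.prob_space_axioms)
      moreover have "1 / real N powr c \<ge> 0" by simp
      ultimately show ?thesis by linarith
    next
      case large: False
      have "k0 \<le> N" using large less_exp[of k0] by linarith
      note fits = k0[OF this]
      interpret L: large_problem "b N" "inp N" N "w N" k0 C "l N" "nu N" "space_bound N" F "f N" "\<tau> N"
      proof
        show "N div 2 ^ k0 \<noteq> 0" using large by (simp add: div_eq_0_iff)
        show "N \<le> 2 ^ nu N" by (rule lg_up)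
        show "2 ^ i < N" if "i < nu N" for i using that by (rule lg_up)
        show "2 ^ (nu N - l N) \<le> space_bound N" "r N * 2 ^ l N * Suc (nu N - l N) \<le> space_bound N"
          "r N * 2 ^ (nu N - 2 * l N) \<le> space_bound N" unfolding space_bound_def by linarith+
      qed (use b2 inp_words[OF N] comp[OF N] f_range[OF N] fits C in auto)
      have R: "R N \<mu>" if "L.good (\<mu> 0)" for \<mu>
        unfolding R_def by (intro exI[of _ "5 * space_bound N + 5"] conjI L.supports_large that)
          (use large in \<open>simp_all add: S_def T_query_def\<close>)
      have "measure (random_tape (b N)) {\<omega>. L.cov (\<lambda>i. \<omega> !! i)} \<le> ?prob"
      proof (rule prob_run_ge[OF L.sets_cov v])
        fix \<omega> assume \<omega>: "sset \<omega> \<subseteq> {..<2 ^ b N}" "\<omega> \<in> {\<omega>. L.cov (\<lambda>i. \<omega> !! i)}"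
        show "L.run ?build (\<lambda>n \<sigma>'. real n \<le> T_build N \<and> R N (mem \<sigma>')) (\<sigma>\<lparr>tape := \<omega>\<rparr>)"
          by (rule wp_mono[OF L.run_build_large[OF vt[OF \<omega>(1)]]])
            (use regs \<omega>(2) ell_exp[OF N alpha(1)] R large in \<open>auto simp: T_build_def\<close>)
      qed
      moreover have "2 ^ nu N * exp (- real (C * nu N)) \<le> 1 / real N powr c"
        by (rule exp_bound[OF N lg_up(1) C(2) c_pos])
      ultimately show ?thesis using L.prob_cov by linarith
    qed
  qed
  have eq: "(\<exists>n \<sigma>' s. exec (b N) (inp N) ?build (\<sigma>\<lparr>tape := \<omega>\<rparr>) n \<sigma>' \<and>
            real n \<le> T_build N \<and> real s \<le> S N \<and>
            supports_ranking (T_query N) (b N) (inp N) ?rank N (w N) (f N) s (mem \<sigma>' 0) \<and>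
            supports_selection (T_query N) (b N) (inp N) ?select N (w N) (f N) s (mem \<sigma>' 0)) \<longleftrightarrow>
      (\<exists>n \<sigma>'. exec (b N) (inp N) ?build (\<sigma>\<lparr>tape := \<omega>\<rparr>) n \<sigma>' \<and> real n \<le> T_build N \<and> R N (mem \<sigma>'))" for N \<sigma> \<omega>
    unfolding R_def by blast
  show ?thesis
    using 1 2 3 main unfolding eq[symmetric] by blast
qed

end
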